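(* Let $\Omega=\mathbb{B}(0,1)\subset\mathbb{C}^2$ be the unit ball. Given an arbitrary $(0,1)$-form $f\in L^2(\mathbb{B}(0,1))$, suppose that the $(0,1)$-form $u\in H^2(\Omega)$, $u=u_1\omega_{\overline L}+u_2\omega_{\overline N}$ near $\partial\Omega$, solves the $\bar\partial$-Neumann problem $$-\Box u=f\ \text{ in }\Omega,\qquad u_2=0\ \text{ on }\partial\Omega,\qquad \overline N u_1=-2u_1\,(L,[L,N])\ \text{ on }\partial\Omega$$ with constant boundary velocity, i.e. $\gamma u$ and $\mathcal{B}u$ are both constant vectors on $\partial\Omega$. Let $a:=(\mathcal{B}u)_2$ and $b:=(\gamma u)_1$. If $b=0$, then $(\mathcal{G}f,d\bar z_2)$ vanishes at the point $(1,0)$.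
   Context: Pointwise Hermitian inner products $(\cdot,\cdot)$ (linear in the first slot) are normalized by $(\partial/\partial z_i,\partial/\partial z_j)=\tfrac12\delta_{ij}$ and $(d\bar z_i,d\bar z_j)=2\delta_{ij}$. On the unit ball the signed distance function is $\delta(z)=|z|-1$, and for $z\ne0$ $$L=\frac{\bar z_2}{|z|}\frac{\partial}{\partial z_1}-\frac{\bar z_1}{|z|}\frac{\partial}{\partial z_2},\quad N=\frac{z_1}{|z|}\frac{\partial}{\partial z_1}+\frac{z_2}{|z|}\frac{\partial}{\partial z_2},$$ $$\omega_{\overline L}=\frac{\bar z_2}{|z|}d\bar z_1-\frac{\bar z_1}{|z|}d\bar z_2,\quad \omega_{\overline N}=\frac{z_1}{|z|}d\bar z_1+\frac{z_2}{|z|}d\bar z_2 .$$ A $(0,1)$-form near $\partial\Omega$ is written $u=u_1\omega_{\overline L}+u_2\omega_{\overline N}$ and identified with the column $(u_1,u_2)^t$; components of boundary values are with respect to this frame. $\Box=2(\bar\partial+\bar\partial^* )^2$, which acts on the coefficients of $d\bar z_1,d\bar z_2$ as $-\Delta$ ($\Delta$ the Euclidean Laplacian on $\mathbb{R}^4$). $\gamma$ is the trace on $\partial\Omega$, and the conormal derivative is $$\mathcal{B}u=2\begin{pmatrix}\overline N&-\overline L\\ L&N\end{pmatrix}\begin{pmatrix}u_1\\ u_2\end{pmatrix}\Big|_{\partial\Omega}+2\begin{pmatrix}2(L,[L,N])&0\\ 0&2([L,N],L)\end{pmatrix}\begin{pmatrix}u_1\\ u_2\end{pmatrix}\Big|_{\partial\Omega}.$$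 The boundary conditions are equivalent to $(\gamma u)_2=0$ and $(\mathcal{B}u)_1=0$. $\mathcal{G}$ is the fundamental solution, acting coefficientwise: for $f=f_1d\bar z_1+f_2d\bar z_2$, $$\mathcal{G}f(z)=\sum_{j=1}^2\Big(\frac1{4\pi^2}\int_{\Omega}\frac{f_j(w)}{|z-w|^2}\,dV(w)\Big)d\bar z_j$$ (the overall sign convention for $\mathcal{G}$ does not affect the claim). Its value at $(1,0)\in\partial\Omega$ means the value there of the boundary trace $\gamma\mathcal{G}f$; as $f$ is only $L^2$, this is the value of the continuous representative of $\gamma\mathcal{G}f$, which exists in the situation of the claim. *)

theory Defs
  imports "HOL-Analysis.Analysis"
begin

text \<open>Points of \<open>\<complex>\<^sup>2\<close> are elements of \<^typ>\<open>complex^2\<close>, whose Euclidean structure is that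
  of \<open>\<real>\<^sup>4\<close>; its real orthonormal basis consists of \<open>axis j 1\<close> and \<open>axis j \<i>\<close>.
  A \<open>(0,1)\<close>-form is the column of its coefficients with respect to \<open>dzbar\<^sub>1, dzbar\<^sub>2\<close>, a
  \<open>(1,0)\<close>-vector field the column of its coefficients with respect to
  \<open>\<partial>/\<partial>z\<^sub>1, \<partial>/\<partial>z\<^sub>2\<close>.\<close>


primrec cont_diff :: "nat \<Rightarrow> ('a::real_normed_vector \<Rightarrow> 'b::real_normed_vector) \<Rightarrow> bool" where
  "cont_diff 0 f = continuous_on UNIV f"
| "cont_diff (Suc k) f =
     ((\<forall>x. f differentiable at x) \<and> (\<forall>h. cont_diff k (\<lambda>x. frechet_derivative f (at x) h)))"

definition smooth :: "('a::real_normed_vector \<Rightarrow> 'b::real_normed_vector) \<Rightarrow> bool" where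
  "smooth f \<longleftrightarrow> (\<forall>k. cont_diff k f)"

definition test_function :: "'a::euclidean_space set \<Rightarrow> ('a \<Rightarrow> real) \<Rightarrow> bool" where
  "test_function D \<phi> \<longleftrightarrow> smooth \<phi> \<and> (\<exists>K. compact K \<and> K \<subseteq> D \<and> (\<forall>x. x \<notin> K \<longrightarrow> \<phi> x = 0))"

definition square_integrable :: "'a measure \<Rightarrow> ('a \<Rightarrow> 'b::euclidean_space) \<Rightarrow> bool" where
  "square_integrable M f \<longleftrightarrow> f \<in> borel_measurable M \<and> integrable M (\<lambda>x. (norm (f x))\<^sup>2)"

definition locally_integrable :: "'a::euclidean_space set \<Rightarrow> ('a \<Rightarrow> 'b::euclidean_space) \<Rightarrow> bool" where
  "locally_integrable D f \<longleftrightarrow> (\<forall>K. compact K \<and> K \<subseteq> D \<longrightarrow> integrable (lebesgue_on K) f)"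

definition has_weak_partial ::
  "'a::euclidean_space set \<Rightarrow> 'a \<Rightarrow> ('a \<Rightarrow> 'b::euclidean_space) \<Rightarrow> ('a \<Rightarrow> 'b) \<Rightarrow> bool" where
  "has_weak_partial D e v w \<longleftrightarrow> locally_integrable D v \<and> locally_integrable D w \<and>
     (\<forall>\<phi>. test_function D \<phi> \<longrightarrow>
        (LINT x|lebesgue_on D. frechet_derivative \<phi> (at x) e *\<^sub>R v x) =
        - (LINT x|lebesgue_on D. \<phi> x *\<^sub>R w x))"

text \<open>Weak derivatives are determined up to null sets; \<open>weak_partial\<close> picks a representative,
  and is only meaningful where a weak derivative exists.\<close>

definition weak_partial ::
  "'a::euclidean_space set \<Rightarrow> 'a \<Rightarrow> ('a \<Rightarrow> 'b::euclidean_space) \<Rightarrow> 'a \<Rightarrow> 'b" where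
  "weak_partial D e v = (SOME w. has_weak_partial D e v w)"

primrec sobolev ::
  "nat \<Rightarrow> 'a::euclidean_space set \<Rightarrow> ('a \<Rightarrow> 'b::euclidean_space) \<Rightarrow> bool" where
  "sobolev 0 D v = square_integrable (lebesgue_on D) v"
| "sobolev (Suc k) D v = (square_integrable (lebesgue_on D) v \<and>
     (\<forall>e\<in>Basis. \<exists>w. has_weak_partial D e v w \<and> sobolev k D w))"

text \<open>Surface measure of the unit sphere in polar coordinates: the measure of \<open>A\<close> is the
  dimension times the volume of the cone \<open>{t x | 0 < t < 1, x \<in> A}\<close>.\<close>

definition sphere_measure :: "'a::euclidean_space measure" where
  "sphere_measure = scale_measure (of_nat DIM('a))
     (distr (restrict_space lborel (ball 0 1 - {0})) (restrict_space borel (sphere 0 1))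
        (\<lambda>x. x /\<^sub>R norm x))"

text \<open>\<open>has_trace D v g\<close>: \<open>g\<close> is the trace on the unit sphere of \<open>v \<in> H\<^sup>1(D)\<close>, i.e. the image of
  \<open>v\<close> under the continuous extension to \<open>H\<^sup>1(D)\<close> of the restriction of smooth functions,
  with values in \<open>L\<^sup>2\<close> of the sphere. It is meant for \<open>D\<close> the unit ball or a one-sided
  neighbourhood \<open>{r < |z| < 1}\<close> of the sphere. The trace \<open>g\<close> is determined up to null sets;
  lower integrals in \<open>[0,\<infinity>]\<close> are used so that convergence to \<open>0\<close> includes finiteness.\<close>

definition has_trace ::
  "'a::euclidean_space set \<Rightarrow> ('a \<Rightarrow> 'b::euclidean_space) \<Rightarrow> ('a \<Rightarrow> 'b) \<Rightarrow> bool" where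
  "has_trace D v g \<longleftrightarrow> sobolev 1 D v \<and> square_integrable sphere_measure g \<and>
     (\<exists>\<phi> :: nat \<Rightarrow> 'a \<Rightarrow> 'b. (\<forall>n. smooth (\<phi> n)) \<and>
        (\<lambda>n. \<integral>\<^sup>+x. ennreal ((norm (\<phi> n x - v x))\<^sup>2) \<partial>lebesgue_on D) \<longlonglongrightarrow> 0 \<and>
        (\<forall>e\<in>Basis. (\<lambda>n. \<integral>\<^sup>+x. ennreal ((norm (frechet_derivative (\<phi> n) (at x) e
                                - weak_partial D e v x))\<^sup>2) \<partial>lebesgue_on D) \<longlonglongrightarrow> 0) \<and>
        (\<lambda>n. \<integral>\<^sup>+x. ennreal ((norm (\<phi> n x - g x))\<^sup>2) \<partial>sphere_measure) \<longlonglongrightarrow> 0)"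

definition eq_on_boundary ::
  "'a::euclidean_space set \<Rightarrow> ('a \<Rightarrow> 'b::euclidean_space) \<Rightarrow> ('a \<Rightarrow> 'b) \<Rightarrow> bool" where
  "eq_on_boundary D v w \<longleftrightarrow> (\<exists>g. has_trace D v g \<and> has_trace D w g)"


text \<open>Wirtinger derivatives, weak and classical.\<close>

definition weak_dz :: "(complex^2) set \<Rightarrow> 2 \<Rightarrow> (complex^2 \<Rightarrow> complex) \<Rightarrow> complex^2 \<Rightarrow> complex" where
  "weak_dz D j v z = (weak_partial D (axis j 1) v z - \<i> * weak_partial D (axis j \<i>) v z) / 2"

definition weak_dzbar :: "(complex^2) set \<Rightarrow> 2 \<Rightarrow> (complex^2 \<Rightarrow> complex) \<Rightarrow> complex^2 \<Rightarrow> complex" where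
  "weak_dzbar D j v z = (weak_partial D (axis j 1) v z + \<i> * weak_partial D (axis j \<i>) v z) / 2"

definition classical_dz :: "2 \<Rightarrow> (complex^2 \<Rightarrow> complex) \<Rightarrow> complex^2 \<Rightarrow> complex" where
  "classical_dz j v z =
     (frechet_derivative v (at z) (axis j 1) - \<i> * frechet_derivative v (at z) (axis j \<i>)) / 2"


text \<open>The \<open>\<partial>\<close>-bar complex on \<open>D\<close>. A \<open>(0,2)\<close>-form is its coefficient with respect to
  \<open>dzbar\<^sub>1 \<and> dzbar\<^sub>2\<close>. The formal adjoints are taken in \<open>L\<^sup>2\<close> for the pointwise inner products with
  \<open>(dzbar\<^sub>i, dzbar\<^sub>j) = 2 \<delta>\<^sub>i\<^sub>j\<close> and \<open>|dzbar\<^sub>1 \<and> dzbar\<^sub>2|\<^sup>2 = 4\<close>; integration by parts then gives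
  the factors \<open>2\<close> below.\<close>

definition dbar_fun :: "(complex^2) set \<Rightarrow> (complex^2 \<Rightarrow> complex) \<Rightarrow> complex^2 \<Rightarrow> complex^2" where
  "dbar_fun D h z = (\<chi> j. weak_dzbar D j h z)"

definition dbar_form :: "(complex^2) set \<Rightarrow> (complex^2 \<Rightarrow> complex^2) \<Rightarrow> complex^2 \<Rightarrow> complex" where
  "dbar_form D u z = weak_dzbar D 1 (\<lambda>w. u w $ 2) z - weak_dzbar D 2 (\<lambda>w. u w $ 1) z"

definition dbar_adj_form :: "(complex^2) set \<Rightarrow> (complex^2 \<Rightarrow> complex^2) \<Rightarrow> complex^2 \<Rightarrow> complex" where
  "dbar_adj_form D u z = - 2 * (\<Sum>j\<in>UNIV. weak_dz D j (\<lambda>w. u w $ j) z)"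

definition dbar_adj_form2 :: "(complex^2) set \<Rightarrow> (complex^2 \<Rightarrow> complex) \<Rightarrow> complex^2 \<Rightarrow> complex^2" where
  "dbar_adj_form2 D h z = vector [2 * weak_dz D 2 h z, - 2 * weak_dz D 1 h z]"

text \<open>The restriction of \<open>2 (dbar + dbar\<^sup>*)\<^sup>2\<close> to \<open>(0,1)\<close>-forms; the squares of dbar and of
  its adjoint vanish.\<close>

definition kohn_box :: "(complex^2) set \<Rightarrow> (complex^2 \<Rightarrow> complex^2) \<Rightarrow> complex^2 \<Rightarrow> complex^2" where
  "kohn_box D u z = 2 *\<^sub>R (dbar_fun D (dbar_adj_form D u) z + dbar_adj_form2 D (dbar_form D u) z)"


definition field_inner :: "complex^2 \<Rightarrow> complex^2 \<Rightarrow> complex" where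
  "field_inner X Y = (1/2) * (\<Sum>j\<in>UNIV. X $ j * cnj (Y $ j))"

definition form_inner :: "complex^2 \<Rightarrow> complex^2 \<Rightarrow> complex" where
  "form_inner \<alpha> \<beta> = 2 * (\<Sum>j\<in>UNIV. \<alpha> $ j * cnj (\<beta> $ j))"

definition dzbar :: "2 \<Rightarrow> complex^2" where
  "dzbar j = axis j 1"

definition L_field :: "complex^2 \<Rightarrow> complex^2" where
  "L_field z = vector [cnj (z $ 2) / norm z, - cnj (z $ 1) / norm z]"

definition N_field :: "complex^2 \<Rightarrow> complex^2" where
  "N_field z = vector [z $ 1 / norm z, z $ 2 / norm z]"

definition omega_Lbar :: "complex^2 \<Rightarrow> complex^2" where
  "omega_Lbar z = (cnj (z $ 2) / norm z) *s dzbar 1 - (cnj (z $ 1) / norm z) *s dzbar 2"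

definition omega_Nbar :: "complex^2 \<Rightarrow> complex^2" where
  "omega_Nbar z = (z $ 1 / norm z) *s dzbar 1 + (z $ 2 / norm z) *s dzbar 2"

text \<open>The commutator of two \<open>(1,0)\<close>-fields is again a \<open>(1,0)\<close>-field, with the following
  coefficients.\<close>

definition lie_bracket ::
  "(complex^2 \<Rightarrow> complex^2) \<Rightarrow> (complex^2 \<Rightarrow> complex^2) \<Rightarrow> complex^2 \<Rightarrow> complex^2" where
  "lie_bracket X Y z = (\<chi> k. \<Sum>j\<in>UNIV. X z $ j * classical_dz j (\<lambda>w. Y w $ k) z
                                     - Y z $ j * classical_dz j (\<lambda>w. X w $ k) z)"

text \<open>\<open>X v\<close> and its conjugate counterpart, with weak derivatives of \<open>v\<close> on \<open>D\<close>.\<close>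

definition field_deriv ::
  "(complex^2) set \<Rightarrow> (complex^2 \<Rightarrow> complex^2) \<Rightarrow> (complex^2 \<Rightarrow> complex) \<Rightarrow> complex^2 \<Rightarrow> complex" where
  "field_deriv D X v z = (\<Sum>j\<in>UNIV. X z $ j * weak_dz D j v z)"

definition field_deriv_bar ::
  "(complex^2) set \<Rightarrow> (complex^2 \<Rightarrow> complex^2) \<Rightarrow> (complex^2 \<Rightarrow> complex) \<Rightarrow> complex^2 \<Rightarrow> complex" where
  "field_deriv_bar D X v z = (\<Sum>j\<in>UNIV. cnj (X z $ j) * weak_dzbar D j v z)"

text \<open>The expression on the one-sided neighbourhood \<open>D\<close> of the sphere whose trace is the
  conormal derivative of \<open>u\<^sub>1 \<omega>\<^sub>L + u\<^sub>2 \<omega>\<^sub>N\<close> (frame \<open>omega_Lbar\<close>, \<open>omega_Nbar\<close>).\<close>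

definition conormal ::
  "(complex^2) set \<Rightarrow> (complex^2 \<Rightarrow> complex) \<Rightarrow> (complex^2 \<Rightarrow> complex) \<Rightarrow> complex^2 \<Rightarrow> complex^2" where
  "conormal D u1 u2 z =
     2 *\<^sub>R vector [field_deriv_bar D N_field u1 z - field_deriv_bar D L_field u2 z,
                 field_deriv D L_field u1 z + field_deriv D N_field u2 z]
   + 2 *\<^sub>R vector [2 * field_inner (L_field z) (lie_bracket L_field N_field z) * u1 z,
                 2 * field_inner (lie_bracket L_field N_field z) (L_field z) * u2 z]"

text \<open>The integral converges for almost every \<open>z\<close> if \<open>f\<close> is square integrable.\<close>

definition newton_potential :: "(complex^2 \<Rightarrow> complex^2) \<Rightarrow> complex^2 \<Rightarrow> complex^2" where
  "newton_potential f z =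
     (\<chi> j. 1 / (4 * pi\<^sup>2) * (LINT w|lebesgue_on (ball 0 1). f w $ j / (norm (z - w))\<^sup>2))"

end

theory Submission
  imports Defs
begin

text \<open>If \<open>b = 0\<close>, then \<open>u\<close> has zero trace, and Green's representation formula expresses the Newton
  potential of \<open>f\<close> as a multiple of \<open>u\<close> plus the single layer potential of the conormal derivative.
  The first component of the conormal derivative vanishes, being the mean over the sphere of a
  tangential derivative of \<open>u\<^sub>2\<close>; the second one is \<open>a\<close>, so that the density of the single layer is
  \<open>a \<omega>\<^sub>N\<close>, with coefficients \<open>a z\<^sub>1, a z\<^sub>2\<close>. The single layer potential of a linear
  function on the sphere is again linear inside the ball, by an ordinary differential equation
  along rays. Hence the trace of the Newton potential is \<open>z \<mapsto> \<gamma> z\<close> for a constant \<open>\<gamma>\<close>, and its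
  second coefficient is \<open>0\<close> at \<open>(1,0)\<close>.

  The kernel \<open>1/|x|\<^sup>2\<close> is regularised to \<open>1/(|x|\<^sup>2 + \<epsilon>)\<close>, and traces are only used through
  Gauss' formula.\<close>

section \<open>Smooth functions and cutoffs\<close>

text \<open>The hypotheses speak of traces, as limits of unspecified smooth approximations, and of
  weak derivatives picked by \<open>SOME\<close>. Both are converted into one integral identity,
  \<open>bpart\<close>, which can be added, multiplied by functions singular at the origin and
  carried along almost-everywhere equalities. The Kohn Laplacian factors through the first-order
  expressions \<open>dbar_adj_form\<close> and \<open>dbar_form\<close>. In the frame these equal
  minus the second and minus half the first component of the conormal derivative, zero-order
  commutator terms included, so the constants in the hypotheses are exactly the boundary data of
  Green's formula. The first component vanishes because the tangential field that is left acts on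
  radial weights by rotations, which annihilate them. The Newton potential is treated in H1 only: in
  real dimension 4 kernels of order |x|^(-2) and |x|^(-3) are integrable near 0, so regularised
  potentials converge together with their first derivatives, and the trace is computed along
  them.\<close>

primrec cd_on :: "nat \<Rightarrow> 'a::real_normed_vector set \<Rightarrow> ('a \<Rightarrow> 'b::real_normed_vector) \<Rightarrow> bool" where
  "cd_on 0 S f = continuous_on S f"
| "cd_on (Suc k) S f =
     ((\<forall>x\<in>S. f differentiable at x) \<and> (\<forall>h. cd_on k S (\<lambda>x. frechet_derivative f (at x) h)))"

lemma cont_diff_eq_cd_on: "cont_diff k f = cd_on k UNIV f"
  by (induction k arbitrary: f) auto

lemma frechet_derivative_eqI:
  "(f has_derivative f') (at x) \<Longrightarrow> frechet_derivative f (at x) = f'"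
  using frechet_derivative_at by blast

text \<open>Derivatives in \<open>cd_on\<close> are taken in the whole space, so on an open set they
  depend only on the values there. This local form of \<open>cont_diff\<close> admits functions such
  as 1/|x| away from the origin.\<close>

lemma cd_on_cong:
  assumes "open S" "\<And>x. x \<in> S \<Longrightarrow> f x = g x"
  shows "cd_on k S f = cd_on k S g"
  using assms(2)
proof (induction k arbitrary: f g)
  case 0
  then show ?case by (auto intro: continuous_on_cong)
next
  case (Suc k)
  have d: "(f has_derivative D) (at x) \<longleftrightarrow> (g has_derivative D) (at x)" if "x \<in> S" for x D
    using has_derivative_transform_within_open[OF _ assms(1) that, of f D UNIV g]
      has_derivative_transform_within_open[OF _ assms(1) that, of g D UNIV f] Suc.prems by auto
  have "frechet_derivative f (at x) = frechet_derivative g (at x)" if "x \<in> S" for x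
    unfolding frechet_derivative_def using d[OF that] by simp
  then have "cd_on k S (\<lambda>x. frechet_derivative f (at x) h) =
             cd_on k S (\<lambda>x. frechet_derivative g (at x) h)" for h
    by (intro Suc.IH) auto
  with d show ?case by (auto simp: differentiable_def)
qed

lemma cd_on_subset: "cd_on k S f \<Longrightarrow> T \<subseteq> S \<Longrightarrow> cd_on k T f"
  by (induction k arbitrary: f) (auto intro: continuous_on_subset)

lemma cd_on_Un:
  assumes "open S" "open T"
  shows "cd_on k S f \<Longrightarrow> cd_on k T f \<Longrightarrow> cd_on k (S \<union> T) f"
  by (induction k arbitrary: f) (auto intro: continuous_on_open_Un assms)

text \<open>Admits any explicit derivative \<open>D\<close> in place of the one picked by
  \<open>frechet_derivative\<close>; the inductive closure proofs run through it.\<close>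

lemma cd_on_SucI:
  assumes "open S" "\<And>x. x \<in> S \<Longrightarrow> (f has_derivative D x) (at x)" "\<And>h. cd_on k S (\<lambda>x. D x h)"
  shows "cd_on (Suc k) S f"
proof -
  have "cd_on k S (\<lambda>x. frechet_derivative f (at x) h)" for h
    using cd_on_cong[OF assms(1), of "\<lambda>x. D x h" "\<lambda>x. frechet_derivative f (at x) h" k]
      assms(3)[of h] frechet_derivative_eqI[OF assms(2)] by simp
  then show ?thesis using assms(2) by (auto simp: differentiable_def)
qed

lemma cd_on_Suc_has_derivative:
  "cd_on (Suc k) S f \<Longrightarrow> x \<in> S \<Longrightarrow> (f has_derivative frechet_derivative f (at x)) (at x)"
  using frechet_derivative_works by auto

lemma cd_on_SucD:
  assumes "open S"
  shows "cd_on (Suc k) S f \<Longrightarrow> cd_on k S f"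
proof (induction k arbitrary: f)
  case 0
  then show ?case
    by (auto simp: continuous_on_eq_continuous_at assms differentiable_imp_continuous_within)
next
  case (Suc k)
  then show ?case by (metis cd_on.simps(2))
qed

lemma cd_on_const: "cd_on k S (\<lambda>x. c)"
proof (induction k arbitrary: c)
  case (Suc k) then show ?case by simp
qed simp

lemma cd_on_add:
  assumes "open S"
  shows "cd_on k S f \<Longrightarrow> cd_on k S g \<Longrightarrow> cd_on k S (\<lambda>x. f x + g x)"
proof (induction k arbitrary: f g)
  case 0 then show ?case by (auto intro: continuous_intros)
next
  case (Suc k)
  show ?case
    by (rule cd_on_SucI[OF assms has_derivative_add[OF Suc.prems[THEN cd_on_Suc_has_derivative]]])
      (use Suc in auto)
qed

lemma cd_on_bounded_linear_comp:
  assumes "open S" "bounded_linear L"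
  shows "cd_on k S f \<Longrightarrow> cd_on k S (\<lambda>x. L (f x))"
proof (induction k arbitrary: f)
  case 0 then show ?case by (auto intro: bounded_linear.continuous_on assms)
next
  case (Suc k)
  show ?case
    by (rule cd_on_SucI[OF assms(1) bounded_linear.has_derivative[OF assms(2) Suc.prems[THEN cd_on_Suc_has_derivative]]])
      (use Suc in auto)
qed

lemma cd_on_bounded_linear:
  assumes "open S" "bounded_linear L"
  shows "cd_on k S L"
proof (cases k)
  case 0 then show ?thesis by (auto intro: bounded_linear.continuous_on assms continuous_on_id)
next
  case (Suc j)
  show ?thesis unfolding Suc
    by (rule cd_on_SucI[OF assms(1) bounded_linear_imp_has_derivative[OF assms(2)]]) (rule cd_on_const)
qed

lemma cd_on_bilinear:
  assumes "open S" "bounded_bilinear pr"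
  shows "cd_on k S f \<Longrightarrow> cd_on k S g \<Longrightarrow> cd_on k S (\<lambda>x. pr (f x) (g x))"
proof (induction k arbitrary: f g)
  case 0 then show ?case by (auto intro: bounded_bilinear.continuous_on[OF assms(2)])
next
  case (Suc k)
  note FD = bounded_bilinear.FDERIV[OF assms(2) Suc.prems[THEN cd_on_Suc_has_derivative]]
  show ?case
    by (rule cd_on_SucI[OF assms(1) FD])
      (use Suc cd_on_SucD[OF assms(1) Suc.prems(1)] cd_on_SucD[OF assms(1) Suc.prems(2)]
        in \<open>auto intro!: cd_on_add assms(1)\<close>)
qed

lemmas cd_on_mult = cd_on_bilinear[OF _ bounded_bilinear_mult]
  and cd_on_scaleR = cd_on_bilinear[OF _ bounded_bilinear_scaleR]
  and cd_on_inner = cd_on_bilinear[OF _ bounded_bilinear_inner]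

lemma cd_on_sum:
  assumes "open S" "\<And>i. i \<in> I \<Longrightarrow> cd_on k S (f i)"
  shows "cd_on k S (\<lambda>x. \<Sum>i\<in>I. f i x)"
  using assms(2) by (induction I rule: infinite_finite_induct) (auto intro: cd_on_const cd_on_add assms(1))

lemma cd_on_prod:
  fixes f :: "'i \<Rightarrow> 'a::real_normed_vector \<Rightarrow> 'b::{real_normed_algebra,comm_monoid_mult}"
  assumes "open S" "\<And>i. i \<in> I \<Longrightarrow> cd_on k S (f i)"
  shows "cd_on k S (\<lambda>x. \<Prod>i\<in>I. f i x)"
  using assms(2) by (induction I rule: infinite_finite_induct) (auto intro: cd_on_const cd_on_mult assms(1))

lemma cd_on_diff:
  assumes "open S" "cd_on k S f" "cd_on k S g"
  shows "cd_on k S (\<lambda>x. f x - g x)"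
  using cd_on_add[OF assms(1,2) cd_on_bounded_linear_comp[OF assms(1) bounded_linear_minus[OF bounded_linear_ident] assms(3)]]
  by simp

lemma cd_on_power:
  fixes f :: "'a::real_normed_vector \<Rightarrow> real"
  assumes "open S" "cd_on k S f"
  shows "cd_on k S (\<lambda>x. f x ^ n)"
  by (induction n) (auto intro: cd_on_const cd_on_mult assms)

text \<open>A linear map on the reals is multiplication by its value at 1. The chain rule therefore
  yields a product with a composite of the same kind, and the induction closes with
  \<open>cd_on_mult\<close>.\<close>

lemma cd_on_compose_real:
  fixes g :: "real \<Rightarrow> real" and f :: "'a::real_normed_vector \<Rightarrow> real"
  assumes "open S" "f ` S \<subseteq> T"
  shows "cd_on k T g \<Longrightarrow> cd_on k S f \<Longrightarrow> cd_on k S (\<lambda>x. g (f x))"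
proof (induction k arbitrary: g)
  case 0 then show ?case
    using continuous_on_compose2[of T g S f] assms(2) by auto
next
  case (Suc k)
  have g: "(g has_derivative frechet_derivative g (at (f x))) (at (f x))" if "x \<in> S" for x
    using Suc.prems(1) assms(2) that cd_on_Suc_has_derivative by blast
  have lin: "frechet_derivative g (at (f x)) t = t * frechet_derivative g (at (f x)) 1" if "x \<in> S" for x t
    using linear_scale[OF has_derivative_linear[OF g[OF that]], of t 1] by simp
  have d: "((\<lambda>x. g (f x)) has_derivative
      (\<lambda>h. frechet_derivative f (at x) h * frechet_derivative g (at (f x)) 1)) (at x)" if "x \<in> S" for x
    by (rule has_derivative_eq_rhs[OF has_derivative_compose[OF cd_on_Suc_has_derivative[OF Suc.prems(2) that] g[OF that]]])
      (rule ext, rule lin[OF that])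
  show ?case
    by (rule cd_on_SucI[OF assms(1) d])
      (use Suc cd_on_SucD[OF assms(1) Suc.prems(2)] in \<open>auto intro!: cd_on_mult assms(1)\<close>)
qed

text \<open>The exponent is generalised because differentiation lowers it by one. Reciprocals and
  roots below are written as powers in order to use this: 1/|x| as
  \<open>(x \<bullet> x) powr (- (1/2))\<close>, the regularised kernel with exponent -1.\<close>

lemma cd_on_powr: "cd_on k {0<..} (\<lambda>t::real. t powr s)"
proof (induction k arbitrary: s)
  case 0 then show ?case by (auto intro!: continuous_intros)
next
  case (Suc k)
  have "((\<lambda>t. t powr s) has_derivative (\<lambda>h. (s * h) * x powr (s - 1))) (at x)" if "x \<in> {0<..}" for x
    using has_real_derivative_powr[of x s] that by (auto simp: has_field_derivative_def mult_ac fun_eq_iff elim: has_derivative_eq_rhs)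
  then show ?case
    by (rule cd_on_SucI[OF open_greaterThan]) (auto intro!: cd_on_mult cd_on_const Suc)
qed

section \<open>A smooth step function\<close>

definition flat :: "nat \<Rightarrow> real \<Rightarrow> real" where
  "flat n t = (if t > 0 then (1/t)^n * exp (- (1/t)) else 0)"

lemma flat_limit: "((flat n) \<longlongrightarrow> 0) (at 0)"
proof -
  have "((\<lambda>x::real. x ^ n * exp (- x)) \<longlongrightarrow> 0) at_top"
    using tendsto_power_div_exp_0[of n] by (simp add: exp_minus field_simps)
  then have "((\<lambda>t::real. (1/t) ^ n * exp (- (1/t))) \<longlongrightarrow> 0) (at_right 0)"
    using filterlim_compose[OF _ filterlim_inverse_at_top_right, of "\<lambda>x::real. x ^ n * exp (- x)" "nhds 0"]
    by (simp add: inverse_eq_divide)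
  then have "(flat n \<longlongrightarrow> 0) (at_right 0)"
    by (rule Lim_transform_eventually) (auto simp: flat_def eventually_at_right_less eventually_at intro: exI[of _ 1])
  moreover have "(flat n \<longlongrightarrow> 0) (at_left 0)"
    by (rule Lim_transform_eventually[OF tendsto_const]) (auto simp: flat_def eventually_at intro: exI[of _ 1])
  ultimately show ?thesis by (simp add: filterlim_at_split)
qed

lemma flat_has_derivative:
  "(flat n has_real_derivative (flat (n+2) t - n * flat (n+1) t)) (at t)"
proof (cases "t = 0")
  case True
  \<comment> \<open>Off the origin the difference quotient at 0 is \<open>flat (n+1)\<close> itself,
    so \<open>flat_limit\<close> gives derivative 0.\<close>
  have "((\<lambda>h. (flat n h - flat n 0) / (h - 0)) \<longlongrightarrow> 0) (at 0)"
    by (rule Lim_transform_eventually[OF flat_limit[of "n+1"]])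
       (auto simp: flat_def eventually_at intro!: exI[of _ 1])
  then show ?thesis using True by (simp add: has_field_derivative_iff flat_def)
next
  case False
  show ?thesis
  proof (cases "t > 0")
    case True
    have "((\<lambda>t. (1/t)^n * exp (- (1/t))) has_real_derivative
        (n * (1/t)^(n-1) * (- 1/t^2) * exp (- (1/t)) + (1/t)^n * (exp (-(1/t)) * (1/t^2)))) (at t)"
      using True by (auto intro!: derivative_eq_intros simp: power2_eq_square)
    moreover have "n * (1/t)^(n-1) * (- 1/t^2) * exp (- (1/t)) + (1/t)^n * (exp (-(1/t)) * (1/t^2))
       = flat (n+2) t - n * flat (n+1) t"
      using True by (cases n) (auto simp: flat_def power_add field_simps power2_eq_square)
    ultimately have "((\<lambda>t. (1/t)^n * exp (- (1/t))) has_real_derivative (flat (n+2) t - n * flat (n+1) t)) (at t)"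
      by simp
    then show ?thesis
      by (rule has_field_derivative_transform_within_open[of _ _ _ "{0<..}"])
        (use True in \<open>auto simp: flat_def\<close>)
  next
    case neg: False
    have "((\<lambda>t. 0) has_real_derivative (flat (n+2) t - n * flat (n+1) t)) (at t)"
      using neg by (simp add: flat_def)
    then show ?thesis
      by (rule has_field_derivative_transform_within_open[of _ _ _ "{..<0}"])
        (use neg False in \<open>auto simp: flat_def\<close>)
  qed
qed

lemma cd_on_flat: "cd_on k UNIV (flat n)"
proof (induction k arbitrary: n)
  case 0 then show ?case
    using flat_has_derivative by (auto intro!: continuous_at_imp_continuous_on DERIV_isCont)
next
  case (Suc k)
  show ?case
    by (rule cd_on_SucI[OF open_UNIV flat_has_derivative[unfolded has_field_derivative_def]])
      (auto intro!: cd_on_mult cd_on_diff cd_on_const Suc)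
qed

lemma flat_nonneg: "flat n t \<ge> 0" and flat_pos: "t > 0 \<Longrightarrow> flat n t > 0" and flat_le0: "t \<le> 0 \<Longrightarrow> flat n t = 0"
  by (auto simp: flat_def)

text \<open>The quotient of exp(-1/t) by exp(-1/t) + exp(-1/(1-t)), each continued by zero. The
  denominator never vanishes because t and 1 - t are not both nonpositive; writing it with
  \<open>powr (-1)\<close> makes \<open>cd_on_powr\<close> applicable.\<close>

definition smooth_step :: "real \<Rightarrow> real" where
  "smooth_step t = flat 0 t * (flat 0 t + flat 0 (1 - t)) powr (-1)"

lemma smooth_step_pos: "flat 0 t + flat 0 (1 - t) > 0"
  by (cases "t > 0") (auto simp: flat_nonneg flat_pos add_pos_nonneg add_nonneg_pos)

lemma smooth_step_0: "t \<le> 0 \<Longrightarrow> smooth_step t = 0"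
  and smooth_step_1: "t \<ge> 1 \<Longrightarrow> smooth_step t = 1"
  using smooth_step_pos[of t] by (auto simp: smooth_step_def flat_le0 powr_minus field_simps)

lemma smooth_step_bounds: "0 \<le> smooth_step t" "smooth_step t \<le> 1"
  using smooth_step_pos[of t] flat_nonneg[of 0 "1-t"]
  by (auto simp: smooth_step_def flat_nonneg powr_minus field_simps)

lemma cd_on_smooth_step: "cd_on k UNIV smooth_step"
proof -
  have "cd_on k UNIV (\<lambda>t. flat 0 (1 - t))"
    by (rule cd_on_compose_real[OF _ _ cd_on_flat])
      (auto intro!: cd_on_diff[OF _ cd_on_const cd_on_bounded_linear] bounded_linear_ident)
  then have "cd_on k UNIV (\<lambda>t. (flat 0 t + flat 0 (1 - t)) powr (-1))"
    by (intro cd_on_compose_real[OF _ _ cd_on_powr])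
      (auto intro!: cd_on_add cd_on_flat smooth_step_pos)
  then show ?thesis unfolding smooth_step_def
    by (intro cd_on_mult cd_on_flat) auto
qed

section \<open>Uniqueness of weak derivatives\<close>

text \<open>As m grows these functions tend to the indicator of the open box, with values in [0,1]
  and zero outside the box. They take the place of mollification in the uniqueness proof.\<close>

definition box_bump :: "'a::euclidean_space \<Rightarrow> 'a \<Rightarrow> nat \<Rightarrow> 'a \<Rightarrow> real" where
  "box_bump a b m x =
     (\<Prod>e\<in>Basis. flat 0 (real m * (x \<bullet> e - a \<bullet> e)) * flat 0 (real m * (b \<bullet> e - x \<bullet> e)))"

lemma smooth_box_bump: "smooth (box_bump a b m)"
proof -
  have 1: "cd_on k UNIV (\<lambda>x::'a. real m * (x \<bullet> e - a \<bullet> e))" for k e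
    by (auto intro!: cd_on_mult cd_on_diff cd_on_const cd_on_inner cd_on_bounded_linear[OF _ bounded_linear_ident])
  have 2: "cd_on k UNIV (\<lambda>x::'a. real m * (b \<bullet> e - x \<bullet> e))" for k e
    by (auto intro!: cd_on_mult cd_on_diff cd_on_const cd_on_inner cd_on_bounded_linear[OF _ bounded_linear_ident])
  show ?thesis unfolding smooth_def cont_diff_eq_cd_on box_bump_def
    by (auto intro!: cd_on_prod cd_on_mult cd_on_compose_real[OF _ _ cd_on_flat] 1 2)
qed

lemma flat0_le1: "flat 0 t \<le> 1"
  by (auto simp: flat_def)

lemma box_bump_bounds: "0 \<le> box_bump a b m x" "box_bump a b m x \<le> 1"
  unfolding box_bump_def
  by (auto intro!: prod_nonneg prod_le_1 mult_nonneg_nonneg mult_le_one simp: flat_nonneg flat0_le1)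

lemma box_bump_outside: "x \<notin> box a b \<Longrightarrow> box_bump a b m x = 0"
proof -
  assume "x \<notin> box a b"
  then obtain e where e: "e \<in> Basis" "x \<bullet> e - a \<bullet> e \<le> 0 \<or> b \<bullet> e - x \<bullet> e \<le> 0"
    by (force simp: mem_box)
  then have "flat 0 (real m * (x \<bullet> e - a \<bullet> e)) * flat 0 (real m * (b \<bullet> e - x \<bullet> e)) = 0"
    by (auto simp: flat_le0 mult_nonneg_nonpos)
  then show ?thesis unfolding box_bump_def using e by (intro prod_zero) auto
qed

lemma flat0_limit: "t > 0 \<Longrightarrow> (\<lambda>m. flat 0 (real m * t)) \<longlonglongrightarrow> 1"
proof -
  assume t: "t > 0"
  have "(\<lambda>m. exp (- (1 / t * inverse (real m)))) \<longlonglongrightarrow> exp (- (1 / t * 0))"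
    by (intro tendsto_intros lim_inverse_n)
  then have "(\<lambda>m. exp (- (1 / t * inverse (real m)))) \<longlonglongrightarrow> 1" by simp
  moreover have "\<forall>\<^sub>F m in sequentially. exp (- (1 / t * inverse (real m))) = flat 0 (real m * t)"
    using eventually_gt_at_top[of 0] by eventually_elim (use t in \<open>auto simp: flat_def divide_simps\<close>)
  ultimately show ?thesis by (rule Lim_transform_eventually)
qed

lemma box_bump_limit: "(\<lambda>m. box_bump a b m x) \<longlonglongrightarrow> indicator (box a b) x"
proof (cases "x \<in> box a b")
  case True
  have "(\<lambda>m. box_bump a b m x) \<longlonglongrightarrow> (\<Prod>e\<in>(Basis::'a set). 1 * 1)"
    unfolding box_bump_def
    using True by (intro tendsto_prod tendsto_mult flat0_limit) (auto simp: mem_box)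
  then show ?thesis using True by simp
qed (simp add: box_bump_outside)

lemma test_function_box_bump: "cbox a b \<subseteq> D \<Longrightarrow> test_function D (box_bump a b m)"
  unfolding test_function_def
  using box_bump_outside[of _ a b m] box_subset_cbox[of a b] smooth_box_bump by (meson compact_cbox in_mono)

lemma smooth_continuous: "smooth f \<Longrightarrow> continuous_on S f"
  unfolding smooth_def by (metis cont_diff.simps(1) continuous_on_subset top_greatest)

lemma borel_of_continuous: "continuous_on UNIV f \<Longrightarrow> f \<in> borel_measurable borel"
  by (rule borel_measurable_continuous_onI)

text \<open>Dominated convergence along \<open>box_bump\<close>. The majorant is |w| on the closed
  box, where local integrability makes \<open>w\<close> integrable.\<close>

lemma integral_box_eq_0:
  fixes w :: "'a::euclidean_space \<Rightarrow> 'b::euclidean_space"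
  assumes "open D" and li: "locally_integrable D w"
    and 0: "\<And>\<phi>. test_function D \<phi> \<Longrightarrow> (LINT x|lebesgue_on D. \<phi> x *\<^sub>R w x) = 0"
    and sub: "cbox a b \<subseteq> D"
  shows "(LINT x|lebesgue. indicator (box a b) x *\<^sub>R w x) = 0"
proof -
  have Dm: "D \<in> sets lebesgue" using \<open>open D\<close> by auto
  have int: "integrable lebesgue (\<lambda>x. indicator (cbox a b) x *\<^sub>R w x)"
    using li sub unfolding locally_integrable_def
    by (simp add: integrable_restrict_space[symmetric])
  have eq: "box_bump a b m x *\<^sub>R w x = box_bump a b m x *\<^sub>R (indicator (cbox a b) x *\<^sub>R w x)" for m x
    using box_bump_outside[of x a b m] box_subset_cbox[of a b] by (auto simp: indicator_def)
  have meas: "(\<lambda>x. box_bump a b m x *\<^sub>R w x) \<in> borel_measurable lebesgue" for m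
    unfolding eq
    by (intro borel_measurable_scaleR borel_measurable_integrable[OF int] measurable_completion)
       (simp add: borel_of_continuous smooth_continuous smooth_box_bump)
  have meas2: "(\<lambda>x. indicator (box a b) x *\<^sub>R w x) \<in> borel_measurable lebesgue"
  proof -
    have "(\<lambda>x. indicator (box a b) x *\<^sub>R w x) = (\<lambda>x. indicator (box a b) x *\<^sub>R (indicator (cbox a b) x *\<^sub>R w x))"
      using box_subset_cbox[of a b] by (force simp: indicator_def fun_eq_iff)
    then show ?thesis
      by (rule ssubst) (intro borel_measurable_scaleR borel_measurable_indicator borel_measurable_integrable[OF int], simp)
  qed
  have "(\<lambda>m. LINT x|lebesgue. box_bump a b m x *\<^sub>R w x) \<longlonglongrightarrow> (LINT x|lebesgue. indicator (box a b) x *\<^sub>R w x)"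
  proof (rule integral_dominated_convergence[where w = "\<lambda>x. norm (indicator (cbox a b) x *\<^sub>R w x)"])
    show "integrable lebesgue (\<lambda>x. norm (indicator (cbox a b) x *\<^sub>R w x))" by (intro integrable_norm int)
    show "AE x in lebesgue. (\<lambda>m. box_bump a b m x *\<^sub>R w x) \<longlonglongrightarrow> indicator (box a b) x *\<^sub>R w x"
      by (intro AE_I2 tendsto_intros box_bump_limit)
    show "AE x in lebesgue. norm (box_bump a b m x *\<^sub>R w x) \<le> norm (indicator (cbox a b) x *\<^sub>R w x)" for m
    proof (rule AE_I2)
      fix x
      have "norm (box_bump a b m x *\<^sub>R w x) = box_bump a b m x * norm (indicator (cbox a b) x *\<^sub>R w x)"
        by (subst eq) (simp add: box_bump_bounds)
      also have "\<dots> \<le> 1 * norm (indicator (cbox a b) x *\<^sub>R w x)"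
        by (intro mult_right_mono box_bump_bounds) auto
      finally show "norm (box_bump a b m x *\<^sub>R w x) \<le> norm (indicator (cbox a b) x *\<^sub>R w x)" by simp
    qed
  qed (use meas meas2 in auto)
  moreover have "(LINT x|lebesgue. box_bump a b m x *\<^sub>R w x) = 0" for m
  proof -
    have "(LINT x|lebesgue. box_bump a b m x *\<^sub>R w x) = (LINT x|lebesgue_on D. box_bump a b m x *\<^sub>R w x)"
      using Dm sub box_subset_cbox[of a b] box_bump_outside[of _ a b m]
      by (subst integral_restrict_space) (force intro!: Bochner_Integration.integral_cong simp: indicator_def)+
    then show ?thesis using 0[OF test_function_box_bump[OF sub]] by simp
  qed
  ultimately show ?thesis by (simp add: LIMSEQ_const_iff)
qed

lemma sigma_finite_lebesgue: "sigma_finite_measure (lebesgue :: 'a::euclidean_space measure)"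
proof
  let ?A = "range (\<lambda>n. ball (0::'a) (real n))"
  have "x \<in> \<Union>?A" for x using reals_Archimedean2[of "norm x"] by (auto simp: mem_ball)
  then have "countable ?A \<and> ?A \<subseteq> sets lebesgue \<and> \<Union>?A = space lebesgue \<and>
      (\<forall>a\<in>?A. emeasure lebesgue a \<noteq> \<infinity>)"
    using emeasure_lborel_ball_finite by (auto simp: less_top)
  then show "\<exists>A. countable A \<and> A \<subseteq> sets lebesgue \<and> \<Union>A = space (lebesgue::'a measure) \<and>
      (\<forall>a\<in>A. emeasure lebesgue a \<noteq> \<infinity>)" by blast
qed

text \<open>Boxes are stable under intersection and generate the Borel sets. By the pi-lambda
  theorem the vanishing of all box integrals of the truncated function passes to Borel sets, then to
  Lebesgue sets, and a function whose integral over every measurable set is 0 vanishes almost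
  everywhere.\<close>

lemma AE_zero_on_cbox:
  fixes w :: "'a::euclidean_space \<Rightarrow> 'b::euclidean_space"
  assumes "open D" and li: "locally_integrable D w"
    and 0: "\<And>\<phi>. test_function D \<phi> \<Longrightarrow> (LINT x|lebesgue_on D. \<phi> x *\<^sub>R w x) = 0"
    and sub: "cbox a b \<subseteq> D"
  shows "AE x in lebesgue. x \<in> cbox a b \<longrightarrow> w x = 0"
proof -
  define g where "g x = indicator (cbox a b) x *\<^sub>R w x" for x
  have int: "integrable lebesgue g"
    using li sub unfolding locally_integrable_def g_def
    by (simp add: integrable_restrict_space[symmetric])
  have setint: "set_integrable lebesgue A g" if "A \<in> sets lebesgue" for A
    unfolding set_integrable_def using integrable_mult_indicator[OF that int] .
  have bx: "set_lebesgue_integral lebesgue (box c d) g = 0" for c d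
  proof -
    obtain c' d' where cd: "box c d \<inter> box a b = box c' d'"
      by (auto simp: box_Int_box)
    \<comment> \<open>The truncation lives on the closed box while \<open>integral_box_eq_0\<close>
      speaks of open boxes; they differ by a null set.\<close>
    have "AE x in lebesgue. x \<notin> cbox a b - box a b"
      using null_sets_cbox_Diff_box[of a b] by (intro AE_completion AE_not_in)
    then have "set_lebesgue_integral lebesgue (box c d) g = (LINT x|lebesgue. indicator (box c' d') x *\<^sub>R w x)"
      unfolding set_lebesgue_integral_def
    proof (intro integral_cong_AE)
      have "(\<lambda>x. indicator (box c' d') x *\<^sub>R w x) = (\<lambda>x. indicator (box c' d') x *\<^sub>R g x)"
        using cd box_subset_cbox[of a b] by (force simp: indicator_def g_def)
      then show "(\<lambda>x. indicator (box c' d') x *\<^sub>R w x) \<in> borel_measurable lebesgue"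
        by (rule ssubst) (intro borel_measurable_scaleR borel_measurable_indicator borel_measurable_integrable[OF int], simp)
      show "(\<lambda>x. indicator (box c d) x *\<^sub>R g x) \<in> borel_measurable lebesgue"
        by (intro borel_measurable_scaleR borel_measurable_indicator borel_measurable_integrable[OF int]) simp
      assume "AE x in lebesgue. x \<notin> cbox a b - box a b"
      then show "AE x in lebesgue. indicator (box c d) x *\<^sub>R g x = indicator (box c' d') x *\<^sub>R w x"
        by (rule AE_mp) (rule AE_I2, use cd[symmetric] box_subset_cbox[of a b] in \<open>auto simp: indicator_def g_def\<close>)
    qed
    also have "\<dots> = 0"
    proof (cases "box c' d' = {}")
      case False
      have "cbox c' d' = closure (box c' d')" using closure_box[OF False] by simp
      also have "\<dots> \<subseteq> cbox a b"
        using cd box_subset_cbox[of a b] by (intro closure_minimal closed_cbox) auto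
      finally show ?thesis using sub by (intro integral_box_eq_0[OF \<open>open D\<close> li 0]) auto
    qed simp
    finally show ?thesis .
  qed
  have Int_stable_boxes: "Int_stable (range (\<lambda>(c, d). box c d::'a set))"
    by (auto simp: Int_stable_def box_Int_box)
  have sb: "sets (lborel :: 'a measure) = sigma_sets UNIV (range (\<lambda>(c, d). box c d))"
    by (simp add: borel_eq_box)
  have subset_Pow: "range (\<lambda>(c, d). box c d::'a set) \<subseteq> Pow UNIV" by simp
  have bor: "set_lebesgue_integral lebesgue A g = 0" if "A \<in> sigma_sets UNIV (range (\<lambda>(c, d). box c d))" for A
    using Int_stable_boxes subset_Pow that
  proof (induction rule: sigma_sets_induct_disjoint)
    case (basic A)
    then show ?case using bx by auto
  next
    case empty then show ?case by (simp add: set_lebesgue_integral_def)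
  next
    case (compl A)
    have A: "A \<in> sets lebesgue" using compl(1) sb sets_completionI_sets[of A lborel] by auto
    have A': "UNIV - A \<in> sets lebesgue" using A by (intro sets.Diff) auto
    \<comment> \<open>The truncation \<open>g\<close> vanishes off the closed box, so its total
      integral is a box integral and hence 0; this settles complements.\<close>
    have U: "set_lebesgue_integral lebesgue (box a b) g = set_lebesgue_integral lebesgue UNIV g"
      unfolding set_lebesgue_integral_def
    proof (intro integral_cong_AE)
      show "AE x in lebesgue. indicator (box a b) x *\<^sub>R g x = indicator UNIV x *\<^sub>R g x"
        using AE_completion[OF AE_not_in[OF null_sets_cbox_Diff_box[of a b]]]
        by eventually_elim (auto simp: g_def indicator_def)
    qed (auto intro!: borel_measurable_scaleR borel_measurable_indicator borel_measurable_integrable[OF int])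
    have "set_lebesgue_integral lebesgue UNIV g = set_lebesgue_integral lebesgue (UNIV - A) g + set_lebesgue_integral lebesgue A g"
      using set_integral_Un[OF _ setint[OF A'] setint[OF A]] by auto
    then show ?case using U bx compl by simp
  next
    case (union A)
    have A: "A i \<in> sets lebesgue" for i using union(2) sb sets_completionI_sets[of "A i" lborel]
      by (metis UNIV_I image_subset_iff)
    have "set_lebesgue_integral lebesgue (\<Union>i. A i) g = (\<Sum>i. set_lebesgue_integral lebesgue (A i) g)"
      by (rule lebesgue_integral_countable_add) (use A union(1) setint in \<open>auto simp: disjoint_family_on_def\<close>)
    then show ?case using union by simp
  qed
  have "AE x in lebesgue. g x = 0"
  proof (rule sigma_finite_measure.density_zero[OF sigma_finite_lebesgue int])
    fix A :: "'a set" assume A: "A \<in> sets lebesgue"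
    obtain S N N' where S: "A = S \<union> N" "N \<subseteq> N'" "N' \<in> null_sets lborel" "S \<in> sets lborel"
      using A by (rule sets_completionE)
    have "set_lebesgue_integral lebesgue A g = set_lebesgue_integral lebesgue S g"
      unfolding set_lebesgue_integral_def
    proof (intro integral_cong_AE)
      show "AE x in lebesgue. indicator A x *\<^sub>R g x = indicator S x *\<^sub>R g x"
        using AE_completion[OF AE_not_in[OF S(3)]] by eventually_elim (use S in \<open>auto simp: indicator_def\<close>)
    qed (use A S in \<open>auto intro!: borel_measurable_scaleR borel_measurable_indicator borel_measurable_integrable[OF int]\<close>)
    also have "\<dots> = 0" using S(4) sb by (intro bor) simp
    finally show "set_lebesgue_integral lebesgue A g = 0" .
  qed
  then show ?thesis by eventually_elim (auto simp: g_def)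
qed

text \<open>An open set is a countable union of closed boxes, so the exceptional null sets of
  \<open>AE_zero_on_cbox\<close> can be united.\<close>

lemma du_Bois_Reymond:
  fixes w :: "'a::euclidean_space \<Rightarrow> 'b::euclidean_space"
  assumes "open D" "locally_integrable D w"
    and "\<And>\<phi>. test_function D \<phi> \<Longrightarrow> (LINT x|lebesgue_on D. \<phi> x *\<^sub>R w x) = 0"
  shows "AE x in lebesgue_on D. w x = 0"
proof -
  obtain \<D> where \<D>: "countable \<D>" "\<D> \<subseteq> Pow D" "\<And>X. X \<in> \<D> \<Longrightarrow> \<exists>a b. X = cbox a b" "\<Union>\<D> = D"
    using open_countable_Union_open_cbox[OF \<open>open D\<close>] by metis
  have "AE x in lebesgue. \<forall>X\<in>\<D>. x \<in> X \<longrightarrow> w x = 0"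
    unfolding AE_ball_countable[OF \<D>(1)]
    using \<D>(2,3) AE_zero_on_cbox[OF assms] by blast
  then have "AE x in lebesgue. x \<in> D \<longrightarrow> w x = 0"
    by eventually_elim (use \<D>(4) in auto)
  then show ?thesis using \<open>open D\<close> by (subst AE_restrict_space_iff) auto
qed

lemma test_function_scaleR_integrable:
  fixes w :: "'a::euclidean_space \<Rightarrow> 'b::euclidean_space"
  assumes D: "open D" and "test_function D \<phi>" and li: "locally_integrable D w"
  shows "integrable (lebesgue_on D) (\<lambda>x. \<phi> x *\<^sub>R w x)"
proof -
  obtain K where K: "compact K" "K \<subseteq> D" "\<And>x. x \<notin> K \<Longrightarrow> \<phi> x = 0" and sm: "smooth \<phi>"
    using assms(2) by (auto simp: test_function_def)
  have int: "integrable lebesgue (\<lambda>x. indicator K x *\<^sub>R w x)"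
    using li K unfolding locally_integrable_def
    by (simp add: integrable_restrict_space[symmetric] borel_compact)
  have "compact (\<phi> ` K)" by (intro compact_continuous_image smooth_continuous sm K)
  then obtain B where B: "\<And>x. x \<in> K \<Longrightarrow> \<bar>\<phi> x\<bar> \<le> B" using compact_imp_bounded[of "\<phi> ` K"]
    by (auto simp: bounded_iff)
  have "integrable lebesgue (\<lambda>x. \<phi> x *\<^sub>R (indicator K x *\<^sub>R w x))"
  proof (rule Bochner_Integration.integrable_bound[where f="\<lambda>x. \<bar>B\<bar> *\<^sub>R (indicator K x *\<^sub>R w x)"])
    show "(\<lambda>x. \<phi> x *\<^sub>R (indicator K x *\<^sub>R w x)) \<in> borel_measurable lebesgue"
      by (intro borel_measurable_scaleR borel_measurable_integrable[OF int] measurable_completion)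
         (simp add: borel_of_continuous smooth_continuous sm)
    show "AE x in lebesgue. norm (\<phi> x *\<^sub>R indicat_real K x *\<^sub>R w x) \<le> norm (\<bar>B\<bar> *\<^sub>R indicat_real K x *\<^sub>R w x)"
      using B by (intro AE_I2) (fastforce simp: indicator_def intro!: mult_right_mono)
    show "integrable lebesgue (\<lambda>x. \<bar>B\<bar> *\<^sub>R (indicator K x *\<^sub>R w x))"
      by (intro integrable_scaleR_right int)
  qed
  moreover have "(\<lambda>x. \<phi> x *\<^sub>R (indicator K x *\<^sub>R w x)) = (\<lambda>x. indicator D x *\<^sub>R \<phi> x *\<^sub>R w x)"
    using K by (force simp: indicator_def fun_eq_iff)
  ultimately show ?thesis using D by (subst integrable_restrict_space) auto
qed

text \<open>Used for weak derivatives, and again to identify the limit of the regularised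
  potentials, where only integrals against test functions are compared.\<close>

lemma weak_AE_unique:
  fixes w w' :: "'a::euclidean_space \<Rightarrow> 'b::euclidean_space"
  assumes "open D" "locally_integrable D w" "locally_integrable D w'"
    and "\<And>\<phi>. test_function D \<phi> \<Longrightarrow>
      (LINT x|lebesgue_on D. \<phi> x *\<^sub>R w x) = (LINT x|lebesgue_on D. \<phi> x *\<^sub>R w' x)"
  shows "AE x in lebesgue_on D. w x = w' x"
proof -
  have "AE x in lebesgue_on D. w x - w' x = 0"
  proof (rule du_Bois_Reymond[OF assms(1)])
    show "locally_integrable D (\<lambda>x. w x - w' x)" using assms(2,3) by (auto simp: locally_integrable_def)
    show "(LINT x|lebesgue_on D. \<phi> x *\<^sub>R (w x - w' x)) = 0" if "test_function D \<phi>" for \<phi>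
      using assms(4)[OF that] test_function_scaleR_integrable[OF assms(1) that assms(2)]
        test_function_scaleR_integrable[OF assms(1) that assms(3)]
      by (simp add: scaleR_diff_right)
  qed
  then show ?thesis by eventually_elim simp
qed

lemma has_weak_partial_AE_unique:
  assumes "open D" "has_weak_partial D e v w" "has_weak_partial D e v w'"
  shows "AE x in lebesgue_on D. w x = w' x"
proof (rule weak_AE_unique[OF assms(1)])
  fix \<phi> assume "test_function D \<phi>"
  then have "- (LINT x|lebesgue_on D. \<phi> x *\<^sub>R w x) = - (LINT x|lebesgue_on D. \<phi> x *\<^sub>R w' x)"
    using assms(2,3) unfolding has_weak_partial_def by metis
  then show "(LINT x|lebesgue_on D. \<phi> x *\<^sub>R w x) = (LINT x|lebesgue_on D. \<phi> x *\<^sub>R w' x)" by simp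
qed (use assms in \<open>auto simp: has_weak_partial_def\<close>)

lemma has_weak_partial_weak_partial:
  "has_weak_partial D e v w \<Longrightarrow> has_weak_partial D e v (weak_partial D e v)"
  using someI[of "has_weak_partial D e v" w] by (simp add: weak_partial_def)

section \<open>Polar coordinates and Gauss' formula on the ball\<close>

lemma measurable_radial_projection:
  "(\<lambda>x. x /\<^sub>R norm x) \<in> restrict_space lborel (ball 0 1 - {0}) \<rightarrow>\<^sub>M
     restrict_space borel (sphere (0::'a::euclidean_space) 1)"
  by (auto simp: measurable_restrict_space2_iff space_restrict_space intro!: measurable_restrict_space1)

lemma space_sphere_measure: "space (sphere_measure :: 'a::euclidean_space measure) = sphere 0 1"
  by (simp add: sphere_measure_def space_scale_measure space_restrict_space)

lemma sets_sphere_measure: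
  "sets (sphere_measure :: 'a::euclidean_space measure) = sets (restrict_space borel (sphere 0 1))"
  by (simp add: sphere_measure_def)

lemma borel_measurable_sphere_measure:
  "f \<in> borel_measurable borel \<Longrightarrow> f \<in> borel_measurable sphere_measure"
  using measurable_restrict_space1[of f borel borel "sphere 0 1"]
  by (subst measurable_cong_sets[OF sets_sphere_measure refl])

lemma nn_integral_sphere_measure:
  fixes F :: "'a::euclidean_space \<Rightarrow> ennreal"
  assumes [measurable]: "F \<in> borel_measurable borel"
  shows "(\<integral>\<^sup>+x. F x \<partial>sphere_measure) =
     of_nat DIM('a) * (\<integral>\<^sup>+x. F (x /\<^sub>R norm x) * indicator (ball 0 1 - {0}) x \<partial>lborel)"
proof -
  have F: "F \<in> borel_measurable (restrict_space borel (sphere 0 1))"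
    by (rule measurable_restrict_space1) measurable
  have F2: "F \<in> borel_measurable (distr (restrict_space lborel (ball 0 1 - {0})) (restrict_space borel (sphere 0 1))
        (\<lambda>x. x /\<^sub>R norm x))"
    using F by simp
  show ?thesis unfolding sphere_measure_def
    by (simp add: nn_integral_scale_measure[OF F2] nn_integral_distr[OF measurable_radial_projection F2]
        nn_integral_restrict_space)
qed

lemma nn_integral_lborel_scale:
  fixes h :: "'a::euclidean_space \<Rightarrow> ennreal"
  assumes [measurable]: "h \<in> borel_measurable borel" and "s > 0"
  shows "(\<integral>\<^sup>+x. h x \<partial>lborel) = ennreal (s ^ DIM('a)) * (\<integral>\<^sup>+x. h (s *\<^sub>R x) \<partial>lborel)"
proof -
  have "(\<integral>\<^sup>+x. h x \<partial>lborel) =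
    (\<integral>\<^sup>+x. h x \<partial>density (distr lborel borel (\<lambda>x. 0 + s *\<^sub>R x)) (\<lambda>_. \<bar>s\<bar>^DIM('a)))"
    using lborel_affine[of s "0::'a"] \<open>s > 0\<close> by simp
  also have "\<dots> = ennreal (s ^ DIM('a)) * (\<integral>\<^sup>+x. h (s *\<^sub>R x) \<partial>lborel)"
    using \<open>s > 0\<close> by (simp add: nn_integral_density nn_integral_distr nn_integral_cmult)
  finally show ?thesis .
qed

lemma nn_integral_inverse_power:
  assumes "a > 0" "n > 0"
  shows "(\<integral>\<^sup>+s. ennreal (real n * inverse (s ^ (n + 1))) * indicator {a<..} s \<partial>lborel) = ennreal (inverse (a ^ n))"
proof -
  have "(\<integral>\<^sup>+s. ennreal (real n * inverse (s ^ (n + 1))) * indicator {a<..} s \<partial>lborel) =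
        (\<integral>\<^sup>+s. ennreal (real n * inverse (s ^ (n + 1))) * indicator {a..} s \<partial>lborel)"
    using AE_lborel_singleton[of a] by (intro nn_integral_cong_AE) (auto simp: indicator_def)
  also have "\<dots> = ennreal (0 - (- inverse (a ^ n)))"
  proof (rule nn_integral_FTC_atLeast)
    show "((\<lambda>s. - inverse (s ^ n)) has_real_derivative real n * inverse (s ^ (n + 1))) (at s)" if "a \<le> s" for s
    proof -
      have "s ^ (n - 1) * (inverse (s ^ n) * inverse (s ^ n)) = inverse (s ^ (n + 1))"
        using that assms by (cases n) (auto simp: field_simps)
      then show ?thesis
        using that assms by (auto intro!: derivative_eq_intros simp: power2_eq_square mult_ac)
    qed
    show "((\<lambda>s::real. - inverse (s ^ n)) \<longlongrightarrow> 0) at_top"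
      using tendsto_minus[OF tendsto_inverse_0_at_top[OF filterlim_pow_at_top[OF assms(2) filterlim_ident]]] by simp
  qed (use assms in auto)
  finally show ?thesis by simp
qed

text \<open>The surface measure is defined through cones, so the right side is a double integral
  over t and a point x of the punctured ball. Substituting t = s |x|, exchanging the integrals and
  substituting x = y / s leaves for each y the integral of n / s^(n+1) over s > |y|, which is
  |y|^(-n) and cancels the Jacobian factor.\<close>

lemma nn_integral_polar:
  fixes f :: "'a::euclidean_space \<Rightarrow> ennreal"
  assumes [measurable]: "f \<in> borel_measurable borel"
  shows "(\<integral>\<^sup>+x. f x \<partial>lborel) =
    (\<integral>\<^sup>+t. ennreal (t ^ (DIM('a) - 1)) * indicator {0<..} t * (\<integral>\<^sup>+x. f (t *\<^sub>R x) \<partial>sphere_measure) \<partial>lborel)"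
proof -
  define n where "n = DIM('a)"
  have n: "n > 0" by (simp add: n_def)
  define c :: "real \<Rightarrow> ennreal" where "c t = ennreal (t ^ (n - 1)) * indicator {0<..} t" for t
  have [measurable]: "c \<in> borel_measurable borel" unfolding c_def by measurable
  define B where "B = ball 0 1 - {0::'a}"
  have [measurable]: "B \<in> sets borel" by (simp add: B_def)
  have "(\<integral>\<^sup>+t. c t * (\<integral>\<^sup>+x. f (t *\<^sub>R x) \<partial>sphere_measure) \<partial>lborel) =
     (\<integral>\<^sup>+t. (\<integral>\<^sup>+x. of_nat n * (c t * f (t *\<^sub>R (x /\<^sub>R norm x)) * indicator B x) \<partial>lborel) \<partial>lborel)"
  proof (rule nn_integral_cong)
    fix t :: real
    have "(\<integral>\<^sup>+x. of_nat n * (c t * f (t *\<^sub>R (x /\<^sub>R norm x)) * indicator B x) \<partial>lborel) =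
      (of_nat n * c t) * (\<integral>\<^sup>+x. f (t *\<^sub>R (x /\<^sub>R norm x)) * indicator B x \<partial>lborel)"
      by (subst nn_integral_cmult[symmetric], measurable) (simp add: mult.assoc)
    then show "c t * (\<integral>\<^sup>+x. f (t *\<^sub>R x) \<partial>sphere_measure) =
      (\<integral>\<^sup>+x. of_nat n * (c t * f (t *\<^sub>R (x /\<^sub>R norm x)) * indicator B x) \<partial>lborel)"
      by (subst nn_integral_sphere_measure, measurable) (simp add: n_def B_def mult_ac)
  qed
  also have "\<dots> = (\<integral>\<^sup>+x. (\<integral>\<^sup>+t. of_nat n * (c t * f (t *\<^sub>R (x /\<^sub>R norm x)) * indicator B x) \<partial>lborel) \<partial>lborel)"
    by (rule lborel_pair.Fubini'[symmetric]) measurable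
  also have "\<dots> = (\<integral>\<^sup>+x. (\<integral>\<^sup>+s. of_nat n * (c s * (ennreal (norm x ^ n) * f (s *\<^sub>R x) * indicator B x)) \<partial>lborel) \<partial>lborel)"
  proof (rule nn_integral_cong)
    fix x :: 'a
    show "(\<integral>\<^sup>+t. of_nat n * (c t * f (t *\<^sub>R (x /\<^sub>R norm x)) * indicator B x) \<partial>lborel) =
      (\<integral>\<^sup>+s. of_nat n * (c s * (ennreal (norm x ^ n) * f (s *\<^sub>R x) * indicator B x)) \<partial>lborel)"
    proof (cases "x \<in> B")
      case True
      then have x: "norm x > 0" by (auto simp: B_def)
      have c: "ennreal (norm x) * c (norm x * s) = c s * ennreal (norm x ^ n)" for s
      proof (cases "s > 0")
        case True
        have "norm x * (norm x * s) ^ (n - 1) = s ^ (n - 1) * norm x ^ n"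
          using n by (cases n) (auto simp: power_mult_distrib)
        then have "ennreal (norm x) * ennreal ((norm x * s) ^ (n - 1)) = ennreal (s ^ (n - 1)) * ennreal (norm x ^ n)"
          using True by (simp flip: ennreal_mult)
        then show ?thesis using x True by (simp add: c_def)
      qed (use x in \<open>auto simp: c_def mult_le_0_iff zero_less_mult_iff\<close>)
      have "(\<integral>\<^sup>+t. of_nat n * (c t * f (t *\<^sub>R (x /\<^sub>R norm x)) * indicator B x) \<partial>lborel) =
        ennreal (norm x) * (\<integral>\<^sup>+s. of_nat n * (c (norm x * s) * f ((norm x * s) *\<^sub>R (x /\<^sub>R norm x))) \<partial>lborel)"
        using True x by (subst nn_integral_real_affine[where c="norm x" and t=0]) auto
      also have "\<dots> = (\<integral>\<^sup>+s. of_nat n * ((ennreal (norm x) * c (norm x * s)) * f (s *\<^sub>R x)) \<partial>lborel)"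
        using x by (subst nn_integral_cmult[symmetric]) (auto simp: mult_ac field_simps)
      finally show ?thesis using True unfolding c by (simp add: mult_ac)
    qed simp
  qed
  also have "\<dots> = (\<integral>\<^sup>+s. (\<integral>\<^sup>+x. of_nat n * (c s * (ennreal (norm x ^ n) * f (s *\<^sub>R x) * indicator B x)) \<partial>lborel) \<partial>lborel)"
    by (rule lborel_pair.Fubini') measurable
  also have "\<dots> = (\<integral>\<^sup>+s. (\<integral>\<^sup>+y. ennreal (norm y ^ n) * f y *
       (ennreal (real n * inverse (s ^ (n + 1))) * (if norm y < s \<and> 0 < norm y then 1 else 0)) \<partial>lborel) \<partial>lborel)"
  proof (rule nn_integral_cong)
    fix s :: real
    show "(\<integral>\<^sup>+x. of_nat n * (c s * (ennreal (norm x ^ n) * f (s *\<^sub>R x) * indicator B x)) \<partial>lborel) =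
      (\<integral>\<^sup>+y. ennreal (norm y ^ n) * f y *
       (ennreal (real n * inverse (s ^ (n + 1))) * (if norm y < s \<and> 0 < norm y then 1 else 0)) \<partial>lborel)"
    proof (cases "s > 0")
      case True
      have i: "ennreal (s ^ n) * (ennreal (norm (s *\<^sub>R x) ^ n) * f (s *\<^sub>R x) *
       (ennreal (real n * inverse (s ^ (n + 1))) * (if norm (s *\<^sub>R x) < s \<and> 0 < norm (s *\<^sub>R x) then 1 else 0))) =
        of_nat n * (c s * (ennreal (norm x ^ n) * f (s *\<^sub>R x) * indicator B x))" for x :: 'a
      proof (cases "x \<in> B")
        case xB: True
        have e: "s ^ n * ((s * norm x) ^ n * (real n * inverse (s ^ (n + 1)))) = real n * (s ^ (n - 1) * norm x ^ n)"
        proof -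
          obtain m where m: "n = Suc m" using n by (cases n) auto
          show ?thesis unfolding m using True by (simp add: field_simps power_mult_distrib)
        qed
        have key: "ennreal (s ^ n) * (ennreal (norm (s *\<^sub>R x) ^ n) * ennreal (real n * inverse (s ^ (n + 1)))) =
          of_nat n * (ennreal (s ^ (n - 1)) * ennreal (norm x ^ n))"
        proof -
          have "ennreal (s ^ n) * (ennreal (norm (s *\<^sub>R x) ^ n) * ennreal (real n * inverse (s ^ (n + 1)))) =
             ennreal (s ^ n * ((s * norm x) ^ n * (real n * inverse (s ^ (n + 1)))))"
          proof -
            have g: "s ^ n \<ge> 0" "(s * norm x) ^ n \<ge> 0" "real n * inverse (s ^ (n + 1)) \<ge> 0"
              using True by auto
            have "norm (s *\<^sub>R x) = s * norm x" using True by simp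
            then show ?thesis
              by (simp only: ennreal_mult[OF g(1) mult_nonneg_nonneg[OF g(2,3)]] ennreal_mult[OF g(2,3)])
          qed
          then show ?thesis unfolding e using True by (simp add: ennreal_of_nat_eq_real_of_nat ennreal_mult)
        qed
        have "s * norm x < s" "x \<noteq> 0" using True xB by (auto simp: B_def)
        then have "ennreal (s ^ n) * (ennreal (norm (s *\<^sub>R x) ^ n) * f (s *\<^sub>R x) *
            (ennreal (real n * inverse (s ^ (n + 1))) * (if norm (s *\<^sub>R x) < s \<and> 0 < norm (s *\<^sub>R x) then 1 else 0))) =
          (ennreal (s ^ n) * (ennreal (norm (s *\<^sub>R x) ^ n) * ennreal (real n * inverse (s ^ (n + 1))))) * f (s *\<^sub>R x)"
          using True by (simp add: mult_ac)
        also have "\<dots> = of_nat n * (c s * (ennreal (norm x ^ n) * f (s *\<^sub>R x) * indicator B x))"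
          unfolding key using xB True by (simp add: c_def mult_ac)
        finally show ?thesis .
      next
        case xB: False
        then have "x = 0 \<or> \<not> s * norm x < s" using True xB by (auto simp: B_def)
        then show ?thesis using xB True by auto
      qed
      show ?thesis
        apply (subst (2) nn_integral_lborel_scale[OF _ True])
         apply measurable
        apply (subst nn_integral_cmult[symmetric])
         apply measurable
        apply (simp only: i n_def[symmetric])
        done
    next
      case False
      then have "\<not> norm y < s" for y :: 'a using norm_ge_zero[of y] by linarith
      with False show ?thesis by (simp add: c_def)
    qed
  qed
  also have "\<dots> = (\<integral>\<^sup>+y. (\<integral>\<^sup>+s. ennreal (norm y ^ n) * f y *
       (ennreal (real n * inverse (s ^ (n + 1))) * (if norm y < s \<and> 0 < norm y then 1 else 0)) \<partial>lborel) \<partial>lborel)"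
    by (rule lborel_pair.Fubini'[symmetric]) measurable
  also have "\<dots> = (\<integral>\<^sup>+y. f y \<partial>lborel)"
  proof (rule nn_integral_cong_AE)
    have "(\<integral>\<^sup>+s. ennreal (norm y ^ n) * f y *
       (ennreal (real n * inverse (s ^ (n + 1))) * (if norm y < s \<and> 0 < norm y then 1 else 0)) \<partial>lborel) = f y"
      if y: "y \<noteq> 0" for y
    proof -
      have "(\<integral>\<^sup>+s. ennreal (norm y ^ n) * f y *
       (ennreal (real n * inverse (s ^ (n + 1))) * (if norm y < s \<and> 0 < norm y then 1 else 0)) \<partial>lborel) =
        ennreal (norm y ^ n) * f y * ennreal (inverse (norm y ^ n))"
      proof -
        have "(if norm y < s \<and> 0 < norm y then 1 else 0) = (indicator {norm y<..} s :: ennreal)" for s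
          using y by (auto simp: indicator_def)
        then show ?thesis
          using nn_integral_inverse_power[of "norm y" n] y n by (subst nn_integral_cmult) (auto simp del: power_Suc)
      qed
      also have "\<dots> = f y * ennreal (norm y ^ n * inverse (norm y ^ n))"
        by (subst ennreal_mult) (auto simp: mult_ac)
      also have "\<dots> = f y" using y by simp
      finally show ?thesis .
    qed
    then show "AE y in lborel. (\<integral>\<^sup>+s. ennreal (norm y ^ n) * f y *
       (ennreal (real n * inverse (s ^ (n + 1))) * (if norm y < s \<and> 0 < norm y then 1 else 0)) \<partial>lborel) = f y"
      using AE_lborel_singleton[of "0::'a"] by auto
  qed
  finally show ?thesis unfolding c_def n_def by simp
qed

lemma emeasure_sphere_measure:
  "emeasure sphere_measure (sphere (0::'a::euclidean_space) 1) = of_nat DIM('a) * emeasure lborel (ball (0::'a) 1)"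
proof -
  have "emeasure sphere_measure (sphere (0::'a) 1) = (\<integral>\<^sup>+x. 1 \<partial>(sphere_measure :: 'a measure))"
    by (simp add: space_sphere_measure)
  also have "\<dots> = of_nat DIM('a) * (\<integral>\<^sup>+x. indicator (ball 0 1 - {0::'a}) x \<partial>lborel)"
    by (subst nn_integral_sphere_measure) auto
  finally show ?thesis by (simp add: emeasure_Diff)
qed

interpretation sphere: finite_measure "sphere_measure :: 'a::euclidean_space measure"
  by standard (simp add: space_sphere_measure emeasure_sphere_measure ennreal_mult_eq_top_iff
      less_imp_neq[OF emeasure_lborel_ball_finite[simplified infinity_ennreal_def]])

lemma measure_sphere_measure:
  "measure sphere_measure (space (sphere_measure :: 'a measure)) = DIM('a) * measure lborel (ball (0::'a::euclidean_space) 1)"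
  by (simp add: measure_def space_sphere_measure emeasure_sphere_measure enn2real_mult)

lemma continuous_bound_on_compact:
  fixes F :: "'a::t2_space \<Rightarrow> 'b::real_normed_vector"
  assumes "continuous_on UNIV F" "compact K"
  obtains C where "C \<ge> 0" "\<And>x. x \<in> K \<Longrightarrow> norm (F x) \<le> C"
proof -
  have "compact (F ` K)" by (intro compact_continuous_image continuous_on_subset[OF assms(1)] assms) auto
  then obtain C where "\<forall>y\<in>F ` K. norm y \<le> C" using compact_imp_bounded bounded_iff by blast
  then show ?thesis by (intro that[of "\<bar>C\<bar>"]) (auto intro: order_trans[OF _ abs_ge_self])
qed

lemma integrable_sphere_continuous:
  fixes F :: "'a::euclidean_space \<Rightarrow> 'b::euclidean_space"
  assumes "continuous_on UNIV F"
  shows "integrable sphere_measure F"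
proof -
  obtain C where "\<And>x. x \<in> sphere 0 1 \<Longrightarrow> norm (F x) \<le> C"
    using continuous_bound_on_compact[OF assms compact_sphere] by metis
  then show ?thesis
    by (intro sphere.integrable_const_bound[where B=C] AE_I2 borel_measurable_sphere_measure borel_of_continuous assms)
       (auto simp: space_sphere_measure)
qed

lemma finite_measure_lebesgue_on_ball: "finite_measure (lebesgue_on (ball (0::'a::euclidean_space) r))"
  by standard (simp add: emeasure_restrict_space less_imp_neq[OF emeasure_lborel_ball_finite[simplified infinity_ennreal_def]])

lemma borel_measurable_lebesgue_on:
  "f \<in> borel_measurable borel \<Longrightarrow> f \<in> borel_measurable (lebesgue_on S)"
  by (intro measurable_restrict_space1 measurable_completion) simp

lemma integrable_ball_continuous:
  fixes F :: "'a::euclidean_space \<Rightarrow> 'b::euclidean_space"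
  assumes "continuous_on UNIV F"
  shows "integrable (lebesgue_on (ball 0 1)) F"
proof -
  interpret finite_measure "lebesgue_on (ball (0::'a) 1)" by (rule finite_measure_lebesgue_on_ball)
  obtain C where "\<And>x. x \<in> cball 0 1 \<Longrightarrow> norm (F x) \<le> C"
    using continuous_bound_on_compact[OF assms compact_cball] by metis
  then show ?thesis
    by (intro integrable_const_bound[where B=C] AE_I2 borel_measurable_lebesgue_on borel_of_continuous assms) auto
qed

text \<open>Integrating \<open>d/dt (t\<^sup>n F(t x)) = t\<^sup>n\<^sup>-\<^sup>1 (n F + DF x)(t x)\<close> over \<open>0 < t < 1\<close> and \<open>x\<close> in the sphere.\<close>

lemma Euler_Gauss_real:
  fixes F :: "'a::euclidean_space \<Rightarrow> real"
  assumes F: "\<And>x. (F has_derivative F' x) (at x)"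
    and M: "continuous_on UNIV (\<lambda>x. F' x x)"
  shows "(LINT x|sphere_measure. F x) = (LINT x|lebesgue_on (ball 0 1). DIM('a) * F x + F' x x)"
proof -
  define n where "n = DIM('a)"
  have n: "n > 0" by (simp add: n_def)
  define M where "M x = n * F x + F' x x" for x
  have Fc: "continuous_on UNIV F" using F has_derivative_continuous continuous_at_imp_continuous_on by blast
  have Mc: "continuous_on UNIV M" unfolding M_def by (intro continuous_intros Fc M)
  have [measurable]: "M \<in> borel_measurable borel" "F \<in> borel_measurable borel" using Mc Fc by (auto intro: borel_of_continuous)
  obtain C0 where C0: "\<And>x. x \<in> cball 0 1 \<Longrightarrow> norm (M x) \<le> C0"
    using continuous_bound_on_compact[OF Mc compact_cball] by metis
  obtain C1 where C1: "\<And>x. x \<in> cball 0 1 \<Longrightarrow> norm (F x) \<le> C1"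
    using continuous_bound_on_compact[OF Fc compact_cball] by metis
  \<comment> \<open>Shifting by constants makes both integrands nonnegative, so that Tonelli and the
    fundamental theorem in [0,\<infinity>] apply. \<open>M + C\<close> still belongs to
    \<open>F + C / n\<close>, and both integrals grow by C times the volume of the ball. The summand
    with \<open>C1\<close> makes C / n dominate |F|.\<close>
  define C where "C = \<bar>C0\<bar> + n * \<bar>C1\<bar>"
  have CM: "M x + C \<ge> 0" if "norm x \<le> 1" for x
  proof -
    have "0 \<le> real n * \<bar>C1\<bar>" by simp
    moreover have "\<bar>M x\<bar> \<le> C0" using C0[of x] that by simp
    ultimately show ?thesis unfolding C_def by linarith
  qed
  have CF: "F x + C / n \<ge> 0" if "norm x \<le> 1" for x
  proof -
    have "C / n \<ge> n * \<bar>C1\<bar> / n" unfolding C_def by (intro divide_right_mono) auto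
    then have "C / n \<ge> \<bar>C1\<bar>" using n by simp
    then show ?thesis using C1[of x] that by auto
  qed
  define B where "B = ball 0 1 - {0::'a}"
  have [measurable]: "B \<in> sets borel" "ball (0::'a) 1 \<in> sets borel" by (simp_all add: B_def)
  have "(\<integral>\<^sup>+x. ennreal (M x + C) * indicator (ball 0 1) x \<partial>lborel) =
    (\<integral>\<^sup>+t. ennreal (t ^ (n - 1)) * indicator {0<..} t *
       (\<integral>\<^sup>+x. ennreal (M (t *\<^sub>R x) + C) * indicator (ball 0 1) (t *\<^sub>R x) \<partial>sphere_measure) \<partial>lborel)"
    unfolding n_def by (rule nn_integral_polar) measurable
  also have "\<dots> = (\<integral>\<^sup>+t. of_nat n * (\<integral>\<^sup>+x. ennreal (t ^ (n - 1)) * indicator {0<..<1} t *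
      ennreal (M (t *\<^sub>R (x /\<^sub>R norm x)) + C) * indicator B x \<partial>lborel) \<partial>lborel)"
  proof (rule nn_integral_cong)
    fix t :: real
    have "(\<integral>\<^sup>+x. ennreal (M (t *\<^sub>R x) + C) * indicator (ball 0 1) (t *\<^sub>R x) \<partial>sphere_measure) =
      of_nat n * (\<integral>\<^sup>+x. ennreal (M (t *\<^sub>R (x /\<^sub>R norm x)) + C) * indicator (ball 0 1) (t *\<^sub>R (x /\<^sub>R norm x)) * indicator B x \<partial>lborel)"
      unfolding B_def n_def by (rule nn_integral_sphere_measure) measurable
    then have "ennreal (t ^ (n - 1)) * indicator {0<..} t *
       (\<integral>\<^sup>+x. ennreal (M (t *\<^sub>R x) + C) * indicator (ball 0 1) (t *\<^sub>R x) \<partial>sphere_measure) =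
       of_nat n * (\<integral>\<^sup>+x. ennreal (t ^ (n - 1)) * indicator {0<..} t *
         (ennreal (M (t *\<^sub>R (x /\<^sub>R norm x)) + C) * indicator (ball 0 1) (t *\<^sub>R (x /\<^sub>R norm x)) * indicator B x) \<partial>lborel)"
      by (subst nn_integral_cmult, measurable) (simp add: mult_ac)
    also have "(\<integral>\<^sup>+x. ennreal (t ^ (n - 1)) * indicator {0<..} t *
         (ennreal (M (t *\<^sub>R (x /\<^sub>R norm x)) + C) * indicator (ball 0 1) (t *\<^sub>R (x /\<^sub>R norm x)) * indicator B x) \<partial>lborel) =
       (\<integral>\<^sup>+x. ennreal (t ^ (n - 1)) * indicator {0<..<1} t *
      ennreal (M (t *\<^sub>R (x /\<^sub>R norm x)) + C) * indicator B x \<partial>lborel)"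
      by (rule nn_integral_cong) (auto simp: indicator_def B_def mult.assoc)
    finally show "ennreal (t ^ (n - 1)) * indicator {0<..} t *
       (\<integral>\<^sup>+x. ennreal (M (t *\<^sub>R x) + C) * indicator (ball 0 1) (t *\<^sub>R x) \<partial>sphere_measure) =
       of_nat n * (\<integral>\<^sup>+x. ennreal (t ^ (n - 1)) * indicator {0<..<1} t *
      ennreal (M (t *\<^sub>R (x /\<^sub>R norm x)) + C) * indicator B x \<partial>lborel)" .
  qed
  also have "\<dots> = of_nat n * (\<integral>\<^sup>+t. (\<integral>\<^sup>+x. ennreal (t ^ (n - 1)) * indicator {0<..<1} t *
      ennreal (M (t *\<^sub>R (x /\<^sub>R norm x)) + C) * indicator B x \<partial>lborel) \<partial>lborel)"
    by (rule nn_integral_cmult) measurable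
  also have "(\<integral>\<^sup>+t. (\<integral>\<^sup>+x. ennreal (t ^ (n - 1)) * indicator {0<..<1} t *
      ennreal (M (t *\<^sub>R (x /\<^sub>R norm x)) + C) * indicator B x \<partial>lborel) \<partial>lborel) =
     (\<integral>\<^sup>+x. (\<integral>\<^sup>+t. ennreal (t ^ (n - 1)) * indicator {0<..<1} t *
      ennreal (M (t *\<^sub>R (x /\<^sub>R norm x)) + C) * indicator B x \<partial>lborel) \<partial>lborel)"
    by (rule lborel_pair.Fubini'[symmetric]) measurable
  also have "\<dots> = (\<integral>\<^sup>+x. ennreal (F (x /\<^sub>R norm x) + C / n) * indicator B x \<partial>lborel)"
  proof (rule nn_integral_cong)
    fix x :: 'a
    show "(\<integral>\<^sup>+t. ennreal (t ^ (n - 1)) * indicator {0<..<1} t *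
      ennreal (M (t *\<^sub>R (x /\<^sub>R norm x)) + C) * indicator B x \<partial>lborel) =
      ennreal (F (x /\<^sub>R norm x) + C / n) * indicator B x"
    proof (cases "x \<in> B")
      case True
      define y where "y = x /\<^sub>R norm x"
      have y: "norm y = 1" using True by (simp add: y_def B_def)
      have "(\<integral>\<^sup>+t. ennreal (t ^ (n - 1)) * indicator {0<..<1} t * ennreal (M (t *\<^sub>R y) + C) \<partial>lborel) =
         (\<integral>\<^sup>+t. ennreal (t ^ (n - 1) * (M (t *\<^sub>R y) + C)) * indicator {0..1} t \<partial>lborel)"
        using AE_lborel_singleton[of "0::real"] AE_lborel_singleton[of "1::real"]
      proof (intro nn_integral_cong_AE, eventually_elim)
        fix t :: real assume "t \<noteq> 0" "t \<noteq> 1"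
        then show "ennreal (t ^ (n - 1)) * indicator {0<..<1} t * ennreal (M (t *\<^sub>R y) + C) =
           ennreal (t ^ (n - 1) * (M (t *\<^sub>R y) + C)) * indicator {0..1} t"
          using CM[of "t *\<^sub>R y"] y by (auto simp: indicator_def ennreal_mult)
      qed
      also have "\<dots> = ennreal ((1 ^ n * F (1 *\<^sub>R y) + C / n * 1 ^ n) - (0 ^ n * F (0 *\<^sub>R y) + C / n * 0 ^ n))"
      proof (rule nn_integral_FTC_Icc[where F="\<lambda>t. t ^ n * F (t *\<^sub>R y) + C / n * t ^ n"])
        fix t :: real assume "t \<in> {0..1}"
        then have t: "0 \<le> t" "t \<le> 1" by auto
        have lin: "F' (t *\<^sub>R y) (c *\<^sub>R y) = c * F' (t *\<^sub>R y) y" for c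
          using linear_scale[OF has_derivative_linear[OF F]] by simp
        have "((\<lambda>t. F (t *\<^sub>R y)) has_derivative (\<lambda>h. F' (t *\<^sub>R y) (h *\<^sub>R y))) (at t)"
          by (rule has_derivative_compose[OF _ F]) (auto intro!: derivative_eq_intros)
        then have d: "((\<lambda>t. F (t *\<^sub>R y)) has_real_derivative F' (t *\<^sub>R y) y) (at t)"
          unfolding has_field_derivative_def by (rule has_derivative_eq_rhs) (simp add: lin fun_eq_iff)
        have pw: "t ^ n = t ^ (n - 1) * t" using n by (cases n) auto
        show "((\<lambda>t. t ^ n * F (t *\<^sub>R y) + C / n * t ^ n) has_real_derivative t ^ (n - 1) * (M (t *\<^sub>R y) + C)) (at t)"
          by (rule derivative_eq_intros d refl)+
             (use n in \<open>simp add: M_def lin pw field_simps\<close>)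
        show "0 \<le> t ^ (n - 1) * (M (t *\<^sub>R y) + C)" using t CM[of "t *\<^sub>R y"] y by auto
      qed auto
      also have "\<dots> = ennreal (F y + C / n)" using n by (simp add: zero_power)
      finally show ?thesis using True by (simp add: y_def)
    qed simp
  qed
  also have "of_nat n * \<dots> = (\<integral>\<^sup>+x. ennreal (F x + C / n) \<partial>sphere_measure)"
    unfolding n_def B_def by (rule nn_integral_sphere_measure[symmetric]) measurable
  also have "\<dots> = ennreal (LINT x|sphere_measure. F x + C / n)"
    using integrable_sphere_continuous[OF Fc] CF
    by (intro nn_integral_eq_integral AE_I2) (auto simp: space_sphere_measure)
  also have "(LINT x|sphere_measure. F x + C / n) = (LINT x|sphere_measure. F x) + C * measure lborel (ball (0::'a) 1)"
    using integrable_sphere_continuous[OF Fc] n by (simp add: measure_sphere_measure[unfolded space_sphere_measure] space_sphere_measure n_def)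
  also have "(\<integral>\<^sup>+x. ennreal (M x + C) * indicator (ball 0 1) x \<partial>lborel) = (\<integral>\<^sup>+x. ennreal (M x + C) \<partial>lebesgue_on (ball 0 1))"
    by (simp add: nn_integral_restrict_space nn_integral_completion)
  also have "\<dots> = ennreal (LINT x|lebesgue_on (ball 0 1). M x + C)"
  proof (intro nn_integral_eq_integral AE_I2)
    interpret finite_measure "lebesgue_on (ball (0::'a) 1)" by (rule finite_measure_lebesgue_on_ball)
    show "integrable (lebesgue_on (ball 0 1)) (\<lambda>x. M x + C)" using integrable_ball_continuous[OF Mc] by auto
  qed (auto simp: CM)
  also have "(LINT x|lebesgue_on (ball 0 1). M x + C) = (LINT x|lebesgue_on (ball 0 1). M x) + C * measure lborel (ball (0::'a) 1)"
  proof -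
    interpret finite_measure "lebesgue_on (ball (0::'a) 1)" by (rule finite_measure_lebesgue_on_ball)
    show ?thesis using integrable_ball_continuous[OF Mc]
      by (simp add: measure_restrict_space)
  qed
  finally have eq: "ennreal ((LINT x|lebesgue_on (ball 0 1). M x) + C * measure lborel (ball (0::'a) 1)) =
    ennreal ((LINT x|sphere_measure. F x) + C * measure lborel (ball (0::'a) 1))" .
  have p1: "(LINT x|sphere_measure. F x) + C * measure lborel (ball (0::'a) 1) \<ge> 0"
  proof -
    have "0 \<le> (LINT x|sphere_measure. F x + C / n)" using CF by (intro integral_nonneg_AE AE_I2) (auto simp: space_sphere_measure)
    then show ?thesis
      using integrable_sphere_continuous[OF Fc] n by (simp add: measure_sphere_measure[unfolded space_sphere_measure] space_sphere_measure n_def mult.commute)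
  qed
  have p2: "(LINT x|lebesgue_on (ball 0 1). M x) + C * measure lborel (ball (0::'a) 1) \<ge> 0"
  proof -
    interpret finite_measure "lebesgue_on (ball (0::'a) 1)" by (rule finite_measure_lebesgue_on_ball)
    have "0 \<le> (LINT x|lebesgue_on (ball 0 1). M x + C)" using CM by (intro integral_nonneg_AE AE_I2) auto
    then show ?thesis using integrable_ball_continuous[OF Mc] by (simp add: measure_restrict_space mult.commute)
  qed
  from eq p1 p2 show ?thesis by (simp add: M_def n_def)
qed

text \<open>By translation invariance the integral of every difference quotient is zero. The
  Lipschitz bound dominates the quotients by a multiple of the indicator of a ball, so
  differentiability almost everywhere is enough for the limit.\<close>

lemma integral_directional_derivative_eq_0:
  fixes F :: "'a::euclidean_space \<Rightarrow> real"
  assumes lip: "\<And>x y. \<bar>F x - F y\<bar> \<le> L * norm (x - y)"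
    and supp: "\<And>x. norm x > R \<Longrightarrow> F x = 0"
    and D: "AE x in lborel. (F has_derivative D x) (at x)"
    and [measurable]: "(\<lambda>x. D x e) \<in> borel_measurable borel"
  shows "(LINT x|lborel. D x e) = 0"
proof -
  have L0: "L * norm (x - y) \<ge> 0" for x y :: 'a
    using lip[of x y] abs_ge_zero[of "F x - F y"] by linarith
  have cont: "continuous_on UNIV F"
  proof (rule continuous_onI)
    fix x :: 'a and \<epsilon> :: real assume "\<epsilon> > 0"
    show "\<exists>d>0. \<forall>x'\<in>UNIV. dist x' x < d \<longrightarrow> dist (F x') (F x) \<le> \<epsilon>"
    proof (intro exI[of _ "\<epsilon> / (\<bar>L\<bar> + 1)"] conjI ballI impI)
      fix x' assume "dist x' x < \<epsilon> / (\<bar>L\<bar> + 1)"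
      then have "norm (x' - x) * (\<bar>L\<bar> + 1) < \<epsilon>" by (simp add: dist_norm pos_less_divide_eq)
      moreover have "L * norm (x' - x) \<le> norm (x' - x) * (\<bar>L\<bar> + 1)"
      proof -
        have "norm (x' - x) * (\<bar>L\<bar> + 1) = \<bar>L\<bar> * norm (x' - x) + norm (x' - x)" by (simp add: algebra_simps)
        then show ?thesis
          using mult_right_mono[OF abs_ge_self[of L] norm_ge_zero[of "x' - x"]] norm_ge_zero[of "x' - x"] by linarith
      qed
      ultimately show "dist (F x') (F x) \<le> \<epsilon>" using lip[of x' x] by (simp add: dist_real_def)
    qed (use \<open>\<epsilon> > 0\<close> in auto)
  qed
  then have [measurable]: "F \<in> borel_measurable borel" by (rule borel_of_continuous)
  obtain C where C: "C \<ge> 0" "\<And>x. x \<in> cball 0 R \<Longrightarrow> norm (F x) \<le> C"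
    using continuous_bound_on_compact[OF cont compact_cball] by metis
  have Fint: "integrable lborel F"
  proof (rule Bochner_Integration.integrable_bound[where f="\<lambda>x. C * indicator (cball 0 R) x"])
    show "integrable lborel (\<lambda>x::'a. C * indicator (cball 0 R) x)"
      using emeasure_lborel_cball_finite by (intro integrable_mult_right integrable_real_indicator) auto
    show "AE x in lborel. norm (F x) \<le> norm (C * indicator (cball 0 R) x)"
      using C supp by (intro AE_I2) (auto simp: indicator_def)
  qed measurable
  have shift_int: "integrable lborel (\<lambda>x. F (c + x))" and shift: "(LINT x|lborel. F (c + x)) = (LINT x|lborel. F x)" for c
  proof -
    have "integrable (distr lborel borel ((+) c)) F" using Fint by (simp add: lborel_distr_plus)
    then show "integrable lborel (\<lambda>x. F (c + x))" by (subst (asm) integrable_distr_eq) auto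
    have "(LINT x|lborel. F x) = (LINT x|distr lborel borel ((+) c). F x)" by (simp add: lborel_distr_plus)
    then show "(LINT x|lborel. F (c + x)) = (LINT x|lborel. F x)" by (subst (asm) integral_distr) auto
  qed
  define s where "s m x = real (Suc m) * (F ((1 / real (Suc m)) *\<^sub>R e + x) - F x)" for m x
  have s0: "(LINT x|lborel. s m x) = 0" for m
    unfolding s_def using shift_int[of "(1 / real (Suc m)) *\<^sub>R e"] shift[of "(1 / real (Suc m)) *\<^sub>R e"] Fint
    by simp
  have "(\<lambda>m. LINT x|lborel. s m x) \<longlonglongrightarrow> (LINT x|lborel. D x e)"
  proof (rule integral_dominated_convergence[where w="\<lambda>x. (L * norm e) * indicator (cball 0 (R + norm e)) x"])
    show "integrable lborel (\<lambda>x::'a. (L * norm e) * indicator (cball 0 (R + norm e)) x)"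
      using emeasure_lborel_cball_finite by (intro integrable_mult_right integrable_real_indicator) auto
    show "AE x in lborel. norm (s m x) \<le> (L * norm e) * indicator (cball 0 (R + norm e)) x" for m
    proof (rule AE_I2)
      fix x
      define v where "v = (1 / real (Suc m)) *\<^sub>R e"
      have nv: "real (Suc m) * norm v = norm e" "norm v \<le> norm e" by (auto simp: v_def divide_simps mult_le_cancel_left1)
      show "norm (s m x) \<le> (L * norm e) * indicator (cball 0 (R + norm e)) x"
      proof (cases "norm x \<le> R + norm e")
        case True
        have "\<bar>F (v + x) - F x\<bar> \<le> L * norm v" using lip[of "v + x" x] by simp
        then have "real (Suc m) * \<bar>F (v + x) - F x\<bar> \<le> real (Suc m) * (L * norm v)" by (intro mult_left_mono) auto
        also have "\<dots> = L * (real (Suc m) * norm v)" by (simp only: mult_ac)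
        finally show ?thesis using True nv by (simp add: s_def v_def abs_mult)
      next
        case False
        have "norm x \<le> norm (v + x) + norm v" using norm_triangle_ineq4[of "v + x" v] by simp
        then have "norm (v + x) > R" "norm x > R" using False nv norm_ge_zero[of e] by linarith+
        then show ?thesis using False supp by (simp add: s_def v_def)
      qed
    qed
    show "AE x in lborel. (\<lambda>m. s m x) \<longlonglongrightarrow> D x e" using D
    proof eventually_elim
      fix x assume "(F has_derivative D x) (at x)"
      then have "((\<lambda>t. F (x + t *\<^sub>R e)) has_derivative (\<lambda>t. D x (t *\<^sub>R e))) (at 0)"
        by (intro has_derivative_compose[of "\<lambda>t. x + t *\<^sub>R e", where g=F, simplified]) (auto intro!: derivative_eq_intros)
      moreover have "D x (t *\<^sub>R e) = D x e * t" for t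
        using linear_scale[OF has_derivative_linear[OF \<open>(F has_derivative D x) (at x)\<close>]] by simp
      ultimately have "((\<lambda>t. F (x + t *\<^sub>R e)) has_real_derivative D x e) (at 0)"
        by (simp add: has_field_derivative_def)
      then have lim: "((\<lambda>h. (F (x + h *\<^sub>R e) - F x) / h) \<longlongrightarrow> D x e) (at 0)" by (simp add: DERIV_def)
      have "filterlim (\<lambda>m. 1 / real (Suc m)) (at 0) sequentially"
        unfolding filterlim_at using LIMSEQ_inverse_real_of_nat by (auto simp: inverse_eq_divide)
      from filterlim_compose[OF lim this] show "(\<lambda>m. s m x) \<longlonglongrightarrow> D x e"
        by (simp add: s_def add.commute mult.commute)
    qed
  qed (auto simp: s_def)
  then show ?thesis by (simp add: s0 LIMSEQ_const_iff)
qed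

lemma cont_diff1D:
  fixes f :: "'a::real_normed_vector \<Rightarrow> 'b::real_normed_vector"
  assumes "cont_diff 1 f"
  shows "(f has_derivative frechet_derivative f (at x)) (at x)"
    and "continuous_on UNIV (\<lambda>x. frechet_derivative f (at x) h)"
    and "continuous_on UNIV f"
proof -
  show d: "(f has_derivative frechet_derivative f (at x)) (at x)" for x
    using assms frechet_derivative_works by (auto simp: eval_nat_numeral)
  show "continuous_on UNIV (\<lambda>x. frechet_derivative f (at x) h)" using assms by (auto simp: eval_nat_numeral)
  show "continuous_on UNIV f" using d has_derivative_continuous continuous_at_imp_continuous_on by blast
qed

lemma cont_diff1I:
  fixes f :: "'a::real_normed_vector \<Rightarrow> 'b::real_normed_vector"
  assumes "\<And>x. (f has_derivative f' x) (at x)" "\<And>h. continuous_on UNIV (\<lambda>x. f' x h)"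
  shows "cont_diff 1 f"
  using assms frechet_derivative_eqI[OF assms(1)] by (auto simp: differentiable_def)

lemma has_derivative_euclidean_expand:
  fixes f' :: "'a::euclidean_space \<Rightarrow> 'b::real_normed_vector"
  assumes "(f has_derivative f') F"
  shows "f' v = (\<Sum>b\<in>Basis. (v \<bullet> b) *\<^sub>R f' b)"
proof -
  interpret linear f' using has_derivative_linear[OF assms] .
  have "f' v = f' (\<Sum>b\<in>Basis. (v \<bullet> b) *\<^sub>R b)" by (simp add: euclidean_representation)
  then show ?thesis by (simp add: sum scaleR)
qed

lemma cont_diff1_continuous_apply:
  fixes f :: "'a::euclidean_space \<Rightarrow> 'b::real_normed_vector"
  assumes "cont_diff 1 f" "continuous_on UNIV g"
  shows "continuous_on UNIV (\<lambda>x. frechet_derivative f (at x) (g x))"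
  by (subst has_derivative_euclidean_expand[OF cont_diff1D(1)[OF assms(1)]])
    (intro continuous_intros cont_diff1D(2)[OF assms(1)] assms(2))

lemma cont_diff1_Lipschitz_cball:
  fixes f :: "'a::euclidean_space \<Rightarrow> real"
  assumes "cont_diff 1 f"
  obtains L where "L \<ge> 0" "\<And>x y. x \<in> cball 0 R \<Longrightarrow> y \<in> cball 0 R \<Longrightarrow> \<bar>f x - f y\<bar> \<le> L * norm (x - y)"
proof -
  have "\<exists>C. C \<ge> 0 \<and> (\<forall>x\<in>cball 0 R. norm (frechet_derivative f (at x) b) \<le> C)" for b
    using continuous_bound_on_compact[OF cont_diff1D(2)[OF assms] compact_cball[of 0 R]] by metis
  then obtain C where C: "\<And>b. C b \<ge> 0" "\<And>b x. x \<in> cball 0 R \<Longrightarrow> norm (frechet_derivative f (at x) b) \<le> C b"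
    by metis
  define L where "L = (\<Sum>b\<in>(Basis::'a set). C b)"
  have bd: "norm (frechet_derivative f (at x) v) \<le> L * norm v" if "x \<in> cball 0 R" for x v
  proof -
    have "norm (frechet_derivative f (at x) v) \<le> (\<Sum>b\<in>Basis. norm ((v \<bullet> b) *\<^sub>R frechet_derivative f (at x) b))"
      by (subst has_derivative_euclidean_expand[OF cont_diff1D(1)[OF assms]]) (rule norm_sum)
    also have "\<dots> \<le> (\<Sum>b\<in>Basis. norm v * C b)"
      unfolding norm_scaleR by (intro sum_mono mult_mono C(2)[OF that]) (auto simp: Basis_le_norm)
    finally show ?thesis by (simp add: L_def sum_distrib_left mult.commute)
  qed
  show ?thesis
  proof (rule that[of L])
    show "L \<ge> 0" by (simp add: L_def sum_nonneg C)
    fix x y :: 'a assume "x \<in> cball 0 R" "y \<in> cball 0 R"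
    then have "norm (f x - f y) \<le> L * norm (x - y)"
      by (intro differentiable_bound[of "cball 0 R" f "\<lambda>x. frechet_derivative f (at x)"] onorm_le bd)
         (auto intro: has_derivative_at_withinI cont_diff1D(1)[OF assms])
    then show "\<bar>f x - f y\<bar> \<le> L * norm (x - y)" by simp
  qed
qed

text \<open>Extended by zero, \<open>G\<close> is Lipschitz on the whole space and differentiable
  off the sphere, which is a null set.\<close>

lemma integral_ball_directional_derivative_eq_0:
  fixes G :: "'a::euclidean_space \<Rightarrow> real"
  assumes G: "cont_diff 1 G" and G0: "\<And>x. norm x = 1 \<Longrightarrow> G x = 0"
  shows "(LINT x|lebesgue_on (ball 0 1). frechet_derivative G (at x) e) = 0"
proof -
  obtain L where L: "L \<ge> 0" "\<And>x y. x \<in> cball 0 1 \<Longrightarrow> y \<in> cball 0 1 \<Longrightarrow> \<bar>G x - G y\<bar> \<le> L * norm (x - y)"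
    using cont_diff1_Lipschitz_cball[OF G] by metis
  define F where "F x = (if norm x < 1 then G x else 0)" for x
  define D where "D x = (if norm x < 1 then frechet_derivative G (at x) else (\<lambda>_. 0))" for x
  have bd: "\<bar>G x\<bar> \<le> L * norm (x - y)" if "norm x < 1" "norm y \<ge> 1" for x y
  proof -
    obtain b :: 'a where b: "norm b = 1" using norm_Basis nonempty_Basis by blast
    \<comment> \<open>The point of the sphere nearest to x, or any unit vector if x = 0. Its
      distance 1 - |x| from x is at most that of any y outside the open ball, and \<open>G\<close>
      vanishes there.\<close>
    define p where "p = (if x = 0 then b else x /\<^sub>R norm x)"
    have p: "norm p = 1" by (simp add: p_def b)
    have "x - p = (1 - 1 / norm x) *\<^sub>R x" if "x \<noteq> 0" using that by (simp add: p_def algebra_simps inverse_eq_divide)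
    then have "norm (x - p) = 1 - norm x" if "x \<noteq> 0"
    proof -
      have "norm (x - p) = \<bar>1 - 1 / norm x\<bar> * norm x" using \<open>x \<noteq> 0 \<Longrightarrow> x - p = _\<close> that by simp
      also have "\<dots> = \<bar>norm x - 1\<bar>" using that by (simp add: abs_if field_simps)
      finally show ?thesis using \<open>norm x < 1\<close> by simp
    qed
    then have "norm (x - p) \<le> 1 - norm x" by (cases "x = 0") (auto simp: p_def b)
    also have "\<dots> \<le> norm (x - y)" using that norm_triangle_ineq2[of y x] by (simp add: norm_minus_commute)
    finally have "norm (x - p) \<le> norm (x - y)" .
    moreover have "\<bar>G x\<bar> \<le> L * norm (x - p)" using L(2)[of x p] p that G0[OF p] by simp
    ultimately show ?thesis using mult_left_mono[OF _ L(1)] by (meson order_trans)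
  qed
  have "(LINT x|lborel. D x e) = 0"
  proof (rule integral_directional_derivative_eq_0)
    show "\<bar>F x - F y\<bar> \<le> L * norm (x - y)" for x y
      using L bd[of x y] bd[of y x] by (auto simp: F_def norm_minus_commute)
    show "\<And>x. 1 < norm x \<Longrightarrow> F x = 0" by (simp add: F_def)
    have "AE x in lborel. x \<notin> sphere (0::'a) 1"
      using negligible_sphere[of "0::'a" 1] by (intro AE_not_in) (simp add: negligible_iff_null_sets null_sets_completion_iff)
    then show "AE x in lborel. (F has_derivative D x) (at x)"
    proof eventually_elim
      fix x :: 'a assume x: "x \<notin> sphere 0 1"
      show "(F has_derivative D x) (at x)"
      proof (cases "norm x < 1")
        case True
        show ?thesis
          by (rule has_derivative_transform_within_open[of G _ _ _ "ball 0 1"])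
             (use True cont_diff1D(1)[OF G] in \<open>auto simp: D_def F_def\<close>)
      next
        case False
        show ?thesis
          by (rule has_derivative_transform_within_open[of "\<lambda>_. 0" _ _ _ "- cball 0 1"])
             (use False x in \<open>auto simp: D_def F_def\<close>)
      qed
    qed
    have [measurable]: "(\<lambda>x. frechet_derivative G (at x) e) \<in> borel_measurable borel"
      by (intro borel_of_continuous cont_diff1D(2)[OF G])
    have "(\<lambda>x. D x e) = (\<lambda>x. if norm x < 1 then frechet_derivative G (at x) e else 0)" by (auto simp: D_def)
    then show "(\<lambda>x. D x e) \<in> borel_measurable borel" by simp
  qed
  moreover have "(LINT x|lebesgue_on (ball 0 1). frechet_derivative G (at x) e) = (LINT x|lborel. D x e)"
  proof -
    have "(LINT x|lebesgue_on (ball 0 1). frechet_derivative G (at x) e) =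
      (LINT x|lebesgue. indicator (ball 0 1) x *\<^sub>R frechet_derivative G (at x) e)" by (simp add: integral_restrict_space)
    also have "\<dots> = (LINT x|lborel. indicator (ball 0 1) x *\<^sub>R frechet_derivative G (at x) e)"
    proof (rule integral_completion)
      have [measurable]: "(\<lambda>x. frechet_derivative G (at x) e) \<in> borel_measurable borel"
        by (intro borel_of_continuous cont_diff1D(2)[OF G])
      show "(\<lambda>x. indicator (ball 0 1) x *\<^sub>R frechet_derivative G (at x) e) \<in> borel_measurable lborel"
        by (intro borel_measurable_scaleR borel_measurable_indicator) auto
    qed
    also have "\<dots> = (LINT x|lborel. D x e)"
      by (rule Bochner_Integration.integral_cong) (auto simp: D_def indicator_def)
    finally show ?thesis .
  qed
  ultimately show ?thesis by simp
qed

text \<open>The weights \<open>h = \<mu>/(\<mu>+1) (1 - |x|\<^sup>2\<^sup>(\<^sup>\<mu>\<^sup>+\<^sup>1\<^sup>))\<close> and \<open>k = 1 - |x|\<^sup>2\<^sup>\<mu>\<close> vanish on the sphere, tend to \<open>1\<close>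
  inside, and satisfy \<open>\<partial>\<^sub>e h = (x \<bullet> e) (x \<bullet> \<nabla>k)\<close>, which reduces the theorem to the radial case.\<close>

lemma Gauss_real:
  fixes \<Theta> :: "'a::euclidean_space \<Rightarrow> real"
  assumes \<Theta>: "cont_diff 1 \<Theta>"
  shows "(LINT x|lebesgue_on (ball 0 1). frechet_derivative \<Theta> (at x) e) = (LINT x|sphere_measure. (x \<bullet> e) * \<Theta> x)"
proof -
  define n where "n = DIM('a)"
  define D where "D x = frechet_derivative \<Theta> (at x)" for x
  have d: "(\<Theta> has_derivative D x) (at x)" for x unfolding D_def by (rule cont_diff1D(1)[OF \<Theta>])
  have c\<Theta>: "continuous_on UNIV \<Theta>" by (rule cont_diff1D(3)[OF \<Theta>])
  have cD: "continuous_on UNIV (\<lambda>x. D x (g x))" if "continuous_on UNIV g" for g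
    unfolding D_def by (rule cont_diff1_continuous_apply[OF \<Theta> that])
  note cont = continuous_intros c\<Theta> cD
  define h where "h m x = (real (Suc m) / real (Suc (Suc m))) * (1 - (x \<bullet> x) ^ Suc (Suc m))" for m and x :: 'a
  define k where "k m x = 1 - (x \<bullet> x) ^ Suc m" for m and x :: 'a
  \<comment> \<open>The integrand that \<open>Euler_Gauss_real\<close> produces for the function (x
    \<bullet> e) \<Theta>(x). The exponent \<mu> of the weights is \<open>Suc m\<close>.\<close>
  define E where "E x = n * (\<Theta> x * (x \<bullet> e)) + (D x x * (x \<bullet> e) + \<Theta> x * (x \<bullet> e))" for x
  have h_der: "(h m has_derivative (\<lambda>v. - 2 * real (Suc m) * (x \<bullet> x) ^ Suc m * (x \<bullet> v))) (at x)" for m x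
  proof -
    have c: "real (Suc m) / real (Suc (Suc m)) * real (Suc (Suc m)) = real (Suc m)" by simp
    have "(h m has_derivative (\<lambda>v. real (Suc m) / real (Suc (Suc m)) * (- (real (Suc (Suc m)) * (x \<bullet> v + v \<bullet> x) * (x \<bullet> x) ^ Suc m)))) (at x)"
      unfolding h_def by (rule derivative_eq_intros refl)+ (auto simp: fun_eq_iff)
    then show ?thesis
    proof (rule has_derivative_eq_rhs, intro ext)
      fix v
      have "real (Suc m) / real (Suc (Suc m)) * (- (real (Suc (Suc m)) * (x \<bullet> v + v \<bullet> x) * (x \<bullet> x) ^ Suc m)) =
        (real (Suc m) / real (Suc (Suc m)) * real (Suc (Suc m))) * (- ((x \<bullet> v + v \<bullet> x) * (x \<bullet> x) ^ Suc m))"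
        by (simp only: mult_minus_right mult.assoc)
      also have "\<dots> = - 2 * real (Suc m) * (x \<bullet> x) ^ Suc m * (x \<bullet> v)"
        unfolding c by (simp add: inner_commute[of v x] algebra_simps)
      finally show "real (Suc m) / real (Suc (Suc m)) * (- (real (Suc (Suc m)) * (x \<bullet> v + v \<bullet> x) * (x \<bullet> x) ^ Suc m)) = \<dots>" .
    qed
  qed
  have k_der: "(k m has_derivative (\<lambda>v. - 2 * real (Suc m) * (x \<bullet> x) ^ m * (x \<bullet> v))) (at x)" for m x
    unfolding k_def by (rule derivative_eq_intros refl)+ (auto simp: fun_eq_iff inner_commute algebra_simps)
  have eq: "(LINT x|lebesgue_on (ball 0 1). h m x * D x e) = (LINT x|lebesgue_on (ball 0 1). k m x * E x)" for m
  proof -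
    \<comment> \<open>The common term: the derivative of \<open>h m\<close> along e times \<Theta>,
      and the radial derivative of \<open>k m\<close> times (x \<bullet> e) \<Theta>, are both equal
      to minus this.\<close>
    define w where "w x = 2 * real (Suc m) * (x \<bullet> x) ^ Suc m * (\<Theta> x * (x \<bullet> e))" for x
    have G: "((\<lambda>x. h m x * \<Theta> x) has_derivative (\<lambda>v. h m x * D x v + (- 2 * real (Suc m) * (x \<bullet> x) ^ Suc m * (x \<bullet> v)) * \<Theta> x)) (at x)" for x
      by (rule has_derivative_mult[OF h_der d])
    have 0: "(LINT x|lebesgue_on (ball 0 1). h m x * D x e - w x) = 0"
    proof -
      have "(LINT x|lebesgue_on (ball 0 1). frechet_derivative (\<lambda>x. h m x * \<Theta> x) (at x) e) = 0"
        by (rule integral_ball_directional_derivative_eq_0, rule cont_diff1I[OF G])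
          (auto intro!: cont simp: h_def norm_eq_1)
      then show ?thesis unfolding frechet_derivative_eqI[OF G]
        by (rule trans[rotated]) (rule Bochner_Integration.integral_cong, auto simp: w_def algebra_simps)
    qed
    have K: "((\<lambda>x. k m x * (\<Theta> x * (x \<bullet> e))) has_derivative (\<lambda>v. k m x * (\<Theta> x * (v \<bullet> e) + D x v * (x \<bullet> e)) +
        (- 2 * real (Suc m) * (x \<bullet> x) ^ m * (x \<bullet> v)) * (\<Theta> x * (x \<bullet> e)))) (at x)" for x
      by (rule has_derivative_mult[OF k_der has_derivative_mult[OF d]]) (rule derivative_eq_intros refl | simp)+
    have "(LINT x|sphere_measure. k m x * (\<Theta> x * (x \<bullet> e))) =
      (LINT x|lebesgue_on (ball 0 1). real DIM('a) * (k m x * (\<Theta> x * (x \<bullet> e))) + (k m x * (\<Theta> x * (x \<bullet> e) + D x x * (x \<bullet> e)) +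
        (- 2 * real (Suc m) * (x \<bullet> x) ^ m * (x \<bullet> x)) * (\<Theta> x * (x \<bullet> e))))"
      by (rule Euler_Gauss_real[OF K]) (intro cont, auto simp: k_def intro!: cont)
    also have "(LINT x|sphere_measure. k m x * (\<Theta> x * (x \<bullet> e))) = (LINT x|(sphere_measure::'a measure). 0)"
      by (rule Bochner_Integration.integral_cong) (auto simp: space_sphere_measure k_def norm_eq_1)
    finally have 1: "0 = (LINT x|lebesgue_on (ball 0 1). k m x * E x - w x)"
      apply simp
      apply (erule trans[rotated])
      apply (rule Bochner_Integration.integral_cong, simp)
      apply (simp add: E_def w_def n_def algebra_simps)
      done
    have int: "integrable (lebesgue_on (ball 0 1)) (\<lambda>x. h m x * D x e)"
      "integrable (lebesgue_on (ball 0 1)) w" "integrable (lebesgue_on (ball 0 1)) (\<lambda>x. k m x * E x)"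
      unfolding h_def w_def k_def E_def by (intro integrable_ball_continuous cont)+
    show ?thesis using 0 1 int by simp
  qed
  have hc: "continuous_on UNIV (\<lambda>x. h m x * D x e)" for m unfolding h_def by (intro cont)
  have Ec: "continuous_on UNIV E" unfolding E_def by (intro cont)
  have kc: "continuous_on UNIV (\<lambda>x. k m x * E x)" for m unfolding k_def by (intro cont Ec)
  have pow0: "(\<lambda>m. (x \<bullet> x) ^ Suc m) \<longlonglongrightarrow> 0" if "x \<in> ball 0 1" for x :: 'a
  proof -
    have "norm x < 1" using that by simp
    then have "x \<bullet> x < 1" by (simp add: dot_square_norm power_less_one_iff abs_square_less_1)
    then show ?thesis using LIMSEQ_power_zero[of "x \<bullet> x"] by (intro LIMSEQ_Suc) auto
  qed
  have pow1: "0 \<le> (x \<bullet> x) ^ m" "(x \<bullet> x) ^ m \<le> 1" if "x \<in> ball 0 1" for x :: 'a and m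
  proof -
    have "norm x < 1" using that by simp
    then have "x \<bullet> x \<le> 1" by (simp add: dot_square_norm power_le_one)
    then show "0 \<le> (x \<bullet> x) ^ m" "(x \<bullet> x) ^ m \<le> 1" by (auto intro: power_le_one)
  qed
  have "(\<lambda>m. LINT x|lebesgue_on (ball 0 1). h m x * D x e) \<longlonglongrightarrow> (LINT x|lebesgue_on (ball 0 1). D x e)"
  proof (rule integral_dominated_convergence[where w="\<lambda>x. norm (D x e)"])
    show "AE x in lebesgue_on (ball 0 1). (\<lambda>m. h m x * D x e) \<longlonglongrightarrow> D x e"
    proof (rule AE_I2)
      fix x :: 'a assume "x \<in> space (lebesgue_on (ball 0 1))"
      then have x: "x \<in> ball 0 1" by simp
      have "(\<lambda>m. 1 - inverse (real (Suc (Suc m)))) \<longlonglongrightarrow> 1 - 0"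
        by (intro tendsto_intros LIMSEQ_Suc[OF LIMSEQ_inverse_real_of_nat])
      moreover have "1 - inverse (real (Suc (Suc m))) = real (Suc m) / real (Suc (Suc m))" for m
        by (simp add: field_simps)
      ultimately have "(\<lambda>m. real (Suc m) / real (Suc (Suc m))) \<longlonglongrightarrow> 1" by simp
      then have "(\<lambda>m. h m x * D x e) \<longlonglongrightarrow> (1 * (1 - 0)) * D x e"
        unfolding h_def by (intro tendsto_intros LIMSEQ_Suc[OF pow0[OF x]])
      then show "(\<lambda>m. h m x * D x e) \<longlonglongrightarrow> D x e" by simp
    qed
    show "AE x in lebesgue_on (ball 0 1). norm (h m x * D x e) \<le> norm (D x e)" for m
    proof (rule AE_I2)
      fix x :: 'a assume "x \<in> space (lebesgue_on (ball 0 1))"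
      then have x: "x \<in> ball 0 1" by simp
      have "\<bar>h m x\<bar> = (real (Suc m) / real (Suc (Suc m))) * (1 - (x \<bullet> x) ^ Suc (Suc m))"
        using pow1[OF x, of "Suc (Suc m)"] unfolding h_def by (subst abs_of_nonneg) (auto intro!: mult_nonneg_nonneg simp del: power_Suc)
      also have "\<dots> \<le> 1 * 1" using pow1[OF x, of "Suc (Suc m)"] by (intro mult_mono) (auto simp del: power_Suc)
      finally show "norm (h m x * D x e) \<le> norm (D x e)" by (simp add: abs_mult mult_left_le_one_le)
    qed
  qed (intro integrable_norm integrable_ball_continuous borel_measurable_lebesgue_on borel_of_continuous hc cD continuous_on_const)+
  moreover have "(\<lambda>m. LINT x|lebesgue_on (ball 0 1). k m x * E x) \<longlonglongrightarrow> (LINT x|lebesgue_on (ball 0 1). E x)"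
  proof (rule integral_dominated_convergence[where w="\<lambda>x. norm (E x)"])
    show "AE x in lebesgue_on (ball 0 1). (\<lambda>m. k m x * E x) \<longlonglongrightarrow> E x"
    proof (rule AE_I2)
      fix x :: 'a assume "x \<in> space (lebesgue_on (ball 0 1))"
      then have x: "x \<in> ball 0 1" by simp
      have "(\<lambda>m. k m x * E x) \<longlonglongrightarrow> (1 - 0) * E x"
        unfolding k_def by (intro tendsto_intros pow0[OF x])
      then show "(\<lambda>m. k m x * E x) \<longlonglongrightarrow> E x" by simp
    qed
    show "AE x in lebesgue_on (ball 0 1). norm (k m x * E x) \<le> norm (E x)" for m
    proof (rule AE_I2)
      fix x :: 'a assume "x \<in> space (lebesgue_on (ball 0 1))"
      then have "\<bar>k m x\<bar> \<le> 1" using pow1[of x "Suc m"] unfolding k_def by (auto simp del: power_Suc)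
      then show "norm (k m x * E x) \<le> norm (E x)" by (simp add: abs_mult mult_left_le_one_le)
    qed
  qed (intro integrable_norm integrable_ball_continuous borel_measurable_lebesgue_on borel_of_continuous kc Ec)+
  ultimately have "(LINT x|lebesgue_on (ball 0 1). D x e) = (LINT x|lebesgue_on (ball 0 1). E x)"
    unfolding eq by (rule LIMSEQ_unique)
  also have "\<dots> = (LINT x|sphere_measure. (x \<bullet> e) * \<Theta> x)"
  proof -
    have "((\<lambda>x. (x \<bullet> e) * \<Theta> x) has_derivative (\<lambda>v. (x \<bullet> e) * D x v + (v \<bullet> e) * \<Theta> x)) (at x)" for x
      by (rule has_derivative_mult[OF _ d]) (rule derivative_eq_intros refl | simp)+
    from Euler_Gauss_real[OF this] show ?thesis by (simp add: E_def n_def cont mult_ac)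
  qed
  finally show ?thesis by (simp add: D_def)
qed

theorem Gauss:
  fixes \<Theta> :: "'a::euclidean_space \<Rightarrow> 'b::euclidean_space"
  assumes \<Theta>: "cont_diff 1 \<Theta>"
  shows "(LINT x|lebesgue_on (ball 0 1). frechet_derivative \<Theta> (at x) e) = (LINT x|sphere_measure. (x \<bullet> e) *\<^sub>R \<Theta> x)"
proof (rule euclidean_eqI)
  fix b :: 'b assume "b \<in> Basis"
  have d: "((\<lambda>x. \<Theta> x \<bullet> b) has_derivative (\<lambda>v. frechet_derivative \<Theta> (at x) v \<bullet> b)) (at x)" for x
    by (intro has_derivative_inner_left cont_diff1D(1)[OF \<Theta>])
  have i1: "integrable (lebesgue_on (ball 0 1)) (\<lambda>x. frechet_derivative \<Theta> (at x) e)"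
    by (intro integrable_ball_continuous cont_diff1D(2)[OF \<Theta>])
  have i2: "integrable sphere_measure (\<lambda>x. (x \<bullet> e) *\<^sub>R \<Theta> x)"
    by (intro integrable_sphere_continuous continuous_intros cont_diff1D(3)[OF \<Theta>])
  have "(LINT x|lebesgue_on (ball 0 1). frechet_derivative \<Theta> (at x) e) \<bullet> b =
    (LINT x|lebesgue_on (ball 0 1). frechet_derivative (\<lambda>x. \<Theta> x \<bullet> b) (at x) e)"
    by (simp add: frechet_derivative_eqI[OF d] integral_inner_left[OF i1])
  also have "\<dots> = (LINT x|sphere_measure. (x \<bullet> e) * (\<Theta> x \<bullet> b))"
    by (rule Gauss_real, rule cont_diff1I[OF d]) (intro continuous_intros cont_diff1D(2)[OF \<Theta>])
  also have "\<dots> = (LINT x|sphere_measure. (x \<bullet> e) *\<^sub>R \<Theta> x) \<bullet> b"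
    using integral_inner_left[OF i2, of b] by simp
  finally show "(LINT x|lebesgue_on (ball 0 1). frechet_derivative \<Theta> (at x) e) \<bullet> b =
     (LINT x|sphere_measure. (x \<bullet> e) *\<^sub>R \<Theta> x) \<bullet> b" .
qed

section \<open>Square-integrable limits\<close>

text \<open>Takes a root by comparing squares, since Cauchy-Schwarz for nonnegative integrals bounds
  the square of the quantity of interest.\<close>

lemma ennreal_tendsto_0_from_square:
  fixes y z :: "nat \<Rightarrow> ennreal"
  assumes z: "z \<longlonglongrightarrow> 0" and K: "K < \<infinity>" and le: "\<And>n. (y n)\<^sup>2 \<le> K * z n"
  shows "y \<longlonglongrightarrow> 0"
proof (rule order_tendstoI)
  fix a :: ennreal assume "0 < a"
  have "(\<lambda>n. K * z n) \<longlonglongrightarrow> K * 0" using z K by (intro ennreal_tendsto_cmult) auto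
  then have "(\<lambda>n. K * z n) \<longlonglongrightarrow> 0" by simp
  moreover have "0 < a\<^sup>2" using \<open>0 < a\<close> by (simp add: power2_eq_square ennreal_zero_less_mult_iff)
  ultimately have "\<forall>\<^sub>F n in sequentially. K * z n < a\<^sup>2" by (rule order_tendstoD)
  then show "\<forall>\<^sub>F n in sequentially. y n < a"
  proof eventually_elim
    fix n assume "K * z n < a\<^sup>2"
    then have "(y n)\<^sup>2 < a\<^sup>2" using le[of n] by (rule order.strict_trans1[rotated])
    then show "y n < a" by (metis not_le power_mono zero_le)
  qed
qed simp

lemma (in finite_measure) L2_imp_L1_tendsto:
  fixes h :: "nat \<Rightarrow> 'a \<Rightarrow> real"
  assumes [measurable]: "\<And>n. h n \<in> borel_measurable M" and h0: "\<And>n x. h n x \<ge> 0"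
    and lim: "(\<lambda>n. \<integral>\<^sup>+x. ennreal ((h n x)\<^sup>2) \<partial>M) \<longlonglongrightarrow> 0"
  shows "(\<lambda>n. \<integral>\<^sup>+x. ennreal (h n x) \<partial>M) \<longlonglongrightarrow> 0"
proof (rule ennreal_tendsto_0_from_square[OF lim])
  show "emeasure M (space M) < \<infinity>" unfolding infinity_ennreal_def less_top[symmetric] by (rule emeasure_finite)
  fix n
  have "(\<integral>\<^sup>+x. 1 * ennreal (h n x) \<partial>M)\<^sup>2 \<le> (\<integral>\<^sup>+x. 1\<^sup>2 \<partial>M) * (\<integral>\<^sup>+x. (ennreal (h n x))\<^sup>2 \<partial>M)"
    by (rule Cauchy_Schwarz_nn_integral) measurable
  then show "(\<integral>\<^sup>+x. ennreal (h n x) \<partial>M)\<^sup>2 \<le> emeasure M (space M) * (\<integral>\<^sup>+x. ennreal ((h n x)\<^sup>2) \<partial>M)"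
    using h0 by (simp add: ennreal_power)
qed

lemma (in finite_measure) square_integrable_imp_integrable':
  assumes "square_integrable M f"
  shows "integrable M f"
proof (rule Bochner_Integration.integrable_bound[where f="\<lambda>x. 1 + (norm (f x))\<^sup>2"])
  show "integrable M (\<lambda>x. 1 + (norm (f x))\<^sup>2)" using assms by (simp add: square_integrable_def)
  show "AE x in M. norm (f x) \<le> norm (1 + (norm (f x))\<^sup>2)"
  proof (rule AE_I2)
    fix x
    have "0 \<le> (norm (f x) - 1)\<^sup>2" by simp
    then have "2 * norm (f x) \<le> 1 + (norm (f x))\<^sup>2" by (simp add: power2_diff)
    then have "norm (f x) \<le> 1 + (norm (f x))\<^sup>2" using norm_ge_zero[of "f x"] by linarith
    then show "norm (f x) \<le> norm (1 + (norm (f x))\<^sup>2)"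
      unfolding real_norm_def by (rule order_trans[OF _ abs_ge_self])
  qed
qed (use assms in \<open>simp add: square_integrable_def\<close>)

lemma integrable_bounded_scaleR:
  fixes f :: "'a \<Rightarrow> 'b::{banach,second_countable_topology}"
  assumes f: "integrable M f" and m: "m \<in> borel_measurable M" and C: "\<And>x. x \<in> space M \<Longrightarrow> \<bar>m x\<bar> \<le> C"
  shows "integrable M (\<lambda>x. m x *\<^sub>R f x)"
proof (rule Bochner_Integration.integrable_bound[where f="\<lambda>x. C *\<^sub>R f x"])
  show "AE x in M. norm (m x *\<^sub>R f x) \<le> norm (C *\<^sub>R f x)"
    using C by (intro AE_I2) (auto intro!: mult_right_mono order_trans[OF _ abs_ge_self])
qed (use f m in \<open>auto intro!: borel_measurable_scaleR\<close>)

text \<open>Passing to the limit in a pairing with a bounded weight: on a finite measure space L2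
  convergence implies L1 convergence.\<close>

lemma (in finite_measure) L2_integral_limit:
  fixes f :: "nat \<Rightarrow> 'a \<Rightarrow> 'b::euclidean_space"
  assumes f: "\<And>n. integrable M (f n)" and F: "square_integrable M F"
    and lim: "(\<lambda>n. \<integral>\<^sup>+x. ennreal ((norm (f n x - F x))\<^sup>2) \<partial>M) \<longlonglongrightarrow> 0"
    and m: "m \<in> borel_measurable M" and C: "\<And>x. x \<in> space M \<Longrightarrow> \<bar>m x\<bar> \<le> C"
  shows "(\<lambda>n. LINT x|M. m x *\<^sub>R f n x) \<longlonglongrightarrow> (LINT x|M. m x *\<^sub>R F x)"
proof (rule tendsto_L1_int)
  note [measurable] = borel_measurable_integrable[OF f] borel_measurable_integrable[OF square_integrable_imp_integrable'[OF F]] m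
  show "integrable M (\<lambda>x. m x *\<^sub>R f n x)" for n by (rule integrable_bounded_scaleR[OF f m C])
  show "integrable M (\<lambda>x. m x *\<^sub>R F x)" by (rule integrable_bounded_scaleR[OF square_integrable_imp_integrable'[OF F] m C])
  have l1: "(\<lambda>n. \<integral>\<^sup>+x. ennreal (norm (f n x - F x)) \<partial>M) \<longlonglongrightarrow> 0"
  proof (rule L2_imp_L1_tendsto[OF _ _ lim])
    show "(\<lambda>x. norm (f n x - F x)) \<in> borel_measurable M" for n by measurable
  qed simp
  have "(\<lambda>n. ennreal \<bar>C\<bar> * (\<integral>\<^sup>+x. ennreal (norm (f n x - F x)) \<partial>M)) \<longlonglongrightarrow> ennreal \<bar>C\<bar> * 0"
    using l1 by (intro ennreal_tendsto_cmult) auto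
  then have lim0: "(\<lambda>n. ennreal \<bar>C\<bar> * (\<integral>\<^sup>+x. ennreal (norm (f n x - F x)) \<partial>M)) \<longlonglongrightarrow> 0" by simp
  show "(\<lambda>n. \<integral>\<^sup>+x. ennreal (norm (m x *\<^sub>R f n x - m x *\<^sub>R F x)) \<partial>M) \<longlonglongrightarrow> 0"
  proof (rule tendsto_sandwich[OF _ _ tendsto_const lim0])
    show "\<forall>\<^sub>F n in sequentially. (\<integral>\<^sup>+x. ennreal (norm (m x *\<^sub>R f n x - m x *\<^sub>R F x)) \<partial>M)
        \<le> ennreal \<bar>C\<bar> * (\<integral>\<^sup>+x. ennreal (norm (f n x - F x)) \<partial>M)"
    proof (rule always_eventually, rule allI)
      fix n
      have "(\<integral>\<^sup>+x. ennreal (norm (m x *\<^sub>R f n x - m x *\<^sub>R F x)) \<partial>M) \<le> (\<integral>\<^sup>+x. ennreal \<bar>C\<bar> * ennreal (norm (f n x - F x)) \<partial>M)"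
      proof (rule nn_integral_mono)
        fix x assume "x \<in> space M"
        have "norm (m x *\<^sub>R f n x - m x *\<^sub>R F x) = \<bar>m x\<bar> * norm (f n x - F x)"
          by (metis norm_scaleR scaleR_diff_right)
        also have "\<dots> \<le> \<bar>C\<bar> * norm (f n x - F x)"
          using C[OF \<open>x \<in> space M\<close>] by (intro mult_right_mono) auto
        finally have "ennreal (norm (m x *\<^sub>R f n x - m x *\<^sub>R F x)) \<le> ennreal (\<bar>C\<bar> * norm (f n x - F x))"
          by (rule ennreal_leI)
        also have "\<dots> = ennreal \<bar>C\<bar> * ennreal (norm (f n x - F x))" by (rule ennreal_mult) auto
        finally show "ennreal (norm (m x *\<^sub>R f n x - m x *\<^sub>R F x)) \<le> ennreal \<bar>C\<bar> * ennreal (norm (f n x - F x))" .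
      qed
      also have "\<dots> = ennreal \<bar>C\<bar> * (\<integral>\<^sup>+x. ennreal (norm (f n x - F x)) \<partial>M)"
        by (rule nn_integral_cmult) measurable
      finally show "(\<integral>\<^sup>+x. ennreal (norm (m x *\<^sub>R f n x - m x *\<^sub>R F x)) \<partial>M) \<le> \<dots>" .
    qed
  qed simp
qed

section \<open>Closure properties of smooth functions and radial cutoffs\<close>

lemma smooth_iff_cd_on: "smooth f \<longleftrightarrow> (\<forall>k. cd_on k UNIV f)"
  by (simp add: smooth_def cont_diff_eq_cd_on)

lemma smooth_has_derivative: "smooth f \<Longrightarrow> (f has_derivative frechet_derivative f (at x)) (at x)"
  by (rule cont_diff1D(1)) (simp add: smooth_def)

lemma smooth_directional: "smooth f \<Longrightarrow> smooth (\<lambda>x. frechet_derivative f (at x) h)"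
  unfolding smooth_iff_cd_on by (metis cd_on.simps(2))

lemma smooth_bilinear: "bounded_bilinear pr \<Longrightarrow> smooth f \<Longrightarrow> smooth g \<Longrightarrow> smooth (\<lambda>x. pr (f x) (g x))"
  unfolding smooth_iff_cd_on by (auto intro: cd_on_bilinear)

lemmas smooth_mult = smooth_bilinear[OF bounded_bilinear_mult]
  and smooth_scaleR = smooth_bilinear[OF bounded_bilinear_scaleR]
  and smooth_inner = smooth_bilinear[OF bounded_bilinear_inner]

lemma smooth_add: "smooth f \<Longrightarrow> smooth g \<Longrightarrow> smooth (\<lambda>x. f x + g x)"
  and smooth_diff: "smooth f \<Longrightarrow> smooth g \<Longrightarrow> smooth (\<lambda>x. f x - g x)"
  and smooth_const: "smooth (\<lambda>x. c)"
  and smooth_bounded_linear: "bounded_linear l \<Longrightarrow> smooth l"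
  unfolding smooth_iff_cd_on
  by (auto intro: cd_on_add cd_on_diff cd_on_const cd_on_bounded_linear)

lemma smooth_sum: "(\<And>i. i \<in> I \<Longrightarrow> smooth (f i)) \<Longrightarrow> smooth (\<lambda>x. \<Sum>i\<in>I. f i x)"
  and smooth_power: "smooth g \<Longrightarrow> smooth (\<lambda>x. g x ^ m :: real)"
  unfolding smooth_iff_cd_on by (auto intro: cd_on_sum cd_on_power)

lemma smooth_compose_real:
  fixes h :: "real \<Rightarrow> real"
  shows "smooth h \<Longrightarrow> smooth g \<Longrightarrow> smooth (\<lambda>x. h (g x))"
  unfolding smooth_iff_cd_on using cd_on_compose_real[of UNIV g UNIV _ h] by auto

lemma smooth_ident: "smooth (\<lambda>x. x)"
  by (rule smooth_bounded_linear) (rule bounded_linear_ident)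

lemmas smooth_intros = smooth_mult smooth_scaleR smooth_inner smooth_add smooth_diff smooth_const smooth_ident
  smooth_sum smooth_power

definition smooth_on :: "'a::real_normed_vector set \<Rightarrow> ('a \<Rightarrow> 'b::real_normed_vector) \<Rightarrow> bool" where
  "smooth_on S f \<longleftrightarrow> (\<forall>k. cd_on k S f)"

lemma smooth_imp_smooth_on: "smooth f \<Longrightarrow> smooth_on S f"
  unfolding smooth_iff_cd_on smooth_on_def by (meson cd_on_subset subset_UNIV)

lemma smooth_on_has_derivative:
  "smooth_on S f \<Longrightarrow> x \<in> S \<Longrightarrow> (f has_derivative frechet_derivative f (at x)) (at x)"
  unfolding smooth_on_def by (meson cd_on_Suc_has_derivative)

lemma smooth_on_continuous: "smooth_on S f \<Longrightarrow> continuous_on S f"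
  unfolding smooth_on_def by (metis cd_on.simps(1))

lemma smooth_on_directional: "smooth_on S f \<Longrightarrow> smooth_on S (\<lambda>x. frechet_derivative f (at x) h)"
  unfolding smooth_on_def by (metis cd_on.simps(2))

lemma smooth_on_mult: "open S \<Longrightarrow> smooth_on S f \<Longrightarrow> smooth_on S g \<Longrightarrow> smooth_on S (\<lambda>x. f x * g x :: 'b::real_normed_algebra)"
  unfolding smooth_on_def by (auto intro: cd_on_mult)

text \<open>The step is applied to |x|^2 instead of |x|, which keeps the function smooth at the
  origin.\<close>

definition cutoff :: "real \<Rightarrow> real \<Rightarrow> 'a::euclidean_space \<Rightarrow> real" where
  "cutoff \<rho> \<rho>' x = smooth_step ((x \<bullet> x - \<rho>\<^sup>2) / (\<rho>'\<^sup>2 - \<rho>\<^sup>2))"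

lemma smooth_cutoff: "smooth (cutoff \<rho> \<rho>')"
proof -
  have "smooth (\<lambda>x. smooth_step ((x \<bullet> x - \<rho>\<^sup>2) * (1 / (\<rho>'\<^sup>2 - \<rho>\<^sup>2))))"
    by (rule smooth_compose_real[of smooth_step])
      (simp add: smooth_iff_cd_on[of smooth_step] cd_on_smooth_step, intro smooth_intros)
  then show ?thesis by (simp add: cutoff_def[abs_def])
qed

lemma cutoff_eq_0:
  assumes "0 \<le> \<rho>" "\<rho> < \<rho>'" "norm x \<le> \<rho>"
  shows "cutoff \<rho> \<rho>' x = 0"
proof -
  have "x \<bullet> x \<le> \<rho>\<^sup>2" using assms by (simp add: dot_square_norm power_mono)
  moreover have "\<rho>\<^sup>2 < \<rho>'\<^sup>2" using assms by (simp add: power_strict_mono)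
  ultimately show ?thesis unfolding cutoff_def by (intro smooth_step_0) (simp add: divide_nonpos_pos)
qed

lemma cutoff_eq_1:
  assumes "0 \<le> \<rho>" "\<rho> < \<rho>'" "norm x \<ge> \<rho>'"
  shows "cutoff \<rho> \<rho>' x = 1"
proof -
  have "\<rho>'\<^sup>2 \<le> x \<bullet> x" using assms by (simp add: dot_square_norm power_mono)
  moreover have "\<rho>\<^sup>2 < \<rho>'\<^sup>2" using assms by (simp add: power_strict_mono)
  ultimately show ?thesis unfolding cutoff_def by (intro smooth_step_1) (simp add: divide_simps)
qed

section \<open>Weak derivatives with boundary values\<close>

definition annulus :: "real \<Rightarrow> 'a::euclidean_space set" where
  "annulus r = {x. r < norm x \<and> norm x < 1}"

lemma open_annulus: "open (annulus r :: 'a::euclidean_space set)"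
proof -
  have "annulus r = {x::'a. r < norm x} \<inter> {x. norm x < 1}" by (auto simp: annulus_def)
  then show ?thesis by (auto intro!: open_Int open_Collect_less continuous_intros)
qed

lemma sets_annulus: "(annulus r :: 'a::euclidean_space set) \<in> sets lebesgue"
  using open_annulus[of r, where ?'a='a] by auto

lemma annulus_subset_ball: "annulus r \<subseteq> ball 0 1"
  by (auto simp: annulus_def)

lemma finite_measure_annulus: "finite_measure (lebesgue_on (annulus r :: 'a::euclidean_space set))"
proof
  have "emeasure lebesgue (annulus r :: 'a set) \<le> emeasure lebesgue (ball (0::'a) 1)"
    by (intro emeasure_mono annulus_subset_ball) auto
  also have "\<dots> < \<infinity>" using emeasure_lborel_ball_finite[of "0::'a" 1] by simp
  finally show "emeasure (lebesgue_on (annulus r)) (space (lebesgue_on (annulus r :: 'a set))) \<noteq> \<infinity>"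
    using sets_annulus[of r, where ?'a='a] by (simp add: emeasure_restrict_space)
qed

text \<open>A weak derivative together with its boundary values: the defining identity is Gauss' formula
  against test functions that vanish near the inner sphere only.\<close>

definition inner_cut :: "real \<Rightarrow> ('a::euclidean_space \<Rightarrow> real) \<Rightarrow> bool" where
  "inner_cut r \<psi> \<longleftrightarrow> smooth \<psi> \<and> (\<exists>r'>r. \<forall>x. norm x \<le> r' \<longrightarrow> \<psi> x = 0)"

definition bpart :: "real \<Rightarrow> 'a::euclidean_space \<Rightarrow> ('a \<Rightarrow> 'b::euclidean_space) \<Rightarrow> ('a \<Rightarrow> 'b) \<Rightarrow> ('a \<Rightarrow> 'b) \<Rightarrow> bool" where
  "bpart r e v w g \<longleftrightarrow> integrable (lebesgue_on (annulus r)) v \<and> integrable (lebesgue_on (annulus r)) w \<and>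
     integrable sphere_measure g \<and>
     (\<forall>\<psi>. inner_cut r \<psi> \<longrightarrow>
       (LINT x|lebesgue_on (annulus r). frechet_derivative \<psi> (at x) e *\<^sub>R v x) + (LINT x|lebesgue_on (annulus r). \<psi> x *\<^sub>R w x) =
       (LINT x|sphere_measure. (\<psi> x * (x \<bullet> e)) *\<^sub>R g x))"

lemma smooth_bound_on_cball:
  assumes "smooth (f :: 'a::euclidean_space \<Rightarrow> 'b::real_normed_vector)"
  obtains C where "C \<ge> 0" "\<And>x. norm x \<le> R \<Longrightarrow> norm (f x) \<le> C"
  using continuous_bound_on_compact[OF smooth_continuous[OF assms] compact_cball[of 0 R]] by (metis mem_cball_0)

lemma smooth_borel: "smooth f \<Longrightarrow> f \<in> borel_measurable borel"
  by (intro borel_of_continuous smooth_continuous)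

lemma smooth_scaleR_integrable:
  fixes v :: "'a::euclidean_space \<Rightarrow> 'b::euclidean_space"
  assumes "smooth \<psi>" "integrable (lebesgue_on S) v" "S \<subseteq> ball 0 1"
  shows "integrable (lebesgue_on S) (\<lambda>x. \<psi> x *\<^sub>R v x)"
proof -
  obtain C where C: "\<And>x. norm x \<le> 1 \<Longrightarrow> norm (\<psi> x) \<le> C" using smooth_bound_on_cball[OF assms(1), of 1] by metis
  show ?thesis
  proof (rule integrable_bounded_scaleR[OF assms(2)])
    show "\<psi> \<in> borel_measurable (lebesgue_on S)" by (intro borel_measurable_lebesgue_on smooth_borel assms)
    fix x assume "x \<in> space (lebesgue_on S)"
    then show "\<bar>\<psi> x\<bar> \<le> C" using C[of x] assms(3) by (force simp: space_restrict_space)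
  qed
qed

lemma smooth_scaleR_integrable_sphere:
  fixes g :: "'a::euclidean_space \<Rightarrow> 'b::euclidean_space"
  assumes "smooth \<psi>" "integrable sphere_measure g"
  shows "integrable sphere_measure (\<lambda>x. \<psi> x *\<^sub>R g x)"
proof -
  obtain C where C: "\<And>x. norm x \<le> 1 \<Longrightarrow> norm (\<psi> x) \<le> C" using smooth_bound_on_cball[OF assms(1), of 1] by metis
  show ?thesis
  proof (rule integrable_bounded_scaleR[OF assms(2)])
    show "\<psi> \<in> borel_measurable sphere_measure" by (intro borel_measurable_sphere_measure smooth_borel assms)
    fix x assume "x \<in> space (sphere_measure :: 'a measure)"
    then show "\<bar>\<psi> x\<bar> \<le> C" using C[of x] by (simp add: space_sphere_measure)
  qed
qed

lemma smooth_inner_e: "smooth (\<lambda>x::'a::euclidean_space. x \<bullet> e)"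
  by (intro smooth_intros)

lemma inner_cut_derivative_eq_0:
  assumes "inner_cut r \<psi>" "norm x \<le> r"
  shows "\<psi> x = 0" "frechet_derivative \<psi> (at x) e = 0"
proof -
  obtain r' where r': "r' > r" "\<And>x. norm x \<le> r' \<Longrightarrow> \<psi> x = 0" using assms by (auto simp: inner_cut_def)
  then show "\<psi> x = 0" using assms by auto
  have "(\<psi> has_derivative (\<lambda>_. 0)) (at x)"
    by (rule has_derivative_transform_within_open[of "\<lambda>_. 0" _ _ _ "ball 0 r'"]) (use r' assms(2) in auto)
  then show "frechet_derivative \<psi> (at x) e = 0" by (simp add: frechet_derivative_eqI)
qed

lemma LINT_annulus_eq_ball:
  fixes h :: "'a::euclidean_space \<Rightarrow> 'b::euclidean_space"
  assumes "\<And>x. norm x \<le> r \<Longrightarrow> h x = 0"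
  shows "(LINT x|lebesgue_on (annulus r). h x) = (LINT x|lebesgue_on (ball 0 1). h x)"
  using sets_annulus[of r, where ?'a='a] assms
  by (simp add: integral_restrict_space) (rule Bochner_Integration.integral_cong[OF refl], force simp: indicator_def annulus_def not_less)

text \<open>Gauss' formula for the product of \<psi> and \<phi>. As \<psi> and its derivative vanish
  on the inner ball, annulus and ball give the same integrals.\<close>

lemma bpart_smooth:
  fixes \<phi> :: "'a::euclidean_space \<Rightarrow> 'b::euclidean_space"
  assumes \<phi>: "smooth \<phi>" and \<psi>: "inner_cut r \<psi>"
  shows "(LINT x|lebesgue_on (annulus r). frechet_derivative \<psi> (at x) e *\<^sub>R \<phi> x) +
      (LINT x|lebesgue_on (annulus r). \<psi> x *\<^sub>R frechet_derivative \<phi> (at x) e) =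
      (LINT x|sphere_measure. (\<psi> x * (x \<bullet> e)) *\<^sub>R \<phi> x)"
proof -
  have s\<psi>: "smooth \<psi>" using \<psi> by (simp add: inner_cut_def)
  have d: "((\<lambda>x. \<psi> x *\<^sub>R \<phi> x) has_derivative (\<lambda>h. \<psi> x *\<^sub>R frechet_derivative \<phi> (at x) h + frechet_derivative \<psi> (at x) h *\<^sub>R \<phi> x)) (at x)" for x
    by (rule has_derivative_scaleR[OF smooth_has_derivative[OF s\<psi>] smooth_has_derivative[OF \<phi>]])
  have i: "integrable (lebesgue_on (ball 0 1)) (\<lambda>x. frechet_derivative \<psi> (at x) e *\<^sub>R \<phi> x)"
      "integrable (lebesgue_on (ball 0 1)) (\<lambda>x. \<psi> x *\<^sub>R frechet_derivative \<phi> (at x) e)"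
    by (intro integrable_ball_continuous smooth_continuous smooth_scaleR smooth_directional s\<psi> \<phi>)+
  have "(LINT x|lebesgue_on (ball 0 1). frechet_derivative \<psi> (at x) e *\<^sub>R \<phi> x) +
      (LINT x|lebesgue_on (ball 0 1). \<psi> x *\<^sub>R frechet_derivative \<phi> (at x) e) =
      (LINT x|lebesgue_on (ball 0 1). frechet_derivative (\<lambda>x. \<psi> x *\<^sub>R \<phi> x) (at x) e)"
    using i by (simp add: frechet_derivative_eqI[OF d] add.commute)
  also have "\<dots> = (LINT x|sphere_measure. (x \<bullet> e) *\<^sub>R (\<psi> x *\<^sub>R \<phi> x))"
    using smooth_scaleR[OF s\<psi> \<phi>] by (intro Gauss) (simp only: smooth_def)
  finally show ?thesis
    using inner_cut_derivative_eq_0[OF \<psi>] by (simp add: LINT_annulus_eq_ball mult.commute)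
qed

text \<open>The trace hypotheses enter through this lemma: \<open>bpart_smooth\<close> for the
  approximations passes to the limit by \<open>L2_integral_limit\<close>. The function picked by
  \<open>weak_partial\<close> is exchanged for a square-integrable one that agrees with it almost
  everywhere.\<close>

lemma has_trace_imp_bpart:
  fixes v :: "'a::euclidean_space \<Rightarrow> 'b::euclidean_space"
  assumes tr: "has_trace (annulus r) v g" and e: "e \<in> Basis"
  shows "\<exists>w. has_weak_partial (annulus r) e v w \<and> square_integrable (lebesgue_on (annulus r)) w \<and> bpart r e v w g"
proof -
  let ?D = "annulus r :: 'a set"
  interpret D: finite_measure "lebesgue_on ?D" by (rule finite_measure_annulus)
  obtain \<phi> where \<phi>: "\<And>n. smooth (\<phi> n)"
    and l1: "(\<lambda>n. \<integral>\<^sup>+x. ennreal ((norm (\<phi> n x - v x))\<^sup>2) \<partial>lebesgue_on ?D) \<longlonglongrightarrow> 0"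
    and l2: "(\<lambda>n. \<integral>\<^sup>+x. ennreal ((norm (frechet_derivative (\<phi> n) (at x) e - weak_partial ?D e v x))\<^sup>2) \<partial>lebesgue_on ?D) \<longlonglongrightarrow> 0"
    and l3: "(\<lambda>n. \<integral>\<^sup>+x. ennreal ((norm (\<phi> n x - g x))\<^sup>2) \<partial>sphere_measure) \<longlonglongrightarrow> 0"
    using tr e unfolding has_trace_def by blast
  have g: "square_integrable sphere_measure g" and s1: "sobolev 1 ?D v" using tr by (auto simp: has_trace_def)
  then obtain w where w: "has_weak_partial ?D e v w" "sobolev 0 ?D w" using e by auto
  then have w2: "square_integrable (lebesgue_on ?D) w" by simp
  have v2: "square_integrable (lebesgue_on ?D) v" using s1 by simp
  have ae: "AE x in lebesgue_on ?D. weak_partial ?D e v x = w x"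
    by (rule has_weak_partial_AE_unique[OF open_annulus has_weak_partial_weak_partial[OF w(1)] w(1)])
  have l2': "(\<lambda>n. \<integral>\<^sup>+x. ennreal ((norm (frechet_derivative (\<phi> n) (at x) e - w x))\<^sup>2) \<partial>lebesgue_on ?D) \<longlonglongrightarrow> 0"
  proof (rule Lim_transform_eventually[OF l2], rule always_eventually, rule allI, rule nn_integral_cong_AE)
    fix n show "AE x in lebesgue_on ?D. ennreal ((norm (frechet_derivative (\<phi> n) (at x) e - weak_partial ?D e v x))\<^sup>2) =
       ennreal ((norm (frechet_derivative (\<phi> n) (at x) e - w x))\<^sup>2)"
      using ae by eventually_elim simp
  qed
  have "bpart r e v w g"
    unfolding bpart_def
  proof (intro conjI allI impI)
    show "integrable (lebesgue_on ?D) v" "integrable (lebesgue_on ?D) w" "integrable sphere_measure g"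
      using D.square_integrable_imp_integrable' v2 w2 sphere.square_integrable_imp_integrable' g by blast+
    fix \<psi> :: "'a \<Rightarrow> real" assume \<psi>: "inner_cut r \<psi>"
    then have s\<psi>: "smooth \<psi>" by (simp add: inner_cut_def)
    obtain C1 where C1: "\<And>x. norm x \<le> 1 \<Longrightarrow> norm (\<psi> x) \<le> C1" using smooth_bound_on_cball[OF s\<psi>, of 1] by metis
    obtain C2 where C2: "\<And>x. norm x \<le> 1 \<Longrightarrow> norm (frechet_derivative \<psi> (at x) e) \<le> C2"
      using smooth_bound_on_cball[OF smooth_directional[OF s\<psi>], of 1] by metis
    have s3: "smooth (\<lambda>x. \<psi> x * (x \<bullet> e))" by (intro smooth_mult s\<psi> smooth_inner_e)
    obtain C3 where C3: "\<And>x. norm x \<le> 1 \<Longrightarrow> norm (\<psi> x * (x \<bullet> e)) \<le> C3" using smooth_bound_on_cball[OF s3, of 1] by metis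
    have int: "integrable (lebesgue_on ?D) h" if sh: "smooth h" for h :: "'a \<Rightarrow> 'b"
    proof -
      obtain C where "\<And>x. norm x \<le> 1 \<Longrightarrow> norm (h x) \<le> C" using smooth_bound_on_cball[OF sh, of 1] by metis
      then show ?thesis
        by (intro D.integrable_const_bound[where B=C] AE_I2 borel_measurable_lebesgue_on smooth_borel \<open>smooth h\<close>) (auto simp: annulus_def)
    qed
    have t1: "(\<lambda>n. LINT x|lebesgue_on ?D. frechet_derivative \<psi> (at x) e *\<^sub>R \<phi> n x) \<longlonglongrightarrow> (LINT x|lebesgue_on ?D. frechet_derivative \<psi> (at x) e *\<^sub>R v x)"
      by (rule D.L2_integral_limit[OF int[OF \<phi>] v2 l1, where C=C2])
        (use C2 in \<open>auto simp: annulus_def intro!: borel_measurable_lebesgue_on smooth_borel smooth_directional s\<psi>\<close>)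
    have t2: "(\<lambda>n. LINT x|lebesgue_on ?D. \<psi> x *\<^sub>R frechet_derivative (\<phi> n) (at x) e) \<longlonglongrightarrow> (LINT x|lebesgue_on ?D. \<psi> x *\<^sub>R w x)"
      by (rule D.L2_integral_limit[OF int[OF smooth_directional[OF \<phi>]] w2 l2', where C=C1])
        (use C1 in \<open>auto simp: annulus_def intro!: borel_measurable_lebesgue_on smooth_borel s\<psi>\<close>)
    have t3: "(\<lambda>n. LINT x|sphere_measure. (\<psi> x * (x \<bullet> e)) *\<^sub>R \<phi> n x) \<longlonglongrightarrow> (LINT x|sphere_measure. (\<psi> x * (x \<bullet> e)) *\<^sub>R g x)"
      by (rule sphere.L2_integral_limit[OF integrable_sphere_continuous[OF smooth_continuous[OF \<phi>]] g l3, where C=C3])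
        (use C3 in \<open>auto simp: space_sphere_measure intro!: borel_measurable_sphere_measure smooth_borel s3\<close>)
    have "(\<lambda>n. (LINT x|lebesgue_on ?D. frechet_derivative \<psi> (at x) e *\<^sub>R \<phi> n x) + (LINT x|lebesgue_on ?D. \<psi> x *\<^sub>R frechet_derivative (\<phi> n) (at x) e))
       \<longlonglongrightarrow> (LINT x|lebesgue_on ?D. frechet_derivative \<psi> (at x) e *\<^sub>R v x) + (LINT x|lebesgue_on ?D. \<psi> x *\<^sub>R w x)"
      by (intro tendsto_add t1 t2)
    then show "(LINT x|lebesgue_on ?D. frechet_derivative \<psi> (at x) e *\<^sub>R v x) + (LINT x|lebesgue_on ?D. \<psi> x *\<^sub>R w x) =
      (LINT x|sphere_measure. (\<psi> x * (x \<bullet> e)) *\<^sub>R g x)"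
      unfolding bpart_smooth[OF \<phi> \<psi>] using t3 by (rule LIMSEQ_unique)
  qed
  with w w2 show ?thesis by blast
qed

text \<open>The support is compact, so its distance from the origin is attained and exceeds r; the
  midpoint serves as the radius in \<open>inner_cut\<close>.\<close>

lemma test_function_annulus_inner_cut:
  fixes \<phi> :: "'a::euclidean_space \<Rightarrow> real"
  assumes "test_function (annulus r) \<phi>" "r < 1"
  shows "inner_cut r \<phi>" "\<And>x. norm x \<ge> 1 \<Longrightarrow> \<phi> x = 0"
proof -
  obtain K :: "'a set" where K: "compact K" "K \<subseteq> annulus r" "\<And>x. x \<notin> K \<Longrightarrow> \<phi> x = 0" and sm: "smooth \<phi>"
    using assms(1) by (auto simp: test_function_def)
  show "\<And>x. norm x \<ge> 1 \<Longrightarrow> \<phi> x = 0" using K by (force simp: annulus_def)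
  have "\<exists>r'>r. \<forall>x. norm x \<le> r' \<longrightarrow> \<phi> x = 0"
  proof (cases "K = {}")
    case True
    then show ?thesis using K(3) by (intro exI[of _ "r + 1"]) auto
  next
    case False
    then obtain x0 where x0: "x0 \<in> K" "\<And>x. x \<in> K \<Longrightarrow> norm x0 \<le> norm x"
      using continuous_attains_inf[OF K(1) False, of norm] continuous_on_norm_id by auto
    then have "r < norm x0" using K(2) by (auto simp: annulus_def)
    show ?thesis
    proof (intro exI[of _ "(r + norm x0) / 2"] conjI allI impI)
      fix x :: 'a assume "norm x \<le> (r + norm x0) / 2"
      then have "norm x < norm x0" using \<open>r < norm x0\<close> by simp
      then show "\<phi> x = 0" using x0(2)[of x] K(3)[of x] by force
    qed (use \<open>r < norm x0\<close> in simp)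
  qed
  then show "inner_cut r \<phi>" using sm by (simp add: inner_cut_def)
qed

lemma integrable_imp_locally_integrable:
  assumes "integrable (lebesgue_on D) v" "D \<in> sets lebesgue"
  shows "locally_integrable D v"
  unfolding locally_integrable_def
proof (intro allI impI)
  fix K assume K: "compact K \<and> K \<subseteq> D"
  have "integrable lebesgue (\<lambda>x. indicator D x *\<^sub>R v x)" using assms by (simp add: integrable_restrict_space)
  from integrable_mult_indicator[OF _ this, of K] K
  have "integrable lebesgue (\<lambda>x. indicator K x *\<^sub>R indicator D x *\<^sub>R v x)" by (simp add: borel_compact)
  moreover have "(\<lambda>x. indicator K x *\<^sub>R indicator D x *\<^sub>R v x) = (\<lambda>x. indicator K x *\<^sub>R v x)"
    using K by (force simp: indicator_def fun_eq_iff)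
  ultimately show "integrable (lebesgue_on K) v" using K by (simp add: integrable_restrict_space borel_compact)
qed

text \<open>A test function of the annulus is an \<open>inner_cut\<close> that also vanishes on the
  sphere, which removes the boundary term. With \<open>has_weak_partial_AE_unique\<close> this pins
  down the derivative in a \<open>bpart\<close>.\<close>

lemma bpart_imp_has_weak_partial:
  fixes v :: "'a::euclidean_space \<Rightarrow> 'b::euclidean_space"
  assumes b: "bpart r e v w g" and "r < 1"
  shows "has_weak_partial (annulus r) e v w"
  unfolding has_weak_partial_def
proof (intro conjI allI impI)
  show "locally_integrable (annulus r) v" "locally_integrable (annulus r) w"
    using b by (auto simp: bpart_def intro: integrable_imp_locally_integrable sets_annulus)
  fix \<phi> :: "'a \<Rightarrow> real" assume t: "test_function (annulus r) \<phi>"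
  have "(LINT x|sphere_measure. (\<phi> x * (x \<bullet> e)) *\<^sub>R g x) = (LINT x|(sphere_measure::'a measure). 0)"
    using test_function_annulus_inner_cut(2)[OF t \<open>r < 1\<close>]
    by (intro Bochner_Integration.integral_cong) (auto simp: space_sphere_measure)
  then have "(LINT x|lebesgue_on (annulus r). frechet_derivative \<phi> (at x) e *\<^sub>R v x) + (LINT x|lebesgue_on (annulus r). \<phi> x *\<^sub>R w x) = 0"
    using b test_function_annulus_inner_cut(1)[OF t \<open>r < 1\<close>] by (simp add: bpart_def)
  then show "(LINT x|lebesgue_on (annulus r). frechet_derivative \<phi> (at x) e *\<^sub>R v x) = - (LINT x|lebesgue_on (annulus r). \<phi> x *\<^sub>R w x)"
    by (simp add: eq_neg_iff_add_eq_0)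
qed

lemma bpart_AE_cong:
  fixes v :: "'a::euclidean_space \<Rightarrow> 'b::euclidean_space"
  assumes b: "bpart r e v w g"
    and v: "AE x in lebesgue_on (annulus r). v x = v' x" "v' \<in> borel_measurable (lebesgue_on (annulus r))"
    and w: "AE x in lebesgue_on (annulus r). w x = w' x" "w' \<in> borel_measurable (lebesgue_on (annulus r))"
  shows "bpart r e v' w' g"
  unfolding bpart_def
proof (intro conjI allI impI)
  have vm: "v \<in> borel_measurable (lebesgue_on (annulus r))" and wm: "w \<in> borel_measurable (lebesgue_on (annulus r))"
    using b by (auto simp: bpart_def)
  show "integrable (lebesgue_on (annulus r)) v'" "integrable (lebesgue_on (annulus r)) w'"
    using b v w integrable_cong_AE[OF vm v(2,1)] integrable_cong_AE[OF wm w(2,1)] by (auto simp: bpart_def)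
  show "integrable sphere_measure g" using b by (simp add: bpart_def)
  fix \<psi> :: "'a \<Rightarrow> real" assume \<psi>: "inner_cut r \<psi>"
  then have s: "smooth \<psi>" by (simp add: inner_cut_def)
  have m: "\<psi> \<in> borel_measurable (lebesgue_on (annulus r))" "(\<lambda>x. frechet_derivative \<psi> (at x) e) \<in> borel_measurable (lebesgue_on (annulus r))"
    by (intro borel_measurable_lebesgue_on smooth_borel smooth_directional s)+
  have "(LINT x|lebesgue_on (annulus r). frechet_derivative \<psi> (at x) e *\<^sub>R v' x) = (LINT x|lebesgue_on (annulus r). frechet_derivative \<psi> (at x) e *\<^sub>R v x)"
    by (rule integral_cong_AE) (use v vm m in \<open>auto intro!: borel_measurable_scaleR\<close>)
  moreover have "(LINT x|lebesgue_on (annulus r). \<psi> x *\<^sub>R w' x) = (LINT x|lebesgue_on (annulus r). \<psi> x *\<^sub>R w x)"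
    by (rule integral_cong_AE) (use w wm m in \<open>auto intro!: borel_measurable_scaleR\<close>)
  ultimately show "(LINT x|lebesgue_on (annulus r). frechet_derivative \<psi> (at x) e *\<^sub>R v' x) + (LINT x|lebesgue_on (annulus r). \<psi> x *\<^sub>R w' x) =
     (LINT x|sphere_measure. (\<psi> x * (x \<bullet> e)) *\<^sub>R g x)"
    using b \<psi> by (simp add: bpart_def)
qed

lemma bpart_linear:
  fixes T :: "'b::euclidean_space \<Rightarrow> 'c::euclidean_space"
  assumes T: "bounded_linear T" and b: "bpart r e v w g"
  shows "bpart r e (\<lambda>x. T (v x)) (\<lambda>x. T (w x)) (\<lambda>x. T (g x))"
  unfolding bpart_def
proof (intro conjI allI impI)
  have i: "integrable (lebesgue_on (annulus r)) v" "integrable (lebesgue_on (annulus r)) w" "integrable sphere_measure g"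
    using b by (auto simp: bpart_def)
  show "integrable (lebesgue_on (annulus r)) (\<lambda>x. T (v x))" "integrable (lebesgue_on (annulus r)) (\<lambda>x. T (w x))"
    "integrable sphere_measure (\<lambda>x. T (g x))"
    using i integrable_bounded_linear[OF T] by auto
  fix \<psi> :: "'a \<Rightarrow> real" assume \<psi>: "inner_cut r \<psi>"
  then have s: "smooth \<psi>" by (simp add: inner_cut_def)
  interpret T: bounded_linear T by fact
  have j: "integrable (lebesgue_on (annulus r)) (\<lambda>x. frechet_derivative \<psi> (at x) e *\<^sub>R v x)" "integrable (lebesgue_on (annulus r)) (\<lambda>x. \<psi> x *\<^sub>R w x)"
    "integrable sphere_measure (\<lambda>x. (\<psi> x * (x \<bullet> e)) *\<^sub>R g x)"
    by (intro smooth_scaleR_integrable smooth_scaleR_integrable_sphere smooth_directional s i annulus_subset_ball smooth_mult smooth_inner_e)+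
  show "(LINT x|lebesgue_on (annulus r). frechet_derivative \<psi> (at x) e *\<^sub>R T (v x)) + (LINT x|lebesgue_on (annulus r). \<psi> x *\<^sub>R T (w x)) =
     (LINT x|sphere_measure. (\<psi> x * (x \<bullet> e)) *\<^sub>R T (g x))"
    using b \<psi> by (simp add: bpart_def T.scaleR[symmetric] integral_bounded_linear[OF T j(1)] integral_bounded_linear[OF T j(2)]
        integral_bounded_linear[OF T j(3)] T.add[symmetric])
qed

lemma bpart_add:
  assumes b: "bpart r e v w g" "bpart r e v' w' g'"
  shows "bpart r e (\<lambda>x. v x + v' x) (\<lambda>x. w x + w' x) (\<lambda>x. g x + g' x)"
  unfolding bpart_def
proof (intro conjI allI impI)
  have i: "integrable (lebesgue_on (annulus r)) v" "integrable (lebesgue_on (annulus r)) w" "integrable sphere_measure g"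
    "integrable (lebesgue_on (annulus r)) v'" "integrable (lebesgue_on (annulus r)) w'" "integrable sphere_measure g'"
    using b by (auto simp: bpart_def)
  then show "integrable (lebesgue_on (annulus r)) (\<lambda>x. v x + v' x)" "integrable (lebesgue_on (annulus r)) (\<lambda>x. w x + w' x)"
    "integrable sphere_measure (\<lambda>x. g x + g' x)" by auto
  fix \<psi> :: "'a \<Rightarrow> real" assume \<psi>: "inner_cut r \<psi>"
  then have s: "smooth \<psi>" by (simp add: inner_cut_def)
  have j: "integrable (lebesgue_on (annulus r)) (\<lambda>x. frechet_derivative \<psi> (at x) e *\<^sub>R v x)" "integrable (lebesgue_on (annulus r)) (\<lambda>x. \<psi> x *\<^sub>R w x)"
    "integrable sphere_measure (\<lambda>x. (\<psi> x * (x \<bullet> e)) *\<^sub>R g x)"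
    "integrable (lebesgue_on (annulus r)) (\<lambda>x. frechet_derivative \<psi> (at x) e *\<^sub>R v' x)" "integrable (lebesgue_on (annulus r)) (\<lambda>x. \<psi> x *\<^sub>R w' x)"
    "integrable sphere_measure (\<lambda>x. (\<psi> x * (x \<bullet> e)) *\<^sub>R g' x)"
    by (intro smooth_scaleR_integrable smooth_scaleR_integrable_sphere smooth_directional s i annulus_subset_ball smooth_mult smooth_inner_e)+
  show "(LINT x|lebesgue_on (annulus r). frechet_derivative \<psi> (at x) e *\<^sub>R (v x + v' x)) + (LINT x|lebesgue_on (annulus r). \<psi> x *\<^sub>R (w x + w' x)) =
     (LINT x|sphere_measure. (\<psi> x * (x \<bullet> e)) *\<^sub>R (g x + g' x))"
  proof -
    have "(LINT x|lebesgue_on (annulus r). frechet_derivative \<psi> (at x) e *\<^sub>R v x) + (LINT x|lebesgue_on (annulus r). \<psi> x *\<^sub>R w x) +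
       ((LINT x|lebesgue_on (annulus r). frechet_derivative \<psi> (at x) e *\<^sub>R v' x) + (LINT x|lebesgue_on (annulus r). \<psi> x *\<^sub>R w' x)) =
      (LINT x|sphere_measure. (\<psi> x * (x \<bullet> e)) *\<^sub>R g x) + (LINT x|sphere_measure. (\<psi> x * (x \<bullet> e)) *\<^sub>R g' x)"
      using b \<psi> by (simp add: bpart_def)
    then show ?thesis using j by (simp add: scaleR_add_right algebra_simps)
  qed
qed

text \<open>Near the origin the product is zero, elsewhere both factors are smooth, and the two open
  sets cover the space. This is how coefficients like 1/|x| become admissible.\<close>

lemma inner_cut_mult:
  fixes m :: "'a::euclidean_space \<Rightarrow> real"
  assumes m: "smooth_on (- {0}) m" and \<psi>: "inner_cut r \<psi>" and "0 \<le> r"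
  shows "inner_cut r (\<lambda>x. m x * \<psi> x)"
proof -
  obtain r' where r': "r' > r" "\<And>x. norm x \<le> r' \<Longrightarrow> \<psi> x = 0" using \<psi> by (auto simp: inner_cut_def)
  have s: "smooth \<psi>" using \<psi> by (simp add: inner_cut_def)
  have "cd_on k (ball 0 r') (\<lambda>x. m x * \<psi> x)" for k
    using cd_on_cong[of "ball 0 r'" "\<lambda>x. m x * \<psi> x" "\<lambda>x. 0" k] r' by (simp add: cd_on_const)
  moreover have "cd_on k (- {0}) (\<lambda>x. m x * \<psi> x)" for k
    using smooth_on_mult[OF _ m smooth_imp_smooth_on[OF s]] by (simp add: smooth_on_def open_Compl)
  ultimately have "cd_on k (ball 0 r' \<union> - {0}) (\<lambda>x. m x * \<psi> x)" for k by (intro cd_on_Un) (auto simp: open_Compl)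
  moreover have "ball 0 r' \<union> - {0} = (UNIV :: 'a set)" using r' \<open>0 \<le> r\<close> by auto
  ultimately have "smooth (\<lambda>x. m x * \<psi> x)" by (simp add: smooth_iff_cd_on)
  then show ?thesis using r' by (auto simp: inner_cut_def)
qed

lemma smooth_on_bounded_annulus:
  fixes m :: "'a::euclidean_space \<Rightarrow> real"
  assumes m: "smooth_on (- {0}) m" and "0 < r"
  obtains C where "\<And>x. r \<le> norm x \<Longrightarrow> norm x \<le> 1 \<Longrightarrow> \<bar>m x\<bar> \<le> C"
proof -
  have K: "compact (cball 0 1 - ball (0::'a) r)" by (intro compact_diff) auto
  have "compact (m ` (cball 0 1 - ball 0 r))"
    by (intro compact_continuous_image K continuous_on_subset[OF smooth_on_continuous[OF m]]) (use \<open>0 < r\<close> in auto)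
  then obtain C where "\<forall>y\<in>m ` (cball 0 1 - ball 0 r). norm y \<le> C" using compact_imp_bounded bounded_iff by blast
  then show ?thesis by (intro that[of C]) (force simp: not_less)
qed

lemma smooth_on_integrable_annulus:
  fixes m :: "'a::euclidean_space \<Rightarrow> real" and v :: "'a \<Rightarrow> 'b::euclidean_space"
  assumes m: "smooth_on (- {0}) m" and "0 < r"
  shows "integrable (lebesgue_on (annulus r)) v \<Longrightarrow> integrable (lebesgue_on (annulus r)) (\<lambda>x. m x *\<^sub>R v x)"
    and "integrable sphere_measure g \<Longrightarrow> integrable sphere_measure (\<lambda>x. m x *\<^sub>R (g x :: 'b))"
proof -
  obtain C where C: "\<And>x. r \<le> norm x \<Longrightarrow> norm x \<le> 1 \<Longrightarrow> \<bar>m x\<bar> \<le> C" using smooth_on_bounded_annulus[OF assms] by metis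
  have C1: "\<bar>m x\<bar> \<le> C" if "norm x = 1" "r < 1" for x using C[of x] that by simp
  obtain C' where C': "\<And>x. 1 \<le> norm x \<Longrightarrow> norm x \<le> 1 \<Longrightarrow> \<bar>m x\<bar> \<le> C'" using smooth_on_bounded_annulus[OF m zero_less_one] by metis
  have "m \<in> borel_measurable (lebesgue_on (annulus r))"
    by (intro continuous_imp_measurable_on_sets_lebesgue sets_annulus continuous_on_subset[OF smooth_on_continuous[OF m]])
      (use \<open>0 < r\<close> in \<open>auto simp: annulus_def\<close>)
  then show "integrable (lebesgue_on (annulus r)) v \<Longrightarrow> integrable (lebesgue_on (annulus r)) (\<lambda>x. m x *\<^sub>R v x)"
    by (rule integrable_bounded_scaleR[rotated, where C=C]) (use C in \<open>auto simp: annulus_def\<close>)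
  have "m \<in> borel_measurable (restrict_space borel (sphere 0 1))"
    by (intro borel_measurable_continuous_on_restrict continuous_on_subset[OF smooth_on_continuous[OF m]]) auto
  then have "m \<in> borel_measurable sphere_measure" by (subst measurable_cong_sets[OF sets_sphere_measure refl])
  then show "integrable sphere_measure g \<Longrightarrow> integrable sphere_measure (\<lambda>x. m x *\<^sub>R (g x :: 'b))"
    by (rule integrable_bounded_scaleR[rotated, where C=C']) (use C' in \<open>auto simp: space_sphere_measure\<close>)
qed

text \<open>The product rule is obtained by shifting the factor onto the test function: m \<psi> is
  again an \<open>inner_cut\<close>.\<close>

lemma bpart_mult:
  fixes m :: "'a::euclidean_space \<Rightarrow> real"
  assumes b: "bpart r e v w g" and m: "smooth_on (- {0}) m" and r: "0 < r"
  shows "bpart r e (\<lambda>x. m x *\<^sub>R v x) (\<lambda>x. frechet_derivative m (at x) e *\<^sub>R v x + m x *\<^sub>R w x) (\<lambda>x. m x *\<^sub>R g x)"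
  unfolding bpart_def
proof (intro conjI allI impI)
  let ?D = "annulus r :: 'a set"
  have i: "integrable (lebesgue_on ?D) v" "integrable (lebesgue_on ?D) w" "integrable sphere_measure g"
    using b by (auto simp: bpart_def)
  have j: "integrable (lebesgue_on ?D) (\<lambda>x. m x *\<^sub>R v x)" "integrable (lebesgue_on ?D) (\<lambda>x. frechet_derivative m (at x) e *\<^sub>R v x)"
     "integrable (lebesgue_on ?D) (\<lambda>x. m x *\<^sub>R w x)"
    by (intro smooth_on_integrable_annulus smooth_on_directional m r i)+
  show "integrable (lebesgue_on ?D) (\<lambda>x. m x *\<^sub>R v x)" "integrable (lebesgue_on ?D) (\<lambda>x. frechet_derivative m (at x) e *\<^sub>R v x + m x *\<^sub>R w x)"
    "integrable sphere_measure (\<lambda>x. m x *\<^sub>R g x)"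
    by (intro Bochner_Integration.integrable_add j smooth_on_integrable_annulus(2)[OF m r i(3)])+
  fix \<psi> :: "'a \<Rightarrow> real" assume \<psi>: "inner_cut r \<psi>"
  then have s: "smooth \<psi>" by (simp add: inner_cut_def)
  have ic: "inner_cut r (\<lambda>x. m x * \<psi> x)" using inner_cut_mult[OF m \<psi>] r by simp
  have d: "frechet_derivative (\<lambda>x. m x * \<psi> x) (at x) e = m x * frechet_derivative \<psi> (at x) e + frechet_derivative m (at x) e * \<psi> x" if "x \<in> ?D" for x
  proof -
    have "x \<in> - {0}" using that r by (auto simp: annulus_def)
    from has_derivative_mult[OF smooth_on_has_derivative[OF m this] smooth_has_derivative[OF s, of x]]
    show ?thesis by (simp add: frechet_derivative_eqI)
  qed
  have "(LINT x|lebesgue_on ?D. frechet_derivative (\<lambda>x. m x * \<psi> x) (at x) e *\<^sub>R v x) + (LINT x|lebesgue_on ?D. (m x * \<psi> x) *\<^sub>R w x) =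
     (LINT x|sphere_measure. ((m x * \<psi> x) * (x \<bullet> e)) *\<^sub>R g x)"
    using b ic by (simp add: bpart_def)
  also have "(LINT x|lebesgue_on ?D. frechet_derivative (\<lambda>x. m x * \<psi> x) (at x) e *\<^sub>R v x) =
     (LINT x|lebesgue_on ?D. frechet_derivative \<psi> (at x) e *\<^sub>R (m x *\<^sub>R v x) + \<psi> x *\<^sub>R (frechet_derivative m (at x) e *\<^sub>R v x))"
    by (rule Bochner_Integration.integral_cong[OF refl], subst d, simp) (simp add: scaleR_add_left mult.commute)
  also have "\<dots> = (LINT x|lebesgue_on ?D. frechet_derivative \<psi> (at x) e *\<^sub>R (m x *\<^sub>R v x)) + (LINT x|lebesgue_on ?D. \<psi> x *\<^sub>R (frechet_derivative m (at x) e *\<^sub>R v x))"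
    by (intro Bochner_Integration.integral_add smooth_scaleR_integrable smooth_directional s j annulus_subset_ball)
  also have "(LINT x|lebesgue_on ?D. (m x * \<psi> x) *\<^sub>R w x) = (LINT x|lebesgue_on ?D. \<psi> x *\<^sub>R (m x *\<^sub>R w x))"
    by (simp add: mult.commute)
  finally have "(LINT x|lebesgue_on ?D. frechet_derivative \<psi> (at x) e *\<^sub>R (m x *\<^sub>R v x)) + ((LINT x|lebesgue_on ?D. \<psi> x *\<^sub>R (frechet_derivative m (at x) e *\<^sub>R v x)) +
      (LINT x|lebesgue_on ?D. \<psi> x *\<^sub>R (m x *\<^sub>R w x))) = (LINT x|sphere_measure. ((m x * \<psi> x) * (x \<bullet> e)) *\<^sub>R g x)" by (simp only: add.assoc)
  also have "(LINT x|lebesgue_on ?D. \<psi> x *\<^sub>R (frechet_derivative m (at x) e *\<^sub>R v x)) + (LINT x|lebesgue_on ?D. \<psi> x *\<^sub>R (m x *\<^sub>R w x)) =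
    (LINT x|lebesgue_on ?D. \<psi> x *\<^sub>R (frechet_derivative m (at x) e *\<^sub>R v x) + \<psi> x *\<^sub>R (m x *\<^sub>R w x))"
    by (rule Bochner_Integration.integral_add[symmetric]) (intro smooth_scaleR_integrable s j annulus_subset_ball)+
  finally show "(LINT x|lebesgue_on ?D. frechet_derivative \<psi> (at x) e *\<^sub>R (m x *\<^sub>R v x)) + (LINT x|lebesgue_on ?D. \<psi> x *\<^sub>R (frechet_derivative m (at x) e *\<^sub>R v x + m x *\<^sub>R w x)) =
     (LINT x|sphere_measure. (\<psi> x * (x \<bullet> e)) *\<^sub>R (m x *\<^sub>R g x))"
    by (simp add: scaleR_add_right mult_ac)
qed

lemma bpart_cong:
  assumes "bpart r e v w g" "\<And>x. x \<in> annulus r \<Longrightarrow> v x = v' x" "\<And>x. x \<in> annulus r \<Longrightarrow> w x = w' x"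
    "\<And>x. norm x = 1 \<Longrightarrow> g x = g' x"
  shows "bpart r e v' w' g'"
proof -
  have g: "x \<in> space sphere_measure \<Longrightarrow> g x = g' x" for x using assms(4) by (simp add: space_sphere_measure)
  have D: "x \<in> space (lebesgue_on (annulus r)) \<Longrightarrow> v x = v' x" "x \<in> space (lebesgue_on (annulus r)) \<Longrightarrow> w x = w' x" for x
    using assms by auto
  have i: "integrable (lebesgue_on (annulus r)) v'" "integrable (lebesgue_on (annulus r)) w'" "integrable sphere_measure g'"
    using assms(1) Bochner_Integration.integrable_cong[of "lebesgue_on (annulus r)" _ v v', OF refl D(1)]
      Bochner_Integration.integrable_cong[of "lebesgue_on (annulus r)" _ w w', OF refl D(2)]
      Bochner_Integration.integrable_cong[of sphere_measure _ g g', OF refl g] by (simp_all add: bpart_def)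
  have "(LINT x|lebesgue_on (annulus r). frechet_derivative \<psi> (at x) e *\<^sub>R v' x) = (LINT x|lebesgue_on (annulus r). frechet_derivative \<psi> (at x) e *\<^sub>R v x)"
    "(LINT x|lebesgue_on (annulus r). \<psi> x *\<^sub>R w' x) = (LINT x|lebesgue_on (annulus r). \<psi> x *\<^sub>R w x)"
    "(LINT x|sphere_measure. (\<psi> x * (x \<bullet> e)) *\<^sub>R g' x) = (LINT x|sphere_measure. (\<psi> x * (x \<bullet> e)) *\<^sub>R g x)" for \<psi>
    by (intro Bochner_Integration.integral_cong refl; simp add: D g)+
  then show ?thesis using assms(1) i unfolding bpart_def by simp
qed

lemma smooth_on_bounded_linear_comp:
  assumes "open S" "bounded_linear l" "smooth_on S f"
  shows "smooth_on S (\<lambda>x. l (f x))"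
  using cd_on_bounded_linear_comp[OF assms(1,2), of _ f] assms(3) unfolding smooth_on_def by blast

lemma smooth_on_scaleR:
  assumes "open S" "smooth_on S c" "smooth_on S f"
  shows "smooth_on S (\<lambda>x. c x *\<^sub>R f x)"
  using cd_on_scaleR[OF assms(1), of _ c f] assms(2,3) unfolding smooth_on_def by blast

section \<open>The frame\<close>

lemma smooth_on_inverse_norm: "smooth_on (- {0}) (\<lambda>x::'a::euclidean_space. 1 / norm x)"
proof -
  have "cd_on k (- {0}) (\<lambda>x::'a. (x \<bullet> x) powr (- (1/2)))" for k
    by (rule cd_on_compose_real[OF _ _ cd_on_powr])
      (auto intro!: cd_on_inner cd_on_bounded_linear[OF _ bounded_linear_ident] simp: open_Compl)
  moreover have "(x \<bullet> x) powr (- (1/2)) = 1 / norm x" for x :: 'a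
    by (simp only: powr_minus_divide powr_half_sqrt[OF inner_ge_zero] norm_eq_sqrt_inner)
  ultimately show ?thesis unfolding smooth_on_def by simp
qed

lemma has_derivative_inverse_norm:
  fixes x :: "'a::euclidean_space"
  assumes "x \<noteq> 0"
  shows "((\<lambda>x. 1 / norm x) has_derivative (\<lambda>h. - ((1 / norm x) ^ 3 * (x \<bullet> h)))) (at x)"
proof -
  have "((\<lambda>x. inverse (norm x)) has_derivative (\<lambda>h. - (inverse (norm x) * (h \<bullet> sgn x) * inverse (norm x)))) (at x)"
    by (rule Deriv.has_derivative_inverse[OF _ has_derivative_norm]) (use assms in auto)
  moreover have "inverse (norm x) * (h \<bullet> sgn x) * inverse (norm x) = (1 / norm x) ^ 3 * (x \<bullet> h)" for h
    by (simp add: sgn_div_norm inverse_eq_divide power3_eq_cube inner_commute)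
  ultimately show ?thesis by (simp add: inverse_eq_divide)
qed

text \<open>Test functions are real, so \<open>bpart_mult\<close> takes real factors; a complex
  factor is split into real and imaginary part.\<close>

lemma bpart_cmult:
  fixes m :: "'a::euclidean_space \<Rightarrow> complex" and v :: "'a \<Rightarrow> complex"
  assumes b: "bpart r e v w g" and m: "smooth_on (- {0}) m" and r: "0 < r"
    and d: "\<And>x. x \<noteq> 0 \<Longrightarrow> (m has_derivative dm x) (at x)"
  shows "bpart r e (\<lambda>x. m x * v x) (\<lambda>x. dm x e * v x + m x * w x) (\<lambda>x. m x * g x)"
proof -
  have ex: "z * y = Re z *\<^sub>R y + \<i> * (Im z *\<^sub>R y)" for z y
    by (subst complex_eq[of z]) (simp add: scaleR_conv_of_real algebra_simps)
  have o: "open (- {0::'a})" by (simp add: open_Compl)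
  note b1 = bpart_mult[OF b smooth_on_bounded_linear_comp[OF o bounded_linear_Re m] r]
    and b2 = bpart_linear[OF bounded_linear_mult_right[of \<i>] bpart_mult[OF b smooth_on_bounded_linear_comp[OF o bounded_linear_Im m] r]]
  show ?thesis
  proof (rule bpart_cong[OF bpart_add[OF b1 b2]])
    fix x :: 'a assume "x \<in> annulus r"
    then have x: "x \<noteq> 0" using r by (auto simp: annulus_def)
    have "frechet_derivative (\<lambda>x. Re (m x)) (at x) = (\<lambda>h. Re (dm x h))" "frechet_derivative (\<lambda>x. Im (m x)) (at x) = (\<lambda>h. Im (dm x h))"
      using bounded_linear.has_derivative[OF bounded_linear_Re d[OF x]] bounded_linear.has_derivative[OF bounded_linear_Im d[OF x]]
      by (simp_all add: frechet_derivative_eqI)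
    then show "frechet_derivative (\<lambda>x. Re (m x)) (at x) e *\<^sub>R v x + Re (m x) *\<^sub>R w x +
         \<i> * (frechet_derivative (\<lambda>x. Im (m x)) (at x) e *\<^sub>R v x + Im (m x) *\<^sub>R w x) = dm x e * v x + m x * w x"
      by (simp add: ex[of "dm x e"] ex[of "m x"] distrib_left)
  qed (rule ex[symmetric])+
qed

lemma smooth_on_normalized_linear:
  fixes l :: "'a::euclidean_space \<Rightarrow> complex"
  assumes "bounded_linear l"
  shows "smooth_on (- {0}) (\<lambda>x. l x / norm x)"
    and "x \<noteq> 0 \<Longrightarrow> ((\<lambda>x. l x / norm x) has_derivative (\<lambda>h. complex_of_real (1 / norm x) * l h - complex_of_real ((1 / norm x) ^ 3 * (x \<bullet> h)) * l x)) (at x)"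
proof -
  have eq: "l x / norm x = (1 / norm x) *\<^sub>R l x" for x by (simp add: scaleR_conv_of_real)
  have "smooth_on (- {0}) l" using assms by (intro smooth_imp_smooth_on smooth_bounded_linear)
  then show "smooth_on (- {0}) (\<lambda>x. l x / norm x)" unfolding eq
    by (intro smooth_on_scaleR smooth_on_inverse_norm) (simp add: open_Compl)
  assume x: "x \<noteq> 0"
  show "((\<lambda>x. l x / norm x) has_derivative (\<lambda>h. complex_of_real (1 / norm x) * l h - complex_of_real ((1 / norm x) ^ 3 * (x \<bullet> h)) * l x)) (at x)"
    unfolding eq
    by (rule has_derivative_eq_rhs[OF has_derivative_scaleR[OF has_derivative_inverse_norm[OF x] bounded_linear_imp_has_derivative[OF assms]]])
      (simp add: scaleR_conv_of_real fun_eq_iff)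
qed

lemma bounded_linear_nth: "bounded_linear (\<lambda>x::complex^2. x $ j)"
  and bounded_linear_cnj_nth: "bounded_linear (\<lambda>x::complex^2. cnj (x $ j))"
  using bounded_linear_compose[OF bounded_linear_cnj bounded_linear_vec_nth[of j]] by (auto intro: bounded_linear_vec_nth)

lemma inner_axis_complex [simp]:
  "(x::complex^2) \<bullet> axis j 1 = Re (x $ j)" "(x::complex^2) \<bullet> axis j \<i> = Im (x $ j)"
  by (simp_all add: inner_axis inner_complex_def)

lemma Basis_complex2: "(Basis :: (complex^2) set) = {axis 1 1, axis 1 \<i>, axis 2 1, axis 2 \<i>}"
  by (auto simp: Basis_vec_def UNIV_2 Basis_complex_def)

lemma axis_complex_in_Basis [simp]: "(axis j 1 :: complex^2) \<in> Basis" "(axis j \<i> :: complex^2) \<in> Basis"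
  by (simp_all add: axis_in_Basis_iff Basis_complex_def)

lemma norm_sq_complex2: "complex_of_real ((norm (z::complex^2))\<^sup>2) = z $ 1 * cnj (z $ 1) + z $ 2 * cnj (z $ 2)"
proof -
  have "(norm z)\<^sup>2 = (cmod (z $ 1))\<^sup>2 + (cmod (z $ 2))\<^sup>2"
    by (simp add: norm_vec_def L2_set_def sum_2 real_sqrt_pow2 add_nonneg_nonneg)
  then show ?thesis by (simp only: complex_norm_square of_real_add)
qed

text \<open>Write L = L0/|z| and N = E/|z| with E the Euler field. Then [L0,E] = L0, L0 annihilates
  |z|, and E(1/|z|) = -1/(2|z|), so [L,N] = (1 + 1/2) L0/|z|^2. The proof checks this in
  coordinates.\<close>

lemma lie_bracket_L_N:
  assumes z: "z \<noteq> 0"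
  shows "lie_bracket L_field N_field z = (3 / (2 * norm z)) *\<^sub>R L_field z"
proof -
  define Q where "Q = complex_of_real (1 / norm z)"
  have Q: "Q * Q * (z $ 1 * cnj (z $ 1) + z $ 2 * cnj (z $ 2)) = 1"
    unfolding norm_sq_complex2[symmetric] Q_def using z by (simp add: power2_eq_square flip: of_real_mult)
  have of1: "complex_of_real ((1 / norm z) ^ 3 * t) = Q * Q * Q * complex_of_real t" for t
    by (simp add: Q_def power3_eq_cube)
  have conv: "x / complex_of_real (norm z) = Q * x" "x / complex_of_real (norm z) ^ 3 = Q * Q * Q * x" for x
    by (simp_all add: Q_def power3_eq_cube)
  \<comment> \<open>The subtracted term comes from the holomorphic derivative of 1/|z|, which is
    -1/2 times the conjugate of z_j over |z|^3; \<open>Q\<close> stands for 1/|z|.\<close>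
  have cdz: "classical_dz j (\<lambda>w. l w / norm w) z =
     Q * ((l (axis j 1) - \<i> * l (axis j \<i>)) - Q * Q * cnj (z $ j) * l z) / 2"
    if "bounded_linear l" for l :: "complex^2 \<Rightarrow> complex" and j
  proof -
    have c: "cnj (z $ j) = complex_of_real (Re (z $ j)) - \<i> * complex_of_real (Im (z $ j))"
      by (simp add: complex_eq_iff)
    show ?thesis
      unfolding classical_dz_def frechet_derivative_eqI[OF smooth_on_normalized_linear(2)[OF that z]] c inner_axis_complex
        of1 Q_def[symmetric]
      by (simp add: field_simps)
  qed
  have N: "(\<lambda>w. N_field w $ k) = (\<lambda>w. w $ k / norm w)" for k
    using exhaust_2[of k] by (auto simp: N_field_def)
  have L1: "(\<lambda>w. L_field w $ 1) = (\<lambda>w. cnj (w $ 2) / norm w)" by (simp add: L_field_def)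
  have L2: "(\<lambda>w. L_field w $ 2) = (\<lambda>w. (- cnj (w $ 1)) / norm w)" by (simp add: L_field_def)
  have bl: "bounded_linear (\<lambda>w::complex^2. - cnj (w $ 1))" by (intro bounded_linear_minus bounded_linear_cnj_nth)
  have comp: "lie_bracket L_field N_field z $ k = (3 / 2) * Q * L_field z $ k" for k
  proof -
    have Q': "Q * Q * z $ 1 * cnj (z $ 1) = 1 - Q * Q * z $ 2 * cnj (z $ 2)" using Q by (simp add: algebra_simps)
    consider "k = 1" | "k = 2" using exhaust_2 by auto
    then show ?thesis
    proof cases
      case 1
      have "lie_bracket L_field N_field z $ k = Q * Q * cnj (z $ 2) + Q * Q * cnj (z $ 2) * (Q * Q * (z $ 1 * cnj (z $ 1) + z $ 2 * cnj (z $ 2))) / 2"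
        unfolding lie_bracket_def 1 N L1 vec_lambda_beta sum_2 cdz[OF bounded_linear_nth] cdz[OF bounded_linear_cnj_nth[of 2]]
        by (simp add: L_field_def N_field_def axis_def conv algebra_simps add_divide_distrib diff_divide_distrib)
      then show ?thesis unfolding Q by (simp add: 1 L_field_def conv algebra_simps)
    next
      case 2
      have "lie_bracket L_field N_field z $ k = - (Q * Q * cnj (z $ 1)) - Q * Q * cnj (z $ 1) * (Q * Q * (z $ 1 * cnj (z $ 1) + z $ 2 * cnj (z $ 2))) / 2"
        unfolding lie_bracket_def 2 N L2 vec_lambda_beta sum_2 cdz[OF bounded_linear_nth] cdz[OF bl]
        by (simp add: L_field_def N_field_def axis_def conv algebra_simps add_divide_distrib diff_divide_distrib)
      then show ?thesis unfolding Q by (simp add: 2 L_field_def conv algebra_simps)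
    qed
  qed
  show ?thesis
    unfolding vec_eq_iff comp vector_scaleR_component by (simp add: Q_def scaleR_conv_of_real)
qed

text \<open>L has Euclidean length 1, so (L,L) = 1/2 in the chosen normalisation; this halves the
  factor 3/(2|z|) of the bracket.\<close>

lemma field_inner_lie:
  assumes z: "z \<noteq> 0"
  shows "field_inner (L_field z) (lie_bracket L_field N_field z) = 3 / (4 * norm z)"
    "field_inner (lie_bracket L_field N_field z) (L_field z) = 3 / (4 * norm z)"
proof -
  have comp: "lie_bracket L_field N_field z $ k = complex_of_real (3 / (2 * norm z)) * L_field z $ k" for k
    unfolding lie_bracket_L_N[OF z] vector_scaleR_component by (simp add: scaleR_conv_of_real)
  have "(\<Sum>j\<in>UNIV. L_field z $ j * cnj (L_field z $ j)) = (z $ 1 * cnj (z $ 1) + z $ 2 * cnj (z $ 2)) / (complex_of_real (norm z))\<^sup>2"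
    by (simp add: sum_2 L_field_def power2_eq_square add_divide_distrib mult.commute)
  also have "\<dots> = 1" unfolding norm_sq_complex2[symmetric] using z by simp
  finally have 1: "L_field z $ 1 * cnj (L_field z $ 1) + L_field z $ 2 * cnj (L_field z $ 2) = 1" by (simp add: sum_2)
  show "field_inner (L_field z) (lie_bracket L_field N_field z) = 3 / (4 * norm z)"
  proof -
    have "field_inner (L_field z) (lie_bracket L_field N_field z) = (3 / (4 * norm z)) * (L_field z $ 1 * cnj (L_field z $ 1) + L_field z $ 2 * cnj (L_field z $ 2))"
      unfolding field_inner_def sum_2 comp complex_cnj_mult complex_cnj_complex_of_real using z by (simp add: field_simps)
    then show ?thesis unfolding 1 by simp
  qed
  show "field_inner (lie_bracket L_field N_field z) (L_field z) = 3 / (4 * norm z)"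
  proof -
    have "field_inner (lie_bracket L_field N_field z) (L_field z) = (3 / (4 * norm z)) * (L_field z $ 1 * cnj (L_field z $ 1) + L_field z $ 2 * cnj (L_field z $ 2))"
      unfolding field_inner_def sum_2 comp complex_cnj_mult complex_cnj_complex_of_real using z by (simp add: field_simps)
    then show ?thesis unfolding 1 by simp
  qed
qed

section \<open>Calculus of weak derivatives\<close>

lemma test_function_directional:
  assumes "test_function D \<phi>"
  shows "test_function D (\<lambda>x. frechet_derivative \<phi> (at x) e)"
proof -
  obtain K where K: "compact K" "K \<subseteq> D" "\<And>x. x \<notin> K \<Longrightarrow> \<phi> x = 0" and sm: "smooth \<phi>"
    using assms(1) by (auto simp: test_function_def)
  have "frechet_derivative \<phi> (at x) e = 0" if "x \<notin> K" for x
  proof -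
    have "(\<phi> has_derivative (\<lambda>_. 0)) (at x)"
      by (rule has_derivative_transform_within_open[of "\<lambda>_. 0" _ _ _ "- K"])
        (use K that in \<open>auto intro: compact_imp_closed\<close>)
    then show ?thesis by (simp add: frechet_derivative_eqI)
  qed
  then show ?thesis using K smooth_directional[OF sm] unfolding test_function_def by blast
qed

lemma locally_integrable_bounded_linear:
  "bounded_linear T \<Longrightarrow> locally_integrable D v \<Longrightarrow> locally_integrable D (\<lambda>x. T (v x))"
  unfolding locally_integrable_def by (auto intro: integrable_bounded_linear)

lemma has_weak_partial_linear:
  fixes T :: "'b::euclidean_space \<Rightarrow> 'c::euclidean_space"
  assumes D: "open D" and T: "bounded_linear T" and w: "has_weak_partial D e v w"
  shows "has_weak_partial D e (\<lambda>x. T (v x)) (\<lambda>x. T (w x))"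
  unfolding has_weak_partial_def
proof (intro conjI allI impI)
  interpret T: bounded_linear T by fact
  have li: "locally_integrable D v" "locally_integrable D w" using w by (auto simp: has_weak_partial_def)
  then show "locally_integrable D (\<lambda>x. T (v x))" "locally_integrable D (\<lambda>x. T (w x))"
    by (auto intro: locally_integrable_bounded_linear T)
  fix \<phi> assume t: "test_function D \<phi>"
  show "(LINT x|lebesgue_on D. frechet_derivative \<phi> (at x) e *\<^sub>R T (v x)) = - (LINT x|lebesgue_on D. \<phi> x *\<^sub>R T (w x))"
    using w t by (simp add: has_weak_partial_def T.scaleR[symmetric] T.neg[symmetric]
        integral_bounded_linear[OF T test_function_scaleR_integrable[OF D t li(2)]]
        integral_bounded_linear[OF T test_function_scaleR_integrable[OF D test_function_directional[OF t] li(1)]])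
qed

lemma has_weak_partial_add:
  assumes D: "open D" and w: "has_weak_partial D e v w" "has_weak_partial D e v' w'"
  shows "has_weak_partial D e (\<lambda>x. v x + v' x) (\<lambda>x. w x + w' x)"
  unfolding has_weak_partial_def
proof (intro conjI allI impI)
  have li: "locally_integrable D v" "locally_integrable D w" "locally_integrable D v'" "locally_integrable D w'"
    using w by (auto simp: has_weak_partial_def)
  then show "locally_integrable D (\<lambda>x. v x + v' x)" "locally_integrable D (\<lambda>x. w x + w' x)"
    by (auto simp: locally_integrable_def)
  fix \<phi> assume t: "test_function D \<phi>"
  note i = test_function_scaleR_integrable[OF D t li(2)] test_function_scaleR_integrable[OF D t li(4)]
    test_function_scaleR_integrable[OF D test_function_directional[OF t, of e] li(1)]
    test_function_scaleR_integrable[OF D test_function_directional[OF t, of e] li(3)]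
  show "(LINT x|lebesgue_on D. frechet_derivative \<phi> (at x) e *\<^sub>R (v x + v' x)) = - (LINT x|lebesgue_on D. \<phi> x *\<^sub>R (w x + w' x))"
    using w t i by (simp add: has_weak_partial_def scaleR_add_right)
qed

lemma test_function_subset: "test_function E \<phi> \<Longrightarrow> E \<subseteq> D \<Longrightarrow> test_function D \<phi>"
  unfolding test_function_def by (meson order_trans)

lemma locally_integrable_subset: "locally_integrable D v \<Longrightarrow> E \<subseteq> D \<Longrightarrow> locally_integrable E v"
  unfolding locally_integrable_def by (meson order_trans)

lemma test_function_LINT_subset:
  fixes v :: "'a::euclidean_space \<Rightarrow> 'b::euclidean_space"
  assumes "test_function E \<phi>" "E \<subseteq> D" "open E" "open D"
  shows "(LINT x|lebesgue_on D. \<phi> x *\<^sub>R v x) = (LINT x|lebesgue_on E. \<phi> x *\<^sub>R v x)"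
proof -
  have "\<phi> x = 0" if "x \<notin> E" for x using assms(1) that unfolding test_function_def by blast
  then have "(LINT x|lebesgue. indicator D x *\<^sub>R \<phi> x *\<^sub>R v x) = (LINT x|lebesgue. indicator E x *\<^sub>R \<phi> x *\<^sub>R v x)"
    using assms(2) by (intro Bochner_Integration.integral_cong refl) (force simp: indicator_def)
  then show ?thesis using assms(3,4) by (simp add: integral_restrict_space)
qed

lemma has_weak_partial_subset:
  assumes w: "has_weak_partial D e v w" and ED: "E \<subseteq> D" "open E" "open D"
  shows "has_weak_partial E e v w"
  unfolding has_weak_partial_def
proof (intro conjI allI impI)
  show "locally_integrable E v" "locally_integrable E w"
    using w ED by (auto simp: has_weak_partial_def intro: locally_integrable_subset)
  fix \<phi> assume t: "test_function E \<phi>"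
  then show "(LINT x|lebesgue_on E. frechet_derivative \<phi> (at x) e *\<^sub>R v x) = - (LINT x|lebesgue_on E. \<phi> x *\<^sub>R w x)"
    using w test_function_subset[OF t ED(1)] test_function_LINT_subset[OF t ED, of w]
      test_function_LINT_subset[OF test_function_directional[OF t, of e] ED, of v]
    by (simp add: has_weak_partial_def)
qed

text \<open>Rests on the completeness of Lebesgue measure, and lets representatives of a class be
  exchanged without separate measurability proofs.\<close>

lemma borel_measurable_AE_lebesgue_on:
  fixes f :: "'a::euclidean_space \<Rightarrow> 'b::euclidean_space"
  assumes "f \<in> borel_measurable (lebesgue_on S)" "AE x in lebesgue_on S. f x = g x" "S \<in> sets lebesgue"
  shows "g \<in> borel_measurable (lebesgue_on S)"
proof -
  have "(\<lambda>x. indicator S x *\<^sub>R f x) \<in> borel_measurable lebesgue"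
    using assms(1,3) by (subst borel_measurable_restrict_space_iff[symmetric]) auto
  moreover have "AE x in lebesgue. indicator S x *\<^sub>R f x = indicator S x *\<^sub>R g x"
  proof -
    have "AE x in lebesgue. x \<in> S \<longrightarrow> f x = g x" using assms(2,3) by (simp add: AE_restrict_space_iff)
    then show ?thesis by eventually_elim (auto simp: indicator_def)
  qed
  ultimately have "(\<lambda>x. indicator S x *\<^sub>R g x) \<in> borel_measurable lebesgue" by (rule borel_measurable_AE)
  then show ?thesis using assms(3) by (subst borel_measurable_restrict_space_iff) auto
qed

lemma AE_lebesgue_on_subset:
  assumes "AE x in lebesgue_on D. P x" "E \<subseteq> D" "D \<in> sets lebesgue" "E \<in> sets lebesgue"
  shows "AE x in lebesgue_on E. P x"
  using assms by (auto simp: AE_restrict_space_iff elim!: eventually_mono)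

lemma integrable_AE_cong_lebesgue_on:
  fixes v :: "'a::euclidean_space \<Rightarrow> 'b::euclidean_space"
  assumes "integrable (lebesgue_on S) v" "AE x in lebesgue_on S. v x = v' x" "S \<in> sets lebesgue"
  shows "integrable (lebesgue_on S) v'"
  using assms borel_measurable_AE_lebesgue_on[OF borel_measurable_integrable[OF assms(1)] assms(2,3)]
    integrable_cong_AE[of v "lebesgue_on S" v'] by auto

lemma has_weak_partial_AE_cong:
  fixes v :: "'a::euclidean_space \<Rightarrow> 'b::euclidean_space"
  assumes w: "has_weak_partial D e v w" and D: "open D" and ae: "AE x in lebesgue_on D. v x = v' x"
  shows "has_weak_partial D e v' w"
proof -
  have Dm: "D \<in> sets lebesgue" using D by auto
  have li: "locally_integrable D v" "locally_integrable D w" using w by (auto simp: has_weak_partial_def)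
  have "locally_integrable D v'"
    unfolding locally_integrable_def
  proof (intro allI impI)
    fix K assume K: "compact K \<and> K \<subseteq> D"
    then have "K \<in> sets lebesgue" by (auto simp: borel_compact)
    then show "integrable (lebesgue_on K) v'"
      using integrable_AE_cong_lebesgue_on[OF _ AE_lebesgue_on_subset[OF ae]] K Dm li by (auto simp: locally_integrable_def)
  qed
  moreover have "(LINT x|lebesgue_on D. \<phi> x *\<^sub>R v' x) = (LINT x|lebesgue_on D. \<phi> x *\<^sub>R v x)" if "test_function D \<phi>" for \<phi>
  proof (rule integral_cong_AE)
    have i: "integrable (lebesgue_on D) (\<lambda>x. \<phi> x *\<^sub>R v x)" by (rule test_function_scaleR_integrable[OF D that li(1)])
    show "(\<lambda>x. \<phi> x *\<^sub>R v x) \<in> borel_measurable (lebesgue_on D)" using i by simp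
    have ae': "AE x in lebesgue_on D. \<phi> x *\<^sub>R v x = \<phi> x *\<^sub>R v' x" using ae by eventually_elim simp
    show "(\<lambda>x. \<phi> x *\<^sub>R v' x) \<in> borel_measurable (lebesgue_on D)"
      by (rule borel_measurable_AE_lebesgue_on[OF borel_measurable_integrable[OF i] ae' Dm])
    show "AE x in lebesgue_on D. \<phi> x *\<^sub>R v' x = \<phi> x *\<^sub>R v x" using ae by eventually_elim simp
  qed
  ultimately show ?thesis using w test_function_directional[of D _ e] unfolding has_weak_partial_def by simp
qed

text \<open>A cutoff near the sphere splits \<open>K\<close> into a test function of the ball and one seen by \<open>bpart\<close>.\<close>

lemma weak_partial_Gauss_ball:
  fixes v :: "'a::euclidean_space \<Rightarrow> 'b::euclidean_space"
  assumes w: "has_weak_partial (ball 0 1) e v w" and b: "bpart r e v w g" and r: "0 < r" "r < 1"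
    and int: "integrable (lebesgue_on (ball 0 1)) v" "integrable (lebesgue_on (ball 0 1)) w" and K: "smooth K"
  shows "(LINT x|lebesgue_on (ball 0 1). frechet_derivative K (at x) e *\<^sub>R v x) + (LINT x|lebesgue_on (ball 0 1). K x *\<^sub>R w x) =
    (LINT x|sphere_measure. (K x * (x \<bullet> e)) *\<^sub>R g x)"
proof -
  \<comment> \<open>\<rho> and \<rho>' divide the interval from r to 1 into thirds.\<close>
  define \<rho> where "\<rho> = (2 * r + 1) / 3"
  define \<rho>' where "\<rho>' = (r + 2) / 3"
  have \<rho>: "0 \<le> \<rho>" "r < \<rho>" "\<rho> < \<rho>'" "\<rho>' < 1" using r by (auto simp: \<rho>_def \<rho>'_def)
  define \<eta> :: "'a \<Rightarrow> real" where "\<eta> = cutoff \<rho> \<rho>'"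
  have s\<eta>: "smooth \<eta>" unfolding \<eta>_def by (rule smooth_cutoff)
  define \<psi> where "\<psi> x = \<eta> x * K x" for x
  define \<phi> where "\<phi> x = (1 - \<eta> x) * K x" for x
  have s\<psi>: "smooth \<psi>" unfolding \<psi>_def by (intro smooth_intros s\<eta> K)
  have s\<phi>: "smooth \<phi>" unfolding \<phi>_def by (intro smooth_intros s\<eta> K)
  have ic: "inner_cut r \<psi>"
    unfolding inner_cut_def using s\<psi> \<rho> cutoff_eq_0[of \<rho> \<rho>'] by (auto simp: \<psi>_def \<eta>_def intro!: exI[of _ \<rho>])
  have t: "test_function (ball 0 1) \<phi>"
    unfolding test_function_def using s\<phi> \<rho> cutoff_eq_1[OF \<rho>(1,3) less_imp_le]
    by (auto simp: \<phi>_def \<eta>_def not_le intro!: exI[of _ "cball 0 \<rho>'"])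
  have KE: "K x = \<psi> x + \<phi> x" for x by (simp add: \<psi>_def \<phi>_def algebra_simps)
  have dK: "frechet_derivative K (at x) e = frechet_derivative \<psi> (at x) e + frechet_derivative \<phi> (at x) e" for x
  proof -
    have "(K has_derivative (\<lambda>h. frechet_derivative \<psi> (at x) h + frechet_derivative \<phi> (at x) h)) (at x)"
      unfolding KE[abs_def] by (intro has_derivative_add smooth_has_derivative s\<psi> s\<phi>)
    then show ?thesis by (simp add: frechet_derivative_eqI)
  qed
  have i: "integrable (lebesgue_on (ball 0 1)) (\<lambda>x. frechet_derivative \<psi> (at x) e *\<^sub>R v x)"
    "integrable (lebesgue_on (ball 0 1)) (\<lambda>x. frechet_derivative \<phi> (at x) e *\<^sub>R v x)"
    "integrable (lebesgue_on (ball 0 1)) (\<lambda>x. \<psi> x *\<^sub>R w x)"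
    "integrable (lebesgue_on (ball 0 1)) (\<lambda>x. \<phi> x *\<^sub>R w x)"
    by (intro smooth_scaleR_integrable smooth_directional s\<psi> s\<phi> int order_refl)+
  have 1: "(LINT x|lebesgue_on (ball 0 1). frechet_derivative \<phi> (at x) e *\<^sub>R v x) + (LINT x|lebesgue_on (ball 0 1). \<phi> x *\<^sub>R w x) = 0"
    using w t by (simp add: has_weak_partial_def)
  have 2: "(LINT x|lebesgue_on (ball 0 1). frechet_derivative \<psi> (at x) e *\<^sub>R v x) + (LINT x|lebesgue_on (ball 0 1). \<psi> x *\<^sub>R w x) =
    (LINT x|sphere_measure. (\<psi> x * (x \<bullet> e)) *\<^sub>R g x)"
  proof -
    have "(LINT x|lebesgue_on (annulus r). frechet_derivative \<psi> (at x) e *\<^sub>R v x) = (LINT x|lebesgue_on (ball 0 1). frechet_derivative \<psi> (at x) e *\<^sub>R v x)"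
      "(LINT x|lebesgue_on (annulus r). \<psi> x *\<^sub>R w x) = (LINT x|lebesgue_on (ball 0 1). \<psi> x *\<^sub>R w x)"
      by (intro LINT_annulus_eq_ball; simp add: inner_cut_derivative_eq_0[OF ic])+
    moreover have "(LINT x|lebesgue_on (annulus r). frechet_derivative \<psi> (at x) e *\<^sub>R v x) + (LINT x|lebesgue_on (annulus r). \<psi> x *\<^sub>R w x) =
      (LINT x|sphere_measure. (\<psi> x * (x \<bullet> e)) *\<^sub>R g x)"
      using b ic unfolding bpart_def by blast
    ultimately show ?thesis by simp
  qed
  have "(LINT x|sphere_measure. (\<psi> x * (x \<bullet> e)) *\<^sub>R g x) = (LINT x|sphere_measure. (K x * (x \<bullet> e)) *\<^sub>R g x)"
  proof (rule Bochner_Integration.integral_cong[OF refl])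
    fix x :: 'a assume "x \<in> space sphere_measure"
    then have "cutoff \<rho> \<rho>' x = 1" using \<rho>(4) by (intro cutoff_eq_1[OF \<rho>(1,3)]) (simp add: space_sphere_measure)
    then show "(\<psi> x * (x \<bullet> e)) *\<^sub>R g x = (K x * (x \<bullet> e)) *\<^sub>R g x" by (simp add: \<psi>_def \<eta>_def)
  qed
  moreover have "(LINT x|lebesgue_on (ball 0 1). frechet_derivative K (at x) e *\<^sub>R v x) =
      (LINT x|lebesgue_on (ball 0 1). frechet_derivative \<psi> (at x) e *\<^sub>R v x) + (LINT x|lebesgue_on (ball 0 1). frechet_derivative \<phi> (at x) e *\<^sub>R v x)"
    unfolding dK scaleR_add_left by (rule Bochner_Integration.integral_add[OF i(1,2)])
  moreover have "(LINT x|lebesgue_on (ball 0 1). K x *\<^sub>R w x) = (LINT x|lebesgue_on (ball 0 1). \<psi> x *\<^sub>R w x) + (LINT x|lebesgue_on (ball 0 1). \<phi> x *\<^sub>R w x)"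
    unfolding KE scaleR_add_left by (rule Bochner_Integration.integral_add[OF i(3,4)])
  moreover have ac: "(c + a) + (d + b) = (c + d) + (a + b)" for a b c d :: 'b by (simp add: algebra_simps)
  ultimately show ?thesis by (simp only: ac[of _ _ "LINT x|lebesgue_on (ball 0 1). \<psi> x *\<^sub>R w x"] 1 2 add_0_right)
qed

section \<open>The Kohn Laplacian as a first-order system\<close>

abbreviation "B4 \<equiv> ball (0::complex^2) 1"

text \<open>\<open>dbar_adj_form\<close> and \<open>dbar_form\<close> of \<open>u\<close>, written with fixed representatives \<open>d e\<close> of the weak
  derivatives of \<open>u\<close>.\<close>

definition adj_rep :: "(complex^2 \<Rightarrow> complex^2 \<Rightarrow> complex^2) \<Rightarrow> complex^2 \<Rightarrow> complex" where
  "adj_rep d z = - ((d (axis 1 1) z $ 1 - \<i> * d (axis 1 \<i>) z $ 1) + (d (axis 2 1) z $ 2 - \<i> * d (axis 2 \<i>) z $ 2))"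

definition dbar_rep :: "(complex^2 \<Rightarrow> complex^2 \<Rightarrow> complex^2) \<Rightarrow> complex^2 \<Rightarrow> complex" where
  "dbar_rep d z = (1/2) * ((d (axis 1 1) z $ 2 + \<i> * d (axis 1 \<i>) z $ 2) - (d (axis 2 1) z $ 1 + \<i> * d (axis 2 \<i>) z $ 1))"

lemma has_weak_partial_cmult:
  "open D \<Longrightarrow> has_weak_partial D e v w \<Longrightarrow> has_weak_partial D e (\<lambda>x. (c::complex) * v x) (\<lambda>x. c * w x)"
  by (rule has_weak_partial_linear[OF _ bounded_linear_mult_right])

lemma bpart_scale:
  "bpart r e v w g \<Longrightarrow> bpart r e (\<lambda>x. (c::complex) * v x) (\<lambda>x. c * w x) (\<lambda>x. c * g x)"
  by (rule bpart_linear[OF bounded_linear_mult_right])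

lemma has_weak_partial_nth:
  "open D \<Longrightarrow> has_weak_partial D e v w \<Longrightarrow> has_weak_partial D e (\<lambda>x. v x $ j :: complex) (\<lambda>x. w x $ j)"
  by (rule has_weak_partial_linear[OF _ bounded_linear_vec_nth])

lemma has_weak_partial_reps:
  assumes D: "open D" and w: "\<And>e. e \<in> Basis \<Longrightarrow> has_weak_partial D e' (d e) (dd e)"
  shows "has_weak_partial D e' (adj_rep d) (adj_rep dd)" "has_weak_partial D e' (dbar_rep d) (dbar_rep dd)"
proof -
  note n = has_weak_partial_nth[OF D w]
  have "has_weak_partial D e' (\<lambda>z. (-1) * ((d (axis 1 1) z $ 1 + (- \<i>) * d (axis 1 \<i>) z $ 1) + (d (axis 2 1) z $ 2 + (- \<i>) * d (axis 2 \<i>) z $ 2)))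
    (\<lambda>z. (-1) * ((dd (axis 1 1) z $ 1 + (- \<i>) * dd (axis 1 \<i>) z $ 1) + (dd (axis 2 1) z $ 2 + (- \<i>) * dd (axis 2 \<i>) z $ 2)))"
    by (intro has_weak_partial_add has_weak_partial_cmult D n) simp_all
  then show "has_weak_partial D e' (adj_rep d) (adj_rep dd)" by (simp add: adj_rep_def[abs_def])
  have "has_weak_partial D e' (\<lambda>z. (1/2) * ((d (axis 1 1) z $ 2 + \<i> * d (axis 1 \<i>) z $ 2) + (-1) * (d (axis 2 1) z $ 1 + \<i> * d (axis 2 \<i>) z $ 1)))
    (\<lambda>z. (1/2) * ((dd (axis 1 1) z $ 2 + \<i> * dd (axis 1 \<i>) z $ 2) + (-1) * (dd (axis 2 1) z $ 1 + \<i> * dd (axis 2 \<i>) z $ 1)))"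
    by (intro has_weak_partial_add has_weak_partial_cmult D n) simp_all
  then show "has_weak_partial D e' (dbar_rep d) (dbar_rep dd)" by (simp add: dbar_rep_def[abs_def] algebra_simps)
qed

lemma AE_adj_dbar_rep:
  assumes D: "open D" and w: "\<And>e. e \<in> Basis \<Longrightarrow> has_weak_partial D e u (d e)"
  shows "AE z in lebesgue_on D. dbar_adj_form D u z = adj_rep d z"
    "AE z in lebesgue_on D. dbar_form D u z = dbar_rep d z"
proof -
  have "AE z in lebesgue_on D. weak_partial D e (\<lambda>w. u w $ j) z = d e z $ j" if "e \<in> Basis" for e j
    using has_weak_partial_nth[OF D w[OF that], of j]
    by (intro has_weak_partial_AE_unique[OF D has_weak_partial_weak_partial])
  note ae = this[OF axis_complex_in_Basis(1)] this[OF axis_complex_in_Basis(2)]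
  show "AE z in lebesgue_on D. dbar_adj_form D u z = adj_rep d z"
    using ae(1)[of 1 1] ae(2)[of 1 1] ae(1)[of 2 2] ae(2)[of 2 2]
    by eventually_elim (simp add: dbar_adj_form_def weak_dz_def sum_2 adj_rep_def field_simps)
  show "AE z in lebesgue_on D. dbar_form D u z = dbar_rep d z"
    using ae(1)[of 1 2] ae(2)[of 1 2] ae(1)[of 2 1] ae(2)[of 2 1]
    by eventually_elim (simp add: dbar_form_def weak_dzbar_def dbar_rep_def field_simps)
qed

text \<open>\<open>kohn_box\<close> differentiates functions that are themselves built from chosen
  weak derivatives. Replacing the inner choices by \<open>d\<close> is an equality almost
  everywhere, which \<open>has_weak_partial_AE_cong\<close> carries through the outer
  derivative.\<close>

lemma AE_kohn_box:
  assumes D: "open D" and d: "\<And>e. e \<in> Basis \<Longrightarrow> has_weak_partial D e u (d e)"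
    and dd: "\<And>e e'. e \<in> Basis \<Longrightarrow> e' \<in> Basis \<Longrightarrow> has_weak_partial D e' (d e) (dd e e')"
  shows "AE z in lebesgue_on D. kohn_box D u z =
    vector [(adj_rep (\<lambda>e. dd e (axis 1 1)) z + \<i> * adj_rep (\<lambda>e. dd e (axis 1 \<i>)) z) +
              2 * (dbar_rep (\<lambda>e. dd e (axis 2 1)) z - \<i> * dbar_rep (\<lambda>e. dd e (axis 2 \<i>)) z),
            (adj_rep (\<lambda>e. dd e (axis 2 1)) z + \<i> * adj_rep (\<lambda>e. dd e (axis 2 \<i>)) z) -
              2 * (dbar_rep (\<lambda>e. dd e (axis 1 1)) z - \<i> * dbar_rep (\<lambda>e. dd e (axis 1 \<i>)) z)]"
proof -
  have "AE z in lebesgue_on D. dbar_adj_form D u z = adj_rep d z" "AE z in lebesgue_on D. dbar_form D u z = dbar_rep d z"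
    by (intro AE_adj_dbar_rep D d; assumption)+
  then have sym: "AE z in lebesgue_on D. adj_rep d z = dbar_adj_form D u z" "AE z in lebesgue_on D. dbar_rep d z = dbar_form D u z"
    by (simp_all add: eq_commute)
  have A: "AE z in lebesgue_on D. weak_partial D e (dbar_adj_form D u) z = adj_rep (\<lambda>e'. dd e' e) z" if "e \<in> Basis" for e
  proof -
    have "has_weak_partial D e (adj_rep d) (adj_rep (\<lambda>e'. dd e' e))"
      by (rule has_weak_partial_reps(1)[OF D]) (rule dd[OF _ that])
    then have "has_weak_partial D e (dbar_adj_form D u) (adj_rep (\<lambda>e'. dd e' e))"
      by (rule has_weak_partial_AE_cong[OF _ D sym(1)])
    then show ?thesis by (intro has_weak_partial_AE_unique[OF D has_weak_partial_weak_partial])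
  qed
  have Q: "AE z in lebesgue_on D. weak_partial D e (dbar_form D u) z = dbar_rep (\<lambda>e'. dd e' e) z" if "e \<in> Basis" for e
  proof -
    have "has_weak_partial D e (dbar_rep d) (dbar_rep (\<lambda>e'. dd e' e))"
      by (rule has_weak_partial_reps(2)[OF D]) (rule dd[OF _ that])
    then have "has_weak_partial D e (dbar_form D u) (dbar_rep (\<lambda>e'. dd e' e))"
      by (rule has_weak_partial_AE_cong[OF _ D sym(2)])
    then show ?thesis by (intro has_weak_partial_AE_unique[OF D has_weak_partial_weak_partial])
  qed
  show ?thesis
    using A[OF axis_complex_in_Basis(1)[of 1]] A[OF axis_complex_in_Basis(2)[of 1]] A[OF axis_complex_in_Basis(1)[of 2]] A[OF axis_complex_in_Basis(2)[of 2]]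
      Q[OF axis_complex_in_Basis(1)[of 1]] Q[OF axis_complex_in_Basis(2)[of 1]] Q[OF axis_complex_in_Basis(1)[of 2]] Q[OF axis_complex_in_Basis(2)[of 2]]
    by eventually_elim
      (simp add: kohn_box_def dbar_fun_def dbar_adj_form2_def weak_dz_def weak_dzbar_def vec_eq_iff forall_2 scaleR_conv_of_real[where 'a=complex] algebra_simps add_divide_distrib diff_divide_distrib)
qed

text \<open>The product rule for \<open>u\<^sub>1 \<omega>\<^sub>L + u\<^sub>2 \<omega>\<^sub>N\<close>, with \<open>a\<^sub>i e\<close> in place of \<open>D\<^sub>e u\<^sub>i\<close>. Its point is that \<open>adj_rep\<close> and
  \<open>dbar_rep\<close> are, up to constants, the components of the conormal derivative.\<close>

definition frame_d :: "(complex^2 \<Rightarrow> complex) \<Rightarrow> (complex^2 \<Rightarrow> complex) \<Rightarrow> (complex^2 \<Rightarrow> complex^2 \<Rightarrow> complex) \<Rightarrow>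
    (complex^2 \<Rightarrow> complex^2 \<Rightarrow> complex) \<Rightarrow> complex^2 \<Rightarrow> complex^2 \<Rightarrow> complex^2" where
  "frame_d u1 u2 a1 a2 e z = (let q = complex_of_real (1 / norm z); t = complex_of_real ((1 / norm z) ^ 3 * (z \<bullet> e)) in
     vector [((q * cnj (e $ 2) - t * cnj (z $ 2)) * u1 z + cnj (z $ 2) / norm z * a1 e z) +
             ((q * e $ 1 - t * z $ 1) * u2 z + z $ 1 / norm z * a2 e z),
             (-1) * ((q * cnj (e $ 1) - t * cnj (z $ 1)) * u1 z + cnj (z $ 1) / norm z * a1 e z) +
             ((q * e $ 2 - t * z $ 2) * u2 z + z $ 2 / norm z * a2 e z)])"

text \<open>The frame coefficients are linear functions divided by |z|, so
  \<open>bpart_cmult\<close> applies to each of them. The zero boundary values of \<open>u1\<close>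
  and \<open>u2\<close> are inherited by the coefficients of \<open>u\<close>.\<close>

lemma bpart_frame:
  assumes b1: "bpart r e u1 (a1 e) (\<lambda>_. 0)" and b2: "bpart r e u2 (a2 e) (\<lambda>_. 0)" and r: "0 < r"
    and fr: "\<And>z. z \<in> annulus r \<Longrightarrow> u z = u1 z *s omega_Lbar z + u2 z *s omega_Nbar z"
  shows "bpart r e (\<lambda>z. u z $ j) (\<lambda>z. frame_d u1 u2 a1 a2 e z $ j) (\<lambda>_. 0)"
proof -
  note m = bpart_cmult[OF _ smooth_on_normalized_linear(1) r smooth_on_normalized_linear(2)]
  note c1 = m[OF b1 bounded_linear_cnj_nth bounded_linear_cnj_nth] and c2 = m[OF b2 bounded_linear_nth bounded_linear_nth]
  consider "j = 1" | "j = 2" using exhaust_2 by auto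
  then show ?thesis
  proof cases
    case 1
    show ?thesis unfolding 1
      by (rule bpart_cong[OF bpart_add[OF c1[of 2] c2[of 1]]])
        (simp_all add: fr omega_Lbar_def omega_Nbar_def dzbar_def axis_def frame_d_def Let_def mult.commute)
  next
    case 2
    show ?thesis unfolding 2
      by (rule bpart_cong[OF bpart_add[OF bpart_scale[OF c1[of 1], of "-1"] c2[of 2]]])
        (simp_all add: fr omega_Lbar_def omega_Nbar_def dzbar_def axis_def frame_d_def Let_def mult.commute)
  qed
qed

text \<open>The first-order parts match term by term. Differentiating the frame coefficients
  contributes 4/|z| from the linear numerators and -|z|^2/|z|^3 from the factor 1/|z|, in total
  3/|z|. This is the zero-order coefficient of the conormal derivative, as 4 (L,[L,N]) =
  3/|z|.\<close>

lemma frame_conormal: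
  assumes z: "z \<in> annulus r" "0 < r"
    and a1: "\<And>e. e \<in> Basis \<Longrightarrow> weak_partial D e u1 z = a1 e z" and a2: "\<And>e. e \<in> Basis \<Longrightarrow> weak_partial D e u2 z = a2 e z"
  shows "adj_rep (frame_d u1 u2 a1 a2) z = - conormal D u1 u2 z $ 2"
    and "dbar_rep (frame_d u1 u2 a1 a2) z = - (1/2) * conormal D u1 u2 z $ 1"
proof -
  have z0: "z \<noteq> 0" using z by (auto simp: annulus_def)
  define q where "q = complex_of_real (1 / norm z)"
  have q: "q * q * (z $ 1 * cnj (z $ 1) + z $ 2 * cnj (z $ 2)) = 1"
    unfolding norm_sq_complex2[symmetric] q_def using z0 by (simp add: power2_eq_square flip: of_real_mult)
  have t: "complex_of_real ((1 / norm z) ^ 3 * s) = q * q * q * complex_of_real s" for s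
    by (simp add: q_def power3_eq_cube)
  have dv: "x / complex_of_real (norm z) = q * x" for x by (simp add: q_def)
  have cq: "cnj q = q" by (simp add: q_def)
  have f1: "field_inner (L_field z) (lie_bracket L_field N_field z) = (3 / 4) * q" "field_inner (lie_bracket L_field N_field z) (L_field z) = (3 / 4) * q"
    unfolding field_inner_lie[OF z0] by (simp_all add: q_def)
  have c: "cnj (z $ j) = complex_of_real (Re (z $ j)) - \<i> * complex_of_real (Im (z $ j))" "z $ j = complex_of_real (Re (z $ j)) + \<i> * complex_of_real (Im (z $ j))" for j
    by (simp_all add: complex_eq_iff)
  note wp = a1[OF axis_complex_in_Basis(1)] a1[OF axis_complex_in_Basis(2)] a2[OF axis_complex_in_Basis(1)] a2[OF axis_complex_in_Basis(2)]
  have con2: "conormal D u1 u2 z $ 2 = q * (cnj (z $ 2) * (a1 (axis 1 1) z - \<i> * a1 (axis 1 \<i>) z) - cnj (z $ 1) * (a1 (axis 2 1) z - \<i> * a1 (axis 2 \<i>) z))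
     + q * (z $ 1 * (a2 (axis 1 1) z - \<i> * a2 (axis 1 \<i>) z) + z $ 2 * (a2 (axis 2 1) z - \<i> * a2 (axis 2 \<i>) z)) + 3 * q * u2 z"
    unfolding conormal_def f1
    by (simp add: field_deriv_def sum_2 weak_dz_def wp L_field_def N_field_def dv cq scaleR_conv_of_real[where 'a=complex])
      (simp add: field_simps)
  have con1: "conormal D u1 u2 z $ 1 = q * (cnj (z $ 1) * (a1 (axis 1 1) z + \<i> * a1 (axis 1 \<i>) z) + cnj (z $ 2) * (a1 (axis 2 1) z + \<i> * a1 (axis 2 \<i>) z))
     - q * (z $ 2 * (a2 (axis 1 1) z + \<i> * a2 (axis 1 \<i>) z) - z $ 1 * (a2 (axis 2 1) z + \<i> * a2 (axis 2 \<i>) z)) + 3 * q * u1 z"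
    unfolding conormal_def f1
    by (simp add: field_deriv_bar_def sum_2 weak_dzbar_def wp L_field_def N_field_def dv cq scaleR_conv_of_real[where 'a=complex])
      (simp add: field_simps)
  define X where "X j = complex_of_real (Re (z $ j))" for j
  define Y where "Y j = complex_of_real (Im (z $ j))" for j
  have cz: "cnj (z $ j) = X j - \<i> * Y j" "z $ j = X j + \<i> * Y j" for j unfolding X_def Y_def by (rule c)+
  have cX: "cnj (X j) = X j" "cnj (Y j) = Y j" for j by (simp_all add: X_def Y_def)
  have q1: "q * (q * q) * (X 1 * X 1 + Y 1 * Y 1 + X 2 * X 2 + Y 2 * Y 2) = q"
  proof -
    have "q * q * (X 1 * X 1 + Y 1 * Y 1 + X 2 * X 2 + Y 2 * Y 2) = 1" using q unfolding cz by (simp add: cX algebra_simps)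
    then show ?thesis by (simp add: mult.assoc)
  qed
  have fd: "frame_d u1 u2 a1 a2 (axis j c) z = vector
      [((q * cnj (axis j c $ 2) - q * q * q * complex_of_real (z \<bullet> axis j c) * cnj (z $ 2)) * u1 z + q * cnj (z $ 2) * a1 (axis j c) z) +
             ((q * axis j c $ 1 - q * q * q * complex_of_real (z \<bullet> axis j c) * z $ 1) * u2 z + q * z $ 1 * a2 (axis j c) z),
       (-1) * ((q * cnj (axis j c $ 1) - q * q * q * complex_of_real (z \<bullet> axis j c) * cnj (z $ 1)) * u1 z + q * cnj (z $ 1) * a1 (axis j c) z) +
             ((q * axis j c $ 2 - q * q * q * complex_of_real (z \<bullet> axis j c) * z $ 2) * u2 z + q * z $ 2 * a2 (axis j c) z)]" for j c
    unfolding frame_d_def Let_def t dv q_def[symmetric] by simp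
  have "adj_rep (frame_d u1 u2 a1 a2) z = - (q * (cnj (z $ 2) * (a1 (axis 1 1) z - \<i> * a1 (axis 1 \<i>) z) - cnj (z $ 1) * (a1 (axis 2 1) z - \<i> * a1 (axis 2 \<i>) z))
     + q * (z $ 1 * (a2 (axis 1 1) z - \<i> * a2 (axis 1 \<i>) z) + z $ 2 * (a2 (axis 2 1) z - \<i> * a2 (axis 2 \<i>) z)) + (4 * q - q * (q * q) * (X 1 * X 1 + Y 1 * Y 1 + X 2 * X 2 + Y 2 * Y 2)) * u2 z)"
    unfolding adj_rep_def fd inner_axis_complex X_def[symmetric] Y_def[symmetric] unfolding cz by (simp add: axis_def cX algebra_simps)
  then show "adj_rep (frame_d u1 u2 a1 a2) z = - conormal D u1 u2 z $ 2" unfolding con2 q1 by simp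
  have "dbar_rep (frame_d u1 u2 a1 a2) z = - (1/2) * (q * (cnj (z $ 1) * (a1 (axis 1 1) z + \<i> * a1 (axis 1 \<i>) z) + cnj (z $ 2) * (a1 (axis 2 1) z + \<i> * a1 (axis 2 \<i>) z))
     - q * (z $ 2 * (a2 (axis 1 1) z + \<i> * a2 (axis 1 \<i>) z) - z $ 1 * (a2 (axis 2 1) z + \<i> * a2 (axis 2 \<i>) z)) + (4 * q - q * (q * q) * (X 1 * X 1 + Y 1 * Y 1 + X 2 * X 2 + Y 2 * Y 2)) * u1 z)"
    unfolding dbar_rep_def fd inner_axis_complex X_def[symmetric] Y_def[symmetric] unfolding cz by (simp add: axis_def cX algebra_simps)
  then show "dbar_rep (frame_d u1 u2 a1 a2) z = - (1/2) * conormal D u1 u2 z $ 1" unfolding con1 q1 by simp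
qed

section \<open>Tangential derivatives of functions with zero trace\<close>

lemma bpartD:
  "bpart r e v w g \<Longrightarrow> inner_cut r \<psi> \<Longrightarrow>
    (LINT x|lebesgue_on (annulus r). frechet_derivative \<psi> (at x) e *\<^sub>R v x) + (LINT x|lebesgue_on (annulus r). \<psi> x *\<^sub>R w x) =
    (LINT x|sphere_measure. (\<psi> x * (x \<bullet> e)) *\<^sub>R g x)"
  unfolding bpart_def by blast

lemma has_derivative_radial:
  fixes x :: "'a::euclidean_space"
  assumes "(G has_real_derivative G') (at (x \<bullet> x))"
  shows "((\<lambda>x. G (x \<bullet> x)) has_derivative (\<lambda>h. 2 * G' * (x \<bullet> h))) (at x)"
proof -
  have "((\<lambda>x. x \<bullet> x) has_derivative (\<lambda>h. 2 * (x \<bullet> h))) (at x)"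
    by (rule derivative_eq_intros refl)+ (simp add: inner_commute)
  from has_derivative_compose[OF this assms[unfolded has_field_derivative_def]]
  show ?thesis by (rule has_derivative_eq_rhs) (simp add: mult_ac)
qed

lemma smooth_has_real_derivative:
  fixes g :: "real \<Rightarrow> real"
  assumes "smooth g"
  shows "(g has_real_derivative frechet_derivative g (at s) 1) (at s)"
proof -
  have "frechet_derivative g (at s) t = frechet_derivative g (at s) 1 * t" for t
    using linear_scale[OF has_derivative_linear[OF smooth_has_derivative[OF assms, of s]], of t 1] by simp
  then have "frechet_derivative g (at s) = (*) (frechet_derivative g (at s) 1)" by (rule ext)
  then show ?thesis unfolding has_field_derivative_def
    by (rule has_derivative_eq_rhs[OF smooth_has_derivative[OF assms]])
qed

lemma smooth_inner_self_compose:
  fixes g :: "real \<Rightarrow> real"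
  shows "smooth g \<Longrightarrow> smooth (\<lambda>x::'a::euclidean_space. g (x \<bullet> x))"
  using smooth_compose_real[of g "\<lambda>x::'a. x \<bullet> x"] smooth_inner[OF smooth_ident smooth_ident] by simp

text \<open>A tangential derivative of a function with zero trace has mean zero over the sphere: pairing with the
  radial functions \<open>\<eta> |x|\<^sup>2\<^sup>m\<close>, whose mass inside the ball disappears in the limit.\<close>

lemma tangential_trace_eq_0:
  fixes v w :: "complex^2 \<Rightarrow> complex"
  assumes r: "0 < r" "r < 1"
    and bw: "\<And>e. e \<in> Basis \<Longrightarrow> bpart r e w (we e) (\<lambda>_. \<kappa>)"
    and ba: "\<And>e. e \<in> Basis \<Longrightarrow> bpart r e v (a e) (\<lambda>_. 0)"
    and w: "\<And>z. z \<in> annulus r \<Longrightarrow> w z = (1 / norm z) *\<^sub>R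
        (z $ 2 * (a (axis 1 1) z + \<i> * a (axis 1 \<i>) z) - z $ 1 * (a (axis 2 1) z + \<i> * a (axis 2 \<i>) z))"
  shows "\<kappa> = 0"
proof -
  let ?D = "annulus r :: (complex^2) set"
  interpret D: finite_measure "lebesgue_on ?D" by (rule finite_measure_annulus)
  have e0: "axis 1 1 \<in> (Basis :: (complex^2) set)" by simp
  define \<rho> where "\<rho> = (r + 1) / 2"
  have \<rho>: "r < \<rho>" "0 < \<rho>" "\<rho> < 1" using r by (auto simp: \<rho>_def)
  \<comment> \<open>A profile in s = |x|^2: zero up to the radius \<rho>, equal to 1 on the sphere,
    and bounded by s^m.\<close>
  define g where "g m s = smooth_step ((s - \<rho>\<^sup>2) * (1 / (1 - \<rho>\<^sup>2))) * s ^ m" for m :: nat and s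
  have sg: "smooth (g m)" for m
  proof -
    have "smooth (\<lambda>s. smooth_step ((s - \<rho>\<^sup>2) * (1 / (1 - \<rho>\<^sup>2))))"
      by (rule smooth_compose_real[of smooth_step])
        (simp add: smooth_iff_cd_on[of smooth_step] cd_on_smooth_step, intro smooth_intros)
    then show ?thesis unfolding g_def by (intro smooth_intros)
  qed
  have \<rho>2: "\<rho>\<^sup>2 < 1" using \<rho> by (simp add: power_less_one_iff abs_square_less_1)
  have g0: "g m s = 0" if "s \<le> \<rho>\<^sup>2" for m s
  proof -
    have "(s - \<rho>\<^sup>2) * (1 / (1 - \<rho>\<^sup>2)) \<le> 0" using that \<rho>2 by (intro mult_nonpos_nonneg) simp_all
    then show ?thesis unfolding g_def by (simp only: smooth_step_0 mult_zero_left)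
  qed
  have g1: "g m 1 = 1" for m
  proof -
    have "(1 - \<rho>\<^sup>2) * (1 / (1 - \<rho>\<^sup>2)) = 1" using \<rho>2 by simp
    then show ?thesis unfolding g_def by (simp only: smooth_step_1[OF order_refl] power_one mult_1)
  qed
  have gb: "\<bar>g m s\<bar> \<le> s ^ m" if "0 \<le> s" for m s
  proof -
    have "\<bar>g m s\<bar> = smooth_step ((s - \<rho>\<^sup>2) * (1 / (1 - \<rho>\<^sup>2))) * s ^ m"
      unfolding g_def using that smooth_step_bounds(1) by (intro abs_of_nonneg mult_nonneg_nonneg zero_le_power)
    also have "\<dots> \<le> 1 * s ^ m" using that by (intro mult_right_mono smooth_step_bounds(2) zero_le_power)
    finally show ?thesis by simp
  qed
  define \<eta> where "\<eta> m x = g m (x \<bullet> x)" for m and x :: "complex^2"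
  define g' where "g' m s = frechet_derivative (g m) (at s) 1" for m s
  have dg: "(g m has_real_derivative g' m s) (at s)" for m s
    unfolding g'_def by (rule smooth_has_real_derivative[OF sg])
  have sg': "smooth (g' m)" for m unfolding g'_def by (rule smooth_directional[OF sg])
  \<comment> \<open>At s = |x|^2 the value 2 s g'(s) is the derivative of \<open>\<eta> m\<close> at
    x in direction x.\<close>
  define T where "T m s = 2 * s * g' m s" for m s
  have sT: "smooth (T m)" for m unfolding T_def by (intro smooth_intros sg')
  define T' where "T' m s = frechet_derivative (T m) (at s) 1" for m s
  have dT: "(T m has_real_derivative T' m s) (at s)" for m s
    unfolding T'_def by (rule smooth_has_real_derivative[OF sT])
  define \<theta> where "\<theta> m x = T m (x \<bullet> x)" for m and x :: "complex^2"
  have in\<rho>: "x \<bullet> x \<le> \<rho>\<^sup>2 \<longleftrightarrow> norm x \<le> \<rho>" for x :: "complex^2"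
    using \<rho> by (simp add: dot_square_norm abs_le_square_iff[symmetric])
  have ic\<eta>: "inner_cut r (\<eta> m)" for m
  proof -
    have "\<eta> m = (\<lambda>x. g m (x \<bullet> x))" by (simp add: \<eta>_def fun_eq_iff)
    then have "smooth (\<eta> m)" using smooth_inner_self_compose[OF sg] by simp
    moreover have "\<eta> m x = 0" if "norm x \<le> \<rho>" for x using g0 in\<rho> that by (simp add: \<eta>_def)
    ultimately show ?thesis unfolding inner_cut_def using \<rho>(1) by blast
  qed
  have \<eta>d: "frechet_derivative (\<eta> m) (at x) h = 2 * g' m (x \<bullet> x) * (x \<bullet> h)" for m x h
  proof -
    have "\<eta> m = (\<lambda>x. g m (x \<bullet> x))" by (simp add: \<eta>_def fun_eq_iff)
    then have "(\<eta> m has_derivative (\<lambda>h. 2 * g' m (x \<bullet> x) * (x \<bullet> h))) (at x)"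
      using has_derivative_radial[OF dg] by (simp only:)
    from frechet_derivative_eqI[OF this] show ?thesis by simp
  qed
  have T0: "T m s = 0" if "s < \<rho>\<^sup>2" for m s
  proof -
    have "(g m has_real_derivative 0) (at s)"
      by (rule has_field_derivative_transform_within_open[of "\<lambda>_. 0" 0 _ "{..<\<rho>\<^sup>2}"]) (use that g0 in auto)
    then have "g' m s = 0" using dg DERIV_unique by blast
    then show ?thesis by (simp add: T_def)
  qed
  have ic\<theta>: "inner_cut r (\<theta> m)" for m
  proof -
    have "\<theta> m x = 0" if "norm x \<le> (r + \<rho>) / 2" for x
    proof -
      have "norm x < \<rho>" using that \<rho> by simp
      then have "x \<bullet> x < \<rho>\<^sup>2" using \<rho> by (simp add: dot_square_norm power_strict_mono)
      then show ?thesis by (simp add: \<theta>_def T0)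
    qed
    moreover have "r < (r + \<rho>) / 2" using \<rho> by simp
    moreover have "smooth (\<theta> m)"
    proof -
      have "\<theta> m = (\<lambda>x. T m (x \<bullet> x))" by (simp add: \<theta>_def fun_eq_iff)
      then show ?thesis using smooth_inner_self_compose[OF sT] by simp
    qed
    ultimately show ?thesis unfolding inner_cut_def by blast
  qed
  \<comment> \<open>Absorbs the factor 1/|z| in the hypothesis on \<open>w\<close>, so that only
    linear coefficients remain in front of the derivatives of v.\<close>
  define P where "P m x = (1 / norm x) * \<theta> m x" for m and x :: "complex^2"
  have icP: "inner_cut r (P m)" for m
  proof -
    have "P m = (\<lambda>x. (1 / norm x) * \<theta> m x)" by (simp add: P_def fun_eq_iff)
    then show ?thesis using inner_cut_mult[OF smooth_on_inverse_norm ic\<theta> less_imp_le[OF r(1)]] by (simp only:)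
  qed
  have sP: "smooth (P m)" for m using icP by (simp add: inner_cut_def)
  define \<tau> where "\<tau> m x = (1 / norm x) * (2 * T' m (x \<bullet> x)) - (1 / norm x) ^ 3 * T m (x \<bullet> x)" for m and x :: "complex^2"
  have Pd: "frechet_derivative (P m) (at x) h = \<tau> m x * (x \<bullet> h)" if "x \<noteq> 0" for m x h
  proof -
    have "P m = (\<lambda>x. (1 / norm x) * T m (x \<bullet> x))" by (simp add: P_def \<theta>_def fun_eq_iff)
    then have "(P m has_derivative (\<lambda>h. 1 / norm x * (2 * T' m (x \<bullet> x) * (x \<bullet> h)) + - ((1 / norm x) ^ 3 * (x \<bullet> h)) * T m (x \<bullet> x))) (at x)"
      using has_derivative_mult[OF has_derivative_inverse_norm[OF that] has_derivative_radial[OF dT]] by (simp only:)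
    from frechet_derivative_eqI[OF this] show ?thesis by (simp add: \<tau>_def left_diff_distrib)
  qed
  have icc: "inner_cut r (\<lambda>x. P m x * (x \<bullet> b))" for m b
    using icP[of m] unfolding inner_cut_def by (auto intro!: smooth_intros)
  \<comment> \<open>Symmetric in e and b, because \<open>P m\<close> is radial. The operator in the
    hypothesis on \<open>w\<close> combines these integrals with antisymmetric coefficients, so that
    they cancel.\<close>
  define J where "J m e b = (LINT x|lebesgue_on ?D. (\<tau> m x * (x \<bullet> e) * (x \<bullet> b)) *\<^sub>R v x)" for m e b
  \<comment> \<open>Only orthogonal pairs e, b occur, so x \<bullet> b has derivative zero along e
    and only the radial factor is differentiated.\<close>
  have I: "(LINT x|lebesgue_on ?D. (P m x * (x \<bullet> b)) *\<^sub>R a e x) = - J m e b" if e: "e \<in> Basis" and eb: "e \<bullet> b = 0" for m e b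
  proof -
    have "(LINT x|lebesgue_on ?D. frechet_derivative (\<lambda>x. P m x * (x \<bullet> b)) (at x) e *\<^sub>R v x) + (LINT x|lebesgue_on ?D. (P m x * (x \<bullet> b)) *\<^sub>R a e x) = 0"
      using ba[OF e] icc unfolding bpart_def by fastforce
    moreover have "(LINT x|lebesgue_on ?D. frechet_derivative (\<lambda>x. P m x * (x \<bullet> b)) (at x) e *\<^sub>R v x) = J m e b"
      unfolding J_def
    proof (rule Bochner_Integration.integral_cong[OF refl])
      fix x assume "x \<in> space (lebesgue_on ?D)"
      then have x: "x \<noteq> 0" using r by (auto simp: annulus_def)
      have "((\<lambda>x. x \<bullet> b) has_derivative (\<lambda>h. h \<bullet> b)) (at x)" by (rule derivative_eq_intros refl | simp)+
      from frechet_derivative_eqI[OF has_derivative_mult[OF smooth_has_derivative[OF sP] this]]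
      show "frechet_derivative (\<lambda>x. P m x * (x \<bullet> b)) (at x) e *\<^sub>R v x = (\<tau> m x * (x \<bullet> e) * (x \<bullet> b)) *\<^sub>R v x"
        by (simp add: Pd[OF x] eb)
    qed
    ultimately show ?thesis by (simp add: eq_neg_iff_add_eq_0 add.commute)
  qed
  have ai: "integrable (lebesgue_on ?D) (a e)" if "e \<in> Basis" for e using ba[OF that] by (simp add: bpart_def)
  have wi: "integrable (lebesgue_on ?D) w" using bw[OF e0] by (simp add: bpart_def)
  have Pi: "integrable (lebesgue_on ?D) (\<lambda>x. (P m x * (x \<bullet> b)) *\<^sub>R a e x)" if "e \<in> Basis" for m b e
    using icc unfolding inner_cut_def by (intro smooth_scaleR_integrable[OF _ ai[OF that]] annulus_subset_ball) auto
  have w\<theta>: "(LINT x|lebesgue_on ?D. \<theta> m x *\<^sub>R w x) = 0" for m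
  proof -
    have ip: "axis 1 c \<bullet> (axis 2 d :: complex^2) = 0" "axis 2 c \<bullet> (axis 1 d :: complex^2) = 0" for c d
      by (simp_all add: inner_axis_axis)
    let ?R = "\<lambda>e b x. (P m x * (x \<bullet> b)) *\<^sub>R a e x"
    have "(LINT x|lebesgue_on ?D. \<theta> m x *\<^sub>R w x) = (LINT x|lebesgue_on ?D.
        ((?R (axis 1 1) (axis 2 1) x + \<i> * ?R (axis 1 1) (axis 2 \<i>) x) + (\<i> * ?R (axis 1 \<i>) (axis 2 1) x + (-1) * ?R (axis 1 \<i>) (axis 2 \<i>) x)) +
        (((-1) * ?R (axis 2 1) (axis 1 1) x + (- \<i>) * ?R (axis 2 1) (axis 1 \<i>) x) + ((- \<i>) * ?R (axis 2 \<i>) (axis 1 1) x + ?R (axis 2 \<i>) (axis 1 \<i>) x)))"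
    proof (rule Bochner_Integration.integral_cong[OF refl])
      fix x assume "x \<in> space (lebesgue_on ?D)"
      then have x: "x \<in> ?D" by simp
      have zz: "x $ j = complex_of_real (Re (x $ j)) + \<i> * complex_of_real (Im (x $ j))" for j by (rule complex_eq)
      have "\<theta> m x *\<^sub>R w x = complex_of_real (P m x) *
        ((complex_of_real (Re (x $ 2)) + \<i> * complex_of_real (Im (x $ 2))) * (a (axis 1 1) x + \<i> * a (axis 1 \<i>) x) -
         (complex_of_real (Re (x $ 1)) + \<i> * complex_of_real (Im (x $ 1))) * (a (axis 2 1) x + \<i> * a (axis 2 \<i>) x))"
        unfolding w[OF x] zz[symmetric] by (simp add: P_def scaleR_conv_of_real)
      then show "\<theta> m x *\<^sub>R w x = ((?R (axis 1 1) (axis 2 1) x + \<i> * ?R (axis 1 1) (axis 2 \<i>) x) + (\<i> * ?R (axis 1 \<i>) (axis 2 1) x + (-1) * ?R (axis 1 \<i>) (axis 2 \<i>) x)) +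
        (((-1) * ?R (axis 2 1) (axis 1 1) x + (- \<i>) * ?R (axis 2 1) (axis 1 \<i>) x) + ((- \<i>) * ?R (axis 2 \<i>) (axis 1 1) x + ?R (axis 2 \<i>) (axis 1 \<i>) x))"
        by (simp add: scaleR_conv_of_real algebra_simps)
    qed
    also have "\<dots> = ((- J m (axis 1 1) (axis 2 1) + \<i> * (- J m (axis 1 1) (axis 2 \<i>))) + (\<i> * (- J m (axis 1 \<i>) (axis 2 1)) + (-1) * (- J m (axis 1 \<i>) (axis 2 \<i>)))) +
        (((-1) * (- J m (axis 2 1) (axis 1 1)) + (- \<i>) * (- J m (axis 2 1) (axis 1 \<i>))) + ((- \<i>) * (- J m (axis 2 \<i>) (axis 1 1)) + (- J m (axis 2 \<i>) (axis 1 \<i>))))"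
      by (simp only: Bochner_Integration.integral_add Bochner_Integration.integrable_add integrable_mult_right Pi axis_complex_in_Basis
          integral_mult_right_zero I ip)
    also have "\<dots> = 0"
    proof -
      have sym: "J m e b = J m b e" for e b
        unfolding J_def by (rule Bochner_Integration.integral_cong[OF refl]) (simp only: mult.assoc mult.commute[of "_ \<bullet> e"])
      show ?thesis
        by (simp add: sym[of "axis 2 1" "axis 1 1"] sym[of "axis 2 1" "axis 1 \<i>"] sym[of "axis 2 \<i>" "axis 1 1"] sym[of "axis 2 \<i>" "axis 1 \<i>"])
    qed
    finally show ?thesis .
  qed
  \<comment> \<open>The divergence of x w(x). Summed over e, the identities against \<eta> (x
    \<bullet> e) give the integrals of \<eta> F and of \<theta> w on one side and \<kappa> times the
    area of the sphere on the other; the \<theta> term is zero by \<open>w\<theta>\<close>.\<close>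
  define F where "F x = real DIM(complex^2) *\<^sub>R w x + (\<Sum>e\<in>Basis. (x \<bullet> e) *\<^sub>R we e x)" for x
  have wei: "integrable (lebesgue_on ?D) (we e)" if "e \<in> Basis" for e using bw[OF that] by (simp add: bpart_def)
  have s\<eta>: "smooth (\<eta> m)" "smooth (\<theta> m)" for m using ic\<eta> ic\<theta> by (auto simp: inner_cut_def)
  have Fi: "integrable (lebesgue_on ?D) F"
    unfolding F_def
    by (intro Bochner_Integration.integrable_add Bochner_Integration.integrable_sum integrable_scaleR_right wi
        smooth_scaleR_integrable[OF smooth_inner_e wei annulus_subset_ball])
  have main: "(LINT x|lebesgue_on ?D. \<eta> m x *\<^sub>R F x) = (measure sphere_measure (space (sphere_measure :: (complex^2) measure))) *\<^sub>R \<kappa>" for m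
  proof -
    have ice: "inner_cut r (\<lambda>x. \<eta> m x * (x \<bullet> e))" for e
      using ic\<eta>[of m] unfolding inner_cut_def by (auto intro!: smooth_intros)
    have ei: "integrable (lebesgue_on ?D) (\<lambda>x. (2 * g' m (x \<bullet> x) * (x \<bullet> e) * (x \<bullet> e) + \<eta> m x * (e \<bullet> e)) *\<^sub>R w x)" for e
      by (intro smooth_scaleR_integrable wi annulus_subset_ball smooth_intros s\<eta> smooth_inner_self_compose sg')
    have fi: "integrable (lebesgue_on ?D) (\<lambda>x. (\<eta> m x * (x \<bullet> e)) *\<^sub>R we e x)" if "e \<in> Basis" for e
      by (intro smooth_scaleR_integrable wei that annulus_subset_ball smooth_intros s\<eta>)
    have gi: "integrable sphere_measure (\<lambda>x. (\<eta> m x * (x \<bullet> e) * (x \<bullet> e)) *\<^sub>R \<kappa>)" for e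
      by (intro smooth_scaleR_integrable_sphere smooth_intros s\<eta>) simp
    have one: "(LINT x|lebesgue_on ?D. (2 * g' m (x \<bullet> x) * (x \<bullet> e) * (x \<bullet> e) + \<eta> m x * (e \<bullet> e)) *\<^sub>R w x) + (LINT x|lebesgue_on ?D. (\<eta> m x * (x \<bullet> e)) *\<^sub>R we e x)
       = (LINT x|sphere_measure. (\<eta> m x * (x \<bullet> e) * (x \<bullet> e)) *\<^sub>R \<kappa>)" if "e \<in> Basis" for e
    proof -
      have "((\<lambda>x. x \<bullet> e) has_derivative (\<lambda>h. h \<bullet> e)) (at x)" for x by (rule derivative_eq_intros refl | simp)+
      from frechet_derivative_eqI[OF has_derivative_mult[OF smooth_has_derivative[OF s\<eta>(1)] this]]
      have "frechet_derivative (\<lambda>x. \<eta> m x * (x \<bullet> e)) (at x) e = 2 * g' m (x \<bullet> x) * (x \<bullet> e) * (x \<bullet> e) + \<eta> m x * (e \<bullet> e)" for x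
        by (simp add: \<eta>d)
      then show ?thesis using bpartD[OF bw[OF that] ice[of e]] by (simp only:)
    qed
    have sums: "(\<Sum>e\<in>Basis. (LINT x|lebesgue_on ?D. (2 * g' m (x \<bullet> x) * (x \<bullet> e) * (x \<bullet> e) + \<eta> m x * (e \<bullet> e)) *\<^sub>R w x) + (LINT x|lebesgue_on ?D. (\<eta> m x * (x \<bullet> e)) *\<^sub>R we e x))
       = (\<Sum>e\<in>Basis. (LINT x|sphere_measure. (\<eta> m x * (x \<bullet> e) * (x \<bullet> e)) *\<^sub>R \<kappa>))"
      by (intro sum.cong refl one)
    have two: "(LINT x|lebesgue_on ?D. (\<Sum>e\<in>Basis. (2 * g' m (x \<bullet> x) * (x \<bullet> e) * (x \<bullet> e) + \<eta> m x * (e \<bullet> e)) *\<^sub>R w x)) + (LINT x|lebesgue_on ?D. (\<Sum>e\<in>Basis. (\<eta> m x * (x \<bullet> e)) *\<^sub>R we e x))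
       = (LINT x|sphere_measure. (\<Sum>e\<in>Basis. (\<eta> m x * (x \<bullet> e) * (x \<bullet> e)) *\<^sub>R \<kappa>))"
    proof -
      have "(LINT x|lebesgue_on ?D. (\<Sum>e\<in>Basis. (2 * g' m (x \<bullet> x) * (x \<bullet> e) * (x \<bullet> e) + \<eta> m x * (e \<bullet> e)) *\<^sub>R w x)) =
        (\<Sum>e\<in>Basis. LINT x|lebesgue_on ?D. (2 * g' m (x \<bullet> x) * (x \<bullet> e) * (x \<bullet> e) + \<eta> m x * (e \<bullet> e)) *\<^sub>R w x)"
        by (rule Bochner_Integration.integral_sum) (rule ei)
      moreover have "(LINT x|lebesgue_on ?D. (\<Sum>e\<in>Basis. (\<eta> m x * (x \<bullet> e)) *\<^sub>R we e x)) =
        (\<Sum>e\<in>Basis. LINT x|lebesgue_on ?D. (\<eta> m x * (x \<bullet> e)) *\<^sub>R we e x)"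
        by (rule Bochner_Integration.integral_sum) (rule fi)
      moreover have "(LINT x|sphere_measure. (\<Sum>e\<in>Basis. (\<eta> m x * (x \<bullet> e) * (x \<bullet> e)) *\<^sub>R \<kappa>)) =
        (\<Sum>e\<in>Basis. LINT x|sphere_measure. (\<eta> m x * (x \<bullet> e) * (x \<bullet> e)) *\<^sub>R \<kappa>)"
        by (rule Bochner_Integration.integral_sum) (rule gi)
      ultimately show ?thesis using sums by (simp only: sum.distrib)
    qed
    have s1: "(\<Sum>e\<in>Basis. (2 * g' m (x \<bullet> x) * (x \<bullet> e) * (x \<bullet> e) + \<eta> m x * (e \<bullet> e)) *\<^sub>R w x) = \<theta> m x *\<^sub>R w x + \<eta> m x *\<^sub>R (real DIM(complex^2) *\<^sub>R w x)" for x
    proof -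
      have "(\<Sum>e\<in>Basis. (2 * g' m (x \<bullet> x) * (x \<bullet> e) * (x \<bullet> e) + \<eta> m x * (e \<bullet> e)) *\<^sub>R w x) =
         (2 * g' m (x \<bullet> x) * (\<Sum>e\<in>Basis. (x \<bullet> e) * (x \<bullet> e)) + \<eta> m x * (\<Sum>e\<in>(Basis::(complex^2) set). e \<bullet> e)) *\<^sub>R w x"
        by (simp add: scaleR_sum_left[symmetric] sum.distrib sum_distrib_left mult.assoc)
      also have "(\<Sum>e\<in>Basis. (x \<bullet> e) * (x \<bullet> e)) = x \<bullet> x" by (rule euclidean_inner[symmetric])
      also have "(\<Sum>e\<in>(Basis::(complex^2) set). e \<bullet> e) = real DIM(complex^2)" by (simp add: inner_Basis)
      finally show ?thesis by (simp add: \<theta>_def T_def scaleR_add_left mult_ac)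
    qed
    have s3: "(\<Sum>e\<in>Basis. (\<eta> m x * (x \<bullet> e) * (x \<bullet> e)) *\<^sub>R \<kappa>) = \<kappa>" if "norm x = 1" for x
    proof -
      have "(\<Sum>e\<in>Basis. (\<eta> m x * (x \<bullet> e) * (x \<bullet> e)) *\<^sub>R \<kappa>) = (\<eta> m x * (\<Sum>e\<in>Basis. (x \<bullet> e) * (x \<bullet> e))) *\<^sub>R \<kappa>"
        by (simp add: scaleR_sum_left[symmetric] sum_distrib_left mult.assoc)
      also have "(\<Sum>e\<in>Basis. (x \<bullet> e) * (x \<bullet> e)) = x \<bullet> x" by (rule euclidean_inner[symmetric])
      finally show ?thesis using that by (simp add: \<eta>_def norm_eq_1 g1)
    qed
    have "(LINT x|sphere_measure. (\<Sum>e\<in>Basis. (\<eta> m x * (x \<bullet> e) * (x \<bullet> e)) *\<^sub>R \<kappa>)) = (LINT x|(sphere_measure :: (complex^2) measure). \<kappa>)"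
      by (rule Bochner_Integration.integral_cong[OF refl]) (simp add: s3 space_sphere_measure)
    then have three: "(LINT x|sphere_measure. (\<Sum>e\<in>Basis. (\<eta> m x * (x \<bullet> e) * (x \<bullet> e)) *\<^sub>R \<kappa>)) = (measure sphere_measure (space (sphere_measure :: (complex^2) measure))) *\<^sub>R \<kappa>"
      by simp
    have i1: "integrable (lebesgue_on ?D) (\<lambda>x. \<theta> m x *\<^sub>R w x)" "integrable (lebesgue_on ?D) (\<lambda>x. \<eta> m x *\<^sub>R (real DIM(complex^2) *\<^sub>R w x))"
      by (intro smooth_scaleR_integrable integrable_scaleR_right wi annulus_subset_ball s\<eta>)+
    have i2: "integrable (lebesgue_on ?D) (\<lambda>x. (\<Sum>e\<in>Basis. (\<eta> m x * (x \<bullet> e)) *\<^sub>R we e x))"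
      by (intro Bochner_Integration.integrable_sum fi)
    have "(LINT x|lebesgue_on ?D. \<eta> m x *\<^sub>R F x) = (LINT x|lebesgue_on ?D. \<eta> m x *\<^sub>R (real DIM(complex^2) *\<^sub>R w x) + (\<Sum>e\<in>Basis. (\<eta> m x * (x \<bullet> e)) *\<^sub>R we e x))"
      by (simp add: F_def scaleR_add_right scaleR_sum_right)
    also have "\<dots> = (LINT x|lebesgue_on ?D. \<eta> m x *\<^sub>R (real DIM(complex^2) *\<^sub>R w x)) + (LINT x|lebesgue_on ?D. (\<Sum>e\<in>Basis. (\<eta> m x * (x \<bullet> e)) *\<^sub>R we e x))"
      by (rule Bochner_Integration.integral_add[OF i1(2) i2])
    also have "\<dots> = (LINT x|sphere_measure. (\<Sum>e\<in>Basis. (\<eta> m x * (x \<bullet> e) * (x \<bullet> e)) *\<^sub>R \<kappa>))"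
      using two unfolding s1 Bochner_Integration.integral_add[OF i1] w\<theta> by simp
    finally show ?thesis unfolding three .
  qed
  have "(\<lambda>m. LINT x|lebesgue_on ?D. \<eta> m x *\<^sub>R F x) \<longlonglongrightarrow> (LINT x|lebesgue_on ?D. 0)"
  proof (rule integral_dominated_convergence[where w="\<lambda>x. norm (F x)"])
    show "integrable (lebesgue_on ?D) (\<lambda>x. norm (F x))" using Fi by simp
    show "(\<lambda>x. \<eta> m x *\<^sub>R F x) \<in> borel_measurable (lebesgue_on ?D)" for m
      using smooth_scaleR_integrable[OF s\<eta>(1) Fi annulus_subset_ball] by (rule borel_measurable_integrable)
    have sq: "0 \<le> x \<bullet> x" "x \<bullet> x < 1" if "x \<in> ?D" for x using that by (auto simp: annulus_def dot_square_norm power_less_one_iff abs_square_less_1)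
    show "AE x in lebesgue_on ?D. (\<lambda>m. \<eta> m x *\<^sub>R F x) \<longlonglongrightarrow> 0"
    proof (rule AE_I2)
      fix x assume "x \<in> space (lebesgue_on ?D)"
      then have x: "0 \<le> x \<bullet> x" "x \<bullet> x < 1" using sq by auto
      have "(\<lambda>m. \<eta> m x) \<longlonglongrightarrow> 0"
        by (rule Lim_null_comparison[OF _ LIMSEQ_power_zero[of "x \<bullet> x"]]) (use x gb in \<open>auto simp: \<eta>_def\<close>)
      then have "(\<lambda>m. \<eta> m x *\<^sub>R F x) \<longlonglongrightarrow> 0 *\<^sub>R F x" by (intro tendsto_intros)
      then show "(\<lambda>m. \<eta> m x *\<^sub>R F x) \<longlonglongrightarrow> 0" by simp
    qed
    show "AE x in lebesgue_on ?D. norm (\<eta> m x *\<^sub>R F x) \<le> norm (F x)" for m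
    proof (rule AE_I2)
      fix x assume "x \<in> space (lebesgue_on ?D)"
      then have x: "0 \<le> x \<bullet> x" "x \<bullet> x < 1" using sq by auto
      then have "(x \<bullet> x) ^ m \<le> 1" by (intro power_le_one) auto
      then have "\<bar>\<eta> m x\<bar> \<le> 1" using gb[OF x(1), of m] unfolding \<eta>_def by linarith
      then show "norm (\<eta> m x *\<^sub>R F x) \<le> norm (F x)" by (simp add: mult_left_le_one_le)
    qed
  qed simp
  then have "(measure sphere_measure (space (sphere_measure :: (complex^2) measure))) *\<^sub>R \<kappa> = 0"
    unfolding main by (simp add: LIMSEQ_const_iff)
  moreover have "measure sphere_measure (space (sphere_measure :: (complex^2) measure)) > 0"
    unfolding measure_sphere_measure by simp
  ultimately show ?thesis by simp
qed

section \<open>Green's formula\<close>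

definition ballint :: "(complex^2 \<Rightarrow> real) \<Rightarrow> (complex^2 \<Rightarrow> complex) \<Rightarrow> complex" where
  "ballint K v = (LINT x|lebesgue_on B4. K x *\<^sub>R v x)"

lemma ballint_add:
  assumes "smooth K" "integrable (lebesgue_on B4) v" "integrable (lebesgue_on B4) w"
  shows "ballint K (\<lambda>x. v x + w x) = ballint K v + ballint K w"
    and "ballint K (\<lambda>x. v x - w x) = ballint K v - ballint K w"
  unfolding ballint_def scaleR_add_right scaleR_diff_right
  by (intro Bochner_Integration.integral_add Bochner_Integration.integral_diff smooth_scaleR_integrable assms order_refl)+

lemma ballint_cmult: "ballint K (\<lambda>x. c * v x) = c * ballint K v"
  unfolding ballint_def mult_scaleR_right[symmetric] by (rule integral_mult_right_zero)

lemma ballint_uminus: "ballint K (\<lambda>x. - v x) = - ballint K v"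
  unfolding ballint_def by simp

lemma ballint_reps:
  assumes K: "smooth K" and d: "\<And>e. e \<in> Basis \<Longrightarrow> integrable (lebesgue_on B4) (d e)"
  shows "ballint K (adj_rep d) = - ((ballint K (\<lambda>z. d (axis 1 1) z $ 1) - \<i> * ballint K (\<lambda>z. d (axis 1 \<i>) z $ 1)) +
      (ballint K (\<lambda>z. d (axis 2 1) z $ 2) - \<i> * ballint K (\<lambda>z. d (axis 2 \<i>) z $ 2)))"
    and "ballint K (dbar_rep d) = (1/2) * ((ballint K (\<lambda>z. d (axis 1 1) z $ 2) + \<i> * ballint K (\<lambda>z. d (axis 1 \<i>) z $ 2)) -
      (ballint K (\<lambda>z. d (axis 2 1) z $ 1) + \<i> * ballint K (\<lambda>z. d (axis 2 \<i>) z $ 1)))"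
    and "integrable (lebesgue_on B4) (adj_rep d)" "integrable (lebesgue_on B4) (dbar_rep d)"
proof -
  have i: "integrable (lebesgue_on B4) (\<lambda>z. d (axis k 1) z $ j)" "integrable (lebesgue_on B4) (\<lambda>z. d (axis k \<i>) z $ j)" for k j
    using integrable_bounded_linear[OF bounded_linear_vec_nth d] by simp_all
  note ii = i(1) integrable_mult_right[OF i(2)] Bochner_Integration.integrable_add Bochner_Integration.integrable_diff
  show "ballint K (adj_rep d) = - ((ballint K (\<lambda>z. d (axis 1 1) z $ 1) - \<i> * ballint K (\<lambda>z. d (axis 1 \<i>) z $ 1)) +
      (ballint K (\<lambda>z. d (axis 2 1) z $ 2) - \<i> * ballint K (\<lambda>z. d (axis 2 \<i>) z $ 2)))"
    unfolding adj_rep_def[abs_def]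
    by (subst ballint_uminus, subst ballint_add(1), rule K, (intro ii)+, (subst ballint_add(2), rule K, (intro ii)+, subst ballint_cmult)+) (rule refl)
  show "ballint K (dbar_rep d) = (1/2) * ((ballint K (\<lambda>z. d (axis 1 1) z $ 2) + \<i> * ballint K (\<lambda>z. d (axis 1 \<i>) z $ 2)) -
      (ballint K (\<lambda>z. d (axis 2 1) z $ 1) + \<i> * ballint K (\<lambda>z. d (axis 2 \<i>) z $ 1)))"
    unfolding dbar_rep_def[abs_def]
    by (subst ballint_cmult, subst ballint_add(2), rule K, (intro ii)+, (subst ballint_add(1), rule K, (intro ii)+, subst ballint_cmult)+) (rule refl)
  show "integrable (lebesgue_on B4) (adj_rep d)" unfolding adj_rep_def[abs_def]
    by (intro Bochner_Integration.integrable_minus ii)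
  show "integrable (lebesgue_on B4) (dbar_rep d)" unfolding dbar_rep_def[abs_def]
    by (intro integrable_mult_right ii)
qed

lemma sum_Basis_complex2:
  "(\<Sum>e\<in>(Basis :: (complex^2) set). h e) = h (axis 1 1) + h (axis 1 \<i>) + h (axis 2 1) + h (axis 2 \<i>)"
proof -
  have "(axis 1 1 :: complex^2) \<noteq> axis 1 \<i>" "(axis 1 1 :: complex^2) \<noteq> axis 2 1" "(axis 1 1 :: complex^2) \<noteq> axis 2 \<i>"
     "(axis 1 \<i> :: complex^2) \<noteq> axis 2 1" "(axis 1 \<i> :: complex^2) \<noteq> axis 2 \<i>" "(axis 2 1 :: complex^2) \<noteq> axis 2 \<i>"
    by (auto simp: axis_eq_axis complex_eq_iff)
  then show ?thesis unfolding Basis_complex2 by (simp add: add.assoc)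
qed

text \<open>Integrating by parts twice: the zero trace of \<open>u\<close> removes the first boundary term, and in the second one
  only the constant trace \<open>- \<beta>\<close> of \<open>adj_rep d\<close> contributes.\<close>

lemma Green_system:
  fixes u f :: "complex^2 \<Rightarrow> complex^2"
  assumes K: "smooth K"
    and H: "\<And>e e' x. frechet_derivative (\<lambda>x. frechet_derivative K (at x) e) (at x) e' = H e e' x"
    and Hsym: "\<And>e e' x. H e e' x = H e' e x"
    and ui: "integrable (lebesgue_on B4) u"
    and di: "\<And>e. e \<in> Basis \<Longrightarrow> integrable (lebesgue_on B4) (d e)"
    and ddi: "\<And>e e'. e \<in> Basis \<Longrightarrow> e' \<in> Basis \<Longrightarrow> integrable (lebesgue_on B4) (dd e e')"
    and fi: "integrable (lebesgue_on B4) f"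
    and G0: "\<And>e j K. e \<in> Basis \<Longrightarrow> smooth K \<Longrightarrow>
       ballint (\<lambda>x. frechet_derivative K (at x) e) (\<lambda>z. u z $ j) + ballint K (\<lambda>z. d e z $ j) = 0"
    and G1: "\<And>e. e \<in> Basis \<Longrightarrow>
       ballint (\<lambda>x. frechet_derivative K (at x) e) (adj_rep d) + ballint K (adj_rep (\<lambda>e'. dd e' e)) =
         (LINT x|sphere_measure. (K x * (x \<bullet> e)) *\<^sub>R (- \<beta>))"
    and G2: "\<And>e. e \<in> Basis \<Longrightarrow>
       ballint (\<lambda>x. frechet_derivative K (at x) e) (dbar_rep d) + ballint K (dbar_rep (\<lambda>e'. dd e' e)) = 0"
    and f: "AE z in lebesgue_on B4. f z =
     - vector [(adj_rep (\<lambda>e. dd e (axis 1 1)) z + \<i> * adj_rep (\<lambda>e. dd e (axis 1 \<i>)) z) +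
              2 * (dbar_rep (\<lambda>e. dd e (axis 2 1)) z - \<i> * dbar_rep (\<lambda>e. dd e (axis 2 \<i>)) z),
            (adj_rep (\<lambda>e. dd e (axis 2 1)) z + \<i> * adj_rep (\<lambda>e. dd e (axis 2 \<i>)) z) -
              2 * (dbar_rep (\<lambda>e. dd e (axis 1 1)) z - \<i> * dbar_rep (\<lambda>e. dd e (axis 1 \<i>)) z)]"
  shows "ballint K (\<lambda>z. f z $ j) = ballint (\<lambda>x. \<Sum>e\<in>Basis. H e e x) (\<lambda>z. u z $ j) + (LINT x|sphere_measure. K x *\<^sub>R (\<beta> * x $ j))"
proof -
  \<comment> \<open>\<open>u\<close> paired with a second derivative of K. By symmetry in e and e'
    the mixed terms from \<open>adj_rep\<close> and \<open>dbar_rep\<close> cancel, and the diagonal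
    ones add up to the Laplacian of K.\<close>
  define h where "h e e' j = ballint (H e e') (\<lambda>z. u z $ j)" for e e' j
  have hs: "h e e' j = h e' e j" for e e' j using Hsym by (simp add: h_def Hsym[of e e', abs_def] fun_eq_iff)
  have sKe: "smooth (\<lambda>x. frechet_derivative K (at x) e)" for e by (rule smooth_directional[OF K])
  have sH: "smooth (H e e')" for e e'
    using smooth_directional[OF sKe[of e], of e'] unfolding H .
  have KD: "ballint (\<lambda>x. frechet_derivative K (at x) e) (\<lambda>z. d e' z $ j) = - h e e' j" if "e' \<in> Basis" for e e' j
    using G0[OF that sKe[of e], of j] unfolding H h_def by (simp add: eq_neg_iff_add_eq_0 add.commute)
  define s where "s e = (LINT x|sphere_measure. (K x * (x \<bullet> e)) *\<^sub>R \<beta>)" for e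
  have A: "ballint K (adj_rep (\<lambda>e'. dd e' e)) = - s e - (h e (axis 1 1) 1 - \<i> * h e (axis 1 \<i>) 1 + (h e (axis 2 1) 2 - \<i> * h e (axis 2 \<i>) 2))"
    if "e \<in> Basis" for e
  proof -
    have "(LINT x|sphere_measure. (K x * (x \<bullet> e)) *\<^sub>R (- \<beta>)) = - s e" by (simp add: s_def)
    then have "ballint K (adj_rep (\<lambda>e'. dd e' e)) = - s e - ballint (\<lambda>x. frechet_derivative K (at x) e) (adj_rep d)"
      using G1[OF that] by (simp add: eq_diff_eq add.commute)
    then show ?thesis by (simp add: ballint_reps(1)[OF sKe di] KD)
  qed
  have Q: "ballint K (dbar_rep (\<lambda>e'. dd e' e)) = (1/2) * (h e (axis 1 1) 2 + \<i> * h e (axis 1 \<i>) 2 - (h e (axis 2 1) 1 + \<i> * h e (axis 2 \<i>) 1))"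
    if "e \<in> Basis" for e
  proof -
    have "ballint K (dbar_rep (\<lambda>e'. dd e' e)) = - ballint (\<lambda>x. frechet_derivative K (at x) e) (dbar_rep d)"
      using G2[OF that] by (simp add: eq_neg_iff_add_eq_0 add.commute)
    then show ?thesis by (simp add: ballint_reps(2)[OF sKe di] KD) (simp add: field_simps)
  qed
  have Ai: "integrable (lebesgue_on B4) (adj_rep (\<lambda>e'. dd e' e))" "integrable (lebesgue_on B4) (dbar_rep (\<lambda>e'. dd e' e))" if "e \<in> Basis" for e
    by (rule ballint_reps(3,4)[OF K ddi[OF _ that]]; assumption)+
  have fj: "ballint K (\<lambda>z. f z $ j) = ballint K F" if "AE z in lebesgue_on B4. f z $ j = F z" "integrable (lebesgue_on B4) F" for F j
    unfolding ballint_def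
  proof (rule integral_cong_AE)
    have "integrable (lebesgue_on B4) (\<lambda>z. f z $ j)" by (rule integrable_bounded_linear[OF bounded_linear_vec_nth fi])
    from smooth_scaleR_integrable[OF K this order_refl]
    show "(\<lambda>x. K x *\<^sub>R f x $ j) \<in> borel_measurable (lebesgue_on B4)" by (rule borel_measurable_integrable)
    show "(\<lambda>x. K x *\<^sub>R F x) \<in> borel_measurable (lebesgue_on B4)"
      using smooth_scaleR_integrable[OF K that(2) order_refl] by (rule borel_measurable_integrable)
    show "AE x in lebesgue_on B4. K x *\<^sub>R f x $ j = K x *\<^sub>R F x" using that(1) by eventually_elim simp
  qed
  note ii = Ai[OF axis_complex_in_Basis(1)] integrable_mult_right[OF Ai(1)[OF axis_complex_in_Basis(2)]] integrable_mult_right[OF Ai(2)[OF axis_complex_in_Basis(2)]]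
    Bochner_Integration.integrable_add Bochner_Integration.integrable_diff integrable_mult_right
  have lap: "ballint (\<lambda>x. \<Sum>e\<in>Basis. H e e x) (\<lambda>z. u z $ j) = h (axis 1 1) (axis 1 1) j + h (axis 1 \<i>) (axis 1 \<i>) j + h (axis 2 1) (axis 2 1) j + h (axis 2 \<i>) (axis 2 \<i>) j" for j
  proof -
    have "ballint (\<lambda>x. \<Sum>e\<in>Basis. H e e x) (\<lambda>z. u z $ j) = (\<Sum>e\<in>Basis. h e e j)"
      unfolding ballint_def h_def scaleR_sum_left
      by (intro Bochner_Integration.integral_sum smooth_scaleR_integrable sH integrable_bounded_linear[OF bounded_linear_vec_nth ui] order_refl)
    then show ?thesis by (simp only: sum_Basis_complex2)
  qed
  \<comment> \<open>The inner products with \<open>axis j 1\<close> and \<open>axis j \<i>\<close>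
    are the real and imaginary part of coordinate j, so the two boundary terms recombine to \<beta>
    times that coordinate.\<close>
  have sph: "(LINT x|sphere_measure. K x *\<^sub>R (\<beta> * x $ j)) = s (axis j 1) + \<i> * s (axis j \<i>)" for j
  proof -
    have i: "integrable sphere_measure (\<lambda>x. (K x * (x \<bullet> e)) *\<^sub>R \<beta>)" for e
      by (intro smooth_scaleR_integrable_sphere smooth_intros K) simp
    have "s (axis j 1) + \<i> * s (axis j \<i>) = (LINT x|sphere_measure. (K x * (x \<bullet> axis j 1)) *\<^sub>R \<beta> + \<i> * ((K x * (x \<bullet> axis j \<i>)) *\<^sub>R \<beta>))"
      unfolding s_def by (subst Bochner_Integration.integral_add, rule i, rule integrable_mult_right, rule i) (simp only: integral_mult_right_zero)
    also have "\<dots> = (LINT x|sphere_measure. K x *\<^sub>R (\<beta> * x $ j))"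
      by (rule Bochner_Integration.integral_cong[OF refl], subst (3) complex_eq) (simp add: scaleR_conv_of_real algebra_simps)
    finally show ?thesis by simp
  qed
  note S = hs[of "axis 1 \<i>" "axis 1 1"] hs[of "axis 2 1" "axis 1 1"] hs[of "axis 2 \<i>" "axis 1 1"] hs[of "axis 2 1" "axis 1 \<i>"]
    hs[of "axis 2 \<i>" "axis 1 \<i>"] hs[of "axis 2 \<i>" "axis 2 1"]
  consider "j = 1" | "j = 2" using exhaust_2 by auto
  then show ?thesis
  proof cases
    case 1
    have "ballint K (\<lambda>z. f z $ 1) = ballint K (\<lambda>z. - ((adj_rep (\<lambda>e. dd e (axis 1 1)) z + \<i> * adj_rep (\<lambda>e. dd e (axis 1 \<i>)) z) +
              2 * (dbar_rep (\<lambda>e. dd e (axis 2 1)) z - \<i> * dbar_rep (\<lambda>e. dd e (axis 2 \<i>)) z)))"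
      by (rule fj) (use f in \<open>auto elim!: eventually_mono intro!: Bochner_Integration.integrable_minus ii\<close>)
    also have "\<dots> = - ((ballint K (adj_rep (\<lambda>e. dd e (axis 1 1))) + \<i> * ballint K (adj_rep (\<lambda>e. dd e (axis 1 \<i>)))) +
              2 * (ballint K (dbar_rep (\<lambda>e. dd e (axis 2 1))) - \<i> * ballint K (dbar_rep (\<lambda>e. dd e (axis 2 \<i>)))))"
      by (subst ballint_uminus, subst ballint_add(1), rule K, (intro ii)+, subst ballint_add(1), rule K, (intro ii)+, subst ballint_cmult, subst ballint_cmult,
          subst ballint_add(2), rule K, (intro ii)+, subst ballint_cmult) (rule refl)
    finally show ?thesis
      unfolding 1 lap sph by (simp add: A Q S) (simp add: algebra_simps add_divide_distrib diff_divide_distrib)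
  next
    case 2
    have "ballint K (\<lambda>z. f z $ 2) = ballint K (\<lambda>z. - ((adj_rep (\<lambda>e. dd e (axis 2 1)) z + \<i> * adj_rep (\<lambda>e. dd e (axis 2 \<i>)) z) -
              2 * (dbar_rep (\<lambda>e. dd e (axis 1 1)) z - \<i> * dbar_rep (\<lambda>e. dd e (axis 1 \<i>)) z)))"
      by (rule fj) (use f in \<open>auto elim!: eventually_mono intro!: Bochner_Integration.integrable_minus ii\<close>)
    also have "\<dots> = - ((ballint K (adj_rep (\<lambda>e. dd e (axis 2 1))) + \<i> * ballint K (adj_rep (\<lambda>e. dd e (axis 2 \<i>)))) -
              2 * (ballint K (dbar_rep (\<lambda>e. dd e (axis 1 1))) - \<i> * ballint K (dbar_rep (\<lambda>e. dd e (axis 1 \<i>)))))"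
      by (subst ballint_uminus, subst ballint_add(2), rule K, (intro ii)+, subst ballint_add(1), rule K, (intro ii)+, subst ballint_cmult, subst ballint_cmult,
          subst ballint_add(2), rule K, (intro ii)+, subst ballint_cmult) (rule refl)
    finally show ?thesis
      unfolding 2 lap sph by (simp add: A Q S) (simp add: algebra_simps add_divide_distrib diff_divide_distrib)
  qed
qed

section \<open>The regularised Newton kernel\<close>

text \<open>At \<open>\<epsilon> = 0\<close> this is 1/|x|^2 off the origin and, by the convention
  for division, 0 at the origin; the estimates that include this case therefore assume x
  nonzero.\<close>

definition newt :: "real \<Rightarrow> 'a::euclidean_space \<Rightarrow> real" where
  "newt \<epsilon> x = 1 / (x \<bullet> x + \<epsilon>)"

text \<open>The derivative of \<open>newt\<close> in direction e. The direction is a free argument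
  because later it is the position itself or the vector spanning a ray.\<close>

definition dnewt :: "real \<Rightarrow> 'a::euclidean_space \<Rightarrow> 'a \<Rightarrow> real" where
  "dnewt \<epsilon> e x = - 2 * (x \<bullet> e) / (x \<bullet> x + \<epsilon>)\<^sup>2"

definition ddnewt :: "real \<Rightarrow> 'a::euclidean_space \<Rightarrow> 'a \<Rightarrow> 'a \<Rightarrow> real" where
  "ddnewt \<epsilon> e e' x = 8 * (x \<bullet> e) * (x \<bullet> e') / (x \<bullet> x + \<epsilon>) ^ 3 - 2 * (e \<bullet> e') / (x \<bullet> x + \<epsilon>)\<^sup>2"

definition bump4 :: "real \<Rightarrow> 'a::euclidean_space \<Rightarrow> real" where
  "bump4 \<epsilon> x = 8 * \<epsilon> / (x \<bullet> x + \<epsilon>) ^ 3"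

lemma smooth_newt:
  assumes "\<epsilon> > 0"
  shows "smooth (newt \<epsilon> :: 'a::euclidean_space \<Rightarrow> real)"
proof -
  have pos: "x \<bullet> x + \<epsilon> > 0" for x :: 'a using assms inner_ge_zero[of x] by linarith
  have "cd_on k UNIV (\<lambda>x::'a. (x \<bullet> x + \<epsilon>) powr (-1))" for k
    by (rule cd_on_compose_real[OF _ _ cd_on_powr])
      (auto intro!: cd_on_add cd_on_const cd_on_inner cd_on_bounded_linear[OF _ bounded_linear_ident] pos)
  moreover have "(\<lambda>x::'a. (x \<bullet> x + \<epsilon>) powr (-1)) = newt \<epsilon>"
    using pos by (simp add: fun_eq_iff newt_def powr_minus_divide powr_one less_imp_le)
  ultimately show ?thesis by (simp add: smooth_iff_cd_on)
qed

lemma smooth_affine_compose: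
  fixes f :: "'a::euclidean_space \<Rightarrow> 'b::real_normed_vector"
  assumes "smooth f" "s = 1 \<or> s = -1"
  shows "smooth (\<lambda>x. f (c + s *\<^sub>R x))"
proof -
  have "cd_on k UNIV (\<lambda>x. f (c + s *\<^sub>R x))" if "cd_on k UNIV f" for k and f :: "'a \<Rightarrow> 'b"
    using that
  proof (induction k arbitrary: f)
    case 0
    then have c: "continuous_on UNIV f" by simp
    have "continuous_on UNIV (\<lambda>x. f (c + s *\<^sub>R x))"
      by (rule continuous_on_compose2[OF c]) (auto intro!: continuous_intros)
    then show ?case by simp
  next
    case (Suc k)
    have d: "((\<lambda>x. f (c + s *\<^sub>R x)) has_derivative (\<lambda>h. s *\<^sub>R frechet_derivative f (at (c + s *\<^sub>R x)) h)) (at x)" for x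
    proof -
      have "((\<lambda>x. c + s *\<^sub>R x) has_derivative (\<lambda>h. s *\<^sub>R h)) (at x)"
        by (rule derivative_eq_intros refl | simp)+
      from has_derivative_compose[OF this cd_on_Suc_has_derivative[OF Suc.prems UNIV_I]]
      show ?thesis
        using linear_scale[OF has_derivative_linear[OF cd_on_Suc_has_derivative[OF Suc.prems UNIV_I]]] by simp
    qed
    show ?case
    proof (rule cd_on_SucI[OF open_UNIV d])
      fix h
      have "cd_on k UNIV (\<lambda>x. frechet_derivative f (at (c + s *\<^sub>R x)) h)"
        using Suc.IH[of "\<lambda>x. frechet_derivative f (at x) h"] Suc.prems by simp
      then show "cd_on k UNIV (\<lambda>x. s *\<^sub>R frechet_derivative f (at (c + s *\<^sub>R x)) h)"
        by (rule cd_on_bounded_linear_comp[OF open_UNIV bounded_linear_scaleR_right])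
    qed
  qed
  then show ?thesis using assms(1) by (simp add: smooth_iff_cd_on)
qed

lemma newt_has_derivative:
  fixes x :: "'a::euclidean_space"
  assumes "x \<bullet> x + \<epsilon> > 0"
  shows "(newt \<epsilon> has_derivative (\<lambda>h. dnewt \<epsilon> h x)) (at x)"
    and "(dnewt \<epsilon> e has_derivative (\<lambda>h. ddnewt \<epsilon> e h x)) (at x)"
proof -
  have n0: "x \<bullet> x + \<epsilon> \<noteq> 0" using assms by simp
  have "((\<lambda>x. inverse (x \<bullet> x + \<epsilon>)) has_derivative (\<lambda>h. - (inverse (x \<bullet> x + \<epsilon>) * (x \<bullet> h + h \<bullet> x) * inverse (x \<bullet> x + \<epsilon>)))) (at x)"
    by (rule Deriv.has_derivative_inverse[where f="\<lambda>x. x \<bullet> x + \<epsilon>" and x=x, OF n0]) (rule derivative_eq_intros refl | simp)+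
  then show n: "(newt \<epsilon> has_derivative (\<lambda>h. dnewt \<epsilon> h x)) (at x)"
    unfolding newt_def[abs_def] inverse_eq_divide
    by (rule has_derivative_eq_rhs) (simp add: fun_eq_iff dnewt_def inner_commute power2_eq_square)
  have eq: "dnewt \<epsilon> e = (\<lambda>x. - 2 * (x \<bullet> e) * (newt \<epsilon> x * newt \<epsilon> x))"
    by (simp add: fun_eq_iff dnewt_def newt_def power2_eq_square)
  have l: "((\<lambda>x. - 2 * (x \<bullet> e)) has_derivative (\<lambda>h. - 2 * (h \<bullet> e))) (at x)"
    by (rule derivative_eq_intros refl | simp)+
  show "(dnewt \<epsilon> e has_derivative (\<lambda>h. ddnewt \<epsilon> e h x)) (at x)"
    unfolding eq
  proof (rule has_derivative_eq_rhs[OF has_derivative_mult[OF l has_derivative_mult[OF n n]]], rule ext)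
    fix h
    define s where "s = x \<bullet> x + \<epsilon>"
    have s: "s \<noteq> 0" using n0 by (simp add: s_def)
    show "- 2 * (x \<bullet> e) * (newt \<epsilon> x * dnewt \<epsilon> h x + dnewt \<epsilon> h x * newt \<epsilon> x) + - 2 * (h \<bullet> e) * (newt \<epsilon> x * newt \<epsilon> x) = ddnewt \<epsilon> e h x"
      unfolding ddnewt_def dnewt_def newt_def s_def[symmetric]
      using s by (simp add: field_simps inner_commute[of h e] power2_eq_square power3_eq_cube)
  qed
qed

lemma kernel_derivs:
  fixes z :: "'a::euclidean_space"
  assumes "\<epsilon> > 0"
  shows "frechet_derivative (\<lambda>w. newt \<epsilon> (w - z)) (at x) e = dnewt \<epsilon> e (x - z)"
    and "frechet_derivative (\<lambda>w. dnewt \<epsilon> e (w - z)) (at x) e' = ddnewt \<epsilon> e e' (x - z)"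
    and "smooth (\<lambda>w. newt \<epsilon> (w - z))"
proof -
  have p: "y \<bullet> y + \<epsilon> > 0" for y :: 'a using assms inner_ge_zero[of y] by linarith
  have t: "((\<lambda>w. w - z) has_derivative (\<lambda>h. h)) (at x)" for x by (rule derivative_eq_intros refl | simp)+
  show "frechet_derivative (\<lambda>w. newt \<epsilon> (w - z)) (at x) e = dnewt \<epsilon> e (x - z)"
    using frechet_derivative_eqI[OF has_derivative_compose[OF t newt_has_derivative(1)[OF p]]] by simp
  show "frechet_derivative (\<lambda>w. dnewt \<epsilon> e (w - z)) (at x) e' = ddnewt \<epsilon> e e' (x - z)"
    using frechet_derivative_eqI[OF has_derivative_compose[OF t newt_has_derivative(2)[OF p]]] by simp
  show "smooth (\<lambda>w. newt \<epsilon> (w - z))"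
    using smooth_affine_compose[OF smooth_newt[OF assms, where ?'a='a], of 1 "- z"] by simp
qed

text \<open>In dimension 4 the sum is 8 |x|^2/s^3 - 8/s^2 with s = |x|^2 + \<epsilon>, and the terms
  of order s^(-2) cancel.\<close>

lemma sum_ddnewt:
  fixes x :: "'a::euclidean_space"
  assumes "\<epsilon> > 0" "DIM('a) = 4"
  shows "(\<Sum>e\<in>Basis. ddnewt \<epsilon> e e x) = - bump4 \<epsilon> x"
proof -
  define s where "s = x \<bullet> x + \<epsilon>"
  have s: "s \<noteq> 0" using assms inner_ge_zero[of x] by (simp add: s_def add_nonneg_pos less_imp_neq[symmetric])
  have "(\<Sum>e\<in>Basis. ddnewt \<epsilon> e e x) = 8 * (\<Sum>e\<in>Basis. (x \<bullet> e) * (x \<bullet> e)) / s ^ 3 - 2 * (\<Sum>e\<in>(Basis::'a set). e \<bullet> e) / s\<^sup>2"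
    unfolding ddnewt_def s_def[symmetric]
    by (simp add: sum_subtractf sum_divide_distrib sum_distrib_left mult.assoc)
  also have "(\<Sum>e\<in>Basis. (x \<bullet> e) * (x \<bullet> e)) = s - \<epsilon>" using euclidean_inner[of x x] by (simp add: s_def)
  also have "(\<Sum>e\<in>(Basis::'a set). e \<bullet> e) = 4" using assms(2) by (simp add: inner_Basis)
  also have "8 * (s - \<epsilon>) / s ^ 3 - 2 * 4 / s\<^sup>2 = - bump4 \<epsilon> x"
    unfolding bump4_def s_def[symmetric] using s by (simp add: field_simps power2_eq_square power3_eq_cube)
  finally show ?thesis .
qed

text \<open>The Jacobian sqrt(\<epsilon>)^4 = \<epsilon>^2 cancels the factor
  \<epsilon>/\<epsilon>^3 that the scaling produces.\<close>

lemma bump4_scale: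
  fixes y :: "'a::euclidean_space"
  assumes "\<epsilon> > 0" "DIM('a) = 4"
  shows "sqrt \<epsilon> ^ DIM('a) * bump4 \<epsilon> (sqrt \<epsilon> *\<^sub>R y) = bump4 1 y"
proof -
  define Y where "Y = y \<bullet> y + 1"
  have Y: "Y > 0" unfolding Y_def using inner_ge_zero[of y] by linarith
  have s2: "sqrt \<epsilon> * sqrt \<epsilon> = \<epsilon>" using assms by simp
  have s4: "sqrt \<epsilon> ^ 4 = \<epsilon> * \<epsilon>"
  proof -
    have "sqrt \<epsilon> ^ 4 = (sqrt \<epsilon> * sqrt \<epsilon>) * (sqrt \<epsilon> * sqrt \<epsilon>)" by (simp only: power4_eq_xxxx mult.assoc)
    then show ?thesis unfolding s2 .
  qed
  have "(sqrt \<epsilon> *\<^sub>R y) \<bullet> (sqrt \<epsilon> *\<^sub>R y) = (sqrt \<epsilon> * sqrt \<epsilon>) * (y \<bullet> y)" by (simp add: mult.assoc)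
  then have nrm: "(sqrt \<epsilon> *\<^sub>R y) \<bullet> (sqrt \<epsilon> *\<^sub>R y) + \<epsilon> = \<epsilon> * Y"
    unfolding s2 Y_def by (simp add: distrib_left)
  show ?thesis unfolding bump4_def assms(2) s4 nrm Y_def[symmetric] using assms(1) Y
    by (simp add: field_simps power3_eq_cube)
qed

text \<open>In polar coordinates the radial density is 8 t^3/(t^2+1)^3, at most 8 t/(t^2+1)^2, which
  is the derivative of -4/(t^2+1).\<close>

lemma integrable_bump4:
  assumes "DIM('a::euclidean_space) = 4"
  shows "integrable lborel (bump4 1 :: 'a \<Rightarrow> real)"
proof (rule integrableI_nonneg)
  have m: "(bump4 1 :: 'a \<Rightarrow> real) \<in> borel_measurable borel" unfolding bump4_def[abs_def] by measurable
  then show "(bump4 1 :: 'a \<Rightarrow> real) \<in> borel_measurable lborel" by simp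
  show "AE x in lborel. 0 \<le> bump4 1 (x::'a)" by (auto simp: bump4_def intro!: divide_nonneg_nonneg add_nonneg_nonneg zero_le_power)
  have "(\<integral>\<^sup>+x. ennreal (bump4 1 (x::'a)) \<partial>lborel) =
    (\<integral>\<^sup>+t. ennreal (t ^ 3) * indicator {0<..} t * (\<integral>\<^sup>+x. ennreal (bump4 1 (t *\<^sub>R (x::'a))) \<partial>sphere_measure) \<partial>lborel)"
    using nn_integral_polar[of "\<lambda>x::'a. ennreal (bump4 1 x)"] m assms by simp
  also have "\<dots> \<le> (\<integral>\<^sup>+t. emeasure sphere_measure (space (sphere_measure :: 'a measure)) * (ennreal (8 * t ^ 3 / (t\<^sup>2 + 1) ^ 3) * indicator {0..} t) \<partial>lborel)"
  proof (rule nn_integral_mono)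
    fix t :: real
    show "ennreal (t ^ 3) * indicator {0<..} t * (\<integral>\<^sup>+x. ennreal (bump4 1 (t *\<^sub>R (x::'a))) \<partial>sphere_measure) \<le>
      emeasure sphere_measure (space (sphere_measure :: 'a measure)) * (ennreal (8 * t ^ 3 / (t\<^sup>2 + 1) ^ 3) * indicator {0..} t)"
    proof (cases "t > 0")
      case True
      have "(\<integral>\<^sup>+x. ennreal (bump4 1 (t *\<^sub>R (x::'a))) \<partial>sphere_measure) = (\<integral>\<^sup>+x. ennreal (8 / (t\<^sup>2 + 1) ^ 3) \<partial>(sphere_measure :: 'a measure))"
        by (rule nn_integral_cong) (simp add: space_sphere_measure bump4_def norm_eq_1 power2_eq_square)
      also have "\<dots> = ennreal (8 / (t\<^sup>2 + 1) ^ 3) * emeasure sphere_measure (space (sphere_measure :: 'a measure))" by simp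
      finally show ?thesis using True by (simp add: ennreal_mult[symmetric] mult_ac flip: mult.assoc)
    qed simp
  qed
  also have "\<dots> = emeasure sphere_measure (space (sphere_measure :: 'a measure)) * (\<integral>\<^sup>+t. ennreal (8 * t ^ 3 / (t\<^sup>2 + 1) ^ 3) * indicator {0..} t \<partial>lborel)"
    by (rule nn_integral_cmult) measurable
  also have "emeasure sphere_measure (space (sphere_measure :: 'a measure)) * (\<integral>\<^sup>+t. ennreal (8 * t ^ 3 / (t\<^sup>2 + 1) ^ 3) * indicator {0..} t \<partial>lborel) \<le>
    emeasure sphere_measure (space (sphere_measure :: 'a measure)) * (\<integral>\<^sup>+t. ennreal (8 * t / (t\<^sup>2 + 1)\<^sup>2) * indicator {0..} t \<partial>lborel)"
  proof (intro mult_left_mono nn_integral_mono zero_le)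
    fix t :: real
    show "ennreal (8 * t ^ 3 / (t\<^sup>2 + 1) ^ 3) * indicator {0..} t \<le> ennreal (8 * t / (t\<^sup>2 + 1)\<^sup>2) * indicator {0..} t"
    proof (cases "t \<ge> 0")
      case True
      have p: "t\<^sup>2 + 1 > 0" by (simp add: add_nonneg_pos)
      have "8 * t ^ 3 / (t\<^sup>2 + 1) ^ 3 = (8 * t / (t\<^sup>2 + 1)\<^sup>2) * (t\<^sup>2 / (t\<^sup>2 + 1))"
        by (simp add: power2_eq_square power3_eq_cube)
      also have "\<dots> \<le> (8 * t / (t\<^sup>2 + 1)\<^sup>2) * 1"
        using True p by (intro mult_left_mono) (auto simp: divide_simps)
      finally show ?thesis using True by (simp add: ennreal_leI)
    qed simp
  qed
  also have "(\<integral>\<^sup>+t. ennreal (8 * t / (t\<^sup>2 + 1)\<^sup>2) * indicator {0..} t \<partial>lborel) = ennreal (0 - (- 4 / (0\<^sup>2 + 1)))"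
  proof (rule nn_integral_FTC_atLeast[where F="\<lambda>t. - 4 / (t\<^sup>2 + 1)"])
    show "((\<lambda>t. - 4 / (t\<^sup>2 + 1)) has_real_derivative 8 * t / (t\<^sup>2 + 1)\<^sup>2) (at t)" for t :: real
    proof -
      have "t\<^sup>2 + 1 \<noteq> 0" by (metis add_nonneg_pos less_irrefl zero_le_power2 zero_less_one)
      then show ?thesis by (auto intro!: derivative_eq_intros simp: power2_eq_square)
    qed
    have "filterlim (\<lambda>t::real. t\<^sup>2 + 1) at_top at_top"
      by (intro filterlim_tendsto_add_at_top[OF tendsto_const, of _ _ 1, simplified add.commute[of 1]] filterlim_pow_at_top filterlim_ident) simp
    from tendsto_mult_right_zero[OF tendsto_inverse_0_at_top[OF this], of "-4"]
    show "((\<lambda>t::real. - 4 / (t\<^sup>2 + 1)) \<longlongrightarrow> 0) at_top" by (simp add: divide_inverse)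
  qed auto
  finally have le: "(\<integral>\<^sup>+x. ennreal (bump4 1 (x::'a)) \<partial>lborel) \<le>
    emeasure sphere_measure (space (sphere_measure :: 'a measure)) * ennreal (0 - (- 4 / (0\<^sup>2 + 1)))" .
  have "emeasure sphere_measure (space (sphere_measure :: 'a measure)) < top"
    unfolding less_top[symmetric] by (rule sphere.emeasure_finite)
  then have "emeasure sphere_measure (space (sphere_measure :: 'a measure)) * ennreal (0 - (- 4 / (0\<^sup>2 + 1))) < \<infinity>"
    unfolding infinity_ennreal_def by (intro ennreal_mult_less_top[THEN iffD2]) simp
  with le show "(\<integral>\<^sup>+x. ennreal (bump4 1 (x::'a)) \<partial>lborel) < \<infinity>" by (rule order.strict_trans1)
qed

text \<open>\<open>bump4 \<epsilon> = - \<Delta> newt \<epsilon>\<close> is an approximate identity in dimension 4.\<close>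

definition mass4 :: "'a::euclidean_space itself \<Rightarrow> real" where
  "mass4 _ = (LINT y|lborel. bump4 1 (y::'a))"

text \<open>The substitution w = z + sqrt(\<epsilon>) y removes \<epsilon> from the kernel by
  \<open>bump4_scale\<close>. The remaining integrand is dominated by C times
  \<open>bump4 1\<close>, and continuity of q at z gives the pointwise limit.\<close>

lemma bump4_approx_identity:
  fixes q :: "'a::euclidean_space \<Rightarrow> real"
  assumes D: "DIM('a) = 4" and q: "q \<in> borel_measurable borel" and C: "\<And>x. \<bar>q x\<bar> \<le> C" and cont: "isCont q z"
    and \<epsilon>: "\<And>m. \<epsilon> m > 0" "\<epsilon> \<longlonglongrightarrow> 0"
  shows "(\<lambda>m. LINT w|lborel. bump4 (\<epsilon> m) (w - z) * q w) \<longlonglongrightarrow> mass4 TYPE('a) * q z"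
    and "\<And>m. \<bar>LINT w|lborel. bump4 (\<epsilon> m) (w - z) * q w\<bar> \<le> mass4 TYPE('a) * C"
    and "\<And>m. integrable lborel (\<lambda>w. bump4 (\<epsilon> m) (w - z) * q w)"
proof -
  note [measurable] = q
  have [measurable]: "(bump4 e :: 'a \<Rightarrow> real) \<in> borel_measurable borel" for e unfolding bump4_def[abs_def] by measurable
  have bpos: "bump4 1 y \<ge> 0" for y :: 'a by (auto simp: bump4_def intro!: divide_nonneg_nonneg add_nonneg_nonneg zero_le_power)
  have C0: "C \<ge> 0" using C[of z] by (auto intro: order_trans[OF abs_ge_zero])
  define F where "F m y = bump4 1 y * q (z + sqrt (\<epsilon> m) *\<^sub>R y)" for m and y :: 'a
  have Fb: "\<bar>F m y\<bar> \<le> C * bump4 1 y" for m y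
    unfolding F_def abs_mult using bpos[of y] C[of "z + sqrt (\<epsilon> m) *\<^sub>R y"] by (simp add: mult.commute[of C] mult_left_mono)
  have Cint: "integrable lborel (\<lambda>y::'a. C * bump4 1 y)" by (intro integrable_mult_right integrable_bump4 D)
  have Fm [measurable]: "F m \<in> borel_measurable borel" for m unfolding F_def[abs_def] by measurable
  have Fi: "integrable lborel (F m)" for m
    by (rule Bochner_Integration.integrable_bound[OF Cint]) (use Fb C0 bpos in \<open>auto simp: abs_mult\<close>)
  have aff: "lborel = density (distr lborel borel (\<lambda>y::'a. z + sqrt (\<epsilon> m) *\<^sub>R y)) (\<lambda>_. ennreal (sqrt (\<epsilon> m) ^ DIM('a)))" for m
    using lborel_affine[of "sqrt (\<epsilon> m)" z] \<epsilon>(1)[of m] by simp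
  have conv: "sqrt (\<epsilon> m) ^ DIM('a) *\<^sub>R (bump4 (\<epsilon> m) ((z + sqrt (\<epsilon> m) *\<^sub>R y) - z) * q (z + sqrt (\<epsilon> m) *\<^sub>R y)) = F m y" for m and y :: 'a
    using bump4_scale[OF \<epsilon>(1)[of m] D, of y] by (simp add: F_def mult.assoc[symmetric])
  have int: "integrable lborel (\<lambda>w. bump4 (\<epsilon> m) (w - z) * q w) \<and> (LINT w|lborel. bump4 (\<epsilon> m) (w - z) * q w) = (LINT y|lborel. F m y)" for m
  proof -
    define g where "g w = bump4 (\<epsilon> m) (w - z) * q w" for w
    define T where "T y = z + sqrt (\<epsilon> m) *\<^sub>R y" for y
    define c where "c = sqrt (\<epsilon> m) ^ DIM('a)"
    have [measurable]: "g \<in> borel_measurable borel" unfolding g_def[abs_def] by measurable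
    have [measurable]: "T \<in> borel_measurable borel" unfolding T_def[abs_def] by measurable
    have c0: "0 \<le> c" unfolding c_def using \<epsilon>(1)[of m] by simp
    have aff': "lborel = density (distr lborel borel T) (\<lambda>_. ennreal c)"
      using aff[of m] unfolding T_def[abs_def] c_def .
    have cg: "(\<lambda>y. c *\<^sub>R g (T y)) = F m"
      using conv[of m] unfolding g_def T_def c_def by (rule ext)
    have "integrable (distr lborel borel T) (\<lambda>w. c *\<^sub>R g w)"
      by (subst integrable_distr_eq, measurable) (simp only: cg Fi)
    then have "integrable (density (distr lborel borel T) (\<lambda>_. ennreal c)) g"
      by (subst integrable_density) (use c0 in simp_all)
    then have 1: "integrable lborel g" unfolding aff'[symmetric] .
    have "integral\<^sup>L (density (distr lborel borel T) (\<lambda>_. ennreal c)) g = (LINT w|distr lborel borel T. c *\<^sub>R g w)"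
      by (rule integral_density) (use c0 in simp_all)
    also have "\<dots> = (LINT y|lborel. c *\<^sub>R g (T y))" by (rule integral_distr) measurable
    finally have 2: "integral\<^sup>L lborel g = (LINT y|lborel. F m y)" unfolding aff'[symmetric] cg .
    show ?thesis using 1 2 unfolding g_def by blast
  qed
  show "\<And>m. integrable lborel (\<lambda>w. bump4 (\<epsilon> m) (w - z) * q w)" using int by blast
  show "\<bar>LINT w|lborel. bump4 (\<epsilon> m) (w - z) * q w\<bar> \<le> mass4 TYPE('a) * C" for m
  proof -
    have "\<bar>LINT y|lborel. F m y\<bar> \<le> (LINT y|lborel. \<bar>F m y\<bar>)" using integral_norm_bound[of lborel "F m"] by simp
    also have "\<dots> \<le> (LINT y|lborel. C * bump4 1 (y::'a))" using Fi Cint Fb by (intro integral_mono) auto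
    finally show ?thesis using int[of m] by (simp add: mass4_def mult.commute)
  qed
  have "(\<lambda>m. LINT y|lborel. F m y) \<longlonglongrightarrow> (LINT y|lborel. bump4 1 (y::'a) * q z)"
  proof (rule integral_dominated_convergence[OF _ _ Cint])
    show "AE y in lborel. (\<lambda>m. F m y) \<longlonglongrightarrow> bump4 1 y * q z"
    proof (rule AE_I2)
      fix y :: 'a
      have "(\<lambda>m. z + sqrt (\<epsilon> m) *\<^sub>R y) \<longlonglongrightarrow> z + sqrt 0 *\<^sub>R y" by (intro tendsto_intros \<epsilon>(2))
      then have "(\<lambda>m. q (z + sqrt (\<epsilon> m) *\<^sub>R y)) \<longlonglongrightarrow> q z" using isCont_tendsto_compose[OF cont] by simp
      then show "(\<lambda>m. F m y) \<longlonglongrightarrow> bump4 1 y * q z" unfolding F_def by (intro tendsto_intros)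
    qed
    show "AE y in lborel. norm (F m y) \<le> C * bump4 1 y" for m using Fb by auto
  qed auto
  then show "(\<lambda>m. LINT w|lborel. bump4 (\<epsilon> m) (w - z) * q w) \<longlonglongrightarrow> mass4 TYPE('a) * q z"
    using int by (simp add: mass4_def)
qed

section \<open>Convolution on the ball\<close>

text \<open>For the even kernels \<open>newt\<close> and \<open>bump4\<close> the argument w - z
  gives the same as z - w, but each derivative in z acquires a minus sign; hence the kernel
  \<open>- dnewt 0 e\<close> for the gradient of the potential.\<close>

definition conv :: "'a measure \<Rightarrow> ('a::euclidean_space \<Rightarrow> real) \<Rightarrow> ('a \<Rightarrow> 'b::euclidean_space) \<Rightarrow> 'a \<Rightarrow> 'b" where
  "conv M \<kappa> f z = (LINT w|M. \<kappa> (w - z) *\<^sub>R f w)"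

text \<open>A remainder quadratic in y - x and uniform on a ball, from Lipschitz bounds for the
  partial derivatives. It gives \<open>conv_has_derivative\<close> an explicit error term.\<close>

lemma smooth_Taylor1:
  fixes \<kappa> :: "'a::euclidean_space \<Rightarrow> real"
  assumes "smooth \<kappa>"
  obtains L where "L \<ge> 0" "\<And>x y. x \<in> cball 0 R \<Longrightarrow> y \<in> cball 0 R \<Longrightarrow>
     \<bar>\<kappa> y - \<kappa> x - frechet_derivative \<kappa> (at x) (y - x)\<bar> \<le> L * norm (y - x) * norm (y - x)"
proof -
  have "\<exists>L. L \<ge> 0 \<and> (\<forall>x\<in>cball 0 R. \<forall>y\<in>cball 0 R. \<bar>frechet_derivative \<kappa> (at x) b - frechet_derivative \<kappa> (at y) b\<bar> \<le> L * norm (x - y))" for b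
  proof -
    have "cont_diff 1 (\<lambda>x. frechet_derivative \<kappa> (at x) b)" using smooth_directional[OF assms] by (simp only: smooth_def)
    from cont_diff1_Lipschitz_cball[OF this, of R] show ?thesis by metis
  qed
  then obtain L where L: "\<And>b. L b \<ge> 0" "\<And>b x y. x \<in> cball 0 R \<Longrightarrow> y \<in> cball 0 R \<Longrightarrow>
     \<bar>frechet_derivative \<kappa> (at x) b - frechet_derivative \<kappa> (at y) b\<bar> \<le> L b * norm (x - y)" by metis
  define C where "C = (\<Sum>b\<in>(Basis::'a set). L b)"
  have C0: "C \<ge> 0" by (simp add: C_def sum_nonneg L)
  have on: "onorm (\<lambda>v. frechet_derivative \<kappa> (at x) v - frechet_derivative \<kappa> (at y) v) \<le> C * norm (x - y)"
    if "x \<in> cball 0 R" "y \<in> cball 0 R" for x y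
  proof (rule onorm_le)
    fix v
    have "frechet_derivative \<kappa> (at x) v - frechet_derivative \<kappa> (at y) v =
      (\<Sum>b\<in>Basis. (v \<bullet> b) *\<^sub>R (frechet_derivative \<kappa> (at x) b - frechet_derivative \<kappa> (at y) b))"
      using has_derivative_euclidean_expand[OF smooth_has_derivative[OF assms], of x v]
        has_derivative_euclidean_expand[OF smooth_has_derivative[OF assms], of y v]
      by (simp add: sum_subtractf right_diff_distrib)
    also have "norm \<dots> \<le> (\<Sum>b\<in>Basis. norm v * (L b * norm (x - y)))"
      by (rule sum_norm_le) (auto intro!: mult_mono Basis_le_norm L(2)[OF that] simp: abs_mult)
    also have "\<dots> = C * norm (x - y) * norm v" by (simp add: C_def sum_distrib_left sum_distrib_right mult_ac)
    finally show "norm (frechet_derivative \<kappa> (at x) v - frechet_derivative \<kappa> (at y) v) \<le> C * norm (x - y) * norm v" .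
  qed
  show ?thesis
  proof (rule that[OF C0])
    fix x y :: 'a assume xy: "x \<in> cball 0 R" "y \<in> cball 0 R"
    have seg: "closed_segment x y \<subseteq> cball 0 R" using xy by (intro closed_segment_subset) auto
    have "norm (\<kappa> y - \<kappa> x - frechet_derivative \<kappa> (at x) (y - x)) \<le> norm (y - x) * (C * norm (y - x))"
    proof (rule differentiable_bound_linearization[where S="closed_segment x y" and f'="\<lambda>x. frechet_derivative \<kappa> (at x)"])
      show "x + t *\<^sub>R (y - x) \<in> closed_segment x y" if "t \<in> {0..1}" for t
        using that by (auto simp: closed_segment_def algebra_simps intro!: exI[of _ t])
      show "(\<kappa> has_derivative frechet_derivative \<kappa> (at u)) (at u within closed_segment x y)" for u
        by (rule has_derivative_at_withinI[OF smooth_has_derivative[OF assms]])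
      show "onorm (frechet_derivative \<kappa> (at u) - frechet_derivative \<kappa> (at x)) \<le> C * norm (y - x)"
        if "u \<in> closed_segment x y" for u
      proof -
        have "norm (u - x) \<le> norm (y - x)" using that segment_bound(1) by blast
        then have "C * norm (u - x) \<le> C * norm (y - x)" by (intro mult_left_mono C0)
        then show ?thesis using on[of u x] that seg xy unfolding fun_diff_def by (auto intro: order_trans)
      qed
    qed auto
    then show "\<bar>\<kappa> y - \<kappa> x - frechet_derivative \<kappa> (at x) (y - x)\<bar> \<le> C * norm (y - x) * norm (y - x)"
      by (simp add: mult_ac)
  qed
qed

text \<open>The common setting of volume potentials (Lebesgue measure on the ball) and single layer
  potentials (\<open>sphere_measure\<close>). Kernels are real, so measurability is demanded of real
  functions.\<close>

definition ball_measure :: "'a::euclidean_space measure \<Rightarrow> bool" where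
  "ball_measure M \<longleftrightarrow> (\<forall>g :: 'a \<Rightarrow> real. g \<in> borel_measurable borel \<longrightarrow> g \<in> borel_measurable M) \<and> space M \<subseteq> cball 0 1"

lemma ball_measureD:
  assumes "ball_measure M"
  shows "\<And>g :: 'a::euclidean_space \<Rightarrow> real. g \<in> borel_measurable borel \<Longrightarrow> g \<in> borel_measurable M"
    and "space M \<subseteq> cball 0 1"
  using assms by (auto simp: ball_measure_def)

lemma ball_measure_instances: "ball_measure (lebesgue_on (ball 0 1))" "ball_measure sphere_measure"
  by (auto simp: ball_measure_def space_sphere_measure intro: borel_measurable_lebesgue_on borel_measurable_sphere_measure)

lemma conv_integrand:
  fixes f :: "'a::euclidean_space \<Rightarrow> 'b::euclidean_space"
  assumes M: "ball_measure M"
    and f: "integrable M f" and \<kappa>: "smooth \<kappa>"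
  shows "integrable M (\<lambda>w. \<kappa> (w - z) *\<^sub>R f w)"
proof -
  have s: "smooth (\<lambda>w. \<kappa> (w - z))" using smooth_affine_compose[OF \<kappa>, of 1 "- z"] by simp
  obtain C where C: "\<And>w. norm w \<le> 1 \<Longrightarrow> norm (\<kappa> (w - z)) \<le> C" using smooth_bound_on_cball[OF s, of 1] by metis
  show ?thesis
    by (rule integrable_bounded_scaleR[OF f ball_measureD(1)[OF M smooth_borel[OF s]], of C]) (use C ball_measureD(2)[OF M] in auto)
qed

lemma conv_has_derivative:
  fixes f :: "'a::euclidean_space \<Rightarrow> 'b::euclidean_space"
  assumes M: "ball_measure M"
    and f: "integrable M f" and \<kappa>: "smooth \<kappa>"
  shows "(conv M \<kappa> f has_derivative (\<lambda>h. - conv M (\<lambda>x. frechet_derivative \<kappa> (at x) h) f z)) (at z)"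
proof -
  let ?D = "\<lambda>h x. frechet_derivative \<kappa> (at x) h"
  note i = conv_integrand[OF M f]
  have Di: "integrable M (\<lambda>w. ?D h (w - z) *\<^sub>R f w)" for h by (rule i[OF smooth_directional[OF \<kappa>]])
  have lin: "?D (h + h') x = ?D h x + ?D h' x" "?D (c *\<^sub>R h) x = c * ?D h x" for h h' c x
    using linear_add[OF has_derivative_linear[OF smooth_has_derivative[OF \<kappa>]]]
      linear_scale[OF has_derivative_linear[OF smooth_has_derivative[OF \<kappa>]]] by auto
  have L: "linear (\<lambda>h. - conv M (?D h) f z)"
    unfolding conv_def
    by (rule linearI) (simp_all add: lin scaleR_add_left Di flip: scaleR_scaleR)
  \<comment> \<open>\<open>cball 0 R\<close> contains w - z and w - y for every w in the closed unit
    ball and every y within distance 1 of z.\<close>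
  define R where "R = norm z + 2"
  obtain C where C: "C \<ge> 0" "\<And>x y. x \<in> cball 0 R \<Longrightarrow> y \<in> cball 0 R \<Longrightarrow>
     \<bar>\<kappa> y - \<kappa> x - ?D (y - x) x\<bar> \<le> C * norm (y - x) * norm (y - x)"
    using smooth_Taylor1[OF \<kappa>, of R] by metis
  define I where "I = (LINT w|M. norm (f w))"
  show ?thesis
  proof (rule has_derivativeI_sandwich[of 1])
    show "bounded_linear (\<lambda>h. - conv M (?D h) f z)" using L by (rule linear_conv_bounded_linear[THEN iffD1])
    show "((\<lambda>y. C * I * norm (y - z)) \<longlongrightarrow> 0) (at z)"
      by (rule tendsto_eq_intros refl | simp)+
    fix y assume y: "y \<noteq> z" "dist y z < 1"
    have "conv M \<kappa> f y - conv M \<kappa> f z - - conv M (?D (y - z)) f z =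
      (LINT w|M. (\<kappa> (w - y) - \<kappa> (w - z) + ?D (y - z) (w - z)) *\<^sub>R f w)"
      unfolding conv_def scaleR_add_left scaleR_diff_left
      by (simp add: i[OF \<kappa>] Di)
    also have "norm \<dots> \<le> (LINT w|M. C * norm (y - z) * norm (y - z) * norm (f w))"
    proof (rule Bochner_Integration.integral_norm_bound_integral)
      have "integrable M (\<lambda>w. (\<kappa> (w - y)) *\<^sub>R f w - \<kappa> (w - z) *\<^sub>R f w + ?D (y - z) (w - z) *\<^sub>R f w)"
        by (intro Bochner_Integration.integrable_add Bochner_Integration.integrable_diff i[OF \<kappa>] Di)
      then show "integrable M (\<lambda>w. (\<kappa> (w - y) - \<kappa> (w - z) + ?D (y - z) (w - z)) *\<^sub>R f w)"
        by (simp only: scaleR_add_left scaleR_diff_left)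
      show "integrable M (\<lambda>w. C * norm (y - z) * norm (y - z) * norm (f w))" using f by simp
      fix w assume "w \<in> space M"
      then have w: "norm w \<le> 1" using ball_measureD(2)[OF M] by auto
      have n: "norm y \<le> norm z + 1" using y norm_triangle_sub[of y z] by (simp add: dist_norm)
      have "w - z \<in> cball 0 R" "w - y \<in> cball 0 R"
        using w n norm_triangle_ineq4[of w z] norm_triangle_ineq4[of w y] by (auto simp: R_def)
      from C(2)[OF this]
      have "\<bar>\<kappa> (w - y) - \<kappa> (w - z) - ?D (z - y) (w - z)\<bar> \<le> C * norm (y - z) * norm (y - z)"
        by (simp add: norm_minus_commute)
      moreover have "?D (z - y) (w - z) = - ?D (y - z) (w - z)" using lin(2)[where c="-1" and h="y - z" and x="w - z"] by simp
      ultimately show "norm ((\<kappa> (w - y) - \<kappa> (w - z) + ?D (y - z) (w - z)) *\<^sub>R f w) \<le> C * norm (y - z) * norm (y - z) * norm (f w)"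
        by (simp add: mult_right_mono)
    qed
    also have "\<dots> = C * I * norm (y - z) * norm (y - z)" by (simp add: I_def)
    finally show "norm (conv M \<kappa> f y - conv M \<kappa> f z - - conv M (?D (y - z)) f z) / norm (y - z) \<le> C * I * norm (y - z)"
      using y by (simp add: divide_le_eq)
  qed simp
qed

text \<open>Induction on the order for all kernels at once: the derivative of a convolution is a
  convolution with the differentiated kernel.\<close>

lemma smooth_conv:
  fixes f :: "'a::euclidean_space \<Rightarrow> 'b::euclidean_space"
  assumes M: "ball_measure M"
    and f: "integrable M f" and \<kappa>: "smooth \<kappa>"
  shows "smooth (conv M \<kappa> f)"
proof -
  note d = conv_has_derivative[OF M f]
  have "cd_on k UNIV (conv M \<kappa> f)" if "smooth \<kappa>" for k and \<kappa>
    using that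
  proof (induction k arbitrary: \<kappa>)
    case 0
    have "continuous (at z) (conv M \<kappa> f)" for z by (rule has_derivative_continuous[OF d[OF 0]])
    then show ?case by (simp add: continuous_at_imp_continuous_on)
  next
    case (Suc k)
    show ?case
    proof (rule cd_on_SucI[OF open_UNIV d[OF Suc.prems]])
      fix h
      have "cd_on k UNIV (conv M (\<lambda>x. frechet_derivative \<kappa> (at x) h) f)" by (rule Suc.IH[OF smooth_directional[OF Suc.prems]])
      then show "cd_on k UNIV (\<lambda>z. - conv M (\<lambda>x. frechet_derivative \<kappa> (at x) h) f z)"
        by (rule cd_on_bounded_linear_comp[OF open_UNIV bounded_linear_minus[OF bounded_linear_ident]])
    qed
  qed
  then show ?thesis using \<kappa> by (simp add: smooth_iff_cd_on)
qed

section \<open>Square-integrable bounds for convolutions\<close>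

lemma nn_integral_shift:
  fixes g :: "'a::euclidean_space \<Rightarrow> ennreal"
  assumes [measurable]: "g \<in> borel_measurable borel"
  shows "(\<integral>\<^sup>+w. g (w - z) \<partial>lborel) = (\<integral>\<^sup>+x. g x \<partial>lborel)" "(\<integral>\<^sup>+z. g (w - z) \<partial>lborel) = (\<integral>\<^sup>+x. g x \<partial>lborel)"
proof -
  have "(\<integral>\<^sup>+x. g x \<partial>distr lborel borel ((+) (- z))) = (\<integral>\<^sup>+x. g (- z + x) \<partial>lborel)" by (subst nn_integral_distr) auto
  then show "(\<integral>\<^sup>+w. g (w - z) \<partial>lborel) = (\<integral>\<^sup>+x. g x \<partial>lborel)" by (simp add: lborel_distr_plus)
  have "(lborel :: 'a measure) = density (distr lborel borel (\<lambda>x. w + (-1) *\<^sub>R x)) (\<lambda>_. ennreal (\<bar>-1\<bar> ^ DIM('a)))"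
    using lborel_affine[of "-1" w] by simp
  then have "(lborel :: 'a measure) = distr lborel borel (\<lambda>x. w - x)" by (simp add: density_1)
  then have "(\<integral>\<^sup>+x. g x \<partial>lborel) = (\<integral>\<^sup>+x. g x \<partial>distr lborel borel (\<lambda>x. w - x))" by simp
  then show "(\<integral>\<^sup>+z. g (w - z) \<partial>lborel) = (\<integral>\<^sup>+x. g x \<partial>lborel)" by (subst (asm) nn_integral_distr) auto
qed

text \<open>Differences of points of the unit ball lie in \<open>ball 0 2\<close>. Both variables
  are covered because \<open>conv_Young\<close> integrates the kernel in each of them.\<close>

lemma nn_integral_kernel_ball:
  fixes \<kappa> :: "'a::euclidean_space \<Rightarrow> real"
  assumes [measurable]: "\<kappa> \<in> borel_measurable borel" and y: "y \<in> ball 0 1"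
  shows "(\<integral>\<^sup>+w. ennreal \<bar>\<kappa> (w - y)\<bar> \<partial>lebesgue_on (ball 0 1)) \<le> (\<integral>\<^sup>+x. ennreal \<bar>\<kappa> x\<bar> * indicator (ball 0 2) x \<partial>lborel)"
    and "(\<integral>\<^sup>+z. ennreal \<bar>\<kappa> (y - z)\<bar> \<partial>lebesgue_on (ball 0 1)) \<le> (\<integral>\<^sup>+x. ennreal \<bar>\<kappa> x\<bar> * indicator (ball 0 2) x \<partial>lborel)"
proof -
  have [measurable]: "ball (0::'a) 2 \<in> sets borel" by simp
  have in2: "norm (w - y) < 2" "norm (y - w) < 2" if "norm w < 1" for w
    using that y norm_triangle_ineq4[of w y] norm_minus_commute[of w y] by auto
  have "(\<integral>\<^sup>+w. ennreal \<bar>\<kappa> (w - y)\<bar> \<partial>lebesgue_on (ball 0 1)) = (\<integral>\<^sup>+w. ennreal \<bar>\<kappa> (w - y)\<bar> * indicator (ball 0 1) w \<partial>lborel)"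
    by (simp add: nn_integral_restrict_space nn_integral_completion)
  also have "\<dots> \<le> (\<integral>\<^sup>+w. ennreal \<bar>\<kappa> (w - y)\<bar> * indicator (ball 0 2) (w - y) \<partial>lborel)"
    using in2 by (intro nn_integral_mono) (auto simp: indicator_def)
  also have "\<dots> = (\<integral>\<^sup>+x. ennreal \<bar>\<kappa> x\<bar> * indicator (ball 0 2) x \<partial>lborel)"
    by (rule nn_integral_shift(1)[of "\<lambda>x. ennreal \<bar>\<kappa> x\<bar> * indicator (ball 0 2) x"]) measurable
  finally show "(\<integral>\<^sup>+w. ennreal \<bar>\<kappa> (w - y)\<bar> \<partial>lebesgue_on (ball 0 1)) \<le> (\<integral>\<^sup>+x. ennreal \<bar>\<kappa> x\<bar> * indicator (ball 0 2) x \<partial>lborel)" .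
  have "(\<integral>\<^sup>+z. ennreal \<bar>\<kappa> (y - z)\<bar> \<partial>lebesgue_on (ball 0 1)) = (\<integral>\<^sup>+z. ennreal \<bar>\<kappa> (y - z)\<bar> * indicator (ball 0 1) z \<partial>lborel)"
    by (simp add: nn_integral_restrict_space nn_integral_completion)
  also have "\<dots> \<le> (\<integral>\<^sup>+z. ennreal \<bar>\<kappa> (y - z)\<bar> * indicator (ball 0 2) (y - z) \<partial>lborel)"
    using in2 by (intro nn_integral_mono) (auto simp: indicator_def)
  also have "\<dots> = (\<integral>\<^sup>+x. ennreal \<bar>\<kappa> x\<bar> * indicator (ball 0 2) x \<partial>lborel)"
    by (rule nn_integral_shift(2)[of "\<lambda>x. ennreal \<bar>\<kappa> x\<bar> * indicator (ball 0 2) x"]) measurable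
  finally show "(\<integral>\<^sup>+z. ennreal \<bar>\<kappa> (y - z)\<bar> \<partial>lebesgue_on (ball 0 1)) \<le> (\<integral>\<^sup>+x. ennreal \<bar>\<kappa> x\<bar> * indicator (ball 0 2) x \<partial>lborel)" .
qed

lemma borel_imp_lebesgue_on_id: "(\<lambda>x. x) \<in> lebesgue_on S \<rightarrow>\<^sub>M borel"
  by (rule borel_measurable_lebesgue_on) simp

text \<open>The Schur test: Cauchy-Schwarz for the factors sqrt|\<kappa>| and sqrt|\<kappa>| |f|,
  then Tonelli, with N bounding the kernel integral in either variable. Finiteness of the bound also
  shows that the convolution integral converges for almost every z.\<close>

lemma conv_Young:
  fixes f :: "'a::euclidean_space \<Rightarrow> 'b::euclidean_space" and \<kappa> :: "'a \<Rightarrow> real"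
  assumes \<kappa>: "\<kappa> \<in> borel_measurable borel" and N: "(\<integral>\<^sup>+x. ennreal \<bar>\<kappa> x\<bar> * indicator (ball 0 2) x \<partial>lborel) = ennreal N" and N0: "0 \<le> N"
    and f: "square_integrable (lebesgue_on (ball 0 1)) f"
  defines "M \<equiv> lebesgue_on (ball (0::'a) 1)"
  shows "(\<integral>\<^sup>+z. (\<integral>\<^sup>+w. ennreal (\<bar>\<kappa> (w - z)\<bar> * norm (f w)) \<partial>M)\<^sup>2 \<partial>M) \<le> ennreal (N\<^sup>2) * (\<integral>\<^sup>+w. ennreal ((norm (f w))\<^sup>2) \<partial>M)"
    and "AE z in M. integrable M (\<lambda>w. \<kappa> (w - z) *\<^sub>R f w)"
    and "conv M \<kappa> f \<in> borel_measurable M"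
    and "(\<integral>\<^sup>+z. ennreal ((norm (conv M \<kappa> f z))\<^sup>2) \<partial>M) \<le> ennreal (N\<^sup>2) * (\<integral>\<^sup>+w. ennreal ((norm (f w))\<^sup>2) \<partial>M)"
proof -
  interpret M: finite_measure M unfolding M_def by (rule finite_measure_lebesgue_on_ball)
  interpret P: pair_sigma_finite M M by unfold_locales
  note [measurable] = \<kappa>
  have [measurable]: "f \<in> borel_measurable M" using f by (simp add: square_integrable_def M_def)
  have [measurable]: "(\<lambda>x. x) \<in> M \<rightarrow>\<^sub>M borel" unfolding M_def by (rule borel_imp_lebesgue_on_id)
  have [measurable]: "fst \<in> M \<Otimes>\<^sub>M M \<rightarrow>\<^sub>M borel" "snd \<in> M \<Otimes>\<^sub>M M \<rightarrow>\<^sub>M borel"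
    using measurable_compose[OF measurable_fst[of M M] \<open>(\<lambda>x. x) \<in> M \<rightarrow>\<^sub>M borel\<close>] measurable_compose[OF measurable_snd[of M M] \<open>(\<lambda>x. x) \<in> M \<rightarrow>\<^sub>M borel\<close>]
    by simp_all
  have km [measurable]: "(\<lambda>p. \<kappa> (snd p - fst p)) \<in> borel_measurable (M \<Otimes>\<^sub>M M)"
    by (rule measurable_compose[OF _ \<kappa>]) (intro borel_measurable_diff; measurable)
  have km2 [measurable]: "(\<lambda>w. \<kappa> (w - z)) \<in> borel_measurable M" for z
    by (rule measurable_compose[OF _ \<kappa>]) (intro borel_measurable_diff; measurable)
  have fm: "(\<lambda>p. f (snd p)) \<in> borel_measurable (M \<Otimes>\<^sub>M M)" by (rule measurable_compose[OF measurable_snd]) fact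
  have K1: "(\<integral>\<^sup>+w. ennreal \<bar>\<kappa> (w - y)\<bar> \<partial>M) \<le> ennreal N" "(\<integral>\<^sup>+z. ennreal \<bar>\<kappa> (y - z)\<bar> \<partial>M) \<le> ennreal N" if "y \<in> space M" for y
    using nn_integral_kernel_ball[OF \<kappa>, of y] that N by (auto simp: M_def)
  have CS: "(\<integral>\<^sup>+w. ennreal (\<bar>\<kappa> (w - z)\<bar> * norm (f w)) \<partial>M)\<^sup>2 \<le> ennreal N * (\<integral>\<^sup>+w. ennreal (\<bar>\<kappa> (w - z)\<bar> * (norm (f w))\<^sup>2) \<partial>M)" if z: "z \<in> space M" for z
  proof -
    have "(\<integral>\<^sup>+w. ennreal (sqrt \<bar>\<kappa> (w - z)\<bar>) * ennreal (sqrt \<bar>\<kappa> (w - z)\<bar> * norm (f w)) \<partial>M)\<^sup>2 \<le>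
      (\<integral>\<^sup>+w. (ennreal (sqrt \<bar>\<kappa> (w - z)\<bar>))\<^sup>2 \<partial>M) * (\<integral>\<^sup>+w. (ennreal (sqrt \<bar>\<kappa> (w - z)\<bar> * norm (f w)))\<^sup>2 \<partial>M)"
      by (rule Cauchy_Schwarz_nn_integral) measurable
    moreover have "ennreal (sqrt \<bar>\<kappa> (w - z)\<bar>) * ennreal (sqrt \<bar>\<kappa> (w - z)\<bar> * norm (f w)) = ennreal (\<bar>\<kappa> (w - z)\<bar> * norm (f w))" for w
      by (simp add: ennreal_mult[symmetric] mult.assoc[symmetric])
    moreover have "(ennreal (sqrt \<bar>\<kappa> (w - z)\<bar>))\<^sup>2 = ennreal \<bar>\<kappa> (w - z)\<bar>" for w by (simp add: ennreal_power)
    moreover have "(ennreal (sqrt \<bar>\<kappa> (w - z)\<bar> * norm (f w)))\<^sup>2 = ennreal (\<bar>\<kappa> (w - z)\<bar> * (norm (f w))\<^sup>2)" for w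
      by (simp add: ennreal_power power_mult_distrib)
    ultimately have "(\<integral>\<^sup>+w. ennreal (\<bar>\<kappa> (w - z)\<bar> * norm (f w)) \<partial>M)\<^sup>2 \<le>
       (\<integral>\<^sup>+w. ennreal \<bar>\<kappa> (w - z)\<bar> \<partial>M) * (\<integral>\<^sup>+w. ennreal (\<bar>\<kappa> (w - z)\<bar> * (norm (f w))\<^sup>2) \<partial>M)" by simp
    also have "\<dots> \<le> ennreal N * (\<integral>\<^sup>+w. ennreal (\<bar>\<kappa> (w - z)\<bar> * (norm (f w))\<^sup>2) \<partial>M)"
      by (intro mult_right_mono K1(1)[OF z]) auto
    finally show ?thesis .
  qed
  have mm: "(\<lambda>(z, w). ennreal (\<bar>\<kappa> (w - z)\<bar> * (norm (f w))\<^sup>2)) \<in> borel_measurable (M \<Otimes>\<^sub>M M)"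
    using km fm unfolding split_beta by measurable
  have "(\<integral>\<^sup>+z. (\<integral>\<^sup>+w. ennreal (\<bar>\<kappa> (w - z)\<bar> * norm (f w)) \<partial>M)\<^sup>2 \<partial>M) \<le> (\<integral>\<^sup>+z. ennreal N * (\<integral>\<^sup>+w. ennreal (\<bar>\<kappa> (w - z)\<bar> * (norm (f w))\<^sup>2) \<partial>M) \<partial>M)"
    by (rule nn_integral_mono) (rule CS)
  also have "\<dots> = ennreal N * (\<integral>\<^sup>+z. (\<integral>\<^sup>+w. ennreal (\<bar>\<kappa> (w - z)\<bar> * (norm (f w))\<^sup>2) \<partial>M) \<partial>M)"
    using M.borel_measurable_nn_integral[OF mm] by (intro nn_integral_cmult) simp
  also have "(\<integral>\<^sup>+z. (\<integral>\<^sup>+w. ennreal (\<bar>\<kappa> (w - z)\<bar> * (norm (f w))\<^sup>2) \<partial>M) \<partial>M) = (\<integral>\<^sup>+w. (\<integral>\<^sup>+z. ennreal (\<bar>\<kappa> (w - z)\<bar> * (norm (f w))\<^sup>2) \<partial>M) \<partial>M)"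
    by (rule P.Fubini'[OF mm, symmetric])
  also have "ennreal N * \<dots> \<le> ennreal N * (\<integral>\<^sup>+w. ennreal N * ennreal ((norm (f w))\<^sup>2) \<partial>M)"
  proof (intro mult_left_mono nn_integral_mono zero_le)
    fix w assume w: "w \<in> space M"
    have [measurable]: "(\<lambda>z. \<kappa> (w - z)) \<in> borel_measurable M"
      by (rule measurable_compose[OF _ \<kappa>]) (intro borel_measurable_diff; measurable)
    have "(\<integral>\<^sup>+z. ennreal (\<bar>\<kappa> (w - z)\<bar> * (norm (f w))\<^sup>2) \<partial>M) = (\<integral>\<^sup>+z. ennreal \<bar>\<kappa> (w - z)\<bar> \<partial>M) * ennreal ((norm (f w))\<^sup>2)"
      by (subst nn_integral_multc[symmetric]) (auto simp: ennreal_mult)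
    also have "\<dots> \<le> ennreal N * ennreal ((norm (f w))\<^sup>2)" by (intro mult_right_mono K1(2)[OF w] zero_le)
    finally show "(\<integral>\<^sup>+z. ennreal (\<bar>\<kappa> (w - z)\<bar> * (norm (f w))\<^sup>2) \<partial>M) \<le> ennreal N * ennreal ((norm (f w))\<^sup>2)" .
  qed
  also have "(\<integral>\<^sup>+w. ennreal N * ennreal ((norm (f w))\<^sup>2) \<partial>M) = ennreal N * (\<integral>\<^sup>+w. ennreal ((norm (f w))\<^sup>2) \<partial>M)"
    by (rule nn_integral_cmult) measurable
  finally show Y: "(\<integral>\<^sup>+z. (\<integral>\<^sup>+w. ennreal (\<bar>\<kappa> (w - z)\<bar> * norm (f w)) \<partial>M)\<^sup>2 \<partial>M) \<le> ennreal (N\<^sup>2) * (\<integral>\<^sup>+w. ennreal ((norm (f w))\<^sup>2) \<partial>M)"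
    using N0 by (simp add: power2_eq_square ennreal_mult mult.assoc)
  have fin: "(\<integral>\<^sup>+w. ennreal ((norm (f w))\<^sup>2) \<partial>M) < \<infinity>"
    using f by (simp add: square_integrable_def M_def integrable_iff_bounded)
  have mm1: "(\<lambda>(z, w). ennreal (\<bar>\<kappa> (w - z)\<bar> * norm (f w))) \<in> borel_measurable (M \<Otimes>\<^sub>M M)"
    using km fm unfolding split_beta by measurable
  have mz: "(\<lambda>z. (\<integral>\<^sup>+w. ennreal (\<bar>\<kappa> (w - z)\<bar> * norm (f w)) \<partial>M)\<^sup>2) \<in> borel_measurable M"
    using M.borel_measurable_nn_integral[OF mm1] by simp
  have "(\<integral>\<^sup>+z. (\<integral>\<^sup>+w. ennreal (\<bar>\<kappa> (w - z)\<bar> * norm (f w)) \<partial>M)\<^sup>2 \<partial>M) \<noteq> \<infinity>"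
  proof -
    have "ennreal (N\<^sup>2) * (\<integral>\<^sup>+w. ennreal ((norm (f w))\<^sup>2) \<partial>M) < \<infinity>"
      unfolding infinity_ennreal_def using fin by (intro ennreal_mult_less_top[THEN iffD2]) simp
    with Y show ?thesis unfolding infinity_ennreal_def less_top by (rule order.strict_trans1)
  qed
  from nn_integral_PInf_AE[OF mz this]
  show "AE z in M. integrable M (\<lambda>w. \<kappa> (w - z) *\<^sub>R f w)"
  proof eventually_elim
    fix z assume "(\<integral>\<^sup>+w. ennreal (\<bar>\<kappa> (w - z)\<bar> * norm (f w)) \<partial>M)\<^sup>2 \<noteq> \<infinity>"
    then have "(\<integral>\<^sup>+w. ennreal (\<bar>\<kappa> (w - z)\<bar> * norm (f w)) \<partial>M) < \<infinity>" by (auto simp: less_top[symmetric] power2_eq_square)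
    then show "integrable M (\<lambda>w. \<kappa> (w - z) *\<^sub>R f w)"
      by (intro integrableI_bounded) (auto intro!: borel_measurable_scaleR)
  qed
  have mc: "(\<lambda>(z, w). \<kappa> (w - z) *\<^sub>R f w) \<in> borel_measurable (M \<Otimes>\<^sub>M M)"
    using km fm unfolding split_beta by (rule borel_measurable_scaleR)
  show "conv M \<kappa> f \<in> borel_measurable M"
    unfolding conv_def[abs_def] using M.borel_measurable_lebesgue_integral[OF mc] by simp
  have "(\<integral>\<^sup>+z. ennreal ((norm (conv M \<kappa> f z))\<^sup>2) \<partial>M) \<le> (\<integral>\<^sup>+z. (\<integral>\<^sup>+w. ennreal (\<bar>\<kappa> (w - z)\<bar> * norm (f w)) \<partial>M)\<^sup>2 \<partial>M)"
  proof (rule nn_integral_mono)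
    fix z
    have "ennreal (norm (conv M \<kappa> f z)) \<le> (\<integral>\<^sup>+w. ennreal (\<bar>\<kappa> (w - z)\<bar> * norm (f w)) \<partial>M)"
    proof (cases "integrable M (\<lambda>w. \<kappa> (w - z) *\<^sub>R f w)")
      case True
      from integral_norm_bound_ennreal[OF True] show ?thesis by (simp add: conv_def)
    next
      \<comment> \<open>Where the integral diverges its value is 0 by convention, so the bound holds
        for every z.\<close>
      case False
      then show ?thesis by (simp add: conv_def not_integrable_integral_eq)
    qed
    then have "(ennreal (norm (conv M \<kappa> f z)))\<^sup>2 \<le> (\<integral>\<^sup>+w. ennreal (\<bar>\<kappa> (w - z)\<bar> * norm (f w)) \<partial>M)\<^sup>2"
      by (rule power_mono) simp
    then show "ennreal ((norm (conv M \<kappa> f z))\<^sup>2) \<le> (\<integral>\<^sup>+w. ennreal (\<bar>\<kappa> (w - z)\<bar> * norm (f w)) \<partial>M)\<^sup>2"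
      by (simp add: ennreal_power)
  qed
  then show "(\<integral>\<^sup>+z. ennreal ((norm (conv M \<kappa> f z))\<^sup>2) \<partial>M) \<le> ennreal (N\<^sup>2) * (\<integral>\<^sup>+w. ennreal ((norm (f w))\<^sup>2) \<partial>M)"
    using Y by (rule order_trans)
qed

text \<open>In polar coordinates the density t^3/t^p is bounded on (0,2) for p at most 3, here by
  2^3 = 8. The Newton kernel and its gradient have orders 2 and 3.\<close>

lemma nn_integral_norm_power_ball:
  assumes D: "DIM('a::euclidean_space) = 4" and p: "p \<le> 3" and C: "C \<ge> 0"
  shows "(\<integral>\<^sup>+x. ennreal (C / norm (x::'a) ^ p) * indicator (ball 0 2) x \<partial>lborel) < \<infinity>"
proof -
  have [measurable]: "ball (0::'a) 2 \<in> sets borel" by simp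
  have "(\<integral>\<^sup>+x. ennreal (C / norm (x::'a) ^ p) * indicator (ball 0 2) x \<partial>lborel) =
    (\<integral>\<^sup>+t. ennreal (t ^ 3) * indicator {0<..} t * (\<integral>\<^sup>+x. ennreal (C / norm (t *\<^sub>R (x::'a)) ^ p) * indicator (ball 0 2) (t *\<^sub>R x) \<partial>sphere_measure) \<partial>lborel)"
    using nn_integral_polar[of "\<lambda>x::'a. ennreal (C / norm x ^ p) * indicator (ball 0 2) x"] D by simp
  also have "\<dots> \<le> (\<integral>\<^sup>+t. ennreal (8 * C) * emeasure sphere_measure (space (sphere_measure :: 'a measure)) * indicator {0<..<2} (t::real) \<partial>lborel)"
  proof (rule nn_integral_mono)
    fix t :: real
    show "ennreal (t ^ 3) * indicator {0<..} t * (\<integral>\<^sup>+x. ennreal (C / norm (t *\<^sub>R (x::'a)) ^ p) * indicator (ball 0 2) (t *\<^sub>R x) \<partial>sphere_measure)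
      \<le> ennreal (8 * C) * emeasure sphere_measure (space (sphere_measure :: 'a measure)) * indicator {0<..<2} t"
    proof (cases "0 < t")
      case True
      have "(\<integral>\<^sup>+x. ennreal (C / norm (t *\<^sub>R (x::'a)) ^ p) * indicator (ball 0 2) (t *\<^sub>R x) \<partial>sphere_measure) =
        (\<integral>\<^sup>+x. ennreal (C / t ^ p) * indicator {0<..<2} t \<partial>(sphere_measure :: 'a measure))"
        by (rule nn_integral_cong) (use True in \<open>auto simp: space_sphere_measure indicator_def\<close>)
      also have "\<dots> = ennreal (C / t ^ p) * indicator {0<..<2} t * emeasure sphere_measure (space (sphere_measure :: 'a measure))" by simp
      finally have eq: "(\<integral>\<^sup>+x. ennreal (C / norm (t *\<^sub>R (x::'a)) ^ p) * indicator (ball 0 2) (t *\<^sub>R x) \<partial>sphere_measure) =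
        ennreal (C / t ^ p) * indicator {0<..<2} t * emeasure sphere_measure (space (sphere_measure :: 'a measure))" .
      show ?thesis
      proof (cases "t < 2")
        case t2: True
        have "t ^ 3 * (C / t ^ p) = C * t ^ (3 - p)" using True p by (simp add: power_diff)
        also have "\<dots> \<le> C * 2 ^ (3 - p)" using True t2 C by (intro mult_left_mono power_mono) auto
        also have "\<dots> \<le> C * 2 ^ 3" using C by (intro mult_left_mono power_increasing) auto
        finally have le: "t ^ 3 * (C / t ^ p) \<le> 8 * C" by simp
        have "ennreal (t ^ 3) * ennreal (C / t ^ p) = ennreal (t ^ 3 * (C / t ^ p))"
          using True C by (intro ennreal_mult[symmetric]) auto
        also have "\<dots> \<le> ennreal (8 * C)" by (rule ennreal_leI[OF le])
        finally have "ennreal (t ^ 3) * ennreal (C / t ^ p) * emeasure sphere_measure (space (sphere_measure :: 'a measure)) \<le>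
          ennreal (8 * C) * emeasure sphere_measure (space (sphere_measure :: 'a measure))" by (rule mult_right_mono) simp
        then show ?thesis unfolding eq using True t2 by (simp add: mult.assoc)
      next
        case False
        then show ?thesis unfolding eq by simp
      qed
    qed simp
  qed
  also have "\<dots> = ennreal (8 * C) * emeasure sphere_measure (space (sphere_measure :: 'a measure)) * emeasure lborel {0<..<2::real}"
    by (subst nn_integral_cmult_indicator) auto
  also have "\<dots> < \<infinity>"
    using sphere.emeasure_finite[of "space (sphere_measure :: 'a measure)"] unfolding infinity_ennreal_def
    by (intro ennreal_mult_less_top[THEN iffD2]) (auto simp: less_top[symmetric] ennreal_mult_eq_top_iff)
  finally show ?thesis .
qed

lemma conv_dominated:
  fixes f :: "'a::euclidean_space \<Rightarrow> 'b::euclidean_space" and \<kappa> :: "'a \<Rightarrow> real"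
  assumes D: "DIM('a) = 4" and p: "p \<le> 3" and C: "C \<ge> 0"
    and f: "square_integrable (lebesgue_on (ball 0 1)) f"
    and \<kappa>: "\<kappa> \<in> borel_measurable borel" "\<And>x. x \<noteq> 0 \<Longrightarrow> \<bar>\<kappa> x\<bar> \<le> C / norm x ^ p"
  shows "square_integrable (lebesgue_on (ball 0 1)) (conv (lebesgue_on (ball 0 1)) \<kappa> f)"
    and "AE z in lebesgue_on (ball 0 1). integrable (lebesgue_on (ball 0 1)) (\<lambda>w. \<kappa> (w - z) *\<^sub>R f w)"
proof -
  note [measurable] = \<kappa>(1)
  have "(\<integral>\<^sup>+x. ennreal \<bar>\<kappa> x\<bar> * indicator (ball 0 2) x \<partial>lborel) \<le> (\<integral>\<^sup>+x. ennreal (C / norm (x::'a) ^ p) * indicator (ball 0 2) x \<partial>lborel)"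
  proof (rule nn_integral_mono_AE)
    show "AE x in lborel. ennreal \<bar>\<kappa> x\<bar> * indicator (ball 0 2) x \<le> ennreal (C / norm x ^ p) * indicator (ball 0 2) x"
      using AE_lborel_singleton[of 0] by eventually_elim (intro mult_right_mono ennreal_leI \<kappa>(2), auto)
  qed
  also have "\<dots> < \<infinity>" by (rule nn_integral_norm_power_ball[OF D p C])
  finally obtain N where N: "(\<integral>\<^sup>+x. ennreal \<bar>\<kappa> x\<bar> * indicator (ball 0 2) x \<partial>lborel) = ennreal N" "0 \<le> N"
    by (cases "(\<integral>\<^sup>+x. ennreal \<bar>\<kappa> x\<bar> * indicator (ball 0 2) x \<partial>lborel)") auto
  note Y = conv_Young[OF \<kappa>(1) N f]
  show "AE z in lebesgue_on (ball 0 1). integrable (lebesgue_on (ball 0 1)) (\<lambda>w. \<kappa> (w - z) *\<^sub>R f w)" by (rule Y(2))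
  have "(\<integral>\<^sup>+w. ennreal ((norm (f w))\<^sup>2) \<partial>lebesgue_on (ball 0 1)) < \<infinity>"
    using f by (simp add: square_integrable_def integrable_iff_bounded)
  then have "ennreal (N\<^sup>2) * (\<integral>\<^sup>+w. ennreal ((norm (f w))\<^sup>2) \<partial>lebesgue_on (ball 0 1)) < \<infinity>"
    unfolding infinity_ennreal_def by (intro ennreal_mult_less_top[THEN iffD2]) simp
  with Y(4) have "(\<integral>\<^sup>+z. ennreal ((norm (conv (lebesgue_on (ball 0 1)) \<kappa> f z))\<^sup>2) \<partial>lebesgue_on (ball 0 1)) < \<infinity>"
    by (rule order.strict_trans1)
  then show "square_integrable (lebesgue_on (ball 0 1)) (conv (lebesgue_on (ball 0 1)) \<kappa> f)"
    unfolding square_integrable_def using Y(3) by (auto intro!: integrableI_bounded)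
qed

text \<open>Dominated convergence gives L1 convergence of the kernels on \<open>ball 0 2\<close>,
  and \<open>conv_Young\<close> turns it into L2 convergence of the potentials.\<close>

lemma conv_tendsto_L2:
  fixes f :: "'a::euclidean_space \<Rightarrow> 'b::euclidean_space" and \<kappa> :: "'a \<Rightarrow> real"
  assumes D: "DIM('a) = 4" and p: "p \<le> 3" and C: "C \<ge> 0"
    and f: "square_integrable (lebesgue_on (ball 0 1)) f"
    and \<kappa>: "\<kappa> \<in> borel_measurable borel" "\<And>x. x \<noteq> 0 \<Longrightarrow> \<bar>\<kappa> x\<bar> \<le> C / norm x ^ p"
    and \<kappa>m: "\<And>m. \<kappa>m m \<in> borel_measurable borel" "\<And>m x. x \<noteq> 0 \<Longrightarrow> \<bar>\<kappa>m m x\<bar> \<le> C / norm x ^ p"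
    and lim: "\<And>x. x \<noteq> 0 \<Longrightarrow> (\<lambda>m. \<kappa>m m x) \<longlonglongrightarrow> \<kappa> x"
  defines "M \<equiv> lebesgue_on (ball (0::'a) 1)"
  shows "(\<lambda>m. \<integral>\<^sup>+z. ennreal ((norm (conv M (\<kappa>m m) f z - conv M \<kappa> f z))\<^sup>2) \<partial>M) \<longlonglongrightarrow> 0"
proof -
  note [measurable] = \<kappa>(1) \<kappa>m(1)
  define n where "n m = (\<integral>\<^sup>+x. ennreal \<bar>\<kappa>m m x - \<kappa> x\<bar> * indicator (ball 0 2) x \<partial>lborel)" for m
  have [measurable]: "ball (0::'a) 2 \<in> sets borel" by simp
  have fin: "(\<integral>\<^sup>+x. ennreal ((2 * C) / norm (x::'a) ^ p) * indicator (ball 0 2) x \<partial>lborel) < \<infinity>"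
    by (rule nn_integral_norm_power_ball[OF D p]) (use C in simp)
  have bd: "ennreal \<bar>\<kappa>m m x - \<kappa> x\<bar> * indicator (ball 0 2) x \<le> ennreal ((2 * C) / norm x ^ p) * indicator (ball 0 2) x" if "x \<noteq> 0" for m x
  proof (intro mult_right_mono ennreal_leI)
    show "\<bar>\<kappa>m m x - \<kappa> x\<bar> \<le> (2 * C) / norm x ^ p" using \<kappa>(2)[OF that] \<kappa>m(2)[OF that, of m] by simp
  qed simp
  have n0: "n \<longlonglongrightarrow> 0"
  proof -
    have "n \<longlonglongrightarrow> (\<integral>\<^sup>+x. 0 \<partial>(lborel :: 'a measure))"
      unfolding n_def
    proof (rule nn_integral_dominated_convergence[OF _ _ _ _ fin])
      show "AE x in lborel. ennreal \<bar>\<kappa>m m x - \<kappa> x\<bar> * indicator (ball 0 2) x \<le> ennreal ((2 * C) / norm x ^ p) * indicator (ball 0 2) x" for m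
        using AE_lborel_singleton[of 0] by eventually_elim (rule bd)
      show "AE x in lborel. (\<lambda>m. ennreal \<bar>\<kappa>m m x - \<kappa> x\<bar> * indicator (ball 0 2) x) \<longlonglongrightarrow> 0"
        using AE_lborel_singleton[of "0::'a"]
      proof eventually_elim
        fix x :: 'a assume x: "x \<noteq> 0"
        have "(\<lambda>m. \<kappa>m m x - \<kappa> x) \<longlonglongrightarrow> \<kappa> x - \<kappa> x" by (intro tendsto_diff lim[OF x] tendsto_const)
        then have "(\<lambda>m. \<bar>\<kappa>m m x - \<kappa> x\<bar>) \<longlonglongrightarrow> 0" by (simp add: tendsto_rabs_zero)
        then have "(\<lambda>m. ennreal \<bar>\<kappa>m m x - \<kappa> x\<bar>) \<longlonglongrightarrow> ennreal 0" by (rule tendsto_ennrealI)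
        then show "(\<lambda>m. ennreal \<bar>\<kappa>m m x - \<kappa> x\<bar> * indicator (ball 0 2) x) \<longlonglongrightarrow> 0"
          by (cases "x \<in> ball 0 2") auto
      qed
    qed auto
    then show ?thesis by simp
  qed
  define F where "F = (\<integral>\<^sup>+w. ennreal ((norm (f w))\<^sup>2) \<partial>M)"
  have Ffin: "F < \<infinity>" unfolding F_def M_def using f by (simp add: square_integrable_def integrable_iff_bounded)
  have nfin: "n m < \<infinity>" for m
  proof -
    have "n m \<le> (\<integral>\<^sup>+x. ennreal ((2 * C) / norm (x::'a) ^ p) * indicator (ball 0 2) x \<partial>lborel)"
      unfolding n_def
    proof (rule nn_integral_mono_AE)
      show "AE x in lborel. ennreal \<bar>\<kappa>m m x - \<kappa> x\<bar> * indicator (ball 0 2) x \<le> ennreal ((2 * C) / norm x ^ p) * indicator (ball 0 2) x"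
        using AE_lborel_singleton[of 0] by eventually_elim (rule bd)
    qed
    then show ?thesis using fin by (rule order.strict_trans1)
  qed
  have le: "(\<integral>\<^sup>+z. ennreal ((norm (conv M (\<kappa>m m) f z - conv M \<kappa> f z))\<^sup>2) \<partial>M) \<le> n m * n m * F" for m
  proof -
    obtain N where N: "n m = ennreal N" "0 \<le> N" using nfin[of m] by (cases "n m") auto
    have "AE z in M. conv M (\<kappa>m m) f z - conv M \<kappa> f z = conv M (\<lambda>x. \<kappa>m m x - \<kappa> x) f z"
    proof -
      have "AE z in M. integrable M (\<lambda>w. \<kappa>m m (w - z) *\<^sub>R f w)" "AE z in M. integrable M (\<lambda>w. \<kappa> (w - z) *\<^sub>R f w)"
        unfolding M_def by (rule conv_dominated(2)[OF D p C f \<kappa>m(1) \<kappa>m(2)], assumption)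
          (rule conv_dominated(2)[OF D p C f \<kappa>(1) \<kappa>(2)], assumption)
      then show ?thesis by eventually_elim (simp add: conv_def scaleR_diff_left)
    qed
    then have "(\<integral>\<^sup>+z. ennreal ((norm (conv M (\<kappa>m m) f z - conv M \<kappa> f z))\<^sup>2) \<partial>M) = (\<integral>\<^sup>+z. ennreal ((norm (conv M (\<lambda>x. \<kappa>m m x - \<kappa> x) f z))\<^sup>2) \<partial>M)"
      by (intro nn_integral_cong_AE) (auto elim!: eventually_mono)
    also have "\<dots> \<le> ennreal (N\<^sup>2) * F"
      unfolding F_def M_def
      by (rule conv_Young(4)[OF _ _ N(2) f]) (use N(1) in \<open>simp_all add: n_def\<close>)
    also have "\<dots> = n m * n m * F" using N by (simp add: power2_eq_square ennreal_mult)
    finally show ?thesis .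
  qed
  have "(\<lambda>m. n m * n m * F) \<longlonglongrightarrow> 0"
  proof -
    have "(\<lambda>m. F * n m) \<longlonglongrightarrow> F * 0" using n0 Ffin by (intro ennreal_tendsto_cmult) auto
    then have Fn: "(\<lambda>m. F * n m) \<longlonglongrightarrow> 0" by simp
    \<comment> \<open>Once the kernel norm is below 1 its square is at most itself, and the limit
      reduces to that of a constant multiple of \<open>n\<close>.\<close>
    have ev: "\<forall>\<^sub>F m in sequentially. n m < 1" using n0 by (rule order_tendstoD) simp
    show ?thesis
    proof (rule tendsto_sandwich[OF _ _ tendsto_const Fn])
      show "\<forall>\<^sub>F m in sequentially. n m * n m * F \<le> F * n m"
        using ev
      proof eventually_elim
        fix m assume "n m < 1"
        then have "n m * (n m * F) \<le> 1 * (n m * F)" by (intro mult_right_mono) auto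
        then show "n m * n m * F \<le> F * n m" by (simp add: mult_ac)
      qed
    qed simp
  qed
  then show ?thesis
    by (rule tendsto_sandwich[OF _ _ tendsto_const, rotated 2]) (auto intro: always_eventually le)
qed

section \<open>The Newton potential as an H1 limit\<close>

lemma has_weak_partial_L2_limit:
  fixes v g :: "'a::euclidean_space \<Rightarrow> 'b::euclidean_space"
  assumes s: "\<And>m. smooth (vm m)"
    and v: "square_integrable (lebesgue_on (ball 0 1)) v" and g: "square_integrable (lebesgue_on (ball 0 1)) g"
    and l1: "(\<lambda>m. \<integral>\<^sup>+z. ennreal ((norm (vm m z - v z))\<^sup>2) \<partial>lebesgue_on (ball 0 1)) \<longlonglongrightarrow> 0"
    and l2: "(\<lambda>m. \<integral>\<^sup>+z. ennreal ((norm (frechet_derivative (vm m) (at z) e - g z))\<^sup>2) \<partial>lebesgue_on (ball 0 1)) \<longlonglongrightarrow> 0"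
  shows "has_weak_partial (ball 0 1) e v g"
  unfolding has_weak_partial_def
proof (intro conjI allI impI)
  interpret M: finite_measure "lebesgue_on (ball (0::'a) 1)" by (rule finite_measure_lebesgue_on_ball)
  show "locally_integrable (ball 0 1) v" "locally_integrable (ball 0 1) g"
    using v g M.square_integrable_imp_integrable' by (auto intro!: integrable_imp_locally_integrable)
  fix \<phi> :: "'a \<Rightarrow> real" assume t: "test_function (ball 0 1) \<phi>"
  then have s\<phi>: "smooth \<phi>" by (simp add: test_function_def)
  have \<phi>0: "\<phi> x = 0" if "norm x = 1" for x using t that unfolding test_function_def by fastforce
  obtain C1 where C1: "\<And>x. norm x \<le> 1 \<Longrightarrow> norm (\<phi> x) \<le> C1" using smooth_bound_on_cball[OF s\<phi>, of 1] by metis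
  obtain C2 where C2: "\<And>x. norm x \<le> 1 \<Longrightarrow> norm (frechet_derivative \<phi> (at x) e) \<le> C2"
    using smooth_bound_on_cball[OF smooth_directional[OF s\<phi>], of 1] by metis
  have t1: "(\<lambda>m. LINT x|lebesgue_on (ball 0 1). frechet_derivative \<phi> (at x) e *\<^sub>R vm m x) \<longlonglongrightarrow> (LINT x|lebesgue_on (ball 0 1). frechet_derivative \<phi> (at x) e *\<^sub>R v x)"
    by (rule M.L2_integral_limit[OF integrable_ball_continuous[OF smooth_continuous[OF s]] v l1, where C=C2])
      (use C2 in \<open>auto intro!: borel_measurable_lebesgue_on smooth_borel smooth_directional s\<phi>\<close>)
  have t2: "(\<lambda>m. LINT x|lebesgue_on (ball 0 1). \<phi> x *\<^sub>R frechet_derivative (vm m) (at x) e) \<longlonglongrightarrow> (LINT x|lebesgue_on (ball 0 1). \<phi> x *\<^sub>R g x)"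
    by (rule M.L2_integral_limit[OF integrable_ball_continuous[OF smooth_continuous[OF smooth_directional[OF s]]] g l2, where C=C1])
      (use C1 in \<open>auto intro!: borel_measurable_lebesgue_on smooth_borel s\<phi>\<close>)
  have eq: "(LINT x|lebesgue_on (ball 0 1). frechet_derivative \<phi> (at x) e *\<^sub>R vm m x) = - (LINT x|lebesgue_on (ball 0 1). \<phi> x *\<^sub>R frechet_derivative (vm m) (at x) e)" for m
  proof -
    have d: "((\<lambda>x. \<phi> x *\<^sub>R vm m x) has_derivative (\<lambda>h. \<phi> x *\<^sub>R frechet_derivative (vm m) (at x) h + frechet_derivative \<phi> (at x) h *\<^sub>R vm m x)) (at x)" for x
      by (rule has_derivative_scaleR[OF smooth_has_derivative[OF s\<phi>] smooth_has_derivative[OF s]])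
    have i: "integrable (lebesgue_on (ball 0 1)) (\<lambda>x. \<phi> x *\<^sub>R frechet_derivative (vm m) (at x) e)"
      "integrable (lebesgue_on (ball 0 1)) (\<lambda>x. frechet_derivative \<phi> (at x) e *\<^sub>R vm m x)"
      by (intro integrable_ball_continuous smooth_continuous smooth_scaleR smooth_directional s\<phi> s)+
    have "(LINT x|lebesgue_on (ball 0 1). frechet_derivative (\<lambda>x. \<phi> x *\<^sub>R vm m x) (at x) e) = (LINT x|sphere_measure. (x \<bullet> e) *\<^sub>R (\<phi> x *\<^sub>R vm m x))"
      using smooth_scaleR[OF s\<phi> s] by (intro Gauss) (simp only: smooth_def)
    also have "\<dots> = (LINT x|(sphere_measure :: 'a measure). 0)"
      by (rule Bochner_Integration.integral_cong[OF refl]) (simp add: space_sphere_measure \<phi>0)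
    finally show ?thesis
      unfolding frechet_derivative_eqI[OF d] Bochner_Integration.integral_add[OF i] by (simp add: eq_neg_iff_add_eq_0 add.commute)
  qed
  show "(LINT x|lebesgue_on (ball 0 1). frechet_derivative \<phi> (at x) e *\<^sub>R v x) = - (LINT x|lebesgue_on (ball 0 1). \<phi> x *\<^sub>R g x)"
    using t1 tendsto_minus[OF t2] unfolding eq by (rule LIMSEQ_unique)
qed

lemma newt_bounds:
  fixes x :: "'a::euclidean_space"
  assumes "x \<noteq> 0" "\<epsilon> \<ge> 0"
  shows "\<bar>newt \<epsilon> x\<bar> \<le> 1 / norm x ^ 2" "\<bar>dnewt \<epsilon> e x\<bar> \<le> 2 * norm e / norm x ^ 3"
proof -
  have n: "norm x > 0" using assms by simp
  have nx: "x \<bullet> x = (norm x)\<^sup>2" by (simp add: dot_square_norm)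
  have p: "0 < (norm x)\<^sup>2" using n by simp
  show "\<bar>newt \<epsilon> x\<bar> \<le> 1 / norm x ^ 2"
    unfolding newt_def nx using p assms(2) by (simp add: frac_le)
  have "\<bar>dnewt \<epsilon> e x\<bar> = 2 * \<bar>x \<bullet> e\<bar> / ((norm x)\<^sup>2 + \<epsilon>)\<^sup>2"
    unfolding dnewt_def nx by (simp add: abs_mult)
  also have "\<dots> \<le> 2 * (norm x * norm e) / ((norm x)\<^sup>2)\<^sup>2"
    using p assms(2) by (intro frac_le mult_left_mono Cauchy_Schwarz_ineq2 power_mono) auto
  also have "\<dots> = 2 * norm e / norm x ^ 3" using n by (simp add: field_simps power2_eq_square power3_eq_cube)
  finally show "\<bar>dnewt \<epsilon> e x\<bar> \<le> 2 * norm e / norm x ^ 3" .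
qed

lemma newt_limits:
  fixes x :: "'a::euclidean_space"
  assumes "x \<noteq> 0" "\<epsilon> \<longlonglongrightarrow> 0"
  shows "(\<lambda>m. newt (\<epsilon> m) x) \<longlonglongrightarrow> newt 0 x" "(\<lambda>m. dnewt (\<epsilon> m) e x) \<longlonglongrightarrow> dnewt 0 e x"
proof -
  have n: "x \<bullet> x + 0 \<noteq> 0" using assms by simp
  have l: "(\<lambda>m. x \<bullet> x + \<epsilon> m) \<longlonglongrightarrow> x \<bullet> x + 0" by (intro tendsto_intros assms(2))
  show "(\<lambda>m. newt (\<epsilon> m) x) \<longlonglongrightarrow> newt 0 x"
    unfolding newt_def by (rule tendsto_divide[OF tendsto_const l n])
  show "(\<lambda>m. dnewt (\<epsilon> m) e x) \<longlonglongrightarrow> dnewt 0 e x"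
    unfolding dnewt_def by (rule tendsto_divide[OF tendsto_const tendsto_power[OF l]]) (use n in simp)
qed

lemma newt_borel: "newt \<epsilon> \<in> borel_measurable borel" "dnewt \<epsilon> e \<in> borel_measurable borel"
  unfolding newt_def[abs_def] dnewt_def[abs_def] by measurable

text \<open>The gradient kernel has order |x|^(-3), still integrable in dimension 4, so the
  derivatives of the regularised potentials have an L2 limit, which is then a weak derivative of the
  Newton potential.\<close>

lemma newton_H1:
  fixes f :: "'a::euclidean_space \<Rightarrow> 'b::euclidean_space"
  assumes D: "DIM('a) = 4" and f: "square_integrable (lebesgue_on (ball 0 1)) f"
    and \<epsilon>: "\<And>m. \<epsilon> m > 0" "\<epsilon> \<longlonglongrightarrow> 0"
  defines "M \<equiv> lebesgue_on (ball (0::'a) 1)"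
  shows "smooth (conv M (newt (\<epsilon> m)) f)"
    and "square_integrable M (conv M (newt 0) f)"
    and "square_integrable M (conv M (\<lambda>x. - dnewt 0 e x) f)"
    and "(\<lambda>m. \<integral>\<^sup>+z. ennreal ((norm (conv M (newt (\<epsilon> m)) f z - conv M (newt 0) f z))\<^sup>2) \<partial>M) \<longlonglongrightarrow> 0"
    and "(\<lambda>m. \<integral>\<^sup>+z. ennreal ((norm (frechet_derivative (conv M (newt (\<epsilon> m)) f) (at z) e - conv M (\<lambda>x. - dnewt 0 e x) f z))\<^sup>2) \<partial>M) \<longlonglongrightarrow> 0"
    and "has_weak_partial (ball 0 1) e (conv M (newt 0) f) (conv M (\<lambda>x. - dnewt 0 e x) f)"
proof -
  interpret M: finite_measure M unfolding M_def by (rule finite_measure_lebesgue_on_ball)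
  have fi: "integrable M f" using M.square_integrable_imp_integrable' f unfolding M_def by blast
  have bm: "ball_measure M" unfolding M_def by (rule ball_measure_instances)
  show s: "smooth (conv M (newt (\<epsilon> m)) f)" for m by (rule smooth_conv[OF bm fi smooth_newt[OF \<epsilon>(1)]])
  have dm: "frechet_derivative (conv M (newt (\<epsilon> m)) f) (at z) e = conv M (\<lambda>x. - dnewt (\<epsilon> m) e x) f z" for m z
  proof -
    have fd: "frechet_derivative (newt (\<epsilon> m)) (at x) e = dnewt (\<epsilon> m) e x" for x :: 'a
      using frechet_derivative_eqI[OF newt_has_derivative(1)[of x "\<epsilon> m"]] \<epsilon>(1)[of m] inner_ge_zero[of x] by (simp add: add_nonneg_pos)
    show ?thesis
      using frechet_derivative_eqI[OF conv_has_derivative[OF bm fi smooth_newt[OF \<epsilon>(1)]]]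
      by (simp add: fd conv_def)
  qed
  have dborel: "(\<lambda>x. - dnewt \<delta> e x) \<in> borel_measurable borel" for \<delta> using newt_borel(2)[of \<delta> e] by simp
  have e0: "\<epsilon> m \<ge> 0" for m using \<epsilon>(1)[of m] by simp
  have db: "x \<noteq> 0 \<Longrightarrow> \<bar>- dnewt \<delta> e x\<bar> \<le> 2 * norm e / norm x ^ 3" if "\<delta> \<ge> 0" for x \<delta>
    using newt_bounds(2)[of x \<delta> e] that by simp
  have dl: "x \<noteq> 0 \<Longrightarrow> (\<lambda>m. - dnewt (\<epsilon> m) e x) \<longlonglongrightarrow> - dnewt 0 e x" for x by (intro tendsto_minus newt_limits(2) \<epsilon>(2))
  show v2: "square_integrable M (conv M (newt 0) f)"
    unfolding M_def by (rule conv_dominated(1)[OF D _ _ f newt_borel(1) newt_bounds(1)]) auto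
  show g2: "square_integrable M (conv M (\<lambda>x. - dnewt 0 e x) f)"
    unfolding M_def by (rule conv_dominated(1)[OF D order_refl _ f dborel db]) auto
  show l1: "(\<lambda>m. \<integral>\<^sup>+z. ennreal ((norm (conv M (newt (\<epsilon> m)) f z - conv M (newt 0) f z))\<^sup>2) \<partial>M) \<longlonglongrightarrow> 0"
    unfolding M_def
    by (rule conv_tendsto_L2[OF D _ _ f newt_borel(1) newt_bounds(1) newt_borel(1) newt_bounds(1) newt_limits(1)[OF _ \<epsilon>(2)]]) (auto simp: e0)
  show l2: "(\<lambda>m. \<integral>\<^sup>+z. ennreal ((norm (frechet_derivative (conv M (newt (\<epsilon> m)) f) (at z) e - conv M (\<lambda>x. - dnewt 0 e x) f z))\<^sup>2) \<partial>M) \<longlonglongrightarrow> 0"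
    unfolding dm unfolding M_def
    by (rule conv_tendsto_L2[OF D order_refl _ f dborel db dborel db dl]) (auto simp: e0)
  show "has_weak_partial (ball 0 1) e (conv M (newt 0) f) (conv M (\<lambda>x. - dnewt 0 e x) f)"
    by (rule has_weak_partial_L2_limit[where vm="\<lambda>m. conv M (newt (\<epsilon> m)) f"])
      (fact s v2[unfolded M_def] g2[unfolded M_def] l1[unfolded M_def] l2[unfolded M_def] | use s v2 g2 l1 l2 in \<open>simp add: M_def\<close>)+
qed

section \<open>The single layer potential of a linear function\<close>

lemma dnewt_linear:
  "dnewt \<epsilon> (a + b) x = dnewt \<epsilon> a x + dnewt \<epsilon> b x" "dnewt \<epsilon> (a - b) x = dnewt \<epsilon> a x - dnewt \<epsilon> b x"
  "dnewt \<epsilon> (c *\<^sub>R a) x = c * dnewt \<epsilon> a x"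
  by (simp_all add: dnewt_def inner_add_right inner_diff_right add_divide_distrib diff_divide_distrib algebra_simps)

text \<open>Green's second identity for \<open>newt\<close> and the harmonic function w \<bullet> e.
  On the unit sphere the normal derivative of w \<bullet> e is w \<bullet> e itself, which gives the
  common factor on the right.\<close>

lemma Green_linear_kernel:
  fixes z :: "'a::euclidean_space"
  assumes \<epsilon>: "\<epsilon> > 0" and D: "DIM('a) = 4"
  shows "(LINT w|lebesgue_on (ball 0 1). (w \<bullet> e) * bump4 \<epsilon> (w - z)) =
    (LINT w|sphere_measure. (w \<bullet> e) * (newt \<epsilon> (w - z) - dnewt \<epsilon> w (w - z)))"
proof -
  let ?K = "\<lambda>w. newt \<epsilon> (w - z)"
  note kd = kernel_derivs[OF \<epsilon>, of z]
  have sK: "smooth ?K" by (rule kd(3))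
  have sKb: "smooth (\<lambda>w. dnewt \<epsilon> b (w - z))" for b using smooth_directional[OF sK, of b] unfolding kd(1) .
  have sKbb: "smooth (\<lambda>w. ddnewt \<epsilon> b b (w - z))" for b using smooth_directional[OF sKb, of b b] by (simp only: kernel_derivs(2)[OF \<epsilon>])
  \<comment> \<open>Component along b of the field whose divergence is w \<bullet> e times the
    Laplacian of the kernel; the two products of first derivatives cancel in each component.\<close>
  define V where "V b w = (w \<bullet> e) * dnewt \<epsilon> b (w - z) - ?K w * (b \<bullet> e)" for b w
  have sV: "smooth (V b)" for b unfolding V_def by (intro smooth_intros sK sKb)
  have dV: "frechet_derivative (V b) (at w) b = (w \<bullet> e) * ddnewt \<epsilon> b b (w - z)" for b w
  proof -
    have l: "((\<lambda>w. w \<bullet> e) has_derivative (\<lambda>h. h \<bullet> e)) (at w)" by (rule derivative_eq_intros refl | simp)+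
    have "(V b has_derivative (\<lambda>h. ((w \<bullet> e) * frechet_derivative (\<lambda>w. dnewt \<epsilon> b (w - z)) (at w) h + (h \<bullet> e) * dnewt \<epsilon> b (w - z)) -
       frechet_derivative ?K (at w) h * (b \<bullet> e))) (at w)"
      unfolding V_def[abs_def]
      by (intro has_derivative_diff has_derivative_mult[OF l] has_derivative_mult_left smooth_has_derivative sKb sK)
    from frechet_derivative_eqI[OF this] show ?thesis by (simp add: kernel_derivs[OF \<epsilon>])
  qed
  have "(\<Sum>b\<in>Basis. LINT w|lebesgue_on (ball 0 1). (w \<bullet> e) * ddnewt \<epsilon> b b (w - z)) = (\<Sum>b\<in>Basis. LINT w|sphere_measure. (w \<bullet> b) * V b w)"
  proof (rule sum.cong[OF refl])
    fix b :: 'a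
    have "cont_diff 1 (V b)" using sV by (simp only: smooth_def)
    from Gauss_real[OF this, of b] show "(LINT w|lebesgue_on (ball 0 1). (w \<bullet> e) * ddnewt \<epsilon> b b (w - z)) = (LINT w|sphere_measure. (w \<bullet> b) * V b w)"
      by (simp add: dV)
  qed
  moreover have "(\<Sum>b\<in>Basis. LINT w|lebesgue_on (ball 0 1). (w \<bullet> e) * ddnewt \<epsilon> b b (w - z)) = (LINT w|lebesgue_on (ball 0 1). - ((w \<bullet> e) * bump4 \<epsilon> (w - z)))"
  proof -
    have "(\<Sum>b\<in>Basis. LINT w|lebesgue_on (ball 0 1). (w \<bullet> e) * ddnewt \<epsilon> b b (w - z)) = (LINT w|lebesgue_on (ball 0 1). (\<Sum>b\<in>Basis. (w \<bullet> e) * ddnewt \<epsilon> b b (w - z)))"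
      by (rule Bochner_Integration.integral_sum[symmetric]) (intro integrable_ball_continuous smooth_continuous smooth_intros sKbb)
    also have "\<dots> = (LINT w|lebesgue_on (ball 0 1). - ((w \<bullet> e) * bump4 \<epsilon> (w - z)))"
      by (simp add: sum_distrib_left[symmetric] sum_ddnewt[OF \<epsilon> D])
    finally show ?thesis .
  qed
  moreover have "(\<Sum>b\<in>Basis. LINT w|sphere_measure. (w \<bullet> b) * V b w) = (LINT w|sphere_measure. - ((w \<bullet> e) * (newt \<epsilon> (w - z) - dnewt \<epsilon> w (w - z))))"
  proof -
    have "(\<Sum>b\<in>Basis. LINT w|sphere_measure. (w \<bullet> b) * V b w) = (LINT w|sphere_measure. (\<Sum>b\<in>Basis. (w \<bullet> b) * V b w))"
      by (rule Bochner_Integration.integral_sum[symmetric]) (intro integrable_sphere_continuous smooth_continuous smooth_intros sV)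
    also have "\<dots> = (LINT w|sphere_measure. - ((w \<bullet> e) * (newt \<epsilon> (w - z) - dnewt \<epsilon> w (w - z))))"
    proof (rule Bochner_Integration.integral_cong[OF refl])
      fix w :: 'a
      have "(\<Sum>b\<in>Basis. (w \<bullet> b) * dnewt \<epsilon> b (w - z)) = dnewt \<epsilon> w (w - z)"
      proof -
        define c where "c = - 2 / ((w - z) \<bullet> (w - z) + \<epsilon>)\<^sup>2"
        have d: "dnewt \<epsilon> b (w - z) = c * ((w - z) \<bullet> b)" for b by (simp add: dnewt_def c_def)
        show ?thesis unfolding d euclidean_inner[of "w - z" w] sum_distrib_left
          by (rule sum.cong[OF refl]) (simp add: mult_ac)
      qed
      moreover have "(\<Sum>b\<in>Basis. (w \<bullet> b) * (b \<bullet> e)) = w \<bullet> e"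
        using euclidean_inner[of w e] by (simp add: inner_commute)
      ultimately show "(\<Sum>b\<in>Basis. (w \<bullet> b) * V b w) = - ((w \<bullet> e) * (newt \<epsilon> (w - z) - dnewt \<epsilon> w (w - z)))"
      proof -
        assume 1: "(\<Sum>b\<in>Basis. (w \<bullet> b) * dnewt \<epsilon> b (w - z)) = dnewt \<epsilon> w (w - z)" and 2: "(\<Sum>b\<in>Basis. (w \<bullet> b) * (b \<bullet> e)) = w \<bullet> e"
        have "(\<Sum>b\<in>Basis. (w \<bullet> b) * V b w) = (w \<bullet> e) * (\<Sum>b\<in>Basis. (w \<bullet> b) * dnewt \<epsilon> b (w - z)) - newt \<epsilon> (w - z) * (\<Sum>b\<in>Basis. (w \<bullet> b) * (b \<bullet> e))"
          unfolding V_def sum_distrib_left sum_subtractf[symmetric] by (rule sum.cong[OF refl]) (simp add: algebra_simps)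
        then show ?thesis unfolding 1 2 by (simp add: algebra_simps)
      qed
    qed
    finally show ?thesis .
  qed
  ultimately show ?thesis by simp
qed

lemma sphere_distance:
  assumes "norm w = 1" shows "norm (w - z) \<ge> 1 - norm z"
  using norm_triangle_ineq2[of w z] assms by simp

text \<open>The limit \<epsilon> to 0 in \<open>Green_linear_kernel\<close>: on the left an
  approximate identity at the interior point z, on the right kernels that stay bounded because |w -
  z| is at least 1 - |z|.\<close>

lemma single_layer_identity:
  fixes z :: "'a::euclidean_space"
  assumes D: "DIM('a) = 4" and z: "norm z < 1"
  shows "(LINT w|sphere_measure. (w \<bullet> e) * (newt 0 (w - z) - dnewt 0 w (w - z))) = mass4 TYPE('a) * (z \<bullet> e)"
proof -
  define \<epsilon> where "\<epsilon> m = inverse (real (Suc m))" for m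
  have \<epsilon>: "\<epsilon> m > 0" "\<epsilon> \<longlonglongrightarrow> 0" for m
    unfolding \<epsilon>_def using LIMSEQ_inverse_real_of_nat by auto
  \<comment> \<open>Extends w \<bullet> e by zero, so that the integral runs over the whole space;
    continuity is required only at z, which lies inside the ball.\<close>
  define q where "q w = (w \<bullet> e) * indicator (ball 0 1) w" for w :: 'a
  have [measurable]: "ball (0::'a) 1 \<in> sets borel" by simp
  have qm: "q \<in> borel_measurable borel" unfolding q_def[abs_def] by measurable
  have qb: "\<bar>q w\<bar> \<le> norm e" for w
  proof (cases "norm w < 1")
    case True
    have "\<bar>w \<bullet> e\<bar> \<le> norm w * norm e" by (rule Cauchy_Schwarz_ineq2)
    also have "\<dots> \<le> 1 * norm e" using True by (intro mult_right_mono) auto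
    finally show ?thesis using True by (simp add: q_def)
  qed (simp add: q_def)
  have qc: "isCont q z"
  proof -
    have "\<forall>\<^sub>F w in nhds z. w \<bullet> e = q w"
      using z by (intro eventually_nhds[THEN iffD2] exI[of _ "ball 0 1"]) (auto simp: q_def)
    moreover have "isCont (\<lambda>w. w \<bullet> e) z" by (intro continuous_intros)
    ultimately show ?thesis by (subst (asm) isCont_cong)
  qed
  have "(\<lambda>m. LINT w|lborel. bump4 (\<epsilon> m) (w - z) * q w) \<longlonglongrightarrow> mass4 TYPE('a) * q z"
    by (rule bump4_approx_identity(1)[OF D qm qb qc \<epsilon>])
  moreover have "(LINT w|lborel. bump4 (\<epsilon> m) (w - z) * q w) = (LINT w|lebesgue_on (ball 0 1). (w \<bullet> e) * bump4 (\<epsilon> m) (w - z))" for m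
  proof -
    have [measurable]: "(bump4 (\<epsilon> m) :: 'a \<Rightarrow> real) \<in> borel_measurable borel" unfolding bump4_def[abs_def] by measurable
    have "(LINT w|lebesgue_on (ball 0 1). (w \<bullet> e) * bump4 (\<epsilon> m) (w - z)) = (LINT w|lebesgue. indicator (ball 0 1) w *\<^sub>R ((w \<bullet> e) * bump4 (\<epsilon> m) (w - z)))"
      by (simp add: integral_restrict_space)
    also have "\<dots> = (LINT w|lborel. indicator (ball 0 1) w *\<^sub>R ((w \<bullet> e) * bump4 (\<epsilon> m) (w - z)))"
    proof (rule integral_completion)
      have [measurable]: "ball (0::'a) 1 \<in> sets borel" by simp
      show "(\<lambda>w. indicator (ball 0 1) w *\<^sub>R ((w \<bullet> e) * bump4 (\<epsilon> m) (w - z))) \<in> borel_measurable lborel" by measurable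
    qed
    also have "\<dots> = (LINT w|lborel. bump4 (\<epsilon> m) (w - z) * q w)"
      by (rule Bochner_Integration.integral_cong) (auto simp: q_def indicator_def)
    finally show ?thesis by simp
  qed
  ultimately have 1: "(\<lambda>m. LINT w|sphere_measure. (w \<bullet> e) * (newt (\<epsilon> m) (w - z) - dnewt (\<epsilon> m) w (w - z))) \<longlonglongrightarrow> mass4 TYPE('a) * (z \<bullet> e)"
    using z by (simp add: Green_linear_kernel[OF \<epsilon>(1) D] q_def)
  have w1: "w - z \<noteq> 0" if "norm w = 1" for w using that z by auto
  have 2: "(\<lambda>m. LINT w|sphere_measure. (w \<bullet> e) * (newt (\<epsilon> m) (w - z) - dnewt (\<epsilon> m) w (w - z))) \<longlonglongrightarrow>
     (LINT w|sphere_measure. (w \<bullet> e) * (newt 0 (w - z) - dnewt 0 w (w - z)))"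
  proof (rule integral_dominated_convergence[where w="\<lambda>_. norm e * (1 / (1 - norm z) ^ 2 + 2 / (1 - norm z) ^ 3)"])
    show "AE w in sphere_measure. (\<lambda>m. (w \<bullet> e) * (newt (\<epsilon> m) (w - z) - dnewt (\<epsilon> m) w (w - z))) \<longlonglongrightarrow> (w \<bullet> e) * (newt 0 (w - z) - dnewt 0 w (w - z))"
      by (intro AE_I2 tendsto_intros newt_limits \<epsilon>(2) w1) (simp_all add: space_sphere_measure)
    have [measurable]: "(\<lambda>w::'a. newt \<delta> (w - z)) \<in> borel_measurable borel" "(\<lambda>w::'a. dnewt \<delta> w (w - z)) \<in> borel_measurable borel" for \<delta>
      unfolding newt_def dnewt_def by measurable
    show "(\<lambda>w. (w \<bullet> e) * (newt (\<epsilon> m) (w - z) - dnewt (\<epsilon> m) w (w - z))) \<in> borel_measurable sphere_measure" for m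
      by (rule borel_measurable_sphere_measure) measurable
    show "(\<lambda>w. (w \<bullet> e) * (newt 0 (w - z) - dnewt 0 w (w - z))) \<in> borel_measurable sphere_measure"
      by (rule borel_measurable_sphere_measure) measurable
    show "AE w in sphere_measure. norm ((w \<bullet> e) * (newt (\<epsilon> m) (w - z) - dnewt (\<epsilon> m) w (w - z))) \<le> norm e * (1 / (1 - norm z) ^ 2 + 2 / (1 - norm z) ^ 3)" for m
    proof (rule AE_I2)
      fix w :: 'a assume "w \<in> space sphere_measure"
      then have w: "norm w = 1" by (simp add: space_sphere_measure)
      have e0: "\<epsilon> m \<ge> 0" using \<epsilon>(1)[of m] by simp
      have p: "0 < 1 - norm z" using z by simp
      note d = sphere_distance[OF w, of z]
      have a: "\<bar>newt (\<epsilon> m) (w - z)\<bar> \<le> 1 / (1 - norm z) ^ 2"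
        using newt_bounds(1)[OF w1[OF w] e0] d p by (elim order_trans) (auto intro!: divide_left_mono power_mono mult_pos_pos zero_less_power)
      have "\<bar>dnewt (\<epsilon> m) w (w - z)\<bar> \<le> 2 / norm (w - z) ^ 3"
        using newt_bounds(2)[OF w1[OF w] e0, of w] w by simp
      also have "\<dots> \<le> 2 / (1 - norm z) ^ 3"
        using d p by (auto intro!: divide_left_mono power_mono mult_pos_pos zero_less_power)
      finally have b: "\<bar>dnewt (\<epsilon> m) w (w - z)\<bar> \<le> 2 / (1 - norm z) ^ 3" .
      have c: "\<bar>w \<bullet> e\<bar> \<le> norm e" using Cauchy_Schwarz_ineq2[of w e] w by simp
      have "\<bar>newt (\<epsilon> m) (w - z) - dnewt (\<epsilon> m) w (w - z)\<bar> \<le> 1 / (1 - norm z) ^ 2 + 2 / (1 - norm z) ^ 3"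
        using a b by linarith
      then show "norm ((w \<bullet> e) * (newt (\<epsilon> m) (w - z) - dnewt (\<epsilon> m) w (w - z))) \<le> norm e * (1 / (1 - norm z) ^ 2 + 2 / (1 - norm z) ^ 3)"
        unfolding real_norm_def abs_mult by (intro mult_mono c) auto
    qed
  qed simp
  show ?thesis by (rule LIMSEQ_unique[OF 2 1])
qed

text \<open>\<open>conv_has_derivative\<close> asks for a kernel smooth everywhere. For w on the
  sphere and points of the segment from 0 to z only arguments of norm at least 1 - |z| occur, so the
  singularity can be cut off below that radius.\<close>

lemma smooth_kernel_cut:
  assumes "\<delta> > 0"
  obtains \<kappa> :: "'a::euclidean_space \<Rightarrow> real" where "smooth \<kappa>" "\<And>x. norm x \<ge> \<delta> \<Longrightarrow> \<kappa> x = newt 0 x"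
    "\<And>x h. norm x \<ge> \<delta> \<Longrightarrow> frechet_derivative \<kappa> (at x) h = dnewt 0 h x"
proof -
  have sn: "smooth_on (- {0}) (newt 0 :: 'a \<Rightarrow> real)"
  proof -
    have "cd_on k (- {0}) (\<lambda>x::'a. (x \<bullet> x) powr (-1))" for k
      by (rule cd_on_compose_real[OF _ _ cd_on_powr])
        (auto intro!: cd_on_inner cd_on_bounded_linear[OF _ bounded_linear_ident] simp: open_Compl)
    moreover have "(\<lambda>x::'a. (x \<bullet> x) powr (-1)) = newt 0"
      by (simp add: fun_eq_iff newt_def powr_minus_divide powr_one)
    ultimately show ?thesis by (simp add: smooth_on_def)
  qed
  define c :: "'a \<Rightarrow> real" where "c = cutoff (\<delta> / 3) (\<delta> / 2)"
  have c1: "c x = 1" if "norm x \<ge> \<delta> / 2" for x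
    unfolding c_def by (rule cutoff_eq_1) (use that assms in auto)
  have ic: "inner_cut 0 c"
    unfolding inner_cut_def c_def using smooth_cutoff cutoff_eq_0[of "\<delta> / 3" "\<delta> / 2"] assms
    by (auto intro!: exI[of _ "\<delta> / 3"])
  have "smooth (\<lambda>x. newt 0 x * c x)" using inner_cut_mult[OF sn ic] by (simp add: inner_cut_def)
  moreover have "newt 0 x * c x = newt 0 x" if "norm x \<ge> \<delta>" for x using c1[of x] that assms by simp
  moreover have "frechet_derivative (\<lambda>x. newt 0 x * c x) (at x) h = dnewt 0 h x" if x: "norm x \<ge> \<delta>" for x h
  proof -
    have x0: "x \<bullet> x + 0 > 0" using x assms by auto
    have "((\<lambda>x. newt 0 x * c x) has_derivative (\<lambda>h. dnewt 0 h x)) (at x)"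
    proof (rule has_derivative_transform_within_open[OF newt_has_derivative(1)[OF x0], of "- cball 0 (\<delta> / 2)"])
      show "x \<in> - cball 0 (\<delta> / 2)" using x assms by simp
      show "newt 0 y = newt 0 y * c y" if "y \<in> - cball 0 (\<delta> / 2)" for y using c1[of y] that by simp
    qed auto
    then show ?thesis by (simp add: frechet_derivative_eqI)
  qed
  ultimately show ?thesis by (rule that)
qed

text \<open>Let a(t) be the potential at t z, with a' = -b. For x = w - t z, homogeneity of degree
  -2 makes the derivative of the kernel in direction x equal to -2 times the kernel. Hence
  \<open>single_layer_identity\<close> at t z reads 3 a + t a' = m t (z \<bullet> e), where m is
  \<open>mass4\<close>. Multiplied by t^2 this is (t^3 a)' = m t^3 (z \<bullet> e), and integrating
  over [0,1] gives the factor m/4.\<close>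

lemma single_layer_linear:
  fixes z :: "'a::euclidean_space"
  assumes D: "DIM('a) = 4" and z: "norm z < 1"
  shows "(LINT w|sphere_measure. (w \<bullet> e) * newt 0 (w - z)) = mass4 TYPE('a) / 4 * (z \<bullet> e)"
proof -
  define \<delta> where "\<delta> = 1 - norm z"
  have \<delta>: "\<delta> > 0" using z by (simp add: \<delta>_def)
  obtain \<kappa> :: "'a \<Rightarrow> real" where \<kappa>: "smooth \<kappa>" "\<And>x. norm x \<ge> \<delta> \<Longrightarrow> \<kappa> x = newt 0 x"
    "\<And>x h. norm x \<ge> \<delta> \<Longrightarrow> frechet_derivative \<kappa> (at x) h = dnewt 0 h x"
    using smooth_kernel_cut[OF \<delta>] by metis
  have far: "norm (w - t *\<^sub>R z) \<ge> \<delta>" if "norm w = 1" "0 \<le> t" "t \<le> 1" for w t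
  proof -
    have "norm (t *\<^sub>R z) \<le> norm z" using that by (simp add: mult_left_le_one_le)
    then show ?thesis using sphere_distance[OF that(1), of "t *\<^sub>R z"] unfolding \<delta>_def by linarith
  qed
  let ?p = "\<lambda>w::'a. w \<bullet> e"
  have pi: "integrable sphere_measure ?p" by (intro integrable_sphere_continuous continuous_intros)
  define a where "a t = conv sphere_measure \<kappa> ?p (t *\<^sub>R z)" for t
  have a_eq: "a t = (LINT w|sphere_measure. (w \<bullet> e) * newt 0 (w - t *\<^sub>R z))" if "0 \<le> t" "t \<le> 1" for t
    unfolding a_def conv_def
    by (rule Bochner_Integration.integral_cong[OF refl]) (simp add: space_sphere_measure \<kappa>(2)[OF far] that mult.commute)
  define b where "b t = conv sphere_measure (\<lambda>x. frechet_derivative \<kappa> (at x) z) ?p (t *\<^sub>R z)" for t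
  have da: "(a has_real_derivative - b t) (at t)" for t
  proof -
    have "((\<lambda>t. t *\<^sub>R z) has_derivative (\<lambda>h. h *\<^sub>R z)) (at t)" by (rule derivative_eq_intros refl | simp)+
    note d = conv_has_derivative[OF ball_measure_instances(2) pi \<kappa>(1), of "t *\<^sub>R z"]
    from has_derivative_compose[OF \<open>((\<lambda>t. t *\<^sub>R z) has_derivative (\<lambda>h. h *\<^sub>R z)) (at t)\<close> d]
    have "(a has_derivative (\<lambda>h. - conv sphere_measure (\<lambda>x. frechet_derivative \<kappa> (at x) (h *\<^sub>R z)) ?p (t *\<^sub>R z))) (at t)"
      unfolding a_def[abs_def] .
    moreover have "conv sphere_measure (\<lambda>x. frechet_derivative \<kappa> (at x) (h *\<^sub>R z)) ?p (t *\<^sub>R z) = b t * h" for h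
    proof -
      have "frechet_derivative \<kappa> (at x) (h *\<^sub>R z) = h * frechet_derivative \<kappa> (at x) z" for x
        using linear_scale[OF has_derivative_linear[OF smooth_has_derivative[OF \<kappa>(1)]]] by simp
      then show ?thesis by (simp add: b_def conv_def mult_ac)
    qed
    moreover have "(\<lambda>h. - (b t * h)) = (*) (- b t)" by (simp add: fun_eq_iff)
    ultimately show ?thesis by (simp add: has_field_derivative_def)
  qed
  have ode: "3 * a t - t * b t = mass4 TYPE('a) * (t * (z \<bullet> e))" if t: "0 \<le> t" "t \<le> 1" for t
  proof -
    have tz: "norm (t *\<^sub>R z) < 1" using t z by (simp add: mult_le_one le_less_trans[OF mult_left_le_one_le])
    have sk: "integrable sphere_measure (\<lambda>w. (w \<bullet> e) * newt 0 (w - t *\<^sub>R z))" "integrable sphere_measure (\<lambda>w. (w \<bullet> e) * dnewt 0 z (w - t *\<^sub>R z))"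
    proof -
      have "integrable sphere_measure (\<lambda>w. \<kappa> (w - t *\<^sub>R z) *\<^sub>R ?p w)" "integrable sphere_measure (\<lambda>w. frechet_derivative \<kappa> (at (w - t *\<^sub>R z)) z *\<^sub>R ?p w)"
        using conv_integrand[OF ball_measure_instances(2) pi \<kappa>(1)] conv_integrand[OF ball_measure_instances(2) pi smooth_directional[OF \<kappa>(1)]] by blast+
      moreover have "integrable sphere_measure (\<lambda>w. \<kappa> (w - t *\<^sub>R z) *\<^sub>R ?p w) = integrable sphere_measure (\<lambda>w. (w \<bullet> e) * newt 0 (w - t *\<^sub>R z))"
        by (rule Bochner_Integration.integrable_cong[OF refl]) (simp add: space_sphere_measure \<kappa>(2)[OF far] t mult.commute)
      moreover have "integrable sphere_measure (\<lambda>w. frechet_derivative \<kappa> (at (w - t *\<^sub>R z)) z *\<^sub>R ?p w) = integrable sphere_measure (\<lambda>w. (w \<bullet> e) * dnewt 0 z (w - t *\<^sub>R z))"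
        by (rule Bochner_Integration.integrable_cong[OF refl]) (simp add: space_sphere_measure \<kappa>(3)[OF far] t mult.commute)
      ultimately show "integrable sphere_measure (\<lambda>w. (w \<bullet> e) * newt 0 (w - t *\<^sub>R z))" "integrable sphere_measure (\<lambda>w. (w \<bullet> e) * dnewt 0 z (w - t *\<^sub>R z))"
        by simp_all
    qed
    have b_eq: "b t = (LINT w|sphere_measure. (w \<bullet> e) * dnewt 0 z (w - t *\<^sub>R z))"
      unfolding b_def conv_def
      by (rule Bochner_Integration.integral_cong[OF refl]) (simp add: space_sphere_measure \<kappa>(3)[OF far] t mult.commute)
    have "3 * a t - t * b t = (LINT w|sphere_measure. 3 * ((w \<bullet> e) * newt 0 (w - t *\<^sub>R z)) - t * ((w \<bullet> e) * dnewt 0 z (w - t *\<^sub>R z)))"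
      using sk by (simp add: a_eq[OF t] b_eq)
    also have "\<dots> = (LINT w|sphere_measure. (w \<bullet> e) * (newt 0 (w - t *\<^sub>R z) - dnewt 0 w (w - t *\<^sub>R z)))"
    proof (rule Bochner_Integration.integral_cong[OF refl])
      fix w :: 'a assume "w \<in> space sphere_measure"
      then have "norm w = 1" by (simp add: space_sphere_measure)
      define x where "x = w - t *\<^sub>R z"
      have "norm x > 0" unfolding x_def using far[OF \<open>norm w = 1\<close> t] \<delta> by linarith
      then have "x \<bullet> x \<noteq> 0" by simp
      then have "dnewt 0 x x = - 2 * newt 0 x" by (simp add: dnewt_def newt_def power2_eq_square)
      moreover have "dnewt 0 w x = dnewt 0 x x + t * dnewt 0 z x"
        unfolding dnewt_linear(3)[symmetric] dnewt_linear(1)[symmetric] by (simp add: x_def)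
      ultimately have td: "t * dnewt 0 z x = dnewt 0 w x + 2 * newt 0 x" by simp
      have "t * ((w \<bullet> e) * dnewt 0 z x) = (w \<bullet> e) * (dnewt 0 w x + 2 * newt 0 x)"
        unfolding td[symmetric] by simp
      then show "3 * ((w \<bullet> e) * newt 0 (w - t *\<^sub>R z)) - t * ((w \<bullet> e) * dnewt 0 z (w - t *\<^sub>R z)) = (w \<bullet> e) * (newt 0 (w - t *\<^sub>R z) - dnewt 0 w (w - t *\<^sub>R z))"
        unfolding x_def[symmetric] by (simp add: algebra_simps)
    qed
    also have "\<dots> = mass4 TYPE('a) * (t * (z \<bullet> e))" using single_layer_identity[OF D tz, of e] by simp
    finally show ?thesis .
  qed
  define G where "G t = t ^ 3 * a t - mass4 TYPE('a) / 4 * (z \<bullet> e) * t ^ 4" for t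
  have dG: "(G has_real_derivative (t ^ 2 * (3 * a t - t * b t) - mass4 TYPE('a) * (z \<bullet> e) * t ^ 3)) (at t)" for t
    unfolding G_def[abs_def]
    by (rule derivative_eq_intros da refl)+ (simp add: field_simps power2_eq_square power3_eq_cube)
  have "G 1 = G 0"
  proof (rule DERIV_isconst2[of 0 1 G])
    show "continuous_on {0..1} G" using dG DERIV_isCont continuous_at_imp_continuous_on by blast
    show "(G has_real_derivative 0) (at t)" if "0 < t" "t < 1" for t
      using dG[of t] ode[of t] that by (simp add: power2_eq_square power3_eq_cube mult_ac)
  qed auto
  then have "a 1 = mass4 TYPE('a) / 4 * (z \<bullet> e)" by (simp add: G_def)
  then show ?thesis using a_eq[of 1] by simp
qed

section \<open>Representation of the Newton potential\<close>

lemma LINT_ball_eq_lborel: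
  fixes h :: "'a::euclidean_space \<Rightarrow> 'b::euclidean_space"
  assumes [measurable]: "h \<in> borel_measurable borel" and h0: "\<And>x. norm x \<ge> 1 \<Longrightarrow> h x = 0"
  shows "(LINT x|lebesgue_on (ball 0 1). h x) = (LINT x|lborel. h x)"
proof -
  have "(LINT x|lebesgue_on (ball 0 1). h x) = (LINT x|lebesgue. indicator (ball 0 1) x *\<^sub>R h x)"
    by (simp add: integral_restrict_space)
  also have "(\<lambda>x. indicator (ball 0 1) x *\<^sub>R h x) = h"
    using h0 by (auto simp: fun_eq_iff indicator_def not_less)
  also have "(LINT x|lebesgue. h x) = (LINT x|lborel. h x)"
    by (rule integral_completion) measurable
  finally show ?thesis .
qed

lemma bump4_bounds:
  fixes x :: "'a::euclidean_space"
  assumes "\<epsilon> > 0" shows "0 \<le> bump4 \<epsilon> x" "bump4 \<epsilon> x \<le> 8 / \<epsilon>\<^sup>2"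
proof -
  have "\<epsilon> ^ 3 \<le> (x \<bullet> x + \<epsilon>) ^ 3" using assms by (intro power_mono) auto
  then have "8 * \<epsilon> / (x \<bullet> x + \<epsilon>) ^ 3 \<le> 8 * \<epsilon> / \<epsilon> ^ 3" using assms by (intro divide_left_mono mult_pos_pos zero_less_power) (auto intro: add_nonneg_pos)
  also have "\<dots> = 8 / \<epsilon>\<^sup>2" using assms by (simp add: power2_eq_square power3_eq_cube)
  finally show "bump4 \<epsilon> x \<le> 8 / \<epsilon>\<^sup>2" by (simp add: bump4_def)
  show "0 \<le> bump4 \<epsilon> x" using assms by (simp add: bump4_def add_nonneg_nonneg)
qed

lemma bump4_borel: "bump4 \<epsilon> \<in> borel_measurable borel"
  unfolding bump4_def[abs_def] by measurable

lemma bump4_minus: "bump4 \<epsilon> (w - z) = bump4 \<epsilon> (z - w)"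
proof -
  have "(w - z) \<bullet> (w - z) = (z - w) \<bullet> (z - w)" by (simp add: inner_diff_left inner_diff_right inner_commute)
  then show ?thesis by (simp add: bump4_def)
qed

text \<open>\<open>u\<close> is merely integrable, with no continuity to exploit. Fubini moves the
  even kernel onto \<psi>, which is bounded and continuous, and \<open>bump4_approx_identity\<close>
  applies there.\<close>

lemma bump4_weak_limit:
  fixes u :: "'a::euclidean_space \<Rightarrow> 'b::euclidean_space"
  assumes D: "DIM('a) = 4" and u: "integrable (lebesgue_on (ball 0 1)) u"
    and \<psi>: "test_function (ball 0 1) \<psi>"
    and \<epsilon>: "\<And>m. \<epsilon> m > 0" "\<epsilon> \<longlonglongrightarrow> 0"
  defines "M \<equiv> lebesgue_on (ball (0::'a) 1)"
  shows "(\<lambda>m. LINT z|M. \<psi> z *\<^sub>R conv M (bump4 (\<epsilon> m)) u z) \<longlonglongrightarrow> (LINT w|M. \<psi> w *\<^sub>R (mass4 TYPE('a) *\<^sub>R u w))"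
proof -
  interpret M: finite_measure M unfolding M_def by (rule finite_measure_lebesgue_on_ball)
  interpret MM: pair_sigma_finite M M ..
  have s\<psi>: "smooth \<psi>" and \<psi>0: "\<And>x. norm x \<ge> 1 \<Longrightarrow> \<psi> x = 0"
    using \<psi> unfolding test_function_def by (auto simp: subset_iff)
  have \<psi>b: "\<psi> \<in> borel_measurable borel" by (rule smooth_borel[OF s\<psi>])
  obtain C where C: "C \<ge> 0" "\<And>x. norm x \<le> 1 \<Longrightarrow> norm (\<psi> x) \<le> C" by (rule smooth_bound_on_cball[OF s\<psi>, of 1]) blast
  have C': "\<bar>\<psi> x\<bar> \<le> C" for x using C \<psi>0[of x] by (cases "norm x \<le> 1") auto
  have id: "(\<lambda>x. x) \<in> M \<rightarrow>\<^sub>M borel" unfolding M_def by (rule borel_imp_lebesgue_on_id)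
  have um: "u \<in> borel_measurable M" using u unfolding M_def by auto
  note [measurable] = bump4_borel \<psi>b id um
  have iu: "integrable (M \<Otimes>\<^sub>M M) (\<lambda>(z, w). u w)"
  proof (rule MM.Fubini_integrable)
    show "(\<lambda>(z, w). u w) \<in> borel_measurable (M \<Otimes>\<^sub>M M)" by measurable
  qed (use u in \<open>auto simp: M_def[symmetric]\<close>)
  have fub: "(LINT z|M. \<psi> z *\<^sub>R conv M (bump4 (\<epsilon> m)) u z) = (LINT w|M. (LINT z|lborel. bump4 (\<epsilon> m) (z - w) * \<psi> z) *\<^sub>R u w)" for m
  proof -
    have p1: "(\<lambda>p. fst p) \<in> M \<Otimes>\<^sub>M M \<rightarrow>\<^sub>M borel" "(\<lambda>p. snd p) \<in> M \<Otimes>\<^sub>M M \<rightarrow>\<^sub>M borel"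
      using measurable_compose[OF measurable_fst id] measurable_compose[OF measurable_snd id] by auto
    have "integrable (M \<Otimes>\<^sub>M M) (\<lambda>p. (\<psi> (fst p) * bump4 (\<epsilon> m) (snd p - fst p)) *\<^sub>R (case p of (z, w) \<Rightarrow> u w))"
    proof (rule integrable_bounded_scaleR[OF iu, where C = "C * (8 / (\<epsilon> m)\<^sup>2)"])
      note [measurable] = p1
      show "(\<lambda>p. \<psi> (fst p) * bump4 (\<epsilon> m) (snd p - fst p)) \<in> borel_measurable (M \<Otimes>\<^sub>M M)" by measurable
      show "\<bar>\<psi> (fst p) * bump4 (\<epsilon> m) (snd p - fst p)\<bar> \<le> C * (8 / (\<epsilon> m)\<^sup>2)" for p
        unfolding abs_mult using C' C(1) by (intro mult_mono) (auto simp: abs_of_nonneg bump4_bounds[OF \<epsilon>(1)])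
    qed
    then have i2: "integrable (M \<Otimes>\<^sub>M M) (\<lambda>(z, w). (\<psi> z * bump4 (\<epsilon> m) (w - z)) *\<^sub>R u w)"
      by (simp add: case_prod_unfold)
    have "(LINT z|M. \<psi> z *\<^sub>R conv M (bump4 (\<epsilon> m)) u z) = (LINT z|M. LINT w|M. (\<psi> z * bump4 (\<epsilon> m) (w - z)) *\<^sub>R u w)"
      unfolding conv_def integral_scaleR_right[symmetric] by simp
    also have "\<dots> = (LINT w|M. LINT z|M. (\<psi> z * bump4 (\<epsilon> m) (w - z)) *\<^sub>R u w)"
      by (rule MM.Fubini_integral[OF i2, symmetric])
    also have "\<dots> = (LINT w|M. (LINT z|lborel. bump4 (\<epsilon> m) (z - w) * \<psi> z) *\<^sub>R u w)"
    proof (rule Bochner_Integration.integral_cong[OF refl])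
      fix w
      have "(LINT z|M. bump4 (\<epsilon> m) (z - w) * \<psi> z) = (LINT z|lborel. bump4 (\<epsilon> m) (z - w) * \<psi> z)"
        unfolding M_def by (rule LINT_ball_eq_lborel) (use \<psi>0 in auto)
      moreover have "integrable M (\<lambda>z. bump4 (\<epsilon> m) (z - w) * \<psi> z)"
      proof (rule M.integrable_const_bound[where B = "(8 / (\<epsilon> m)\<^sup>2) * C"])
        show "AE z in M. norm (bump4 (\<epsilon> m) (z - w) * \<psi> z) \<le> (8 / (\<epsilon> m)\<^sup>2) * C"
          unfolding real_norm_def abs_mult using C' C(1) by (intro AE_I2 mult_mono) (auto simp: abs_of_nonneg bump4_bounds[OF \<epsilon>(1)])
      qed measurable
      then have "(LINT z|M. (bump4 (\<epsilon> m) (z - w) * \<psi> z) *\<^sub>R u w) = (LINT z|M. bump4 (\<epsilon> m) (z - w) * \<psi> z) *\<^sub>R u w"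
        by simp
      ultimately show "(LINT z|M. (\<psi> z * bump4 (\<epsilon> m) (w - z)) *\<^sub>R u w) = (LINT z|lborel. bump4 (\<epsilon> m) (z - w) * \<psi> z) *\<^sub>R u w"
        by (simp add: bump4_minus[of _ w] mult.commute)
    qed
    finally show ?thesis .
  qed
  have cont: "isCont \<psi> w" for w using smooth_continuous[OF s\<psi>, of UNIV] by (simp add: continuous_on_eq_continuous_at)
  note bi = bump4_approx_identity[OF D \<psi>b C' cont \<epsilon>]
  have meas: "(\<lambda>w. LINT z|lborel. bump4 (\<epsilon> m) (z - w) * \<psi> z) \<in> borel_measurable M" for m
  proof -
    have "(\<lambda>w. LINT z|lborel. bump4 (\<epsilon> m) (z - w) * \<psi> z) \<in> borel_measurable borel" by measurable
    from measurable_compose[OF id this] show ?thesis .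
  qed
  show ?thesis unfolding fub
  proof (rule integral_dominated_convergence[where w = "\<lambda>w. (mass4 TYPE('a) * C) * norm (u w)"])
    show "integrable M (\<lambda>w. (mass4 TYPE('a) * C) * norm (u w))" using u by (simp add: M_def)
    show "(\<lambda>w. \<psi> w *\<^sub>R (mass4 TYPE('a) *\<^sub>R u w)) \<in> borel_measurable M" by measurable
    show "(\<lambda>w. (LINT z|lborel. bump4 (\<epsilon> m) (z - w) * \<psi> z) *\<^sub>R u w) \<in> borel_measurable M" for m
      using meas[of m] um by measurable
    show "AE w in M. (\<lambda>m. (LINT z|lborel. bump4 (\<epsilon> m) (z - w) * \<psi> z) *\<^sub>R u w) \<longlonglongrightarrow> \<psi> w *\<^sub>R (mass4 TYPE('a) *\<^sub>R u w)"
    proof (rule AE_I2)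
      fix w
      have "(\<lambda>m. (LINT z|lborel. bump4 (\<epsilon> m) (z - w) * \<psi> z) *\<^sub>R u w) \<longlonglongrightarrow> (mass4 TYPE('a) * \<psi> w) *\<^sub>R u w"
        by (intro tendsto_scaleR bi(1) tendsto_const)
      then show "(\<lambda>m. (LINT z|lborel. bump4 (\<epsilon> m) (z - w) * \<psi> z) *\<^sub>R u w) \<longlonglongrightarrow> \<psi> w *\<^sub>R (mass4 TYPE('a) *\<^sub>R u w)"
        by (simp add: mult.commute)
    qed
    show "AE w in M. norm ((LINT z|lborel. bump4 (\<epsilon> m) (z - w) * \<psi> z) *\<^sub>R u w) \<le> mass4 TYPE('a) * C * norm (u w)" for m
      unfolding norm_scaleR using bi(2) by (intro AE_I2 mult_right_mono) auto
  qed
qed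

lemma newt_sphere_bound:
  fixes z :: "'a::euclidean_space"
  assumes w: "norm w = 1" and z: "norm z \<le> \<rho>" "\<rho> < 1" and "\<epsilon> \<ge> 0"
  shows "\<bar>newt \<epsilon> (w - z)\<bar> \<le> 1 / (1 - \<rho>)\<^sup>2"
proof -
  have g: "norm (w - z) \<ge> 1 - \<rho>" using sphere_distance[OF w, of z] z by linarith
  then have "w - z \<noteq> 0" using z by auto
  from newt_bounds(1)[OF this assms(4)] have "\<bar>newt \<epsilon> (w - z)\<bar> \<le> 1 / (norm (w - z))\<^sup>2" .
  also have "\<dots> \<le> 1 / (1 - \<rho>)\<^sup>2" using g z by (intro divide_left_mono power_mono mult_pos_pos zero_less_power) auto
  finally show ?thesis .
qed

text \<open>Expanding \<open>l\<close> in the real basis reduces the limit to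
  \<open>single_layer_linear\<close>, coordinate by coordinate.\<close>

lemma single_layer_limit:
  fixes l :: "'a::euclidean_space \<Rightarrow> 'b::euclidean_space"
  assumes D: "DIM('a) = 4" and l: "bounded_linear l" and \<epsilon>: "\<And>m. \<epsilon> m > 0" "\<epsilon> \<longlonglongrightarrow> 0" and z: "norm z < 1"
  shows "(\<lambda>m. conv sphere_measure (newt (\<epsilon> m)) l z) \<longlonglongrightarrow> (mass4 TYPE('a) / 4) *\<^sub>R l z"
proof -
  have lc: "continuous_on UNIV l" using l by (rule linear_continuous_on)
  have lm: "l \<in> borel_measurable sphere_measure" by (intro borel_measurable_sphere_measure borel_of_continuous lc)
  have nm: "(\<lambda>w. newt \<delta> (w - z)) \<in> borel_measurable sphere_measure" for \<delta>
    by (intro borel_measurable_sphere_measure measurable_compose[OF _ newt_borel(1)]) measurable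
  have li: "integrable sphere_measure l" by (rule integrable_sphere_continuous[OF lc])
  have lim: "(\<lambda>m. conv sphere_measure (newt (\<epsilon> m)) l z) \<longlonglongrightarrow> conv sphere_measure (newt 0) l z"
    unfolding conv_def
  proof (rule integral_dominated_convergence[where w = "\<lambda>w. 1 / (1 - norm z)\<^sup>2 * norm (l w)"])
    show "AE w in sphere_measure. (\<lambda>m. newt (\<epsilon> m) (w - z) *\<^sub>R l w) \<longlonglongrightarrow> newt 0 (w - z) *\<^sub>R l w"
    proof (rule AE_I2)
      fix w :: 'a assume "w \<in> space sphere_measure"
      then have "w - z \<noteq> 0" using z by (auto simp: space_sphere_measure)
      then show "(\<lambda>m. newt (\<epsilon> m) (w - z) *\<^sub>R l w) \<longlonglongrightarrow> newt 0 (w - z) *\<^sub>R l w"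
        by (intro tendsto_scaleR newt_limits \<epsilon> tendsto_const)
    qed
    show "AE w in sphere_measure. norm (newt (\<epsilon> m) (w - z) *\<^sub>R l w) \<le> 1 / (1 - norm z)\<^sup>2 * norm (l w)" for m
    proof (rule AE_I2)
      fix w :: 'a assume "w \<in> space sphere_measure"
      then show "norm (newt (\<epsilon> m) (w - z) *\<^sub>R l w) \<le> 1 / (1 - norm z)\<^sup>2 * norm (l w)"
        unfolding norm_scaleR using z less_imp_le[OF \<epsilon>(1)[of m]]
        by (intro mult_right_mono newt_sphere_bound[OF _ order.refl]) (auto simp: space_sphere_measure)
    qed
  qed (use li lm nm in \<open>auto intro!: borel_measurable_scaleR\<close>)
  have "conv sphere_measure (newt 0) l z = (LINT w|sphere_measure. (\<Sum>e\<in>Basis. ((w \<bullet> e) * newt 0 (w - z)) *\<^sub>R l e))"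
    unfolding conv_def
  proof (rule Bochner_Integration.integral_cong[OF refl])
    fix w :: 'a
    have "l w = (\<Sum>e\<in>Basis. (w \<bullet> e) *\<^sub>R l e)"
      by (rule has_derivative_euclidean_expand[OF bounded_linear_imp_has_derivative[OF l, of "at 0"]])
    then show "newt 0 (w - z) *\<^sub>R l w = (\<Sum>e\<in>Basis. ((w \<bullet> e) * newt 0 (w - z)) *\<^sub>R l e)"
      by (simp add: scaleR_sum_right mult.commute)
  qed
  also have "\<dots> = (\<Sum>e\<in>Basis. (LINT w|sphere_measure. (w \<bullet> e) * newt 0 (w - z)) *\<^sub>R l e)"
  proof -
    have "integrable sphere_measure (\<lambda>w. (w \<bullet> e) * newt 0 (w - z))" for e
    proof -
      have "integrable sphere_measure (\<lambda>w. newt 0 (w - z) *\<^sub>R (w \<bullet> e))"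
        by (rule integrable_bounded_scaleR[OF _ nm, where C = "1 / (1 - norm z)\<^sup>2"])
          (use z in \<open>auto intro!: integrable_sphere_continuous continuous_intros newt_sphere_bound simp: space_sphere_measure\<close>)
      then show ?thesis by (simp add: mult.commute)
    qed
    then show ?thesis by (subst Bochner_Integration.integral_sum) simp_all
  qed
  also have "\<dots> = (\<Sum>e\<in>Basis. (mass4 TYPE('a) / 4) *\<^sub>R ((z \<bullet> e) *\<^sub>R l e))"
    by (simp add: single_layer_linear[OF D z])
  also have "\<dots> = (mass4 TYPE('a) / 4) *\<^sub>R l z"
    using has_derivative_euclidean_expand[OF bounded_linear_imp_has_derivative[OF l, of "at 0"], of z]
    by (simp add: scaleR_sum_right)
  finally show ?thesis using lim by simp
qed

text \<open>The support of \<psi> keeps a positive distance from the sphere, which bounds the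
  kernels uniformly in \<epsilon>.\<close>

lemma single_layer_weak_limit:
  fixes l :: "'a::euclidean_space \<Rightarrow> 'b::euclidean_space"
  assumes D: "DIM('a) = 4" and l: "bounded_linear l" and \<epsilon>: "\<And>m. \<epsilon> m > 0" "\<epsilon> \<longlonglongrightarrow> 0"
    and \<psi>: "test_function (ball 0 1) \<psi>"
  defines "M \<equiv> lebesgue_on (ball (0::'a) 1)"
  shows "(\<lambda>m. LINT z|M. \<psi> z *\<^sub>R conv sphere_measure (newt (\<epsilon> m)) l z) \<longlonglongrightarrow> (LINT z|M. \<psi> z *\<^sub>R ((mass4 TYPE('a) / 4) *\<^sub>R l z))"
proof -
  interpret M: finite_measure M unfolding M_def by (rule finite_measure_lebesgue_on_ball)
  obtain K where s\<psi>: "smooth \<psi>" and K: "compact K" "K \<subseteq> ball 0 1" "\<And>x. x \<notin> K \<Longrightarrow> \<psi> x = 0"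
    using \<psi> unfolding test_function_def by blast
  have lc: "continuous_on UNIV l" using l by (rule linear_continuous_on)
  have li: "integrable sphere_measure l" by (rule integrable_sphere_continuous[OF lc])
  obtain \<rho> where \<rho>: "\<rho> < 1" "\<And>x. x \<in> K \<Longrightarrow> norm x \<le> \<rho>"
  proof (cases "K = {}")
    case False
    then obtain x0 where "x0 \<in> K" "\<And>x. x \<in> K \<Longrightarrow> norm x \<le> norm x0"
      using continuous_attains_sup[OF K(1) False continuous_on_norm_id] by blast
    then show ?thesis using that[of "norm x0"] K(2) by auto
  qed (use that[of 0] in auto)
  obtain C where C: "C \<ge> 0" "\<And>x. norm x \<le> 1 \<Longrightarrow> norm (\<psi> x) \<le> C" by (rule smooth_bound_on_cball[OF s\<psi>, of 1]) blast
  define B where "B = 1 / (1 - \<rho>)\<^sup>2 * (LINT w|sphere_measure. norm (l w))"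
  have B: "norm (conv sphere_measure (newt (\<epsilon> m)) l z) \<le> B" if "z \<in> K" for m z
  proof -
    have ci: "integrable sphere_measure (\<lambda>w. newt (\<epsilon> m) (w - z) *\<^sub>R l w)"
      by (rule conv_integrand[OF ball_measure_instances(2) li smooth_newt[OF \<epsilon>(1)]])
    have "norm (conv sphere_measure (newt (\<epsilon> m)) l z) \<le> (LINT w|sphere_measure. norm (newt (\<epsilon> m) (w - z) *\<^sub>R l w))"
      unfolding conv_def by (rule integral_norm_bound)
    also have "\<dots> \<le> (LINT w|sphere_measure. 1 / (1 - \<rho>)\<^sup>2 * norm (l w))"
    proof (rule Bochner_Integration.integral_mono)
      fix w :: 'a assume "w \<in> space sphere_measure"
      then show "norm (newt (\<epsilon> m) (w - z) *\<^sub>R l w) \<le> 1 / (1 - \<rho>)\<^sup>2 * norm (l w)"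
        unfolding norm_scaleR using \<rho> that less_imp_le[OF \<epsilon>(1)[of m]]
        by (intro mult_right_mono newt_sphere_bound) (auto simp: space_sphere_measure)
    next
      show "integrable sphere_measure (\<lambda>w. norm (newt (\<epsilon> m) (w - z) *\<^sub>R l w))" using ci by (rule integrable_norm)
    qed (use li in auto)
    also have "\<dots> = B" by (simp add: B_def)
    finally show ?thesis .
  qed
  have "B \<ge> 0" unfolding B_def by (intro mult_nonneg_nonneg integral_nonneg_AE) auto
  have bm: "h \<in> borel_measurable M" if "continuous_on UNIV h" for h :: "'a \<Rightarrow> 'b"
    unfolding M_def by (intro borel_measurable_lebesgue_on borel_of_continuous that)
  show ?thesis
  proof (rule integral_dominated_convergence[where w = "\<lambda>_. C * B"])
    show "(\<lambda>z. \<psi> z *\<^sub>R ((mass4 TYPE('a) / 4) *\<^sub>R l z)) \<in> borel_measurable M"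
      by (intro bm continuous_intros smooth_continuous[OF s\<psi>] lc)
    show "(\<lambda>z. \<psi> z *\<^sub>R conv sphere_measure (newt (\<epsilon> m)) l z) \<in> borel_measurable M" for m
      by (intro bm continuous_intros smooth_continuous[OF s\<psi>] smooth_continuous smooth_conv[OF ball_measure_instances(2) li] smooth_newt \<epsilon>)
    show "AE z in M. (\<lambda>m. \<psi> z *\<^sub>R conv sphere_measure (newt (\<epsilon> m)) l z) \<longlonglongrightarrow> \<psi> z *\<^sub>R ((mass4 TYPE('a) / 4) *\<^sub>R l z)"
      by (rule AE_I2, intro tendsto_scaleR tendsto_const single_layer_limit[OF D l \<epsilon>]) (simp add: M_def)
    show "AE z in M. norm (\<psi> z *\<^sub>R conv sphere_measure (newt (\<epsilon> m)) l z) \<le> C * B" for m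
    proof (rule AE_I2)
      fix z assume z: "z \<in> space M"
      show "norm (\<psi> z *\<^sub>R conv sphere_measure (newt (\<epsilon> m)) l z) \<le> C * B"
      proof (cases "z \<in> K")
        case True
        then show ?thesis unfolding norm_scaleR using C z B \<open>B \<ge> 0\<close> by (intro mult_mono) (auto simp: M_def)
      qed (use K(3) C(1) \<open>B \<ge> 0\<close> in auto)
    qed
  qed simp
qed

text \<open>Lets \<epsilon> tend to 0 in Green's formula. The three terms converge in different
  senses, the left one in L2 and that of \<open>u\<close> only weakly, so the limits are compared
  against test functions and \<open>weak_AE_unique\<close> concludes.\<close>

lemma potential_representation:
  fixes u f :: "'a::euclidean_space \<Rightarrow> 'b::euclidean_space"
  assumes D: "DIM('a) = 4" and f: "square_integrable (lebesgue_on (ball 0 1)) f"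
    and u: "integrable (lebesgue_on (ball 0 1)) u" and l: "bounded_linear l"
  defines "M \<equiv> lebesgue_on (ball (0::'a) 1)"
  assumes green: "\<And>\<epsilon> z. \<epsilon> > 0 \<Longrightarrow> conv M (newt \<epsilon>) f z = - conv M (bump4 \<epsilon>) u z + conv sphere_measure (newt \<epsilon>) l z"
  shows "AE z in M. conv M (newt 0) f z = (mass4 TYPE('a) / 4) *\<^sub>R l z - mass4 TYPE('a) *\<^sub>R u z"
  unfolding M_def
proof (rule weak_AE_unique)
  interpret M: finite_measure M unfolding M_def by (rule finite_measure_lebesgue_on_ball)
  define \<epsilon> where "\<epsilon> m = inverse (real (Suc m))" for m
  have \<epsilon>: "\<epsilon> m > 0" "\<epsilon> \<longlonglongrightarrow> 0" for m
    unfolding \<epsilon>_def using LIMSEQ_inverse_real_of_nat by auto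
  have lc: "continuous_on UNIV l" using l by (rule linear_continuous_on)
  have lis: "integrable sphere_measure l" by (rule integrable_sphere_continuous[OF lc])
  have li: "integrable M l" unfolding M_def by (rule integrable_ball_continuous[OF lc])
  note H1 = newton_H1[OF D f \<epsilon>, folded M_def]
  have v: "integrable M (conv M (newt 0) f)" by (rule M.square_integrable_imp_integrable'[OF H1(2)])
  have Ml: "ball (0::'a) 1 \<in> sets lebesgue" by simp
  show "locally_integrable (ball 0 1) (conv (lebesgue_on (ball 0 1)) (newt 0) f)"
    using integrable_imp_locally_integrable[OF _ Ml] v by (simp add: M_def)
  show "locally_integrable (ball 0 1) (\<lambda>z. (mass4 TYPE('a) / 4) *\<^sub>R l z - mass4 TYPE('a) *\<^sub>R u z)"
    by (rule integrable_imp_locally_integrable[OF _ Ml], rule Bochner_Integration.integrable_diff) (use li u in \<open>auto simp: M_def\<close>)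
  fix \<psi> :: "'a \<Rightarrow> real" assume \<psi>: "test_function (ball 0 1) \<psi>"
  then have s\<psi>: "smooth \<psi>" by (simp add: test_function_def)
  obtain C where C: "C \<ge> 0" "\<And>x. norm x \<le> 1 \<Longrightarrow> norm (\<psi> x) \<le> C" by (rule smooth_bound_on_cball[OF s\<psi>, of 1]) blast
  have cm: "integrable M (conv M (newt (\<epsilon> m)) f)" for m
    using integrable_ball_continuous[OF smooth_continuous[OF H1(1)]] by (simp add: M_def)
  have lim1: "(\<lambda>m. LINT z|M. \<psi> z *\<^sub>R conv M (newt (\<epsilon> m)) f z) \<longlonglongrightarrow> (LINT z|M. \<psi> z *\<^sub>R conv M (newt 0) f z)"
  proof (rule M.L2_integral_limit[OF cm H1(2) H1(4)])
    show "\<psi> \<in> borel_measurable M" unfolding M_def by (intro borel_measurable_lebesgue_on smooth_borel s\<psi>)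
    show "\<bar>\<psi> x\<bar> \<le> C" if "x \<in> space M" for x using C(2)[of x] that by (simp add: M_def)
  qed
  have ib: "integrable M (\<lambda>z. \<psi> z *\<^sub>R h z)" if "integrable M h" for h :: "'a \<Rightarrow> 'b"
    using smooth_scaleR_integrable[OF s\<psi>, of "ball 0 1" h] that by (simp add: M_def)
  have si: "integrable M (conv sphere_measure (newt (\<epsilon> m)) l)" for m
    unfolding M_def by (intro integrable_ball_continuous smooth_continuous smooth_conv[OF ball_measure_instances(2) lis] smooth_newt \<epsilon>)
  have bu: "conv M (bump4 (\<epsilon> m)) u z = conv sphere_measure (newt (\<epsilon> m)) l z - conv M (newt (\<epsilon> m)) f z" for m z
    using green[OF \<epsilon>(1)[of m], of z] by simp
  have eq: "(LINT z|M. \<psi> z *\<^sub>R conv M (newt (\<epsilon> m)) f z) =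
     (LINT z|M. \<psi> z *\<^sub>R conv sphere_measure (newt (\<epsilon> m)) l z) - (LINT z|M. \<psi> z *\<^sub>R conv M (bump4 (\<epsilon> m)) u z)" for m
    unfolding bu scaleR_diff_right using ib[OF si[of m]] ib[OF cm[of m]] by simp
  have "(\<lambda>m. LINT z|M. \<psi> z *\<^sub>R conv M (newt (\<epsilon> m)) f z) \<longlonglongrightarrow>
     (LINT z|M. \<psi> z *\<^sub>R ((mass4 TYPE('a) / 4) *\<^sub>R l z)) - (LINT z|M. \<psi> z *\<^sub>R (mass4 TYPE('a) *\<^sub>R u z))"
    unfolding eq using single_layer_weak_limit[OF D l \<epsilon> \<psi>] bump4_weak_limit[OF D u \<psi> \<epsilon>] unfolding M_def[symmetric]
    by (intro tendsto_diff)
  from LIMSEQ_unique[OF lim1 this]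
  have "(LINT z|M. \<psi> z *\<^sub>R conv M (newt 0) f z) = (LINT z|M. \<psi> z *\<^sub>R ((mass4 TYPE('a) / 4) *\<^sub>R l z)) - (LINT z|M. \<psi> z *\<^sub>R (mass4 TYPE('a) *\<^sub>R u z))" .
  also have "\<dots> = (LINT z|M. \<psi> z *\<^sub>R ((mass4 TYPE('a) / 4) *\<^sub>R l z - mass4 TYPE('a) *\<^sub>R u z))"
  proof -
    have "integrable M (\<lambda>z. (mass4 TYPE('a) / 4) *\<^sub>R l z)" "integrable M (\<lambda>z. mass4 TYPE('a) *\<^sub>R u z)" using li u by (auto simp: M_def)
    from ib[OF this(1)] ib[OF this(2)] show ?thesis by (simp only: scaleR_diff_right) (rule Bochner_Integration.integral_diff[symmetric])
  qed
  finally show "(LINT x|lebesgue_on (ball 0 1). \<psi> x *\<^sub>R conv (lebesgue_on (ball 0 1)) (newt 0) f x) =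
     (LINT x|lebesgue_on (ball 0 1). \<psi> x *\<^sub>R ((mass4 TYPE('a) / 4) *\<^sub>R l x - mass4 TYPE('a) *\<^sub>R u x))"
    unfolding M_def .
qed simp

section \<open>Traces\<close>

text \<open>From |f h| \<le> |f - F| |h| + |F| |h|: the first product is at most the sum of the
  squares, the second is handled by Cauchy-Schwarz.\<close>

lemma L2_product_tendsto:
  fixes f :: "nat \<Rightarrow> 'a \<Rightarrow> 'b::euclidean_space" and h :: "nat \<Rightarrow> 'a \<Rightarrow> 'c::euclidean_space"
  assumes [measurable]: "\<And>n. f n \<in> borel_measurable M" "\<And>n. h n \<in> borel_measurable M" and F: "square_integrable M F"
    and lf: "(\<lambda>n. \<integral>\<^sup>+x. ennreal ((norm (f n x - F x))\<^sup>2) \<partial>M) \<longlonglongrightarrow> 0"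
    and lh: "(\<lambda>n. \<integral>\<^sup>+x. ennreal ((norm (h n x))\<^sup>2) \<partial>M) \<longlonglongrightarrow> 0"
  shows "(\<lambda>n. \<integral>\<^sup>+x. ennreal (norm (f n x) * norm (h n x)) \<partial>M) \<longlonglongrightarrow> 0"
proof -
  have [measurable]: "F \<in> borel_measurable M" using F by (simp add: square_integrable_def)
  define y where "y n = (\<integral>\<^sup>+x. ennreal (norm (F x)) * ennreal (norm (h n x)) \<partial>M)" for n
  have "y \<longlonglongrightarrow> 0"
  proof (rule ennreal_tendsto_0_from_square[OF lh])
    show "(\<integral>\<^sup>+x. ennreal ((norm (F x))\<^sup>2) \<partial>M) < \<infinity>"
      using F by (simp add: square_integrable_def integrable_iff_bounded)
    fix n
    have "(y n)\<^sup>2 \<le> (\<integral>\<^sup>+x. (ennreal (norm (F x)))\<^sup>2 \<partial>M) * (\<integral>\<^sup>+x. (ennreal (norm (h n x)))\<^sup>2 \<partial>M)"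
      unfolding y_def by (rule Cauchy_Schwarz_nn_integral) measurable
    then show "(y n)\<^sup>2 \<le> (\<integral>\<^sup>+x. ennreal ((norm (F x))\<^sup>2) \<partial>M) * (\<integral>\<^sup>+x. ennreal ((norm (h n x))\<^sup>2) \<partial>M)"
      by (simp add: ennreal_power)
  qed
  have "(\<integral>\<^sup>+x. ennreal (norm (f n x) * norm (h n x)) \<partial>M) \<le>
      (\<integral>\<^sup>+x. ennreal ((norm (f n x - F x))\<^sup>2) \<partial>M) + (\<integral>\<^sup>+x. ennreal ((norm (h n x))\<^sup>2) \<partial>M) + y n" for n
  proof -
    have "(\<integral>\<^sup>+x. ennreal (norm (f n x) * norm (h n x)) \<partial>M) \<le>
      (\<integral>\<^sup>+x. (ennreal ((norm (f n x - F x))\<^sup>2) + ennreal ((norm (h n x))\<^sup>2)) + ennreal (norm (F x)) * ennreal (norm (h n x)) \<partial>M)"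
    proof (rule nn_integral_mono)
      fix x
      let ?a = "norm (f n x - F x)" and ?b = "norm (h n x)"
      have "norm (f n x) \<le> ?a + norm (F x)" using norm_triangle_ineq[of "f n x - F x" "F x"] by simp
      then have "norm (f n x) * ?b \<le> (?a + norm (F x)) * ?b" by (rule mult_right_mono) simp
      also have "\<dots> \<le> ?a\<^sup>2 + ?b\<^sup>2 + norm (F x) * ?b"
      proof -
        have "2 * (?a * ?b) \<le> ?a\<^sup>2 + ?b\<^sup>2" using sum_squares_bound[of ?a ?b] by simp
        moreover have "0 \<le> ?a * ?b" by simp
        ultimately have "?a * ?b \<le> ?a\<^sup>2 + ?b\<^sup>2" by linarith
        then show ?thesis by (simp add: distrib_right)
      qed
      finally have "ennreal (norm (f n x) * ?b) \<le> ennreal (?a\<^sup>2 + ?b\<^sup>2 + norm (F x) * ?b)" by (rule ennreal_leI)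
      also have "\<dots> = ennreal (?a\<^sup>2) + ennreal (?b\<^sup>2) + ennreal (norm (F x)) * ennreal ?b" by (simp add: ennreal_plus ennreal_mult)
      finally show "ennreal (norm (f n x) * norm (h n x)) \<le> (ennreal ((norm (f n x - F x))\<^sup>2) + ennreal ((norm (h n x))\<^sup>2)) + ennreal (norm (F x)) * ennreal (norm (h n x))" .
    qed
    also have "\<dots> = (\<integral>\<^sup>+x. ennreal ((norm (f n x - F x))\<^sup>2) \<partial>M) + (\<integral>\<^sup>+x. ennreal ((norm (h n x))\<^sup>2) \<partial>M) + y n"
      unfolding y_def by (simp add: nn_integral_add)
    finally show ?thesis .
  qed
  moreover have "(\<lambda>n. (\<integral>\<^sup>+x. ennreal ((norm (f n x - F x))\<^sup>2) \<partial>M) + (\<integral>\<^sup>+x. ennreal ((norm (h n x))\<^sup>2) \<partial>M) + y n) \<longlonglongrightarrow> 0 + 0 + 0"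
    by (intro tendsto_add lf lh \<open>y \<longlonglongrightarrow> 0\<close>)
  ultimately have u: "\<And>n. (\<integral>\<^sup>+x. ennreal (norm (f n x) * norm (h n x)) \<partial>M) \<le> (\<integral>\<^sup>+x. ennreal ((norm (f n x - F x))\<^sup>2) \<partial>M) + (\<integral>\<^sup>+x. ennreal ((norm (h n x))\<^sup>2) \<partial>M) + y n"
    "(\<lambda>n. (\<integral>\<^sup>+x. ennreal ((norm (f n x - F x))\<^sup>2) \<partial>M) + (\<integral>\<^sup>+x. ennreal ((norm (h n x))\<^sup>2) \<partial>M) + y n) \<longlonglongrightarrow> 0" by simp_all
  show ?thesis by (rule tendsto_sandwich[OF _ _ tendsto_const u(2)]) (use u(1) in auto)
qed

lemma integral_tendsto_0_bound:
  fixes F :: "nat \<Rightarrow> 'a \<Rightarrow> 'b::euclidean_space"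
  assumes F: "\<And>n. integrable M (F n)" and le: "\<And>n x. x \<in> space M \<Longrightarrow> ennreal (norm (F n x)) \<le> G n x"
    and G: "(\<lambda>n. \<integral>\<^sup>+x. G n x \<partial>M) \<longlonglongrightarrow> 0"
  shows "(\<lambda>n. LINT x|M. F n x) \<longlonglongrightarrow> 0"
proof -
  have "ennreal (norm (LINT x|M. F n x)) \<le> (\<integral>\<^sup>+x. G n x \<partial>M)" for n
  proof -
    have "ennreal (norm (LINT x|M. F n x)) \<le> (\<integral>\<^sup>+x. ennreal (norm (F n x)) \<partial>M)" by (rule integral_norm_bound_ennreal[OF F])
    also have "\<dots> \<le> (\<integral>\<^sup>+x. G n x \<partial>M)" by (rule nn_integral_mono[OF le])
    finally show ?thesis .
  qed
  then have "(\<lambda>n. ennreal (norm (LINT x|M. F n x))) \<longlonglongrightarrow> 0"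
    using tendsto_sandwich[OF always_eventually always_eventually tendsto_const[of 0] G] by simp
  then have "(\<lambda>n. ennreal (norm (LINT x|M. F n x))) \<longlonglongrightarrow> ennreal 0" by simp
  then have "(\<lambda>n. norm (LINT x|M. F n x)) \<longlonglongrightarrow> 0"
    by (subst (asm) tendsto_ennreal_iff) auto
  then show ?thesis by (rule tendsto_norm_zero_cancel)
qed

text \<open>Pairing the zero trace with \<open>\<chi> (x \<bullet> e) (q\<^sub>m \<bullet> b)\<close> and summing over \<open>e\<close> and \<open>b\<close> turns the boundary
  integral of \<open>|q\<^sub>m|\<^sup>2\<close> into interior integrals that tend to \<open>0\<close>.\<close>

lemma bpart_0_imp_trace_limit:
  fixes q :: "'a::euclidean_space \<Rightarrow> 'b::euclidean_space"
  assumes r: "0 < r" "r < 1"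
    and q: "square_integrable (lebesgue_on (annulus r)) q" and dq: "\<And>e. e \<in> Basis \<Longrightarrow> square_integrable (lebesgue_on (annulus r)) (dq e)"
    and b: "\<And>e. e \<in> Basis \<Longrightarrow> bpart r e q (dq e) (\<lambda>_. 0)"
    and s: "\<And>m. smooth (qm m)"
    and l1: "(\<lambda>m. \<integral>\<^sup>+x. ennreal ((norm (qm m x - q x))\<^sup>2) \<partial>lebesgue_on (annulus r)) \<longlonglongrightarrow> 0"
    and l2: "\<And>e. e \<in> Basis \<Longrightarrow> (\<lambda>m. \<integral>\<^sup>+x. ennreal ((norm (frechet_derivative (qm m) (at x) e - dq e x))\<^sup>2) \<partial>lebesgue_on (annulus r)) \<longlonglongrightarrow> 0"
  shows "(\<lambda>m. \<integral>\<^sup>+x. ennreal ((norm (qm m x))\<^sup>2) \<partial>sphere_measure) \<longlonglongrightarrow> 0"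
proof -
  define A where "A = lebesgue_on (annulus r :: 'a set)"
  interpret A: finite_measure A unfolding A_def by (rule finite_measure_annulus)
  define \<rho>1 \<rho>2 where "\<rho>1 = (2 * r + 1) / 3" and "\<rho>2 = (r + 2) / 3"
  have \<rho>: "r < \<rho>1" "\<rho>1 < \<rho>2" "\<rho>2 < 1" using r by (auto simp: \<rho>1_def \<rho>2_def)
  \<comment> \<open>Equals x \<bullet> e on the sphere, while the cutoff provides the vanishing near
    the inner ball that \<open>inner_cut\<close> demands.\<close>
  define k where "k e x = cutoff \<rho>1 \<rho>2 x * (x \<bullet> e)" for e x :: 'a
  have sk: "smooth (k e)" for e unfolding k_def[abs_def] by (intro smooth_mult smooth_cutoff smooth_inner_e)
  have k1: "k e x = x \<bullet> e" if "norm x = 1" for e x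
    using cutoff_eq_1[of \<rho>1 \<rho>2 x] \<rho> r that by (simp add: k_def)
  have k0: "k e x = 0" if "norm x \<le> \<rho>1" for e x
    using cutoff_eq_0[of \<rho>1 \<rho>2 x] \<rho> r that by (simp add: k_def)
  have bm: "h \<in> borel_measurable A" if "smooth h" for h :: "'a \<Rightarrow> 'c::euclidean_space"
    unfolding A_def by (intro borel_measurable_lebesgue_on smooth_borel that)
  have bm': "h \<in> borel_measurable A" if "smooth h" for h :: "'a \<Rightarrow> real"
    unfolding A_def by (intro borel_measurable_lebesgue_on smooth_borel that)
  have ia: "integrable A h" if sh: "smooth h" for h :: "'a \<Rightarrow> 'b"
  proof -
    obtain C where "\<And>x. norm x \<le> 1 \<Longrightarrow> norm (h x) \<le> C" using smooth_bound_on_cball[OF sh, of 1] by metis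
    then show ?thesis
      by (intro A.integrable_const_bound[where B=C] AE_I2 bm sh) (auto simp: annulus_def A_def)
  qed
  have iq: "integrable A q" and idq: "\<And>e. e \<in> Basis \<Longrightarrow> integrable A (dq e)"
    using q dq A.square_integrable_imp_integrable' by (auto simp: A_def[symmetric])
  have main: "(\<lambda>m. LINT x|sphere_measure. ((k e x * (qm m x \<bullet> c)) * (x \<bullet> e)) *\<^sub>R qm m x) \<longlonglongrightarrow> 0"
    if e: "e \<in> Basis" and c: "c \<in> Basis" for e and c :: 'b
  proof -
    let ?\<psi> = "\<lambda>m x. k e x * (qm m x \<bullet> c)"
    let ?d\<psi> = "\<lambda>m x. k e x * (frechet_derivative (qm m) (at x) e \<bullet> c) + frechet_derivative (k e) (at x) e * (qm m x \<bullet> c)"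
    have s\<psi>: "smooth (?\<psi> m)" for m by (intro smooth_intros sk s)
    have ic: "inner_cut r (?\<psi> m)" for m
      unfolding inner_cut_def using s\<psi> k0 \<rho>(1) by (intro conjI exI[of _ \<rho>1]) auto
    have d\<psi>: "frechet_derivative (?\<psi> m) (at x) e = ?d\<psi> m x" for m x
    proof -
      have "((\<lambda>x. qm m x \<bullet> c) has_derivative (\<lambda>h. frechet_derivative (qm m) (at x) h \<bullet> c)) (at x)"
        by (rule bounded_linear.has_derivative[OF bounded_linear_inner_left smooth_has_derivative[OF s]])
      from frechet_derivative_eqI[OF has_derivative_mult[OF smooth_has_derivative[OF sk] this]]
      show ?thesis by simp
    qed
    obtain C1 where C1: "C1 \<ge> 0" "\<And>x. norm x \<le> 1 \<Longrightarrow> norm (k e x) \<le> C1" using smooth_bound_on_cball[OF sk, of 1] by metis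
    obtain C2 where C2: "C2 \<ge> 0" "\<And>x. norm x \<le> 1 \<Longrightarrow> norm (frechet_derivative (k e) (at x) e) \<le> C2"
      using smooth_bound_on_cball[OF smooth_directional[OF sk], of 1] by metis
    define C where "C = C1 + C2"
    have cn: "\<bar>v \<bullet> c\<bar> \<le> norm v" for v :: 'b using Basis_le_norm[OF c] .
    have p1: "\<bar>?\<psi> m x\<bar> \<le> C * norm (qm m x)" if "norm x \<le> 1" for m x
    proof -
      have "\<bar>?\<psi> m x\<bar> \<le> C1 * norm (qm m x)" unfolding abs_mult using C1 cn that by (intro mult_mono) auto
      also have "\<dots> \<le> C * norm (qm m x)" using C2 by (intro mult_right_mono) (auto simp: C_def)
      finally show ?thesis .
    qed
    have p2: "\<bar>?d\<psi> m x\<bar> \<le> C * norm (frechet_derivative (qm m) (at x) e) + C * norm (qm m x)" if "norm x \<le> 1" for m x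
    proof -
      have "\<bar>?d\<psi> m x\<bar> \<le> \<bar>k e x\<bar> * \<bar>frechet_derivative (qm m) (at x) e \<bullet> c\<bar> + \<bar>frechet_derivative (k e) (at x) e\<bar> * \<bar>qm m x \<bullet> c\<bar>"
        unfolding abs_mult[symmetric] by (rule abs_triangle_ineq)
      also have "\<dots> \<le> C * norm (frechet_derivative (qm m) (at x) e) + C * norm (qm m x)"
        using C1(2)[OF that] C2(2)[OF that] C1(1) C2(1) cn by (intro add_mono mult_mono) (auto simp: C_def)
      finally show ?thesis .
    qed
    have "C \<ge> 0" using C1 C2 by (simp add: C_def)
    have T1: "(\<lambda>m. LINT x|A. ?d\<psi> m x *\<^sub>R (qm m x - q x)) \<longlonglongrightarrow> 0"
    proof (rule integral_tendsto_0_bound)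
      show "integrable A (\<lambda>x. ?d\<psi> m x *\<^sub>R (qm m x - q x))" for m
        unfolding d\<psi>[symmetric] A_def
        by (rule smooth_scaleR_integrable[OF smooth_directional[OF s\<psi>] _ annulus_subset_ball])
          (use ia[OF s[of m]] iq in \<open>auto simp: A_def\<close>)
      let ?G = "\<lambda>m x. ennreal C * ennreal (norm (frechet_derivative (qm m) (at x) e) * norm (qm m x - q x)) + ennreal C * ennreal (norm (qm m x) * norm (qm m x - q x))"
      show "ennreal (norm (?d\<psi> m x *\<^sub>R (qm m x - q x))) \<le> ?G m x" if "x \<in> space A" for m x
      proof -
        have "norm x \<le> 1" using that by (auto simp: A_def annulus_def)
        then have "norm (?d\<psi> m x *\<^sub>R (qm m x - q x)) \<le> (C * norm (frechet_derivative (qm m) (at x) e) + C * norm (qm m x)) * norm (qm m x - q x)"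
          unfolding norm_scaleR by (intro mult_right_mono p2) auto
        also have "\<dots> = C * (norm (frechet_derivative (qm m) (at x) e) * norm (qm m x - q x)) + C * (norm (qm m x) * norm (qm m x - q x))"
          by (simp add: algebra_simps)
        finally show ?thesis using \<open>C \<ge> 0\<close> by (simp add: ennreal_leI ennreal_plus[symmetric] ennreal_mult[symmetric] del: ennreal_plus)
      qed
      have m1: "(\<lambda>x. frechet_derivative (qm m) (at x) e) \<in> borel_measurable A" "qm m \<in> borel_measurable A" "(\<lambda>x. qm m x - q x) \<in> borel_measurable A" for m
        using bm[OF s[of m]] bm[OF smooth_directional[OF s[of m]]] iq by auto
      note [measurable] = m1
      have "(\<lambda>m. ennreal C * (\<integral>\<^sup>+x. ennreal (norm (frechet_derivative (qm m) (at x) e) * norm (qm m x - q x)) \<partial>A) + ennreal C * (\<integral>\<^sup>+x. ennreal (norm (qm m x) * norm (qm m x - q x)) \<partial>A)) \<longlonglongrightarrow> ennreal C * 0 + ennreal C * 0"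
        by (intro tendsto_add ennreal_tendsto_cmult L2_product_tendsto[OF m1(1) m1(3) dq[OF e, folded A_def] l2[OF e, folded A_def] l1[folded A_def]]
           L2_product_tendsto[OF m1(2) m1(3) q[folded A_def] l1[folded A_def] l1[folded A_def]]) auto
      then show "(\<lambda>m. \<integral>\<^sup>+x. ?G m x \<partial>A) \<longlonglongrightarrow> 0"
        by (simp add: nn_integral_add nn_integral_cmult)
    qed
    have T2: "(\<lambda>m. LINT x|A. ?\<psi> m x *\<^sub>R (frechet_derivative (qm m) (at x) e - dq e x)) \<longlonglongrightarrow> 0"
    proof (rule integral_tendsto_0_bound)
      show "integrable A (\<lambda>x. ?\<psi> m x *\<^sub>R (frechet_derivative (qm m) (at x) e - dq e x))" for m
        unfolding A_def
        by (rule smooth_scaleR_integrable[OF s\<psi> _ annulus_subset_ball])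
          (use ia[OF smooth_directional[OF s[of m]]] idq[OF e] in \<open>auto simp: A_def\<close>)
      let ?G = "\<lambda>m x. ennreal C * ennreal (norm (qm m x) * norm (frechet_derivative (qm m) (at x) e - dq e x))"
      show "ennreal (norm (?\<psi> m x *\<^sub>R (frechet_derivative (qm m) (at x) e - dq e x))) \<le> ?G m x" if "x \<in> space A" for m x
      proof -
        have "norm x \<le> 1" using that by (auto simp: A_def annulus_def)
        then have "norm (?\<psi> m x *\<^sub>R (frechet_derivative (qm m) (at x) e - dq e x)) \<le> (C * norm (qm m x)) * norm (frechet_derivative (qm m) (at x) e - dq e x)"
          unfolding norm_scaleR by (intro mult_right_mono p1) auto
        also have "\<dots> = C * (norm (qm m x) * norm (frechet_derivative (qm m) (at x) e - dq e x))"
          by (simp add: algebra_simps)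
        finally show ?thesis using \<open>C \<ge> 0\<close> by (simp add: ennreal_leI ennreal_mult[symmetric])
      qed
      have m1: "qm m \<in> borel_measurable A" "(\<lambda>x. frechet_derivative (qm m) (at x) e - dq e x) \<in> borel_measurable A" for m
        using bm[OF s[of m]] bm[OF smooth_directional[OF s[of m]]] idq[OF e] by auto
      note [measurable] = m1
      have "(\<lambda>m. ennreal C * (\<integral>\<^sup>+x. ennreal (norm (qm m x) * norm (frechet_derivative (qm m) (at x) e - dq e x)) \<partial>A)) \<longlonglongrightarrow> ennreal C * 0"
        by (intro ennreal_tendsto_cmult L2_product_tendsto[OF m1(1) m1(2) q[folded A_def] l1[folded A_def] l2[OF e, folded A_def]]) auto
      then show "(\<lambda>m. \<integral>\<^sup>+x. ?G m x \<partial>A) \<longlonglongrightarrow> 0"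
        by (simp add: nn_integral_cmult)
    qed
    \<comment> \<open>The formula for the smooth \<open>qm m\<close> minus the identity for q. The
      test function depends on m, but each interior term now contains a factor that tends to 0 in
      L2.\<close>
    have "(LINT x|sphere_measure. (?\<psi> m x * (x \<bullet> e)) *\<^sub>R qm m x) =
       (LINT x|A. ?d\<psi> m x *\<^sub>R (qm m x - q x)) + (LINT x|A. ?\<psi> m x *\<^sub>R (frechet_derivative (qm m) (at x) e - dq e x))" for m
    proof -
      have 1: "(LINT x|A. ?d\<psi> m x *\<^sub>R qm m x) + (LINT x|A. ?\<psi> m x *\<^sub>R frechet_derivative (qm m) (at x) e) = (LINT x|sphere_measure. (?\<psi> m x * (x \<bullet> e)) *\<^sub>R qm m x)"
        using bpart_smooth[OF s[of m] ic[of m], of e] unfolding d\<psi> A_def .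
      have 2: "(LINT x|A. ?d\<psi> m x *\<^sub>R q x) + (LINT x|A. ?\<psi> m x *\<^sub>R dq e x) = 0"
        using bpartD[OF b[OF e] ic[of m]] unfolding d\<psi> A_def by simp
      have i: "integrable A (\<lambda>x. ?d\<psi> m x *\<^sub>R h x)" "integrable A (\<lambda>x. ?\<psi> m x *\<^sub>R h x)" if "integrable A h" for h :: "'a \<Rightarrow> 'b"
        using smooth_scaleR_integrable[OF smooth_directional[OF s\<psi>[of m], of e] _ annulus_subset_ball, of r h]
          smooth_scaleR_integrable[OF s\<psi>[of m] _ annulus_subset_ball, of r h] that unfolding d\<psi> A_def by auto
      have 3: "(LINT x|A. ?d\<psi> m x *\<^sub>R (qm m x - q x)) = (LINT x|A. ?d\<psi> m x *\<^sub>R qm m x) - (LINT x|A. ?d\<psi> m x *\<^sub>R q x)"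
        unfolding scaleR_diff_right by (rule Bochner_Integration.integral_diff[OF i(1)[OF ia[OF s]] i(1)[OF iq]])
      have 4: "(LINT x|A. ?\<psi> m x *\<^sub>R (frechet_derivative (qm m) (at x) e - dq e x)) =
         (LINT x|A. ?\<psi> m x *\<^sub>R frechet_derivative (qm m) (at x) e) - (LINT x|A. ?\<psi> m x *\<^sub>R dq e x)"
        unfolding scaleR_diff_right by (rule Bochner_Integration.integral_diff[OF i(2)[OF ia[OF smooth_directional[OF s]]] i(2)[OF idq[OF e]]])
      have g: "a + b' = (a - c') + (b' - d')" if "c' + d' = 0" for a b' c' d' :: 'b
      proof -
        have "(a - c') + (b' - d') = a + b' - (c' + d')" by simp
        then show ?thesis using that by simp
      qed
      show ?thesis unfolding 3 4 1[symmetric] by (rule g[OF 2])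
    qed
    then show ?thesis using tendsto_add[OF T1 T2] by simp
  qed
  \<comment> \<open>Summed over e and c, the squares of x \<bullet> e and of
    \<open>qm m x \<bullet> c\<close> add up to |x|^2 times the square of the norm, and |x| =
    1.\<close>
  have sq: "(LINT x|sphere_measure. (norm (qm m x))\<^sup>2) =
      (\<Sum>e\<in>Basis. \<Sum>c\<in>Basis. (LINT x|sphere_measure. ((k e x * (qm m x \<bullet> c)) * (x \<bullet> e)) *\<^sub>R qm m x) \<bullet> c)" for m
  proof -
    have i1: "integrable sphere_measure (\<lambda>x. ((k e x * (qm m x \<bullet> c)) * (x \<bullet> e)) *\<^sub>R qm m x)" for e c
      by (intro integrable_sphere_continuous smooth_continuous smooth_intros sk s)
    have i2: "integrable sphere_measure (\<lambda>x. (((k e x * (qm m x \<bullet> c)) * (x \<bullet> e)) *\<^sub>R qm m x) \<bullet> c)" for e c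
      by (rule integrable_inner_left) (rule i1)
    have "(LINT x|sphere_measure. (norm (qm m x))\<^sup>2) = (LINT x|sphere_measure. (\<Sum>e\<in>Basis. \<Sum>c\<in>Basis. (((k e x * (qm m x \<bullet> c)) * (x \<bullet> e)) *\<^sub>R qm m x) \<bullet> c))"
    proof (rule Bochner_Integration.integral_cong[OF refl])
      fix x :: 'a assume "x \<in> space sphere_measure"
      then have x: "norm x = 1" by (simp add: space_sphere_measure)
      have "(\<Sum>e\<in>Basis. \<Sum>c\<in>Basis. (((k e x * (qm m x \<bullet> c)) * (x \<bullet> e)) *\<^sub>R qm m x) \<bullet> c) =
        (\<Sum>e\<in>Basis. (x \<bullet> e) * (x \<bullet> e)) * (\<Sum>c\<in>Basis. (qm m x \<bullet> c) * (qm m x \<bullet> c))"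
        unfolding sum_product by (intro sum.cong refl) (simp add: k1[OF x])
      also have "\<dots> = (x \<bullet> x) * (qm m x \<bullet> qm m x)" by (simp add: euclidean_inner[symmetric])
      also have "\<dots> = (norm (qm m x))\<^sup>2" using x by (simp add: power2_norm_eq_inner norm_eq_1)
      finally show "(norm (qm m x))\<^sup>2 = (\<Sum>e\<in>Basis. \<Sum>c\<in>Basis. (((k e x * (qm m x \<bullet> c)) * (x \<bullet> e)) *\<^sub>R qm m x) \<bullet> c)" by simp
    qed
    also have "\<dots> = (\<Sum>e\<in>Basis. \<Sum>c\<in>Basis. (LINT x|sphere_measure. ((k e x * (qm m x \<bullet> c)) * (x \<bullet> e)) *\<^sub>R qm m x) \<bullet> c)"
      by (simp only: Bochner_Integration.integral_sum[OF Bochner_Integration.integrable_sum[OF i2]] Bochner_Integration.integral_sum[OF i2] integral_inner_left[OF i1])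
    finally show ?thesis .
  qed
  have "(\<lambda>m. LINT x|sphere_measure. (norm (qm m x))\<^sup>2) \<longlonglongrightarrow> 0"
    unfolding sq by (intro tendsto_null_sum) (use tendsto_inner[OF main tendsto_const] in force)
  then have "(\<lambda>m. ennreal (LINT x|sphere_measure. (norm (qm m x))\<^sup>2)) \<longlonglongrightarrow> ennreal 0" by (rule tendsto_ennrealI)
  moreover have "(\<integral>\<^sup>+x. ennreal ((norm (qm m x))\<^sup>2) \<partial>sphere_measure) = ennreal (LINT x|sphere_measure. (norm (qm m x))\<^sup>2)" for m
    by (intro nn_integral_eq_integral integrable_sphere_continuous continuous_intros smooth_continuous s) auto
  ultimately show ?thesis by simp
qed


section \<open>Restriction and uniqueness of traces\<close>

lemma nn_integral_lebesgue_on_mono: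
  assumes "S \<subseteq> T" "S \<in> sets lebesgue" "T \<in> sets lebesgue"
  shows "(\<integral>\<^sup>+x. g x \<partial>lebesgue_on S) \<le> (\<integral>\<^sup>+x. g x \<partial>lebesgue_on T)"
proof -
  have "(\<integral>\<^sup>+x. g x \<partial>lebesgue_on S) = (\<integral>\<^sup>+x. g x * indicator S x \<partial>lebesgue)" "(\<integral>\<^sup>+x. g x \<partial>lebesgue_on T) = (\<integral>\<^sup>+x. g x * indicator T x \<partial>lebesgue)"
    using assms by (simp_all add: nn_integral_restrict_space)
  then show ?thesis using assms(1) by (auto intro!: nn_integral_mono simp: indicator_def)
qed

lemma tendsto_nn_integral_subset:
  assumes "S \<subseteq> T" "S \<in> sets lebesgue" "T \<in> sets lebesgue" and "(\<lambda>n. \<integral>\<^sup>+x. g n x \<partial>lebesgue_on T) \<longlonglongrightarrow> 0"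
  shows "(\<lambda>n. \<integral>\<^sup>+x. g n x \<partial>lebesgue_on S) \<longlonglongrightarrow> 0"
  by (rule tendsto_sandwich[OF _ _ tendsto_const assms(4)]) (use nn_integral_lebesgue_on_mono[OF assms(1-3)] in auto)

lemma square_integrable_subset:
  fixes v :: "'a::euclidean_space \<Rightarrow> 'b::euclidean_space"
  assumes "square_integrable (lebesgue_on T) v" "S \<subseteq> T" "S \<in> sets lebesgue" "T \<in> sets lebesgue"
  shows "square_integrable (lebesgue_on S) v"
proof -
  have m: "v \<in> borel_measurable (lebesgue_on S)"
    using assms by (auto simp: square_integrable_def intro: measurable_restrict_mono)
  moreover have "integrable (lebesgue_on S) (\<lambda>x. (norm (v x))\<^sup>2)"
  proof (rule integrableI_bounded)
    show "(\<lambda>x. (norm (v x))\<^sup>2) \<in> borel_measurable (lebesgue_on S)" using m by measurable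
    have "(\<integral>\<^sup>+x. ennreal (norm ((norm (v x))\<^sup>2)) \<partial>lebesgue_on S) \<le> (\<integral>\<^sup>+x. ennreal (norm ((norm (v x))\<^sup>2)) \<partial>lebesgue_on T)"
      by (rule nn_integral_lebesgue_on_mono[OF assms(2-4)])
    also have "\<dots> < \<infinity>" using assms(1) unfolding square_integrable_def integrable_iff_bounded by blast
    finally show "(\<integral>\<^sup>+x. ennreal (norm ((norm (v x))\<^sup>2)) \<partial>lebesgue_on S) < \<infinity>" .
  qed
  ultimately show ?thesis by (simp add: square_integrable_def)
qed

lemma square_integrable_AE_cong:
  fixes v v' :: "'a::euclidean_space \<Rightarrow> 'b::euclidean_space"
  assumes "square_integrable (lebesgue_on S) v" "AE x in lebesgue_on S. v x = v' x" "S \<in> sets lebesgue"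
  shows "square_integrable (lebesgue_on S) v'"
proof -
  have v: "v \<in> borel_measurable (lebesgue_on S)" "integrable (lebesgue_on S) (\<lambda>x. (norm (v x))\<^sup>2)"
    using assms(1) by (auto simp: square_integrable_def)
  have m: "v' \<in> borel_measurable (lebesgue_on S)" by (rule borel_measurable_AE_lebesgue_on[OF v(1) assms(2,3)])
  have "AE x in lebesgue_on S. (norm (v x))\<^sup>2 = (norm (v' x))\<^sup>2" using assms(2) by eventually_elim simp
  from integrable_AE_cong_lebesgue_on[OF v(2) this assms(3)] m show ?thesis by (simp add: square_integrable_def)
qed

text \<open>Any square-integrable weak derivatives \<open>w\<close> may be supplied; the
  \<open>weak_partial\<close> in \<open>has_trace\<close> agrees with them almost
  everywhere.\<close>

lemma has_traceI:
  fixes v :: "'a::euclidean_space \<Rightarrow> 'b::euclidean_space"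
  assumes D: "open D" and v: "square_integrable (lebesgue_on D) v" and g: "square_integrable sphere_measure g"
    and w: "\<And>e. e \<in> Basis \<Longrightarrow> has_weak_partial D e v (w e)" "\<And>e. e \<in> Basis \<Longrightarrow> square_integrable (lebesgue_on D) (w e)"
    and s: "\<And>n. smooth (\<phi> n)"
    and l: "(\<lambda>n. \<integral>\<^sup>+x. ennreal ((norm (\<phi> n x - v x))\<^sup>2) \<partial>lebesgue_on D) \<longlonglongrightarrow> 0"
      "\<And>e. e \<in> Basis \<Longrightarrow> (\<lambda>n. \<integral>\<^sup>+x. ennreal ((norm (frechet_derivative (\<phi> n) (at x) e - w e x))\<^sup>2) \<partial>lebesgue_on D) \<longlonglongrightarrow> 0"
      "(\<lambda>n. \<integral>\<^sup>+x. ennreal ((norm (\<phi> n x - g x))\<^sup>2) \<partial>sphere_measure) \<longlonglongrightarrow> 0"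
  shows "has_trace D v g"
proof -
  have "(\<lambda>n. \<integral>\<^sup>+x. ennreal ((norm (frechet_derivative (\<phi> n) (at x) e - weak_partial D e v x))\<^sup>2) \<partial>lebesgue_on D) \<longlonglongrightarrow> 0"
    if e: "e \<in> Basis" for e
  proof (rule Lim_transform_eventually[OF l(2)[OF e]], rule always_eventually, rule allI, rule nn_integral_cong_AE)
    have ae: "AE x in lebesgue_on D. weak_partial D e v x = w e x"
      by (rule has_weak_partial_AE_unique[OF D has_weak_partial_weak_partial[OF w(1)[OF e]] w(1)[OF e]])
    fix n show "AE x in lebesgue_on D. ennreal ((norm (frechet_derivative (\<phi> n) (at x) e - w e x))\<^sup>2) =
       ennreal ((norm (frechet_derivative (\<phi> n) (at x) e - weak_partial D e v x))\<^sup>2)"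
      using ae by eventually_elim simp
  qed
  moreover have "sobolev 1 D v" using v w by auto
  ultimately show ?thesis unfolding has_trace_def using g s l(1,3) by blast
qed

lemma has_trace_subset:
  fixes v :: "'a::euclidean_space \<Rightarrow> 'b::euclidean_space"
  assumes t: "has_trace D v g" and ED: "E \<subseteq> D" "open E" "open D"
  shows "has_trace E v g"
proof -
  have l: "E \<in> sets lebesgue" "D \<in> sets lebesgue" using ED by auto
  obtain \<phi> where \<phi>: "\<And>n. smooth (\<phi> n)"
    and l1: "(\<lambda>n. \<integral>\<^sup>+x. ennreal ((norm (\<phi> n x - v x))\<^sup>2) \<partial>lebesgue_on D) \<longlonglongrightarrow> 0"
    and l2: "\<And>e. e \<in> Basis \<Longrightarrow> (\<lambda>n. \<integral>\<^sup>+x. ennreal ((norm (frechet_derivative (\<phi> n) (at x) e - weak_partial D e v x))\<^sup>2) \<partial>lebesgue_on D) \<longlonglongrightarrow> 0"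
    and l3: "(\<lambda>n. \<integral>\<^sup>+x. ennreal ((norm (\<phi> n x - g x))\<^sup>2) \<partial>sphere_measure) \<longlonglongrightarrow> 0"
    using t unfolding has_trace_def by blast
  have g: "square_integrable sphere_measure g" and s1: "sobolev 1 D v" using t by (auto simp: has_trace_def)
  have w: "has_weak_partial D e v (weak_partial D e v) \<and> square_integrable (lebesgue_on D) (weak_partial D e v)" if e: "e \<in> Basis" for e
  proof -
    obtain w where w: "has_weak_partial D e v w" "square_integrable (lebesgue_on D) w" using s1 e by auto
    note w' = has_weak_partial_weak_partial[OF w(1)]
    show ?thesis using w' square_integrable_AE_cong[OF w(2) has_weak_partial_AE_unique[OF ED(3) w(1) w'] l(2)] by blast
  qed
  show ?thesis
  proof (rule has_traceI[OF ED(2) _ g, where \<phi> = \<phi>])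
    show "square_integrable (lebesgue_on E) v" using s1 by (auto intro: square_integrable_subset[OF _ ED(1) l])
    show "has_weak_partial E e v (weak_partial D e v)" "square_integrable (lebesgue_on E) (weak_partial D e v)" if "e \<in> Basis" for e
      using w[OF that] has_weak_partial_subset[OF _ ED] square_integrable_subset[OF _ ED(1) l] by blast+
    show "smooth (\<phi> n)" for n by (rule \<phi>)
  qed (intro tendsto_nn_integral_subset[OF ED(1) l] l1 l2 l3; assumption)+
qed


text \<open>The cone over a relatively open piece of the sphere is open and contains p/2, hence has
  positive volume.\<close>

lemma emeasure_sphere_open_ne_0:
  assumes U: "open U" "p \<in> U" and p: "norm (p :: 'a::euclidean_space) = 1"
  shows "emeasure sphere_measure (U \<inter> sphere 0 1) \<noteq> 0"
proof -
  let ?B = "ball (0::'a) 1 - {0}"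
  let ?P = "(\<lambda>x::'a. x /\<^sub>R norm x) -` U \<inter> ?B"
  have op: "open ?P"
    by (subst Int_commute, rule continuous_open_preimage) (auto intro!: continuous_intros U simp: open_delete)
  have "(1/2) *\<^sub>R p \<in> ?P" using U p by auto
  then have "\<not> negligible ?P" using open_not_negligible[OF op] by blast
  then have ne: "emeasure lborel ?P \<noteq> 0"
    using op by (auto simp: negligible_iff_null_sets null_sets_def)
  have m: "(\<lambda>x. x /\<^sub>R norm x) \<in> restrict_space lborel ?B \<rightarrow>\<^sub>M restrict_space borel (sphere 0 1)"
    by (rule measurable_restrict_space2) (auto simp: space_restrict_space intro!: measurable_restrict_space1)
  have s: "U \<inter> sphere 0 1 \<in> sets (restrict_space borel (sphere 0 1))"
    using U(1) by (auto simp: sets_restrict_space_iff)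
  have "emeasure sphere_measure (U \<inter> sphere 0 1) = of_nat DIM('a) * emeasure (restrict_space lborel ?B) ((\<lambda>x. x /\<^sub>R norm x) -` (U \<inter> sphere 0 1) \<inter> space (restrict_space lborel ?B))"
    unfolding sphere_measure_def emeasure_scale_measure by (subst emeasure_distr[OF m s]) simp
  also have "(\<lambda>x. x /\<^sub>R norm x) -` (U \<inter> sphere 0 1) \<inter> space (restrict_space lborel ?B) = ?P"
    by (auto simp: space_restrict_space)
  also have "emeasure (restrict_space lborel ?B) ?P = emeasure lborel ?P"
    by (subst emeasure_restrict_space) (auto simp: open_delete)
  finally show ?thesis using ne by simp
qed

lemma box_bump_pos: "x \<in> box a b \<Longrightarrow> 0 < m \<Longrightarrow> 0 < box_bump a b m x"
  unfolding box_bump_def by (intro prod_pos) (auto simp: mem_box intro!: mult_pos_pos flat_pos)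

text \<open>\<open>bpart\<close> sees a trace only through its products with x \<bullet> e; since
  the squares of x \<bullet> e sum to 1 on the sphere, all integrals of \<psi> (g - g') vanish. If
  the traces differed at p, a bump at p times the inner product of g - g' with its value at p would
  be nonnegative and positive near p, contradicting
  \<open>emeasure_sphere_open_ne_0\<close>.\<close>

lemma has_trace_continuous_unique:
  fixes v :: "'a::euclidean_space \<Rightarrow> 'b::euclidean_space"
  assumes t: "has_trace (ball 0 1) v g" "has_trace (ball 0 1) v g'"
    and c: "continuous_on (sphere 0 1) g" "continuous_on (sphere 0 1) g'" and p: "norm p = 1"
  shows "g p = g' p"
proof (rule ccontr)
  assume ne: "g p \<noteq> g' p"
  define h where "h x = g x - g' x" for x
  define r :: real where "r = 1/2"
  have ig: "integrable sphere_measure g" "integrable sphere_measure g'"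
    using t sphere.square_integrable_imp_integrable' by (auto simp: has_trace_def)
  have ih: "integrable sphere_measure h" unfolding h_def[abs_def] using ig by simp
  have tr: "has_trace (annulus r) v g" "has_trace (annulus r) v g'"
    using has_trace_subset[OF _ annulus_subset_ball open_annulus] t by auto
  have eq1: "(LINT x|sphere_measure. (\<psi> x * (x \<bullet> e)) *\<^sub>R h x) = 0" if e: "e \<in> Basis" and \<psi>: "inner_cut r \<psi>" for e :: 'a and \<psi>
  proof -
    obtain w where w: "has_weak_partial (annulus r) e v w" "bpart r e v w g" using has_trace_imp_bpart[OF tr(1) e] by blast
    obtain w' where w': "has_weak_partial (annulus r) e v w'" "bpart r e v w' g'" using has_trace_imp_bpart[OF tr(2) e] by blast
    have ae: "AE x in lebesgue_on (annulus r). w' x = w x" by (rule has_weak_partial_AE_unique[OF open_annulus w'(1) w(1)])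
    have "bpart r e v w g'"
      by (rule bpart_AE_cong[OF w'(2) _ _ ae]) (use w(2) in \<open>auto simp: bpart_def\<close>)
    from bpartD[OF this \<psi>] bpartD[OF w(2) \<psi>]
    have "(LINT x|sphere_measure. (\<psi> x * (x \<bullet> e)) *\<^sub>R g x) = (LINT x|sphere_measure. (\<psi> x * (x \<bullet> e)) *\<^sub>R g' x)" by simp
    moreover have "smooth (\<lambda>x. \<psi> x * (x \<bullet> e))" using \<psi> by (intro smooth_mult smooth_inner_e) (simp add: inner_cut_def)
    note smooth_scaleR_integrable_sphere[OF this ig(1)] smooth_scaleR_integrable_sphere[OF this ig(2)]
    ultimately show ?thesis unfolding h_def scaleR_diff_right by simp
  qed
  have eq: "(LINT x|sphere_measure. \<psi> x *\<^sub>R h x) = 0" if \<psi>: "inner_cut r \<psi>" for \<psi>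
  proof -
    have s\<psi>: "smooth \<psi>" using \<psi> by (simp add: inner_cut_def)
    have "(LINT x|sphere_measure. \<psi> x *\<^sub>R h x) = (LINT x|sphere_measure. (\<Sum>e\<in>Basis. ((\<psi> x * (x \<bullet> e)) * (x \<bullet> e)) *\<^sub>R h x))"
    proof (rule Bochner_Integration.integral_cong[OF refl])
      fix x :: 'a assume "x \<in> space sphere_measure"
      then have "(\<Sum>e\<in>Basis. (x \<bullet> e) * (x \<bullet> e)) = 1"
        by (simp add: space_sphere_measure euclidean_inner[symmetric] norm_eq_1)
      then have "\<psi> x = (\<Sum>e\<in>Basis. (\<psi> x * (x \<bullet> e)) * (x \<bullet> e))"
        by (simp add: mult.assoc sum_distrib_left[symmetric])
      then show "\<psi> x *\<^sub>R h x = (\<Sum>e\<in>Basis. ((\<psi> x * (x \<bullet> e)) * (x \<bullet> e)) *\<^sub>R h x)"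
        unfolding scaleR_sum_left[symmetric] by simp
    qed
    also have "\<dots> = (\<Sum>e\<in>Basis. LINT x|sphere_measure. ((\<psi> x * (x \<bullet> e)) * (x \<bullet> e)) *\<^sub>R h x)"
      by (rule Bochner_Integration.integral_sum) (intro smooth_scaleR_integrable_sphere ih smooth_mult smooth_inner_e s\<psi>)
    also have "\<dots> = 0"
    proof (rule sum.neutral, rule ballI)
      fix e :: 'a assume e: "e \<in> Basis"
      have "inner_cut r (\<lambda>x. \<psi> x * (x \<bullet> e))"
        using \<psi> unfolding inner_cut_def by (auto intro!: smooth_mult smooth_inner_e)
      from eq1[OF e this] show "(LINT x|sphere_measure. ((\<psi> x * (x \<bullet> e)) * (x \<bullet> e)) *\<^sub>R h x) = 0" .
    qed
    finally show ?thesis .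
  qed
  have hc: "continuous_on (sphere 0 1) (\<lambda>x. h x \<bullet> h p)" unfolding h_def by (intro continuous_intros c)
  have "0 < h p \<bullet> h p" using ne by (simp add: h_def)
  then obtain \<delta> where \<delta>: "\<delta> > 0" "\<And>x. norm x = 1 \<Longrightarrow> dist x p < \<delta> \<Longrightarrow> 0 < h x \<bullet> h p"
  proof -
    assume 0: "0 < h p \<bullet> h p" and that: "\<And>\<delta>. \<delta> > 0 \<Longrightarrow> (\<And>x. norm x = 1 \<Longrightarrow> dist x p < \<delta> \<Longrightarrow> 0 < h x \<bullet> h p) \<Longrightarrow> thesis"
    have "p \<in> sphere 0 1" using p by simp
    with hc 0 obtain \<delta> where "\<delta> > 0" and d: "\<And>x. x \<in> sphere 0 1 \<Longrightarrow> dist x p < \<delta> \<Longrightarrow> dist (h x \<bullet> h p) (h p \<bullet> h p) < h p \<bullet> h p"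
      unfolding continuous_on_iff by blast
    show thesis
    proof (rule that[OF \<open>\<delta> > 0\<close>])
      fix x :: 'a assume "norm x = 1" "dist x p < \<delta>"
      then show "0 < h x \<bullet> h p" using d[of x] by (simp add: dist_real_def)
    qed
  qed
  \<comment> \<open>Within distance 1/4 of the unit vector p the norm exceeds 3/4, so the bump
    vanishes for norm at most 3/4, a radius larger than r = 1/2.\<close>
  obtain a b where ab: "cbox a b \<subseteq> ball p (min \<delta> (1/4))" "p \<in> box a b"
    by (rule open_contains_cbox[of "ball p (min \<delta> (1/4))" p]) (use \<delta>(1) in auto)
  define \<psi> where "\<psi> = box_bump a b 1"
  have sub: "x \<in> box a b \<Longrightarrow> dist x p < \<delta> \<and> dist x p < 1/4" for x
    using ab(1) box_subset_cbox[of a b] by (auto simp: dist_commute subset_iff)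
  have ic: "inner_cut r \<psi>"
    unfolding inner_cut_def
  proof (intro conjI exI[of _ "3/4"] allI impI)
    show "smooth \<psi>" unfolding \<psi>_def by (rule smooth_box_bump)
    show "r < 3/4" by (simp add: r_def)
    fix x :: 'a assume x: "norm x \<le> 3/4"
    have "norm p \<le> norm x + dist x p" using norm_triangle_ineq3[of x p] by (simp add: dist_norm)
    then have "x \<notin> box a b" using sub[of x] x p by auto
    then show "\<psi> x = 0" unfolding \<psi>_def by (rule box_bump_outside)
  qed
  have i\<psi>: "integrable sphere_measure (\<lambda>x. \<psi> x *\<^sub>R h x)"
    using smooth_scaleR_integrable_sphere[OF _ ih] ic by (simp add: inner_cut_def)
  have "(LINT x|sphere_measure. \<psi> x * (h x \<bullet> h p)) = (LINT x|sphere_measure. \<psi> x *\<^sub>R h x) \<bullet> h p"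
    using integral_inner_left[OF i\<psi>, of "h p"] by simp
  then have z: "(LINT x|sphere_measure. \<psi> x * (h x \<bullet> h p)) = 0" by (simp add: eq[OF ic])
  have i: "integrable sphere_measure (\<lambda>x. \<psi> x * (h x \<bullet> h p))"
    using integrable_inner_left[OF i\<psi>, of "h p"] by simp
  have nn: "0 \<le> \<psi> x * (h x \<bullet> h p)" if "norm x = 1" for x
  proof (cases "x \<in> box a b")
    case True
    then show ?thesis using \<delta>(2)[OF that] sub[of x] box_bump_bounds(1)[of a b 1 x] by (simp add: \<psi>_def)
  qed (simp add: \<psi>_def box_bump_outside)
  have "AE x in sphere_measure. \<psi> x * (h x \<bullet> h p) = 0"
    by (rule integral_nonneg_eq_0_iff_AE[THEN iffD1, OF i _ z]) (auto simp: space_sphere_measure nn)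
  moreover have "AE x in sphere_measure. norm (x::'a) = 1" by (rule AE_I2) (simp add: space_sphere_measure)
  ultimately have "AE x in sphere_measure. x \<notin> box a b"
  proof eventually_elim
    fix x assume 0: "\<psi> x * (h x \<bullet> h p) = 0" and n: "norm x = 1"
    show "x \<notin> box a b"
    proof
      assume x: "x \<in> box a b"
      then have "0 < \<psi> x" "0 < h x \<bullet> h p" using \<delta>(2)[OF n] sub[OF x] box_bump_pos[OF x, of 1] by (auto simp: \<psi>_def)
      then show False using 0 by auto
    qed
  qed
  moreover have "{x \<in> space sphere_measure. \<not> x \<notin> box a b} = box a b \<inter> sphere 0 1" by (auto simp: space_sphere_measure)
  moreover have "box a b \<inter> sphere 0 1 \<in> sets sphere_measure"
    unfolding sets_sphere_measure by (auto simp: sets_restrict_space_iff)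
  ultimately have "emeasure sphere_measure (box a b \<inter> sphere 0 1) = 0"
    by (subst (asm) AE_iff_measurable) auto
  with emeasure_sphere_open_ne_0[OF open_box ab(2) p] show False by simp
qed

text \<open>The potential minus \<open>l\<close> is a multiple of \<open>u\<close>, so near the
  sphere it has zero boundary values in the sense of \<open>bpart\<close>. The smooth
  \<open>qm = vm - l\<close> approximate it in H1 and, by \<open>bpart_0_imp_trace_limit\<close>,
  tend to 0 on the sphere; so the regularised potentials \<open>vm\<close> themselves witness the
  trace \<open>l\<close>. \<open>V\<close> is a second representative of the potential.\<close>

lemma newton_has_trace:
  fixes f u V :: "'a::euclidean_space \<Rightarrow> 'b::euclidean_space"
  assumes D: "DIM('a) = 4" and f: "square_integrable (lebesgue_on (ball 0 1)) f" and l: "bounded_linear l"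
    and r: "0 < r" "r < 1" and b: "\<And>e. e \<in> Basis \<Longrightarrow> bpart r e u (d e) (\<lambda>_. 0)"
  defines "M \<equiv> lebesgue_on (ball (0::'a) 1)"
  assumes rep: "AE z in M. conv M (newt 0) f z = l z + \<kappa> *\<^sub>R u z"
    and V: "AE z in M. conv M (newt 0) f z = V z"
  shows "has_trace (ball 0 1) V l"
proof -
  define \<epsilon> where "\<epsilon> m = inverse (real (Suc m))" for m
  have \<epsilon>: "\<epsilon> m > 0" "\<epsilon> \<longlonglongrightarrow> 0" for m
    unfolding \<epsilon>_def using LIMSEQ_inverse_real_of_nat by auto
  note H1 = newton_H1[OF D f \<epsilon>, folded M_def]
  let ?A = "annulus r :: 'a set"
  have Bl: "ball (0::'a) 1 \<in> sets lebesgue" by simp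
  have sl: "smooth l" by (rule smooth_bounded_linear[OF l])
  have lc: "continuous_on UNIV l" using l by (rule linear_continuous_on)
  define v where "v = conv M (newt 0) f"
  define w where "w e = conv M (\<lambda>x. - dnewt 0 e x) f" for e
  define vm where "vm m = conv M (newt (\<epsilon> m)) f" for m
  define q where "q z = v z - l z" for z
  define dq where "dq e z = w e z - l e" for e z
  define qm where "qm m z = vm m z - l z" for m z
  have svm: "smooth (vm m)" for m unfolding vm_def by (rule H1(1))
  have sqm: "smooth (qm m)" for m unfolding qm_def[abs_def] by (intro smooth_diff svm sl)
  have dqm: "frechet_derivative (qm m) (at x) e = frechet_derivative (vm m) (at x) e - l e" for m x e
    using frechet_derivative_eqI[OF has_derivative_diff[OF smooth_has_derivative[OF svm] bounded_linear_imp_has_derivative[OF l]]]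
    unfolding qm_def[abs_def] by simp
  have sq_diff: "square_integrable M (\<lambda>z. h z - k z)" if h: "square_integrable M h" and k: "continuous_on UNIV k" for h k :: "'a \<Rightarrow> 'b"
  proof -
    have hk: "h \<in> borel_measurable M" "k \<in> borel_measurable M" "integrable M (\<lambda>z. (norm (h z))\<^sup>2)" "integrable M (\<lambda>z. (norm (k z))\<^sup>2)"
      using h k by (auto simp: square_integrable_def M_def intro!: borel_measurable_lebesgue_on borel_of_continuous integrable_ball_continuous continuous_intros)
    note [measurable] = hk(1,2)
    have "integrable M (\<lambda>z. (norm (h z - k z))\<^sup>2)"
    proof (rule Bochner_Integration.integrable_bound)
      show "integrable M (\<lambda>z. 2 * (norm (h z))\<^sup>2 + 2 * (norm (k z))\<^sup>2)" by (intro Bochner_Integration.integrable_add integrable_mult_right impI hk(3,4))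
      show "AE z in M. norm ((norm (h z - k z))\<^sup>2) \<le> norm (2 * (norm (h z))\<^sup>2 + 2 * (norm (k z))\<^sup>2)"
      proof (rule AE_I2)
        fix z
        have "(norm (h z - k z))\<^sup>2 \<le> (norm (h z) + norm (k z))\<^sup>2" by (intro power_mono norm_triangle_ineq4) simp
        also have "\<dots> \<le> 2 * (norm (h z))\<^sup>2 + 2 * (norm (k z))\<^sup>2"
          using sum_squares_bound[of "norm (h z)" "norm (k z)"] by (simp add: power2_sum)
        finally show "norm ((norm (h z - k z))\<^sup>2) \<le> norm (2 * (norm (h z))\<^sup>2 + 2 * (norm (k z))\<^sup>2)" by simp
      qed
    qed measurable
    then show ?thesis unfolding square_integrable_def by simp
  qed
  have sqq: "square_integrable M q" unfolding q_def[abs_def] v_def by (rule sq_diff[OF H1(2) lc])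
  have sqdq: "square_integrable M (dq e)" for e unfolding dq_def[abs_def] w_def by (rule sq_diff[OF H1(3)]) simp
  have l1: "(\<lambda>m. \<integral>\<^sup>+z. ennreal ((norm (qm m z - q z))\<^sup>2) \<partial>M) \<longlonglongrightarrow> 0"
    using H1(4) by (simp add: qm_def q_def vm_def v_def)
  have l2: "(\<lambda>m. \<integral>\<^sup>+z. ennreal ((norm (frechet_derivative (qm m) (at z) e - dq e z))\<^sup>2) \<partial>M) \<longlonglongrightarrow> 0" for e
    using H1(5)[of e] by (simp add: dqm dq_def vm_def w_def)
  have wq: "has_weak_partial (ball 0 1) e q (dq e)" for e
    by (rule has_weak_partial_L2_limit[OF sqm sqq[unfolded M_def] sqdq[unfolded M_def] l1[unfolded M_def] l2[unfolded M_def]])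
  have Al: "?A \<in> sets lebesgue" by (rule sets_annulus)
  note Asub = annulus_subset_ball[of r, where 'a='a]
  have rA: "AE z in lebesgue_on ?A. \<kappa> *\<^sub>R u z = q z"
  proof -
    have "AE z in lebesgue_on ?A. conv M (newt 0) f z = l z + \<kappa> *\<^sub>R u z" using AE_lebesgue_on_subset[OF rep[unfolded M_def] Asub Bl Al] by (simp add: M_def)
    then show ?thesis by eventually_elim (simp add: q_def v_def)
  qed
  have sqA: "square_integrable (lebesgue_on ?A) q" "square_integrable (lebesgue_on ?A) (dq e)" for e
    using square_integrable_subset[OF _ Asub Al Bl] sqq sqdq by (auto simp: M_def)
  have bq: "bpart r e q (dq e) (\<lambda>_. 0)" if e: "e \<in> Basis" for e
  proof -
    have bk: "bpart r e (\<lambda>x. \<kappa> *\<^sub>R u x) (\<lambda>x. \<kappa> *\<^sub>R d e x) (\<lambda>_. 0)"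
      using bpart_linear[OF bounded_linear_scaleR_right b[OF e], of \<kappa>] by simp
    have wA: "has_weak_partial ?A e q (dq e)" by (rule has_weak_partial_subset[OF wq Asub open_annulus open_ball])
    have "has_weak_partial ?A e q (\<lambda>x. \<kappa> *\<^sub>R d e x)"
      by (rule has_weak_partial_AE_cong[OF bpart_imp_has_weak_partial[OF bk r(2)] open_annulus rA])
    from has_weak_partial_AE_unique[OF open_annulus this wA]
    have "AE x in lebesgue_on ?A. \<kappa> *\<^sub>R d e x = dq e x" .
    from bpart_AE_cong[OF bk rA _ this] sqA show ?thesis by (simp add: square_integrable_def)
  qed
  have l3: "(\<lambda>m. \<integral>\<^sup>+x. ennreal ((norm (qm m x))\<^sup>2) \<partial>sphere_measure) \<longlonglongrightarrow> 0"
    by (rule bpart_0_imp_trace_limit[OF r sqA bq sqm tendsto_nn_integral_subset[OF Asub Al Bl l1[unfolded M_def]] tendsto_nn_integral_subset[OF Asub Al Bl l2[unfolded M_def]]])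
  show ?thesis
  proof (rule has_traceI[OF open_ball _ _ _ _ svm, where w = w])
    show "square_integrable (lebesgue_on (ball 0 1)) V"
      by (rule square_integrable_AE_cong[OF H1(2)[unfolded M_def] V[unfolded M_def] Bl])
    show "square_integrable sphere_measure l"
      unfolding square_integrable_def
      by (intro conjI integrable_sphere_continuous continuous_intros lc borel_measurable_sphere_measure borel_of_continuous)
    show "has_weak_partial (ball 0 1) e V (w e)" for e
    proof -
      have "has_weak_partial (ball 0 1) e v (w e)" using H1(6) by (simp add: v_def w_def)
      moreover have "AE z in lebesgue_on (ball 0 1). v z = V z" using V unfolding v_def M_def .
      ultimately show ?thesis by (rule has_weak_partial_AE_cong[OF _ open_ball])
    qed
    show "square_integrable (lebesgue_on (ball 0 1)) (w e)" for e using H1(3)[of e] by (simp add: w_def M_def)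
    show "(\<lambda>n. \<integral>\<^sup>+x. ennreal ((norm (frechet_derivative (vm n) (at x) e - w e x))\<^sup>2) \<partial>lebesgue_on (ball 0 1)) \<longlonglongrightarrow> 0" for e
      using H1(5)[of e] by (simp add: w_def vm_def M_def)
    show "(\<lambda>n. \<integral>\<^sup>+x. ennreal ((norm (vm n x - l x))\<^sup>2) \<partial>sphere_measure) \<longlonglongrightarrow> 0" using l3 by (simp add: qm_def)
    show "(\<lambda>n. \<integral>\<^sup>+x. ennreal ((norm (vm n x - V x))\<^sup>2) \<partial>lebesgue_on (ball 0 1)) \<longlonglongrightarrow> 0"
    proof (rule Lim_transform_eventually[OF H1(4)[unfolded M_def]], rule always_eventually, rule allI, rule nn_integral_cong_AE)
      fix n
      show "AE x in lebesgue_on (ball 0 1). ennreal ((norm (conv (lebesgue_on (ball 0 1)) (newt (\<epsilon> n)) f x - conv (lebesgue_on (ball 0 1)) (newt 0) f x))\<^sup>2) =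
         ennreal ((norm (vm n x - V x))\<^sup>2)"
        using V unfolding M_def by eventually_elim (simp add: vm_def M_def)
    qed
  qed
qed

section \<open>The boundary value problem\<close>

text \<open>Passes to the representative that occurs inside \<open>conormal\<close>.\<close>

lemma bpart_weak_partial:
  fixes v :: "'a::euclidean_space \<Rightarrow> 'b::euclidean_space"
  assumes b: "bpart r e v w g" and r: "r < 1"
  shows "bpart r e v (weak_partial (annulus r) e v) g"
proof -
  note w = bpart_imp_has_weak_partial[OF b r]
  have ae: "AE x in lebesgue_on (annulus r). w x = weak_partial (annulus r) e v x"
    by (rule has_weak_partial_AE_unique[OF open_annulus w has_weak_partial_weak_partial[OF w]])
  have m: "v \<in> borel_measurable (lebesgue_on (annulus r))" "w \<in> borel_measurable (lebesgue_on (annulus r))"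
    using b by (auto simp: bpart_def)
  show ?thesis
    by (rule bpart_AE_cong[OF b _ m(1) ae borel_measurable_AE_lebesgue_on[OF m(2) ae sets_annulus]]) simp
qed

text \<open>Boundary values are known for expressions in the frame near the sphere, weak derivatives
  on the whole ball for expressions in fixed representatives. Where the functions agree almost
  everywhere so do their derivatives, and the boundary identity is transferred.\<close>

lemma bpart_replace:
  fixes v :: "'a::euclidean_space \<Rightarrow> 'b::euclidean_space"
  assumes b: "bpart r e v w g" and r: "r < 1" and ae: "AE x in lebesgue_on (annulus r). v x = v' x"
    and w': "has_weak_partial (ball 0 1) e v' w'"
    and int: "integrable (lebesgue_on (ball 0 1)) v'" "integrable (lebesgue_on (ball 0 1)) w'"
  shows "bpart r e v' w' g" and "AE x in lebesgue_on (annulus r). w x = w' x"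
proof -
  have "has_weak_partial (annulus r) e v' w"
    by (rule has_weak_partial_AE_cong[OF bpart_imp_has_weak_partial[OF b r] open_annulus ae])
  from has_weak_partial_AE_unique[OF open_annulus this has_weak_partial_subset[OF w' annulus_subset_ball open_annulus open_ball]]
  show ae': "AE x in lebesgue_on (annulus r). w x = w' x" .
  have m: "h \<in> borel_measurable (lebesgue_on (annulus r))" if "integrable (lebesgue_on (ball 0 1)) h" for h :: "'a \<Rightarrow> 'b"
    using measurable_restrict_mono[OF borel_measurable_integrable[OF that] annulus_subset_ball] .
  show "bpart r e v' w' g" by (rule bpart_AE_cong[OF b ae m[OF int(1)] ae' m[OF int(2)]])
qed

text \<open>\<open>eq_on_boundary\<close> only says that v and 0 share some trace g. As 0 has weak
  derivative 0, all boundary pairings of g vanish, and g may be subtracted.\<close>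

lemma bpart_zero_boundary:
  fixes v :: "'a::euclidean_space \<Rightarrow> 'b::euclidean_space"
  assumes b: "bpart r e v w g" and z: "bpart r e (\<lambda>_. 0) w0 g" and r: "r < 1"
  shows "bpart r e v w (\<lambda>_. 0)"
proof -
  have "has_weak_partial (annulus r) e (\<lambda>_. 0 :: 'b) (\<lambda>_. 0)"
    unfolding has_weak_partial_def locally_integrable_def by simp
  from has_weak_partial_AE_unique[OF open_annulus bpart_imp_has_weak_partial[OF z r] this]
  have "AE x in lebesgue_on (annulus r). w0 x = 0" .
  from bpart_AE_cong[OF z _ _ this] have "bpart r e (\<lambda>_. 0) (\<lambda>_. 0) g" by simp
  from bpart_linear[OF bounded_linear_minus[OF bounded_linear_ident] this] have "bpart r e (\<lambda>_. 0) (\<lambda>_. 0) (\<lambda>x. - g x)" by simp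
  from bpart_add[OF b this] show ?thesis by simp
qed

lemma has_trace_nth_bpart:
  assumes "has_trace (annulus r) (\<lambda>z. v z :: complex^2) (\<lambda>_. c)" "e \<in> Basis"
  obtains w where "bpart r e (\<lambda>z. v z $ j) w (\<lambda>_. c $ j)"
proof -
  obtain w where "bpart r e v w (\<lambda>_. c)" using has_trace_imp_bpart[OF assms] by blast
  from that[OF bpart_linear[OF bounded_linear_nth this]] show ?thesis .
qed

lemma field_deriv_bar_L:
  "2 * field_deriv_bar D L_field v z = (1 / norm z) *\<^sub>R
     (z $ 2 * (weak_partial D (axis 1 1) v z + \<i> * weak_partial D (axis 1 \<i>) v z) -
      z $ 1 * (weak_partial D (axis 2 1) v z + \<i> * weak_partial D (axis 2 \<i>) v z))"
  unfolding field_deriv_bar_def weak_dzbar_def L_field_def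
  by (simp add: sum_2 scaleR_conv_of_real add_divide_distrib diff_divide_distrib algebra_simps)

text \<open>The second boundary condition makes the first component of the conormal derivative the tangential
  derivative of a function with zero trace, namely of \<open>u\<^sub>2\<close> along the conjugate of \<open>-2 L\<close>.\<close>

lemma conormal_fst_eq_0:
  fixes u1 u2 :: "complex^2 \<Rightarrow> complex"
  assumes r: "0 < r" "r < 1"
    and u2: "\<And>e. e \<in> Basis \<Longrightarrow> bpart r e u2 (weak_partial (annulus r) e u2) (\<lambda>_. 0)"
    and N: "eq_on_boundary (annulus r) (field_deriv_bar (annulus r) N_field u1)
           (\<lambda>z. - 2 * u1 z * field_inner (L_field z) (lie_bracket L_field N_field z))"
    and C: "has_trace (annulus r) (conormal (annulus r) u1 u2) (\<lambda>_. Bu)"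
  shows "Bu $ 1 = 0"
proof -
  let ?D = "annulus r :: (complex^2) set"
  let ?P = "field_deriv_bar ?D N_field u1"
  let ?Q = "\<lambda>z. - 2 * u1 z * field_inner (L_field z) (lie_bracket L_field N_field z)"
  \<comment> \<open>In the interior the normal derivatives and the zero-order terms cancel, leaving
    \<open>2 * field_deriv_bar ?D L_field u2\<close>; on the boundary the common trace g of
    \<open>?P\<close> and \<open>?Q\<close> drops out.\<close>
  let ?W = "\<lambda>z. (- 1) * (conormal ?D u1 u2 z $ 1) + 2 * ?P z + (- 2) * ?Q z"
  obtain g where g: "has_trace ?D ?P g" "has_trace ?D ?Q g" using N unfolding eq_on_boundary_def by blast
  have "\<exists>w. bpart r e ?W w (\<lambda>_. - (Bu $ 1))" if e: "e \<in> Basis" for e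
  proof -
    obtain w where w: "bpart r e (\<lambda>z. conormal ?D u1 u2 z $ 1) w (\<lambda>_. Bu $ 1)" using has_trace_nth_bpart[OF C e] .
    obtain p where p: "bpart r e ?P p g" using has_trace_imp_bpart[OF g(1) e] by blast
    obtain q where q: "bpart r e ?Q q g" using has_trace_imp_bpart[OF g(2) e] by blast
    from bpart_add[OF bpart_add[OF bpart_scale[OF w, of "-1"] bpart_scale[OF p, of 2]] bpart_scale[OF q, of "-2"]]
    have b: "bpart r e ?W (\<lambda>x. (- 1) * w x + 2 * p x + (- 2) * q x) (\<lambda>x. (- 1) * Bu $ 1 + 2 * g x + (- 2) * g x)" .
    have "bpart r e ?W (\<lambda>x. (- 1) * w x + 2 * p x + (- 2) * q x) (\<lambda>_. - (Bu $ 1))"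
      by (rule bpart_cong[OF b]) simp_all
    then show ?thesis by blast
  qed
  then have "\<forall>e\<in>Basis. \<exists>w. bpart r e ?W w (\<lambda>_. - (Bu $ 1))" by blast
  from bchoice[OF this] obtain we where we: "\<And>e. e \<in> Basis \<Longrightarrow> bpart r e ?W (we e) (\<lambda>_. - (Bu $ 1))" by blast
  have "- (Bu $ 1) = 0"
  proof (rule tangential_trace_eq_0[OF r we u2])
    fix z :: "complex^2"
    have "?W z = 2 * field_deriv_bar ?D L_field u2 z" by (simp add: conormal_def scaleR_conv_of_real algebra_simps)
    then show "?W z = (1 / norm z) *\<^sub>R (z $ 2 * (weak_partial ?D (axis 1 1) u2 z + \<i> * weak_partial ?D (axis 1 \<i>) u2 z) -
        z $ 1 * (weak_partial ?D (axis 2 1) u2 z + \<i> * weak_partial ?D (axis 2 \<i>) u2 z))"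
      unfolding field_deriv_bar_L .
  qed
  then show ?thesis by simp
qed

lemma sobolev_2E:
  fixes u :: "'a::euclidean_space \<Rightarrow> 'b::euclidean_space"
  assumes "sobolev 2 D u"
  obtains d dd where "square_integrable (lebesgue_on D) u"
    "\<And>e. e \<in> Basis \<Longrightarrow> has_weak_partial D e u (d e)" "\<And>e. e \<in> Basis \<Longrightarrow> square_integrable (lebesgue_on D) (d e)"
    "\<And>e e'. e \<in> Basis \<Longrightarrow> e' \<in> Basis \<Longrightarrow> has_weak_partial D e' (d e) (dd e e')"
    "\<And>e e'. e \<in> Basis \<Longrightarrow> e' \<in> Basis \<Longrightarrow> square_integrable (lebesgue_on D) (dd e e')"
proof -
  have u: "square_integrable (lebesgue_on D) u" "\<forall>e\<in>Basis. \<exists>w. has_weak_partial D e u w \<and> sobolev 1 D w"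
    using assms by (auto simp: numeral_2_eq_2)
  from bchoice[OF u(2)] obtain d where d: "\<forall>e\<in>Basis. has_weak_partial D e u (d e) \<and> sobolev 1 D (d e)" by blast
  have "\<forall>e\<in>Basis. \<exists>h. \<forall>e'\<in>Basis. has_weak_partial D e' (d e) (h e') \<and> square_integrable (lebesgue_on D) (h e')"
  proof
    fix e :: 'a assume "e \<in> Basis"
    with d have "\<forall>e'\<in>Basis. \<exists>w. has_weak_partial D e' (d e) w \<and> square_integrable (lebesgue_on D) w" by auto
    then show "\<exists>h. \<forall>e'\<in>Basis. has_weak_partial D e' (d e) (h e') \<and> square_integrable (lebesgue_on D) (h e')" by (rule bchoice)
  qed
  from bchoice[OF this] obtain dd where
    dd: "\<forall>e\<in>Basis. \<forall>e'\<in>Basis. has_weak_partial D e' (d e) (dd e e') \<and> square_integrable (lebesgue_on D) (dd e e')" by blast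
  show ?thesis by (rule that[OF u(1), of d dd]) (use d dd in auto)
qed

lemma newton_potential_nth:
  "newton_potential f z $ j = complex_of_real (1 / (4 * pi\<^sup>2)) * conv (lebesgue_on B4) (newt 0) (\<lambda>w. f w $ j) z"
proof -
  have "newt 0 (w - z) *\<^sub>R (f w $ j) = f w $ j / complex_of_real ((norm (z - w))\<^sup>2)" for w
    unfolding newt_def by (simp add: power2_norm_eq_inner[symmetric] norm_minus_commute scaleR_conv_of_real divide_simps)
  then show ?thesis by (simp add: newton_potential_def conv_def)
qed

lemma DIM_complex2: "DIM(complex^2) = 4" by simp

text \<open>\<open>newton_potential\<close> integrates each coefficient separately; it agrees with
  the vector-valued integral where the latter converges, which is almost everywhere by
  \<open>conv_dominated\<close>.\<close>

lemma AE_conv_newton_potential: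
  assumes f: "square_integrable (lebesgue_on B4) f"
  shows "AE z in lebesgue_on B4. conv (lebesgue_on B4) (newt 0) (\<lambda>w. (1 / (4 * pi\<^sup>2)) *\<^sub>R f w) z = newton_potential f z"
proof -
  have "AE z in lebesgue_on B4. integrable (lebesgue_on B4) (\<lambda>w. newt 0 (w - z) *\<^sub>R f w)"
    by (rule conv_dominated(2)[where p=2 and C=1, OF _ _ _ f newt_borel(1)]) (use newt_bounds(1)[of _ 0] in auto)
  then show ?thesis
  proof eventually_elim
    fix z assume i: "integrable (lebesgue_on B4) (\<lambda>w. newt 0 (w - z) *\<^sub>R f w)"
    have "conv (lebesgue_on B4) (newt 0) (\<lambda>w. (1 / (4 * pi\<^sup>2)) *\<^sub>R f w) z = (1 / (4 * pi\<^sup>2)) *\<^sub>R (LINT w|lebesgue_on B4. newt 0 (w - z) *\<^sub>R f w)"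
      unfolding conv_def integral_scaleR_right[symmetric] by (simp add: mult.commute)
    moreover have "(LINT w|lebesgue_on B4. newt 0 (w - z) *\<^sub>R f w) $ j = conv (lebesgue_on B4) (newt 0) (\<lambda>w. f w $ j) z" for j
      unfolding conv_def using integral_bounded_linear[OF bounded_linear_nth i, of j] by simp
    ultimately show "conv (lebesgue_on B4) (newt 0) (\<lambda>w. (1 / (4 * pi\<^sup>2)) *\<^sub>R f w) z = newton_potential f z"
      unfolding vec_eq_iff newton_potential_nth by (simp only: vector_scaleR_component scaleR_conv_of_real[where ?'a=complex] simp_thms)
  qed
qed

lemma bounded_linear_scalar_mult: "bounded_linear (\<lambda>z::complex^2. c *s z)"
  unfolding linear_conv_bounded_linear[symmetric]
  by (rule linearI) (simp_all add: vec_eq_iff algebra_simps)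

lemma bpart_vec2:
  assumes "\<And>j. bpart r e (\<lambda>z. u z $ j) (\<lambda>z. w z $ j) (\<lambda>_. 0)"
  shows "bpart r e u (w :: complex^2 \<Rightarrow> complex^2) (\<lambda>_. 0)"
proof -
  have l: "bounded_linear (axis j :: complex \<Rightarrow> complex^2)" for j
    unfolding linear_conv_bounded_linear[symmetric] by (rule linearI) (simp_all add: vec_eq_iff axis_def)
  have ax: "axis 1 (x $ 1) + axis 2 (x $ 2) = x" for x :: "complex^2"
    unfolding vec_eq_iff forall_2 by (simp add: axis_def)
  have a0: "axis j 0 = (0 :: complex^2)" for j by (simp add: vec_eq_iff axis_def)
  from bpart_add[OF bpart_linear[OF l[of 1] assms[of 1]] bpart_linear[OF l[of 2] assms[of 2]]]
  show ?thesis by (simp add: ax a0)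
qed

text \<open>\<open>Green_system\<close> with the smooth kernel \<open>newt \<epsilon>\<close>
  centred at z supplies the hypothesis \<open>green\<close> of
  \<open>potential_representation\<close>. The Gauss identities it asks for come from the weak
  derivatives on the ball and the boundary values near the sphere through
  \<open>weak_partial_Gauss_ball\<close>.\<close>

lemma newton_potential_component:
  fixes f u :: "complex^2 \<Rightarrow> complex^2"
  assumes r: "0 < r" "r < 1"
    and f: "square_integrable (lebesgue_on B4) f" and u: "square_integrable (lebesgue_on B4) u"
    and d: "\<And>e. e \<in> Basis \<Longrightarrow> has_weak_partial B4 e u (d e)" and dL2: "\<And>e. e \<in> Basis \<Longrightarrow> square_integrable (lebesgue_on B4) (d e)"
    and dd: "\<And>e e'. e \<in> Basis \<Longrightarrow> e' \<in> Basis \<Longrightarrow> has_weak_partial B4 e' (d e) (dd e e')"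
    and ddL2: "\<And>e e'. e \<in> Basis \<Longrightarrow> e' \<in> Basis \<Longrightarrow> square_integrable (lebesgue_on B4) (dd e e')"
    and bu: "\<And>e j. e \<in> Basis \<Longrightarrow> bpart r e (\<lambda>z. u z $ j) (\<lambda>z. d e z $ j) (\<lambda>_. 0)"
    and badj: "\<And>e. e \<in> Basis \<Longrightarrow> bpart r e (adj_rep d) (adj_rep (\<lambda>e'. dd e' e)) (\<lambda>_. - \<beta>)"
    and bdbar: "\<And>e. e \<in> Basis \<Longrightarrow> bpart r e (dbar_rep d) (dbar_rep (\<lambda>e'. dd e' e)) (\<lambda>_. 0)"
    and box: "AE z in lebesgue_on B4. - kohn_box B4 u z = f z"
  shows "AE z in lebesgue_on B4. conv (lebesgue_on B4) (newt 0) (\<lambda>w. f w $ j) z =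
    (mass4 TYPE(complex^2) / 4) *\<^sub>R (\<beta> * z $ j) - mass4 TYPE(complex^2) *\<^sub>R (u z $ j)"
proof -
  interpret B: finite_measure "lebesgue_on B4" by (rule finite_measure_lebesgue_on_ball)
  have fi: "integrable (lebesgue_on B4) f" and ui: "integrable (lebesgue_on B4) u"
    and di: "\<And>e. e \<in> Basis \<Longrightarrow> integrable (lebesgue_on B4) (d e)"
    and ddi: "\<And>e e'. e \<in> Basis \<Longrightarrow> e' \<in> Basis \<Longrightarrow> integrable (lebesgue_on B4) (dd e e')"
    using f u dL2 ddL2 B.square_integrable_imp_integrable' by auto
  have nthi: "integrable (lebesgue_on B4) (\<lambda>z. v z $ i)" if "integrable (lebesgue_on B4) v" for v :: "complex^2 \<Rightarrow> complex^2" and i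
    by (rule integrable_bounded_linear[OF bounded_linear_nth that])
  have G0: "ballint (\<lambda>x. frechet_derivative K (at x) e) (\<lambda>z. u z $ i) + ballint K (\<lambda>z. d e z $ i) = 0"
    if "e \<in> Basis" "smooth K" for e i K
    using weak_partial_Gauss_ball[OF has_weak_partial_nth[OF open_ball d[OF that(1)]] bu[OF that(1)] r nthi[OF ui] nthi[OF di[OF that(1)]] that(2), of i]
    unfolding ballint_def by simp
  have wreps: "has_weak_partial B4 e (adj_rep d) (adj_rep (\<lambda>e'. dd e' e))" "has_weak_partial B4 e (dbar_rep d) (dbar_rep (\<lambda>e'. dd e' e))"
    if e: "e \<in> Basis" for e
    by (rule has_weak_partial_reps[OF open_ball]; use dd e in auto)+
  have ireps: "integrable (lebesgue_on B4) (adj_rep d)" "integrable (lebesgue_on B4) (dbar_rep d)"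
    using ballint_reps(3,4)[OF smooth_const di] by auto
  have idreps: "integrable (lebesgue_on B4) (adj_rep (\<lambda>e'. dd e' e))" "integrable (lebesgue_on B4) (dbar_rep (\<lambda>e'. dd e' e))"
    if "e \<in> Basis" for e
    using ballint_reps(3,4)[OF smooth_const, of "\<lambda>e'. dd e' e"] ddi that by auto
  have kb: "AE z in lebesgue_on B4. kohn_box B4 u z =
     vector [(adj_rep (\<lambda>e. dd e (axis 1 1)) z + \<i> * adj_rep (\<lambda>e. dd e (axis 1 \<i>)) z) +
              2 * (dbar_rep (\<lambda>e. dd e (axis 2 1)) z - \<i> * dbar_rep (\<lambda>e. dd e (axis 2 \<i>)) z),
            (adj_rep (\<lambda>e. dd e (axis 2 1)) z + \<i> * adj_rep (\<lambda>e. dd e (axis 2 \<i>)) z) -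
              2 * (dbar_rep (\<lambda>e. dd e (axis 1 1)) z - \<i> * dbar_rep (\<lambda>e. dd e (axis 1 \<i>)) z)]"
    by (rule AE_kohn_box[OF open_ball d dd])
  have fae: "AE z in lebesgue_on B4. f z =
     - vector [(adj_rep (\<lambda>e. dd e (axis 1 1)) z + \<i> * adj_rep (\<lambda>e. dd e (axis 1 \<i>)) z) +
              2 * (dbar_rep (\<lambda>e. dd e (axis 2 1)) z - \<i> * dbar_rep (\<lambda>e. dd e (axis 2 \<i>)) z),
            (adj_rep (\<lambda>e. dd e (axis 2 1)) z + \<i> * adj_rep (\<lambda>e. dd e (axis 2 \<i>)) z) -
              2 * (dbar_rep (\<lambda>e. dd e (axis 1 1)) z - \<i> * dbar_rep (\<lambda>e. dd e (axis 1 \<i>)) z)]"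
    using box kb by eventually_elim simp
  have green: "conv (lebesgue_on B4) (newt \<epsilon>) (\<lambda>w. f w $ j) z =
     - conv (lebesgue_on B4) (bump4 \<epsilon>) (\<lambda>w. u w $ j) z + conv sphere_measure (newt \<epsilon>) (\<lambda>x. \<beta> * x $ j) z"
    if \<epsilon>: "\<epsilon> > 0" for \<epsilon> z
  proof -
    let ?K = "\<lambda>w. newt \<epsilon> (w - z)"
    have K: "smooth ?K" by (rule kernel_derivs(3)[OF \<epsilon>])
    have H: "frechet_derivative (\<lambda>x. frechet_derivative ?K (at x) e) (at x) e' = ddnewt \<epsilon> e e' (x - z)" for e e' x
      by (simp only: kernel_derivs[OF \<epsilon>])
    have Hsym: "ddnewt \<epsilon> e e' (x - z) = ddnewt \<epsilon> e' e (x - z)" for e e' x by (simp add: ddnewt_def inner_commute mult_ac)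
    have G1: "ballint (\<lambda>x. frechet_derivative ?K (at x) e) (adj_rep d) + ballint ?K (adj_rep (\<lambda>e'. dd e' e)) =
         (LINT x|sphere_measure. (?K x * (x \<bullet> e)) *\<^sub>R (- \<beta>))" if e: "e \<in> Basis" for e
      using weak_partial_Gauss_ball[OF wreps(1)[OF e] badj[OF e] r ireps(1) idreps(1)[OF e] K] unfolding ballint_def .
    have G2: "ballint (\<lambda>x. frechet_derivative ?K (at x) e) (dbar_rep d) + ballint ?K (dbar_rep (\<lambda>e'. dd e' e)) = 0" if e: "e \<in> Basis" for e
      using weak_partial_Gauss_ball[OF wreps(2)[OF e] bdbar[OF e] r ireps(2) idreps(2)[OF e] K] unfolding ballint_def by simp
    have "ballint ?K (\<lambda>z. f z $ j) = ballint (\<lambda>x. \<Sum>e\<in>Basis. ddnewt \<epsilon> e e (x - z)) (\<lambda>z. u z $ j) + (LINT x|sphere_measure. ?K x *\<^sub>R (\<beta> * x $ j))"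
      by (rule Green_system[OF K H Hsym ui di ddi fi G0 G1 G2 fae])
    then show ?thesis
      by (simp add: ballint_def conv_def sum_ddnewt[OF \<epsilon> DIM_complex2])
  qed
  have fj: "square_integrable (lebesgue_on B4) (\<lambda>w. f w $ j)"
  proof -
    have m: "(\<lambda>w. f w $ j) \<in> borel_measurable (lebesgue_on B4)" using nthi[OF fi] by auto
    have "integrable (lebesgue_on B4) (\<lambda>x. (norm (f x $ j))\<^sup>2)"
      by (rule Bochner_Integration.integrable_bound[of _ "\<lambda>x. (norm (f x))\<^sup>2"])
        (use f m in \<open>auto simp: square_integrable_def intro!: AE_I2 power_mono Finite_Cartesian_Product.norm_nth_le borel_measurable_power borel_measurable_norm\<close>)
    with m show ?thesis by (simp add: square_integrable_def)
  qed
  have l: "bounded_linear (\<lambda>x::complex^2. \<beta> * x $ j)"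
    by (rule bounded_linear_compose[OF bounded_linear_mult_right bounded_linear_nth])
  show ?thesis
    by (rule potential_representation[OF DIM_complex2 fj nthi[OF ui] l green])
qed

text \<open>\<gamma> is \<beta> \<mu>/4 times the normalising factor 1/(4 pi^2) of the Newton
  potential. The term in \<open>u\<close> leaves no trace by \<open>bu\<close>.\<close>

lemma newton_potential_trace:
  fixes f u :: "complex^2 \<Rightarrow> complex^2"
  assumes r: "0 < r" "r < 1"
    and f: "square_integrable (lebesgue_on B4) f"
    and bu: "\<And>e j. e \<in> Basis \<Longrightarrow> bpart r e (\<lambda>z. u z $ j) (\<lambda>z. d e z $ j) (\<lambda>_. 0)"
    and rep: "\<And>j. AE z in lebesgue_on B4. conv (lebesgue_on B4) (newt 0) (\<lambda>w. f w $ j) z =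
        (\<mu> / 4) *\<^sub>R (\<beta> * z $ j) - \<mu> *\<^sub>R (u z $ j)"
  obtains \<gamma> where "has_trace B4 (newton_potential f) (\<lambda>z. \<gamma> *s z)"
proof -
  define c where "c = 1 / (4 * pi\<^sup>2)"
  define \<gamma> where "\<gamma> = complex_of_real (c * \<mu> / 4) * \<beta>"
  have cf: "square_integrable (lebesgue_on B4) (\<lambda>w. c *\<^sub>R f w)"
    using f by (auto simp: square_integrable_def power_mult_distrib)
  note np = AE_conv_newton_potential[OF f, folded c_def]
  have "AE z in lebesgue_on B4. conv (lebesgue_on B4) (newt 0) (\<lambda>w. c *\<^sub>R f w) z = \<gamma> *s z + (- c * \<mu>) *\<^sub>R u z"
    using np rep[of 1] rep[of 2]
  proof eventually_elim
    fix z
    assume 0: "conv (lebesgue_on B4) (newt 0) (\<lambda>w. c *\<^sub>R f w) z = newton_potential f z"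
      and 1: "conv (lebesgue_on B4) (newt 0) (\<lambda>w. f w $ 1) z = (\<mu> / 4) *\<^sub>R (\<beta> * z $ 1) - \<mu> *\<^sub>R (u z $ 1)"
        "conv (lebesgue_on B4) (newt 0) (\<lambda>w. f w $ 2) z = (\<mu> / 4) *\<^sub>R (\<beta> * z $ 2) - \<mu> *\<^sub>R (u z $ 2)"
    have e: "complex_of_real c * ((\<mu> / 4) *\<^sub>R (\<beta> * x) - \<mu> *\<^sub>R y) = \<gamma> * x + (- c * \<mu>) *\<^sub>R y" for x y :: complex
      by (simp add: \<gamma>_def scaleR_conv_of_real algebra_simps)
    show "conv (lebesgue_on B4) (newt 0) (\<lambda>w. c *\<^sub>R f w) z = \<gamma> *s z + (- c * \<mu>) *\<^sub>R u z"
      unfolding 0 vec_eq_iff forall_2 newton_potential_nth 1 c_def[symmetric]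
      by (simp only: vector_add_component vector_smult_component vector_scaleR_component e simp_thms)
  qed
  from newton_has_trace[OF DIM_complex2 cf bounded_linear_scalar_mult r bpart_vec2[OF bu] this np]
  show ?thesis by (rule that)
qed

theorem theorem4p1:
  fixes f u :: "complex^2 \<Rightarrow> complex^2"
    and u1 u2 :: "complex^2 \<Rightarrow> complex"
    and r :: real
    and D :: "(complex^2) set"
    and gu Bu :: "complex^2"
    and a b :: complex
  assumes f_L2: "square_integrable (lebesgue_on (ball 0 1)) f"
    and u_H2: "sobolev 2 (ball 0 1) u"
    and r: "0 < r" "r < 1"
    and D: "D = {z. r < norm z \<and> norm z < 1}"
    and u_frame: "\<And>z. z \<in> D \<Longrightarrow> u z = u1 z *s omega_Lbar z + u2 z *s omega_Nbar z"
    and box_eq: "AE z in lebesgue_on (ball 0 1). - kohn_box (ball 0 1) u z = f z"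
    and bc_Dirichlet: "eq_on_boundary D u2 (\<lambda>_. 0)"
    and bc_Neumann: "eq_on_boundary D (field_deriv_bar D N_field u1)
           (\<lambda>z. - 2 * u1 z * field_inner (L_field z) (lie_bracket L_field N_field z))"
    and trace_const: "has_trace D (\<lambda>z. vector [u1 z, u2 z]) (\<lambda>_. gu)"
    and conormal_const: "has_trace D (conormal D u1 u2) (\<lambda>_. Bu)"
    and a: "a = Bu $ 2"
    and b: "b = gu $ 1"
    and b0: "b = 0"
  shows "(\<exists>g. continuous_on (sphere 0 1) g \<and> has_trace (ball 0 1) (newton_potential f) g) \<and>
         (\<forall>g. continuous_on (sphere 0 1) g \<and> has_trace (ball 0 1) (newton_potential f) g \<longrightarrow>
              form_inner (g (vector [1, 0])) (dzbar 2) = 0)"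
proof -
  have Da: "D = annulus r" using D by (simp add: annulus_def)
  note uf = u_frame[unfolded Da] and bD = bc_Dirichlet[unfolded Da] and bN = bc_Neumann[unfolded Da]
    and tc = trace_const[unfolded Da] and cc = conormal_const[unfolded Da]
  let ?A = "annulus r :: (complex^2) set"
  interpret B: finite_measure "lebesgue_on B4" by (rule finite_measure_lebesgue_on_ball)
  obtain d dd where u: "square_integrable (lebesgue_on B4) u"
    and d: "\<And>e. e \<in> Basis \<Longrightarrow> has_weak_partial B4 e u (d e)" and dL2: "\<And>e. e \<in> Basis \<Longrightarrow> square_integrable (lebesgue_on B4) (d e)"
    and dd: "\<And>e e'. e \<in> Basis \<Longrightarrow> e' \<in> Basis \<Longrightarrow> has_weak_partial B4 e' (d e) (dd e e')"
    and ddL2: "\<And>e e'. e \<in> Basis \<Longrightarrow> e' \<in> Basis \<Longrightarrow> square_integrable (lebesgue_on B4) (dd e e')"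
    using sobolev_2E[OF u_H2] by blast
  have ui: "integrable (lebesgue_on B4) u"
    and di: "\<And>e. e \<in> Basis \<Longrightarrow> integrable (lebesgue_on B4) (d e)"
    and ddi: "\<And>e e'. e \<in> Basis \<Longrightarrow> e' \<in> Basis \<Longrightarrow> integrable (lebesgue_on B4) (dd e e')"
    using u dL2 ddL2 B.square_integrable_imp_integrable' by auto
  have nthi: "integrable (lebesgue_on B4) (\<lambda>z. v z $ i)" if "integrable (lebesgue_on B4) v" for v :: "complex^2 \<Rightarrow> complex^2" and i
    by (rule integrable_bounded_linear[OF bounded_linear_nth that])
  \<comment> \<open>The very derivatives that \<open>conormal\<close> picks on the annulus, so that
    \<open>frame_conormal\<close> applies to them.\<close>
  define a1 where "a1 e = weak_partial ?A e u1" for e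
  define a2 where "a2 e = weak_partial ?A e u2" for e
  have b1: "bpart r e u1 (a1 e) (\<lambda>_. 0)" if e: "e \<in> Basis" for e
  proof -
    obtain w where "bpart r e (\<lambda>z. (vector [u1 z, u2 z] :: complex^2) $ 1) w (\<lambda>_. gu $ 1)" using has_trace_nth_bpart[OF tc e, where j=1] .
    then have "bpart r e u1 w (\<lambda>_. 0)" using b b0 by simp
    from bpart_weak_partial[OF this r(2)] show ?thesis unfolding a1_def .
  qed
  obtain g where g: "has_trace ?A u2 g" "has_trace ?A (\<lambda>_. 0) g" using bD unfolding eq_on_boundary_def by blast
  have b2: "bpart r e u2 (a2 e) (\<lambda>_. 0)" if e: "e \<in> Basis" for e
  proof -
    obtain w where "bpart r e u2 w g" using has_trace_imp_bpart[OF g(1) e] by blast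
    moreover obtain w0 where "bpart r e (\<lambda>_. 0) w0 g" using has_trace_imp_bpart[OF g(2) e] by blast
    ultimately have "bpart r e u2 w (\<lambda>_. 0)" by (rule bpart_zero_boundary[OF _ _ r(2)])
    from bpart_weak_partial[OF this r(2)] show ?thesis unfolding a2_def .
  qed
  have Bu1: "Bu $ 1 = 0" by (rule conormal_fst_eq_0[OF r _ bN cc]) (use b2 in \<open>simp add: a2_def\<close>)
  have frame: "bpart r e (\<lambda>z. u z $ j) (\<lambda>z. d e z $ j) (\<lambda>_. 0)" "AE z in lebesgue_on ?A. frame_d u1 u2 a1 a2 e z $ j = d e z $ j"
    if e: "e \<in> Basis" for e j
  proof -
    have bf: "bpart r e (\<lambda>z. u z $ j) (\<lambda>z. frame_d u1 u2 a1 a2 e z $ j) (\<lambda>_. 0)"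
      by (rule bpart_frame) (rule b1[OF e] b2[OF e] r(1) uf | assumption)+
    show "bpart r e (\<lambda>z. u z $ j) (\<lambda>z. d e z $ j) (\<lambda>_. 0)" "AE z in lebesgue_on ?A. frame_d u1 u2 a1 a2 e z $ j = d e z $ j"
      using bpart_replace[OF bf r(2) _ has_weak_partial_nth[OF open_ball d[OF e]] nthi[OF ui] nthi[OF di[OF e]]] by simp_all
  qed
  have ae: "AE z in lebesgue_on ?A. \<forall>e\<in>Basis. \<forall>j. frame_d u1 u2 a1 a2 e z $ j = d e z $ j"
    using frame(2) by (intro AE_finite_allI) (auto simp: forall_2)
  have inA: "AE z in lebesgue_on ?A. z \<in> ?A" by (rule AE_I2) simp
  \<comment> \<open>Links the conormal derivative, whose trace is given on the annulus, with an
    expression in the derivatives \<open>d\<close> of \<open>u\<close> on the whole ball, to which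
    Green's formula applies.\<close>
  have adj: "AE z in lebesgue_on ?A. - conormal ?A u1 u2 z $ 2 = adj_rep d z"
    using ae inA
  proof eventually_elim
    fix z assume h: "\<forall>e\<in>Basis. \<forall>j. frame_d u1 u2 a1 a2 e z $ j = d e z $ j" and z: "z \<in> ?A"
    have "adj_rep (frame_d u1 u2 a1 a2) z = adj_rep d z" using h unfolding adj_rep_def by simp
    then show "- conormal ?A u1 u2 z $ 2 = adj_rep d z"
      using frame_conormal(1)[OF z r(1), of ?A u1 a1 u2 a2] by (simp add: a1_def a2_def)
  qed
  have dbar: "AE z in lebesgue_on ?A. - (1/2) * conormal ?A u1 u2 z $ 1 = dbar_rep d z"
    using ae inA
  proof eventually_elim
    fix z assume h: "\<forall>e\<in>Basis. \<forall>j. frame_d u1 u2 a1 a2 e z $ j = d e z $ j" and z: "z \<in> ?A"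
    have "dbar_rep (frame_d u1 u2 a1 a2) z = dbar_rep d z" using h unfolding dbar_rep_def by simp
    then show "- (1/2) * conormal ?A u1 u2 z $ 1 = dbar_rep d z"
      using frame_conormal(2)[OF z r(1), of ?A u1 a1 u2 a2] by (simp add: a1_def a2_def)
  qed
  have wreps: "has_weak_partial B4 e (adj_rep d) (adj_rep (\<lambda>e'. dd e' e))" "has_weak_partial B4 e (dbar_rep d) (dbar_rep (\<lambda>e'. dd e' e))"
    if e: "e \<in> Basis" for e
    by (rule has_weak_partial_reps[OF open_ball]; use dd e in auto)+
  have ireps: "integrable (lebesgue_on B4) (adj_rep d)" "integrable (lebesgue_on B4) (dbar_rep d)"
    using ballint_reps(3,4)[OF smooth_const di] by auto
  have idreps: "integrable (lebesgue_on B4) (adj_rep (\<lambda>e'. dd e' e))" "integrable (lebesgue_on B4) (dbar_rep (\<lambda>e'. dd e' e))"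
    if "e \<in> Basis" for e
    using ballint_reps(3,4)[OF smooth_const, of "\<lambda>e'. dd e' e"] ddi that by auto
  have badj: "bpart r e (adj_rep d) (adj_rep (\<lambda>e'. dd e' e)) (\<lambda>_. - (Bu $ 2))" if e: "e \<in> Basis" for e
  proof -
    obtain w where "bpart r e (\<lambda>z. conormal ?A u1 u2 z $ 2) w (\<lambda>_. Bu $ 2)" using has_trace_nth_bpart[OF cc e, where j=2] .
    from bpart_scale[OF this, of "-1"] have "bpart r e (\<lambda>z. - conormal ?A u1 u2 z $ 2) (\<lambda>z. - w z) (\<lambda>_. - (Bu $ 2))" by simp
    from bpart_replace(1)[OF this r(2) adj wreps(1)[OF e] ireps(1) idreps(1)[OF e]] show ?thesis .
  qed
  have bdbar: "bpart r e (dbar_rep d) (dbar_rep (\<lambda>e'. dd e' e)) (\<lambda>_. 0)" if e: "e \<in> Basis" for e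
  proof -
    obtain w where "bpart r e (\<lambda>z. conormal ?A u1 u2 z $ 1) w (\<lambda>_. Bu $ 1)" using has_trace_nth_bpart[OF cc e, where j=1] .
    from bpart_scale[OF this, of "- (1/2)"] have "bpart r e (\<lambda>z. - (1/2) * conormal ?A u1 u2 z $ 1) (\<lambda>z. - (1/2) * w z) (\<lambda>_. 0)" by (simp add: Bu1)
    from bpart_replace(1)[OF this r(2) dbar wreps(2)[OF e] ireps(2) idreps(2)[OF e]] show ?thesis .
  qed
  have rep: "AE z in lebesgue_on B4. conv (lebesgue_on B4) (newt 0) (\<lambda>w. f w $ j) z =
    (mass4 TYPE(complex^2) / 4) *\<^sub>R (Bu $ 2 * z $ j) - mass4 TYPE(complex^2) *\<^sub>R (u z $ j)" for j
    by (rule newton_potential_component[OF r f_L2 u d dL2 dd ddL2 frame(1) badj bdbar box_eq])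
  obtain \<gamma> where tr: "has_trace B4 (newton_potential f) (\<lambda>z. \<gamma> *s z)"
    using newton_potential_trace[OF r f_L2 frame(1) rep] .
  have c: "continuous_on (sphere 0 1) (\<lambda>z::complex^2. \<gamma> *s z)"
    by (rule linear_continuous_on[OF bounded_linear_scalar_mult])
  have n: "norm (vector [1, 0] :: complex^2) = 1" by (simp add: norm_vec_def L2_set_def sum_2)
  have "form_inner (g (vector [1, 0])) (dzbar 2) = 0"
    if "continuous_on (sphere 0 1) g" "has_trace B4 (newton_potential f) g" for g
  proof -
    have "g (vector [1, 0]) = \<gamma> *s vector [1, 0]" by (rule has_trace_continuous_unique[OF that(2) tr that(1) c n])
    then show ?thesis by (simp add: form_inner_def dzbar_def sum_2 axis_def)
  qed
  with c tr show ?thesis by blast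
qed

end
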